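(* Let $(\mathcal{M},\varphi,\xi,\eta,g)$, $\dim\mathcal{M}=2n+1\geqslant 3$, be a real-analytic almost cosymplectic manifold with Kählerian leaves. Then: (a) there is an open covering $(\mathcal{U}_\iota)_{\iota\in I}$ of $\mathcal{M}$ such that for each $\mathcal{U}_\iota$ there is a diffeomorphism $f_\iota:\mathcal{U}_\iota\to(-a,a)\times D'$, where $(-a,a)$ is an open interval, $a>0$, and $D'$ is a domain in $\mathbb{C}^n$ (with $a$ and $D'$ allowed to depend on $\iota$); (b) on $\mathcal{U}_\iota$, with $(t,z^1,\ldots,z^n)$ the coordinates given by $f_\iota$ ($t$ real, $z^i$ complex, $z^{\bar i}=\overline{z^i}$), the (complexified) structure $(\varphi,\xi,\eta,g)$ is described by the local expressions $$\varphi\frac{\partial}{\partial t}=-\sqrt{-1}\sum_{i=1}^n\Big(a^i\frac{\partial}{\partial z^i}-a^{\bar i}\frac{\partial}{\partial z^{\bar i}}\Big),$$ $$\varphi\frac{\partial}{\partial z^i}=\sqrt{-1}\,\frac{\partial}{\partial z^i},\qquad \varphi\frac{\partial}{\partial z^{\bar i}}=-\sqrt{-1}\,\frac{\partial}{\partial z^{\bar i}},\qquad i=1,\ldots,n,$$ $$\eta=dt,\qquad \xi=\frac{\partial}{\partial t}+\sum_{i=1}^n\Big(a^i\frac{\partial}{\partial z^i}+a^{\bar i}\frac{\partial}{\partial z^{\bar i}}\Big),$$ $$g=r\,dt^2+2\sum_{i=1}^n\big(b_i\,dt\,dz^i+b_{\bar i}\,dt\,dz^{\bar i}\big)+2\sum_{i,j=1}^n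 g_{i\bar j}\,dz^i\,dz^{\bar j},$$ for some functions $a^i,a^{\bar i},b_i,b_{\bar i},g_{i\bar j}$ (complex-valued) and $r$ (real-valued) on $\mathcal{U}_\iota$; (c) these coefficients are related by $$r=1+2\sum_{i,j=1}^n a^i a^{\bar j}g_{i\bar j},\qquad b_i=-\sum_{j=1}^n a^{\bar j}g_{i\bar j},\qquad a^{\bar i}=\overline{a^i},\qquad b_{\bar i}=\overline{b_i},$$ and $(g_{i\bar j})$ is an $n\times n$ Hermitian matrix.
   Context: Manifolds are smooth and connected. An almost contact metric structure $(\varphi,\xi,\eta,g)$ on a manifold $\mathcal{M}$ of odd dimension $2n+1\ge 3$ consists of a $(1,1)$-tensor field $\varphi$, a vector field $\xi$, a $1$-form $\eta$ and a Riemannian metric $g$ with $$\varphi^2=-\mathrm{Id}+\eta\otimes\xi,\quad \eta(\xi)=1,\quad \eta(X)=g(X,\xi),\quad g(\varphi X,\varphi Y)=g(X,Y)-\eta(X)\eta(Y).$$ The manifold is almost cosymplectic if both $\eta$ and the fundamental $2$-form $\varPhi(X,Y)=g(\varphi X,Y)$ are closed. It is called real-analytic if $\mathcal{M}$ is a real-analytic manifold and $\varphi,\xi,\eta,g$ are real-analytic tensor fields. The distribution $\ker\eta$ of an almost cosymplectic manifold is completely integrable. On each leaf $\mathcal{N}$ of the resulting foliation, with inclusion $\iota:\mathcal{N}\to\mathcal{M}$, there is an almost Kähler structure $(J,G)$ given by $\iota_*\circ J=\varphi\circ\iota_*$, $G=\iota^*g$. The manifold $\mathcal{M}$ has Kählerian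 leaves if $(\mathcal{N},J,G)$ is a Kähler manifold for every leaf $\mathcal{N}$. Local expressions are for the complexified structure: $\varphi,\eta,g$ are extended complex-linearly (and $g$ complex-bilinearly) to $T\mathcal{M}\otimes\mathbb{C}$. With $z^i=x^i+\sqrt{-1}\,y^i$, $\frac{\partial}{\partial z^i}=\frac12\big(\frac{\partial}{\partial x^i}-\sqrt{-1}\frac{\partial}{\partial y^i}\big)$ and $\frac{\partial}{\partial z^{\bar i}}=\frac12\big(\frac{\partial}{\partial x^i}+\sqrt{-1}\frac{\partial}{\partial y^i}\big)$. Products of differentials in $g$ are symmetric products, normalized so that the expression for $g$ means: $g(\partial_t,\partial_t)=r$, $g(\partial_t,\partial_{z^i})=b_i$, $g(\partial_t,\partial_{z^{\bar i}})=b_{\bar i}$, $g(\partial_{z^i},\partial_{z^{\bar j}})=g_{i\bar j}$, $g(\partial_{z^i},\partial_{z^j})=g(\partial_{z^{\bar i}},\partial_{z^{\bar j}})=0$. *)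

theory Defs
  imports "HOL-Analysis.Analysis"
begin

section \<open>Smooth and real-analytic maps between Euclidean spaces\<close>

text \<open>The set \<open>S\<close> is open in all uses below.\<close>

primrec C_k_on :: "nat \<Rightarrow> 'a::euclidean_space set \<Rightarrow> ('a \<Rightarrow> 'b::euclidean_space) \<Rightarrow> bool" where
  "C_k_on 0 S f \<longleftrightarrow> continuous_on S f"
| "C_k_on (Suc k) S f \<longleftrightarrow>
     (\<forall>x\<in>S. f differentiable (at x)) \<and> (\<forall>v. C_k_on k S (\<lambda>x. frechet_derivative f (at x) v))"

definition smooth_on :: "'a::euclidean_space set \<Rightarrow> ('a \<Rightarrow> 'b::euclidean_space) \<Rightarrow> bool" where
  "smooth_on S f \<longleftrightarrow> (\<forall>k. C_k_on k S f)"

text \<open>Near each point of \<open>S\<close>, \<open>f\<close> is the sum of a convergent power series in the coordinates;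
  the multi-indices are the functions \<open>\<alpha>\<close> on the standard basis, extended by \<open>0\<close>.\<close>

definition real_analytic_on :: "'a::euclidean_space set \<Rightarrow> ('a \<Rightarrow> 'b::euclidean_space) \<Rightarrow> bool" where
  "real_analytic_on S f \<longleftrightarrow>
     (\<forall>p\<in>S. \<exists>e>0. \<exists>c :: ('a \<Rightarrow> nat) \<Rightarrow> 'b. \<forall>x\<in>ball p e.
        ((\<lambda>\<alpha>. (\<Prod>b\<in>Basis. ((x - p) \<bullet> b) ^ \<alpha> b) *\<^sub>R c \<alpha>) has_sum f x)
          {\<alpha>. \<forall>b. b \<notin> Basis \<longrightarrow> \<alpha> b = 0})"

datatype regularity = Smooth | Analytic

definition regular_on ::
  "regularity \<Rightarrow> 'a::euclidean_space set \<Rightarrow> ('a \<Rightarrow> 'b::euclidean_space) \<Rightarrow> bool" where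
  "regular_on k S f = (case k of Smooth \<Rightarrow> smooth_on S f | Analytic \<Rightarrow> real_analytic_on S f)"


section \<open>Manifolds\<close>

text \<open>A chart is a pair of its domain and its coordinate map; only the values of the coordinate
  map on the domain matter.\<close>

type_synonym ('m, 'e) chart = "'m set \<times> ('m \<Rightarrow> 'e)"

definition chart_inv :: "('m, 'e) chart \<Rightarrow> 'e \<Rightarrow> 'm" where
  "chart_inv c = inv_into (fst c) (snd c)"

definition is_chart :: "'m topology \<Rightarrow> ('m, 'e::euclidean_space) chart \<Rightarrow> bool" where
  "is_chart X c \<longleftrightarrow> openin X (fst c) \<and> open (snd c ` fst c) \<and>
     homeomorphic_map (subtopology X (fst c)) (top_of_set (snd c ` fst c)) (snd c)"

text \<open>The two model spaces may be different Euclidean spaces (of the same dimension).\<close>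

definition compatible ::
  "regularity \<Rightarrow> ('m, 'e::euclidean_space) chart \<Rightarrow> ('m, 'f::euclidean_space) chart \<Rightarrow> bool" where
  "compatible k c d \<longleftrightarrow>
     regular_on k (snd c ` (fst c \<inter> fst d)) (snd d \<circ> chart_inv c) \<and>
     regular_on k (snd d ` (fst c \<inter> fst d)) (snd c \<circ> chart_inv d)"

definition manifold :: "regularity \<Rightarrow> 'm topology \<Rightarrow> ('m, 'e::euclidean_space) chart set \<Rightarrow> bool" where
  "manifold k X A \<longleftrightarrow>
     Hausdorff_space X \<and> second_countable X \<and> connected_space X \<and>
     topspace X = (\<Union>c\<in>A. fst c) \<and>
     (\<forall>c\<in>A. is_chart X c) \<and> (\<forall>c\<in>A. \<forall>d\<in>A. compatible k c d)"

text \<open>\<open>dmap c f p\<close> is the differential at \<open>p\<close> of a map \<open>f\<close> with values in a Euclidean space, tangent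
  vectors at \<open>p\<close> being given by their components in the chart \<open>c\<close>. In particular,
  \<open>dmap c (snd d) p\<close> converts components in \<open>c\<close> to components in \<open>d\<close>.\<close>

definition dmap ::
  "('m, 'e::euclidean_space) chart \<Rightarrow> ('m \<Rightarrow> 'f::euclidean_space) \<Rightarrow> 'm \<Rightarrow> 'e \<Rightarrow> 'f" where
  "dmap c f p = frechet_derivative (f \<circ> chart_inv c) (at (snd c p))"

definition diffeomorphism ::
  "'m topology \<Rightarrow> ('m, 'e::euclidean_space) chart set \<Rightarrow> 'm set \<Rightarrow> ('m \<Rightarrow> 'f::euclidean_space) \<Rightarrow>
   'f set \<Rightarrow> bool" where
  "diffeomorphism X A U f S \<longleftrightarrow>
     is_chart X (U, f) \<and> f ` U = S \<and> (\<forall>c\<in>A. compatible Smooth c (U, f))"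


section \<open>Tensor fields\<close>

text \<open>A tensor field assigns to a chart \<open>c\<close> and a point \<open>p\<close> of its domain the components at \<open>p\<close>
  with respect to \<open>c\<close>, subject to the transformation law of the respective type of tensors.\<close>

type_synonym ('m, 'e) vector_field = "('m, 'e) chart \<Rightarrow> 'm \<Rightarrow> 'e"
type_synonym ('m, 'e) one_form = "('m, 'e) chart \<Rightarrow> 'm \<Rightarrow> 'e \<Rightarrow> real"
type_synonym ('m, 'e) endo_field = "('m, 'e) chart \<Rightarrow> 'm \<Rightarrow> 'e \<Rightarrow> 'e"
type_synonym ('m, 'e) bilinear_field = "('m, 'e) chart \<Rightarrow> 'm \<Rightarrow> 'e \<Rightarrow> 'e \<Rightarrow> real"

definition in_coords :: "('m, 'e) chart \<Rightarrow> (('m, 'e) chart \<Rightarrow> 'm \<Rightarrow> 'a) \<Rightarrow> 'e \<Rightarrow> 'a" where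
  "in_coords c T = (\<lambda>x. T c (chart_inv c x))"

definition is_vector_field ::
  "regularity \<Rightarrow> ('m, 'e::euclidean_space) chart set \<Rightarrow> ('m, 'e) vector_field \<Rightarrow> bool" where
  "is_vector_field k A V \<longleftrightarrow>
     (\<forall>c\<in>A. regular_on k (snd c ` fst c) (in_coords c V)) \<and>
     (\<forall>c\<in>A. \<forall>d\<in>A. \<forall>p\<in>fst c \<inter> fst d. V d p = dmap c (snd d) p (V c p))"

definition is_one_form ::
  "regularity \<Rightarrow> ('m, 'e::euclidean_space) chart set \<Rightarrow> ('m, 'e) one_form \<Rightarrow> bool" where
  "is_one_form k A \<omega> \<longleftrightarrow>
     (\<forall>c\<in>A. \<forall>p\<in>fst c. linear (\<omega> c p)) \<and>
     (\<forall>c\<in>A. \<forall>v. regular_on k (snd c ` fst c) (\<lambda>x. in_coords c \<omega> x v)) \<and>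
     (\<forall>c\<in>A. \<forall>d\<in>A. \<forall>p\<in>fst c \<inter> fst d. \<forall>v. \<omega> d p (dmap c (snd d) p v) = \<omega> c p v)"

definition is_endo_field ::
  "regularity \<Rightarrow> ('m, 'e::euclidean_space) chart set \<Rightarrow> ('m, 'e) endo_field \<Rightarrow> bool" where
  "is_endo_field k A F \<longleftrightarrow>
     (\<forall>c\<in>A. \<forall>p\<in>fst c. linear (F c p)) \<and>
     (\<forall>c\<in>A. \<forall>v. regular_on k (snd c ` fst c) (\<lambda>x. in_coords c F x v)) \<and>
     (\<forall>c\<in>A. \<forall>d\<in>A. \<forall>p\<in>fst c \<inter> fst d. \<forall>v.
        F d p (dmap c (snd d) p v) = dmap c (snd d) p (F c p v))"

definition is_bilinear_field ::
  "regularity \<Rightarrow> ('m, 'e::euclidean_space) chart set \<Rightarrow> ('m, 'e) bilinear_field \<Rightarrow> bool" where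
  "is_bilinear_field k A h \<longleftrightarrow>
     (\<forall>c\<in>A. \<forall>p\<in>fst c. bilinear (h c p)) \<and>
     (\<forall>c\<in>A. \<forall>u v. regular_on k (snd c ` fst c) (\<lambda>x. in_coords c h x u v)) \<and>
     (\<forall>c\<in>A. \<forall>d\<in>A. \<forall>p\<in>fst c \<inter> fst d. \<forall>u v.
        h d p (dmap c (snd d) p u) (dmap c (snd d) p v) = h c p u v)"

definition riemannian_metric ::
  "regularity \<Rightarrow> ('m, 'e::euclidean_space) chart set \<Rightarrow> ('m, 'e) bilinear_field \<Rightarrow> bool" where
  "riemannian_metric k A g \<longleftrightarrow>
     is_bilinear_field k A g \<and>
     (\<forall>c\<in>A. \<forall>p\<in>fst c. (\<forall>u v. g c p u v = g c p v u) \<and> (\<forall>v. v \<noteq> 0 \<longrightarrow> g c p v v > 0))"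

text \<open>Closedness: the exterior derivative vanishes in every chart, evaluated on vector fields with
  constant components (whose Lie brackets vanish).\<close>

definition closed_one_form ::
  "('m, 'e::euclidean_space) chart set \<Rightarrow> ('m, 'e) one_form \<Rightarrow> bool" where
  "closed_one_form A \<omega> \<longleftrightarrow>
     (\<forall>c\<in>A. \<forall>x\<in>snd c ` fst c. \<forall>u v.
        frechet_derivative (\<lambda>y. in_coords c \<omega> y v) (at x) u
        - frechet_derivative (\<lambda>y. in_coords c \<omega> y u) (at x) v = 0)"

definition closed_two_form ::
  "('m, 'e::euclidean_space) chart set \<Rightarrow> ('m, 'e) bilinear_field \<Rightarrow> bool" where
  "closed_two_form A \<Omega> \<longleftrightarrow>
     (\<forall>c\<in>A. \<forall>x\<in>snd c ` fst c. \<forall>u v w.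
        frechet_derivative (\<lambda>y. in_coords c \<Omega> y v w) (at x) u
        + frechet_derivative (\<lambda>y. in_coords c \<Omega> y w u) (at x) v
        + frechet_derivative (\<lambda>y. in_coords c \<Omega> y u v) (at x) w = 0)"

definition fundamental_form ::
  "('m, 'e) endo_field \<Rightarrow> ('m, 'e) bilinear_field \<Rightarrow> ('m, 'e) bilinear_field" where
  "fundamental_form F g = (\<lambda>c p u v. g c p (F c p u) v)"


section \<open>Almost cosymplectic manifolds\<close>

definition almost_contact_metric ::
  "regularity \<Rightarrow> ('m, 'e::euclidean_space) chart set \<Rightarrow> ('m, 'e) endo_field \<Rightarrow> ('m, 'e) vector_field \<Rightarrow>
   ('m, 'e) one_form \<Rightarrow> ('m, 'e) bilinear_field \<Rightarrow> bool" where
  "almost_contact_metric k A \<phi> \<xi> \<eta> g \<longleftrightarrow>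
     is_endo_field k A \<phi> \<and> is_vector_field k A \<xi> \<and> is_one_form k A \<eta> \<and> riemannian_metric k A g \<and>
     (\<forall>c\<in>A. \<forall>p\<in>fst c.
        (\<forall>v. \<phi> c p (\<phi> c p v) = - v + \<eta> c p v *\<^sub>R \<xi> c p) \<and>
        \<eta> c p (\<xi> c p) = 1 \<and>
        (\<forall>v. \<eta> c p v = g c p v (\<xi> c p)) \<and>
        (\<forall>u v. g c p (\<phi> c p u) (\<phi> c p v) = g c p u v - \<eta> c p u * \<eta> c p v))"

definition almost_cosymplectic ::
  "regularity \<Rightarrow> 'm topology \<Rightarrow> ('m, 'e::euclidean_space) chart set \<Rightarrow> ('m, 'e) endo_field \<Rightarrow>
   ('m, 'e) vector_field \<Rightarrow> ('m, 'e) one_form \<Rightarrow> ('m, 'e) bilinear_field \<Rightarrow> bool" where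
  "almost_cosymplectic k X A \<phi> \<xi> \<eta> g \<longleftrightarrow>
     manifold k X A \<and> almost_contact_metric k A \<phi> \<xi> \<eta> g \<and>
     closed_one_form A \<eta> \<and> closed_two_form A (fundamental_form \<phi> g)"


section \<open>Kaehler manifolds\<close>

definition lie_bracket ::
  "('e::euclidean_space \<Rightarrow> 'e) \<Rightarrow> ('e \<Rightarrow> 'e) \<Rightarrow> 'e \<Rightarrow> 'e" where
  "lie_bracket V W = (\<lambda>x. frechet_derivative W (at x) (V x) - frechet_derivative V (at x) (W x))"

definition nijenhuis ::
  "('e::euclidean_space \<Rightarrow> 'e \<Rightarrow> 'e) \<Rightarrow> ('e \<Rightarrow> 'e) \<Rightarrow> ('e \<Rightarrow> 'e) \<Rightarrow> 'e \<Rightarrow> 'e" where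
  "nijenhuis J V W = (\<lambda>x.
     lie_bracket (\<lambda>y. J y (V y)) (\<lambda>y. J y (W y)) x
     - J x (lie_bracket (\<lambda>y. J y (V y)) W x)
     - J x (lie_bracket V (\<lambda>y. J y (W y)) x)
     - lie_bracket V W x)"

text \<open>As the Nijenhuis tensor is a tensor, fields with constant components suffice.\<close>

definition integrable_acs :: "('m, 'e::euclidean_space) chart set \<Rightarrow> ('m, 'e) endo_field \<Rightarrow> bool" where
  "integrable_acs A J \<longleftrightarrow>
     (\<forall>c\<in>A. \<forall>x\<in>snd c ` fst c. \<forall>u v. nijenhuis (in_coords c J) (\<lambda>_. u) (\<lambda>_. v) x = 0)"

definition almost_kaehler ::
  "'m topology \<Rightarrow> ('m, 'e::euclidean_space) chart set \<Rightarrow> ('m, 'e) endo_field \<Rightarrow>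
   ('m, 'e) bilinear_field \<Rightarrow> bool" where
  "almost_kaehler X A J G \<longleftrightarrow>
     manifold Smooth X A \<and> is_endo_field Smooth A J \<and> riemannian_metric Smooth A G \<and>
     (\<forall>c\<in>A. \<forall>p\<in>fst c.
        (\<forall>v. J c p (J c p v) = - v) \<and> (\<forall>u v. G c p (J c p u) (J c p v) = G c p u v)) \<and>
     closed_two_form A (fundamental_form J G)"

definition kaehler ::
  "'m topology \<Rightarrow> ('m, 'e::euclidean_space) chart set \<Rightarrow> ('m, 'e) endo_field \<Rightarrow>
   ('m, 'e) bilinear_field \<Rightarrow> bool" where
  "kaehler X A J G \<longleftrightarrow> almost_kaehler X A J G \<and> integrable_acs A J"


section \<open>Leaves\<close>

text \<open>A connected integral manifold of \<open>ker \<eta>\<close> is an injectively immersed connected manifold;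
  its points are points of the ambient manifold, so that the inclusion is the identity, but its
  topology \<open>Y\<close> may be finer than the subspace topology.\<close>

definition integral_manifold ::
  "'m topology \<Rightarrow> ('m, 'e::euclidean_space) chart set \<Rightarrow> ('m, 'e) one_form \<Rightarrow>
   'm topology \<Rightarrow> ('m, 'l::euclidean_space) chart set \<Rightarrow> bool" where
  "integral_manifold X A \<eta> Y B \<longleftrightarrow>
     manifold Smooth Y B \<and>
     continuous_map Y X (\<lambda>p. p) \<and>
     (\<forall>b\<in>B. \<forall>c\<in>A.
        smooth_on (snd b ` (fst b \<inter> fst c)) (snd c \<circ> chart_inv b) \<and>
        (\<forall>p\<in>fst b \<inter> fst c.
           inj (dmap b (snd c) p) \<and> range (dmap b (snd c) p) = {v. \<eta> c p v = 0}))"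

definition leaf ::
  "'m topology \<Rightarrow> ('m, 'e::euclidean_space) chart set \<Rightarrow> ('m, 'e) one_form \<Rightarrow>
   'm topology \<Rightarrow> ('m, 'l::euclidean_space) chart set \<Rightarrow> bool" where
  "leaf X A \<eta> Y B \<longleftrightarrow>
     integral_manifold X A \<eta> Y B \<and>
     (\<forall>Y' (B' :: ('m, 'l) chart set).
        integral_manifold X A \<eta> Y' B' \<and> topspace Y \<subseteq> topspace Y' \<longrightarrow> topspace Y' = topspace Y)"

text \<open>\<open>\<iota>\<^sub>* \<circ> J = \<phi> \<circ> \<iota>\<^sub>*\<close> and \<open>G = \<iota>\<^sup>* g\<close>, where \<open>\<iota>\<close> is the inclusion of the leaf.\<close>

definition induced_structure ::
  "('m, 'e::euclidean_space) chart set \<Rightarrow> ('m, 'e) endo_field \<Rightarrow> ('m, 'e) bilinear_field \<Rightarrow>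
   ('m, 'l::euclidean_space) chart set \<Rightarrow> ('m, 'l) endo_field \<Rightarrow> ('m, 'l) bilinear_field \<Rightarrow> bool" where
  "induced_structure A \<phi> g B J G \<longleftrightarrow>
     (\<forall>b\<in>B. \<forall>c\<in>A. \<forall>p\<in>fst b \<inter> fst c.
        (\<forall>v. dmap b (snd c) p (J b p v) = \<phi> c p (dmap b (snd c) p v)) \<and>
        (\<forall>u v. G b p u v = g c p (dmap b (snd c) p u) (dmap b (snd c) p v)))"

text \<open>The type argument is the Euclidean space on which the leaves are modelled; its dimension has
  to be one less than that of the ambient manifold.\<close>

definition kaehlerian_leaves ::
  "'l::euclidean_space itself \<Rightarrow> 'm topology \<Rightarrow> ('m, 'e::euclidean_space) chart set \<Rightarrow>
   ('m, 'e) endo_field \<Rightarrow> ('m, 'e) one_form \<Rightarrow> ('m, 'e) bilinear_field \<Rightarrow> bool" where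
  "kaehlerian_leaves _ X A \<phi> \<eta> g \<longleftrightarrow>
     (\<forall>Y (B :: ('m, 'l) chart set). leaf X A \<eta> Y B \<longrightarrow>
        (\<exists>J G. induced_structure A \<phi> g B J G \<and> kaehler Y B J G))"


section \<open>Complexified tangent spaces and coordinate vector fields\<close>

text \<open>The pair \<open>(u, v)\<close> in the complexification of a real vector space stands for \<open>u + \<i> v\<close>.\<close>

type_synonym 'v cplxn = "'v \<times> 'v"

definition cplx :: "'v::real_vector \<Rightarrow> 'v cplxn" where
  "cplx v = (v, 0)"

definition cscale :: "complex \<Rightarrow> 'v::real_vector cplxn \<Rightarrow> 'v cplxn" (infixr "*\<^sub>c" 75) where
  "z *\<^sub>c w = (Re z *\<^sub>R fst w - Im z *\<^sub>R snd w, Re z *\<^sub>R snd w + Im z *\<^sub>R fst w)"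

definition ext_endo :: "('v \<Rightarrow> 'v) \<Rightarrow> 'v cplxn \<Rightarrow> 'v cplxn" where
  "ext_endo F w = (F (fst w), F (snd w))"

definition ext_bilinear :: "('v \<Rightarrow> 'v \<Rightarrow> real) \<Rightarrow> 'v cplxn \<Rightarrow> 'v cplxn \<Rightarrow> complex" where
  "ext_bilinear h w w' =
     Complex (h (fst w) (fst w') - h (snd w) (snd w')) (h (fst w) (snd w') + h (snd w) (fst w'))"

text \<open>Let \<open>f\<close> be a coordinate system \<open>(t, z\<^sup>1, \<dots>, z\<^sup>n)\<close> with domain \<open>U\<close>. The following are the components
  in the chart \<open>c\<close> of the vectors \<open>\<partial>/\<partial>t\<close>, \<open>\<partial>/\<partial>x\<^sup>i\<close>, \<open>\<partial>/\<partial>y\<^sup>i\<close>, \<open>\<partial>/\<partial>z\<^sup>i\<close> and the conjugate of the latter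
  at \<open>p \<in> U\<close>, where \<open>z\<^sup>i = x\<^sup>i + \<i> y\<^sup>i\<close>.\<close>

definition d_t ::
  "('m, real \<times> (complex ^ 'n)) chart \<Rightarrow> ('m, 'e::euclidean_space) chart \<Rightarrow> 'm \<Rightarrow> 'e" where
  "d_t f c p = dmap f (snd c) p (1, 0)"

definition d_x ::
  "('m, real \<times> (complex ^ 'n)) chart \<Rightarrow> ('m, 'e::euclidean_space) chart \<Rightarrow> 'm \<Rightarrow> 'n \<Rightarrow> 'e" where
  "d_x f c p i = dmap f (snd c) p (0, axis i 1)"

definition d_y ::
  "('m, real \<times> (complex ^ 'n)) chart \<Rightarrow> ('m, 'e::euclidean_space) chart \<Rightarrow> 'm \<Rightarrow> 'n \<Rightarrow> 'e" where
  "d_y f c p i = dmap f (snd c) p (0, axis i \<i>)"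

definition d_z ::
  "('m, real \<times> (complex ^ 'n)) chart \<Rightarrow> ('m, 'e::euclidean_space) chart \<Rightarrow> 'm \<Rightarrow> 'n \<Rightarrow> 'e cplxn" where
  "d_z f c p i = (1/2) *\<^sub>c (cplx (d_x f c p i) - \<i> *\<^sub>c cplx (d_y f c p i))"

definition d_zbar ::
  "('m, real \<times> (complex ^ 'n)) chart \<Rightarrow> ('m, 'e::euclidean_space) chart \<Rightarrow> 'm \<Rightarrow> 'n \<Rightarrow> 'e cplxn" where
  "d_zbar f c p i = (1/2) *\<^sub>c (cplx (d_x f c p i) + \<i> *\<^sub>c cplx (d_y f c p i))"

text \<open>The local expressions at the point \<open>p\<close>, for tangent vectors given by their components in \<open>c\<close>.\<close>

definition local_expressions ::
  "('m, real \<times> (complex ^ 'n)) chart \<Rightarrow> ('m, 'e::euclidean_space) chart \<Rightarrow> 'm \<Rightarrow>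
   ('m, 'e) endo_field \<Rightarrow> ('m, 'e) vector_field \<Rightarrow> ('m, 'e) one_form \<Rightarrow> ('m, 'e) bilinear_field \<Rightarrow>
   ('n \<Rightarrow> complex) \<Rightarrow> ('n \<Rightarrow> complex) \<Rightarrow> ('n \<Rightarrow> complex) \<Rightarrow> ('n \<Rightarrow> complex) \<Rightarrow>
   ('n \<Rightarrow> 'n \<Rightarrow> complex) \<Rightarrow> real \<Rightarrow> bool" where
  "local_expressions f c p \<phi> \<xi> \<eta> g a abar b bbar h r \<longleftrightarrow>
     ext_endo (\<phi> c p) (cplx (d_t f c p)) =
       (- \<i>) *\<^sub>c (\<Sum>i\<in>UNIV. a i *\<^sub>c d_z f c p i - abar i *\<^sub>c d_zbar f c p i) \<and>
     (\<forall>i. ext_endo (\<phi> c p) (d_z f c p i) = \<i> *\<^sub>c d_z f c p i) \<and>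
     (\<forall>i. ext_endo (\<phi> c p) (d_zbar f c p i) = (- \<i>) *\<^sub>c d_zbar f c p i) \<and>
     \<eta> c p = dmap c (\<lambda>q. fst (snd f q)) p \<and>
     cplx (\<xi> c p) =
       cplx (d_t f c p) + (\<Sum>i\<in>UNIV. a i *\<^sub>c d_z f c p i + abar i *\<^sub>c d_zbar f c p i) \<and>
     ext_bilinear (g c p) (cplx (d_t f c p)) (cplx (d_t f c p)) = of_real r \<and>
     (\<forall>i. ext_bilinear (g c p) (cplx (d_t f c p)) (d_z f c p i) = b i) \<and>
     (\<forall>i. ext_bilinear (g c p) (cplx (d_t f c p)) (d_zbar f c p i) = bbar i) \<and>
     (\<forall>i j. ext_bilinear (g c p) (d_z f c p i) (d_zbar f c p j) = h i j) \<and>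
     (\<forall>i j. ext_bilinear (g c p) (d_z f c p i) (d_z f c p j) = 0) \<and>
     (\<forall>i j. ext_bilinear (g c p) (d_zbar f c p i) (d_zbar f c p j) = 0)"

end

theory Submission
  imports Defs "HOL-Complex_Analysis.Conformal_Mappings"
begin

text \<open>Since \<open>\<eta>\<close> is closed, locally \<open>\<eta> = dt\<close>. The leaves being Kaehler, the Nijenhuis tensor of \<open>\<phi>\<close>
  vanishes on \<open>ker \<eta>\<close>, so the \<open>-\<i>\<close>-eigendistribution of \<open>\<phi>\<close> is involutive. By real-analyticity it
  extends to a holomorphic involutive distribution on a neighbourhood in the complexified coordinate space,
  where a holomorphic Frobenius theorem applies: flowing linearly along the distribution, a linear differential
  equation forces the remaining components of the derivative to vanish, so the transverse parameters of the
  flow are first integrals. Restricted to real points, they are functions \<open>z\<^sup>i\<close> annihilated by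
  the \<open>-\<i>\<close>-eigenspace, and \<open>(t, z)\<close> is the required chart. The relations between the coefficients are
  linear algebra at each point.\<close>

text \<open>The Kaehler hypothesis quantifies over maximal connected integral manifolds that are
  second countable, so it yields nothing until such a leaf has been built through every point; hence
  the atlas of foliated charts and the plaques. Those charts serve twice: with any \<open>z\<close>
  injective on \<open>ker \<eta>\<close> to build leaves, and with the final complex
  \<open>z\<close> as the charts wanted. Frobenius is not applied leaf by leaf, where the dependence
  of the complex coordinates on \<open>t\<close> would be out of control, but once to the whole
  complexified chart, which treats all leaves simultaneously. The distribution is carried by a
  holomorphic family of projections: no frame is chosen, and involutivity becomes a symmetry of the
  derivative of the projection. Complex vectors are pairs of real ones with \<open>Jc\<close> as
  multiplication by \<open>\<i>\<close>; a map is holomorphic if its real derivative commutes with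
  \<open>Jc\<close>, and its estimates come from one-variable theory on complex lines. The
  identities that the structure satisfies at real points are propagated to complex points by
  \<open>holo_zero\<close>.\<close>

abbreviation (input) fd :: "('a::real_normed_vector \<Rightarrow> 'b::real_normed_vector) \<Rightarrow> 'a \<Rightarrow> 'a \<Rightarrow> 'b" where
  "fd f x \<equiv> frechet_derivative f (at x)"

section \<open>Frechet derivatives: congruence on open sets and expansion in a basis\<close>

lemma fd_eqI: "(f has_derivative f') (at x) \<Longrightarrow> fd f x = f'"
  by (metis frechet_derivative_at)

lemma fd_works: "f differentiable (at x) \<Longrightarrow> (f has_derivative fd f x) (at x)"
  by (simp add: frechet_derivative_works)

lemma has_derivative_cong_open:
  assumes "open S" "x \<in> S" "\<And>y. y \<in> S \<Longrightarrow> f y = g y"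
  shows "(f has_derivative f') (at x) \<longleftrightarrow> (g has_derivative f') (at x)"
  using has_derivative_transform_within_open[of f f' x UNIV S g]
    has_derivative_transform_within_open[of g f' x UNIV S f] assms by auto

lemma fd_cong_open:
  assumes "open S" "x \<in> S" "\<And>y. y \<in> S \<Longrightarrow> f y = g y"
  shows "fd f x = fd g x"
  unfolding frechet_derivative_def using has_derivative_cong_open[OF assms] by simp

lemma linear_fd: "f differentiable (at x) \<Longrightarrow> linear (fd f x)"
  by (rule linear_frechet_derivative)

lemma linear_sum_Basis:
  fixes f :: "'a::euclidean_space \<Rightarrow> 'b::real_vector"
  assumes "linear f"
  shows "f x = (\<Sum>b\<in>Basis. (x \<bullet> b) *\<^sub>R f b)"
proof -
  have "f x = f (\<Sum>b\<in>Basis. (x \<bullet> b) *\<^sub>R b)" by (simp add: euclidean_representation)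
  also have "\<dots> = (\<Sum>b\<in>Basis. (x \<bullet> b) *\<^sub>R f b)"
    by (simp add: linear_sum[OF assms] linear_scale[OF assms])
  finally show ?thesis .
qed

subsection \<open>Differentiability of class C^k\<close>

lemma C_k_on_cong:
  assumes "open S" "\<And>x. x \<in> S \<Longrightarrow> f x = g x" "C_k_on k S f"
  shows "C_k_on k S g"
  using assms(2,3)
proof (induction k arbitrary: f g)
  case 0
  then show ?case by (simp cong: continuous_on_cong_simp)
next
  case (Suc k)
  have eq: "fd f x = fd g x" if "x \<in> S" for x
    using fd_cong_open[OF assms(1) that] Suc.prems(1) by blast
  have "g differentiable (at x)" if "x \<in> S" for x
  proof -
    have "f differentiable (at x)" using Suc.prems(2) that by simp
    then show ?thesis
      using has_derivative_cong_open[OF assms(1) that, of f g] Suc.prems(1) unfolding differentiable_def by blast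
  qed
  moreover have "C_k_on k S (\<lambda>x. fd g x v)" for v
    using Suc.IH[of "\<lambda>x. fd f x v" "\<lambda>x. fd g x v"] Suc.prems(2) eq by auto
  ultimately show ?case by simp
qed

lemma C_k_on_subset: "C_k_on k S f \<Longrightarrow> T \<subseteq> S \<Longrightarrow> C_k_on k T f"
  by (induction k arbitrary: f) (auto intro: continuous_on_subset)

lemma C_k_on_SucD: "C_k_on (Suc k) S f \<Longrightarrow> C_k_on k S f"
proof (induction k arbitrary: f)
  case 0
  then show ?case
    by (auto intro!: continuous_at_imp_continuous_on differentiable_imp_continuous_within)
next
  case (Suc k)
  show ?case
    using Suc.prems Suc.IH by (subst C_k_on.simps) simp
qed

lemma C_k_on_SucI:
  assumes "open S" "\<And>x. x \<in> S \<Longrightarrow> (f has_derivative f' x) (at x)"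
    and "\<And>v. C_k_on k S (\<lambda>x. f' x v)"
  shows "C_k_on (Suc k) S f"
proof -
  have "fd f x = f' x" if "x \<in> S" for x using fd_eqI assms(2) that by blast
  then have "C_k_on k S (\<lambda>x. fd f x v)" for v
    using C_k_on_cong[OF assms(1) _ assms(3)[of v]] by auto
  then show ?thesis using assms(2) by (auto simp: differentiable_def)
qed

lemma C_k_on_const: "open S \<Longrightarrow> C_k_on k S (\<lambda>x. c)"
  by (induction k arbitrary: c) (auto intro!: C_k_on_SucI derivative_eq_intros simp del: C_k_on.simps(2))

lemma C_k_on_bounded_linear:
  assumes "open S" "bounded_linear f"
  shows "C_k_on k S f"
proof (cases k)
  case 0
  then show ?thesis using assms by (simp add: linear_continuous_on)
next
  case (Suc m)
  have "C_k_on (Suc m) S f"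
    by (rule C_k_on_SucI[OF assms(1)]) (auto intro: bounded_linear_imp_has_derivative assms C_k_on_const)
  then show ?thesis using Suc by simp
qed

lemma C_k_on_bounded_linear_o:
  assumes "open S" "bounded_linear h" "C_k_on k S f"
  shows "C_k_on k S (\<lambda>x. h (f x))"
  using assms(3)
proof (induction k arbitrary: f)
  case 0
  then show ?case
    using bounded_linear.continuous_on[OF assms(2)] by auto
next
  case (Suc k)
  show ?case
    by (rule C_k_on_SucI[OF assms(1), of _ "\<lambda>x v. h (fd f x v)"])
      (use Suc in \<open>auto intro: bounded_linear.has_derivative[OF assms(2)] fd_works\<close>)
qed

lemma C_k_on_add:
  assumes "open S" "C_k_on k S f" "C_k_on k S g"
  shows "C_k_on k S (\<lambda>x. f x + g x)"
  using assms(2,3)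
proof (induction k arbitrary: f g)
  case (Suc k)
  show ?case
    by (rule C_k_on_SucI[OF assms(1), of _ "\<lambda>x v. fd f x v + fd g x v"])
      (use Suc in \<open>auto intro!: derivative_eq_intros fd_works\<close>)
qed (auto intro: continuous_intros)

lemma C_k_on_scaleR:
  fixes f :: "'a::euclidean_space \<Rightarrow> real"
  assumes "open S" "C_k_on k S f" "C_k_on k S g"
  shows "C_k_on k S (\<lambda>x. f x *\<^sub>R g x)"
  using assms(2,3)
proof (induction k arbitrary: f g)
  case (Suc k)
  have "C_k_on k S f" "C_k_on k S g" using Suc.prems C_k_on_SucD by blast+
  then have "C_k_on k S (\<lambda>x. f x *\<^sub>R fd g x v + fd f x v *\<^sub>R g x)" for v
    using Suc by (intro C_k_on_add[OF assms(1)]) auto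
  then show ?case
    using Suc.prems
    by (intro C_k_on_SucI[OF assms(1), of _ "\<lambda>x v. f x *\<^sub>R fd g x v + fd f x v *\<^sub>R g x"])
      (auto intro!: derivative_eq_intros fd_works)
qed (auto intro: continuous_intros)

lemma C_k_on_sum:
  assumes "open S" "\<And>i. i \<in> I \<Longrightarrow> C_k_on k S (f i)"
  shows "C_k_on k S (\<lambda>x. \<Sum>i\<in>I. f i x)"
  using assms(2)
  by (induction I rule: infinite_finite_induct)
    (auto intro: C_k_on_const[OF assms(1)] C_k_on_add[OF assms(1)])

lemma C_k_on_inner_const:
  assumes "open S" "C_k_on k S f"
  shows "C_k_on k S (\<lambda>x. f x \<bullet> b)"
  using C_k_on_bounded_linear_o[OF assms(1) bounded_linear_inner_left assms(2)] .

text \<open>The chain rule produces \<open>fd f (g x) (fd g x v)\<close>, whose direction moves with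
  \<open>x\<close>, while the induction hypothesis only covers derivatives in fixed directions.
  Expanding the moving direction in the basis repairs this.\<close>

lemma C_k_on_compose:
  assumes "open S" "open T" "C_k_on k T f" "C_k_on k S g" "g ` S \<subseteq> T"
  shows "C_k_on k S (\<lambda>x. f (g x))"
  using assms(3,4)
proof (induction k arbitrary: f)
  case 0
  then show ?case using continuous_on_compose2 assms(5) by auto
next
  case (Suc k)
  have g: "C_k_on k S g" using Suc.prems C_k_on_SucD by blast
  have fg: "fd f (g x) w = (\<Sum>b\<in>Basis. (w \<bullet> b) *\<^sub>R fd f (g x) b)" if "x \<in> S" for x w
    using Suc.prems(1) assms(5) that by (intro linear_sum_Basis linear_fd) auto
  have "C_k_on k S (\<lambda>x. fd f (g x) b)" for b
    using Suc.IH[OF _ g, of "\<lambda>x. fd f x b"] Suc.prems(1) by auto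
  then have "C_k_on k S (\<lambda>x. \<Sum>b\<in>Basis. (fd g x v \<bullet> b) *\<^sub>R fd f (g x) b)" for v
    using Suc.prems(2) by (intro C_k_on_sum C_k_on_scaleR C_k_on_inner_const assms) auto
  then have "C_k_on k S (\<lambda>x. fd f (g x) (fd g x v))" for v
    by (rule C_k_on_cong[OF assms(1), rotated]) (simp add: fg)
  moreover have "((\<lambda>x. f (g x)) has_derivative (\<lambda>v. fd f (g x) (fd g x v))) (at x)" if "x \<in> S" for x
    using Suc.prems assms(5) that by (intro has_derivative_compose[OF fd_works, of _ _ f, unfolded o_def] fd_works) auto
  ultimately show ?case by (intro C_k_on_SucI[OF assms(1)]) auto
qed

subsection \<open>Smooth maps\<close>

lemma smooth_on_fd: "smooth_on S f \<Longrightarrow> smooth_on S (\<lambda>x. fd f x v)"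
  unfolding smooth_on_def by (metis C_k_on.simps(2))

lemma smooth_on_differentiable: "smooth_on S f \<Longrightarrow> x \<in> S \<Longrightarrow> f differentiable (at x)"
  unfolding smooth_on_def by (metis C_k_on.simps(2))

lemma smooth_on_has_derivative: "smooth_on S f \<Longrightarrow> x \<in> S \<Longrightarrow> (f has_derivative fd f x) (at x)"
  by (simp add: fd_works smooth_on_differentiable)

lemma smooth_on_continuous: "smooth_on S f \<Longrightarrow> continuous_on S f"
  unfolding smooth_on_def by (metis C_k_on.simps(1))

lemma smooth_on_cong:
  "open S \<Longrightarrow> (\<And>x. x \<in> S \<Longrightarrow> f x = g x) \<Longrightarrow> smooth_on S f \<Longrightarrow> smooth_on S g"
  unfolding smooth_on_def using C_k_on_cong by blast

lemma smooth_on_subset: "smooth_on S f \<Longrightarrow> T \<subseteq> S \<Longrightarrow> smooth_on T f"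
  unfolding smooth_on_def using C_k_on_subset by blast

lemma smooth_on_compose:
  "open S \<Longrightarrow> open T \<Longrightarrow> smooth_on T f \<Longrightarrow> smooth_on S g \<Longrightarrow> g ` S \<subseteq> T \<Longrightarrow> smooth_on S (\<lambda>x. f (g x))"
  unfolding smooth_on_def using C_k_on_compose by blast

lemma smooth_on_bounded_linear: "open S \<Longrightarrow> bounded_linear f \<Longrightarrow> smooth_on S f"
  unfolding smooth_on_def using C_k_on_bounded_linear by blast

lemma smooth_on_bounded_linear_o:
  "open S \<Longrightarrow> bounded_linear h \<Longrightarrow> smooth_on S f \<Longrightarrow> smooth_on S (\<lambda>x. h (f x))"
  unfolding smooth_on_def using C_k_on_bounded_linear_o by blast

text \<open>A smooth derivative gives one order more than asked for; dropping it treats order 0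
  together with all others.\<close>

lemma smooth_onI:
  assumes "open S" "\<And>x. x \<in> S \<Longrightarrow> (f has_derivative f' x) (at x)"
    and "\<And>v. smooth_on S (\<lambda>x. f' x v)"
  shows "smooth_on S f"
  unfolding smooth_on_def
proof
  fix k
  have "C_k_on (Suc k) S f"
    by (rule C_k_on_SucI[OF assms(1,2)]) (use assms(3) smooth_on_def in blast)+
  then show "C_k_on k S f" by (rule C_k_on_SucD)
qed

lemma smooth_on_local:
  assumes "\<And>x. x \<in> S \<Longrightarrow> \<exists>T. x \<in> T \<and> smooth_on T f \<and> open T"
  shows "smooth_on S f"
proof -
  have "C_k_on k S f" if "\<And>x. x \<in> S \<Longrightarrow> \<exists>T. x \<in> T \<and> C_k_on k T f \<and> open T" for k
    using that
  proof (induction k arbitrary: f)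
    case 0
    show ?case
      using 0 by (auto intro!: continuous_at_imp_continuous_on) (metis continuous_on_eq_continuous_at)
  next
    case (Suc k)
    have "\<exists>T. x \<in> T \<and> C_k_on k T (\<lambda>x. fd f x v) \<and> open T" if "x \<in> S" for x v
      using Suc.prems[OF that] by auto
    then have "C_k_on k S (\<lambda>x. fd f x v)" for v by (rule Suc.IH)
    then show ?case using Suc.prems by (auto) 
  qed
  then show ?thesis unfolding smooth_on_def using assms unfolding smooth_on_def by blast
qed

lemma bounded_linear_Pair1: "bounded_linear (\<lambda>x. (x, 0))"
  by (intro bounded_linear_intros)

lemma bounded_linear_Pair2: "bounded_linear (\<lambda>x. (0, x))"
  by (intro bounded_linear_intros)

lemma smooth_on_add: "open S \<Longrightarrow> smooth_on S f \<Longrightarrow> smooth_on S g \<Longrightarrow> smooth_on S (\<lambda>x. f x + g x)"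
  unfolding smooth_on_def using C_k_on_add by blast

lemma smooth_on_Pair:
  assumes "open S" "smooth_on S f" "smooth_on S g"
  shows "smooth_on S (\<lambda>x. (f x, g x))"
  using smooth_on_add[OF assms(1) smooth_on_bounded_linear_o[OF assms(1) bounded_linear_Pair1 assms(2)]
      smooth_on_bounded_linear_o[OF assms(1) bounded_linear_Pair2 assms(3)]] by simp

subsection \<open>Symmetry of the second derivative\<close>

text \<open>The mean value theorem is applied twice: to the difference in direction \<open>v\<close>
  as a function of \<open>s\<close>, then to the resulting first derivative along \<open>v\<close>.
  Only the parallelogram at \<open>x\<close> with sides \<open>h u\<close> and \<open>h v\<close>
  has to lie in \<open>S\<close>.\<close>

lemma second_difference_mvt:
  fixes f :: "'a::euclidean_space \<Rightarrow> real"
  assumes B: "\<And>s t. 0 \<le> s \<Longrightarrow> s \<le> h \<Longrightarrow> 0 \<le> t \<Longrightarrow> t \<le> h \<Longrightarrow> x + s *\<^sub>R u + t *\<^sub>R v \<in> S"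
    and C: "C_k_on 2 S f" and h: "h > 0"
  shows "\<exists>s t. 0 \<le> s \<and> s \<le> h \<and> 0 \<le> t \<and> t \<le> h \<and>
    f (x + h *\<^sub>R u + h *\<^sub>R v) - f (x + h *\<^sub>R u) - f (x + h *\<^sub>R v) + f x
     = h * h * fd (\<lambda>y. fd f y u) (x + s *\<^sub>R u + t *\<^sub>R v) v"
proof -
  have d1: "(f has_derivative fd f y) (at y)" if "y \<in> S" for y
    using C that by (auto simp: numeral_2_eq_2 intro: fd_works)
  have d2: "((\<lambda>y. fd f y u) has_derivative fd (\<lambda>y. fd f y u) y) (at y)" if "y \<in> S" for y
    using C that by (auto simp: numeral_2_eq_2 intro: fd_works)
  let ?g = "\<lambda>s. f (x + s *\<^sub>R u + h *\<^sub>R v) - f (x + s *\<^sub>R u)"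
  have "(?g has_real_derivative fd f (x + s *\<^sub>R u + h *\<^sub>R v) u - fd f (x + s *\<^sub>R u) u) (at s)"
    if "0 \<le> s" "s \<le> h" for s
  proof -
    have 1: "x + s *\<^sub>R u + h *\<^sub>R v \<in> S" "x + s *\<^sub>R u \<in> S"
      using B[of s h] B[of s 0] that h by auto
    have "((\<lambda>s. f (x + s *\<^sub>R u + h *\<^sub>R v)) has_derivative (\<lambda>r. fd f (x + s *\<^sub>R u + h *\<^sub>R v) (r *\<^sub>R u))) (at s)"
      by (rule has_derivative_compose[of "\<lambda>s. x + s *\<^sub>R u + h *\<^sub>R v" _ s UNIV f])
        (auto intro!: derivative_eq_intros d1 1)
    moreover have "((\<lambda>s. f (x + s *\<^sub>R u)) has_derivative (\<lambda>r. fd f (x + s *\<^sub>R u) (r *\<^sub>R u))) (at s)"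
      by (rule has_derivative_compose[of "\<lambda>s. x + s *\<^sub>R u" _ s UNIV f])
        (auto intro!: derivative_eq_intros d1 1)
    ultimately have "(?g has_derivative (\<lambda>r. fd f (x + s *\<^sub>R u + h *\<^sub>R v) (r *\<^sub>R u) - fd f (x + s *\<^sub>R u) (r *\<^sub>R u))) (at s)"
      by (rule has_derivative_diff)
    moreover have "linear (fd f (x + s *\<^sub>R u + h *\<^sub>R v))" "linear (fd f (x + s *\<^sub>R u))"
      using d1 1 has_derivative_linear by blast+
    ultimately show ?thesis
      unfolding has_field_derivative_def
      by (elim has_derivative_eq_rhs) (simp add: fun_eq_iff linear_scale algebra_simps)
  qed
  then obtain s where s: "0 < s" "s < h"
    "?g h - ?g 0 = h * (fd f (x + s *\<^sub>R u + h *\<^sub>R v) u - fd f (x + s *\<^sub>R u) u)"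
    using MVT2[OF h, of ?g "\<lambda>s. fd f (x + s *\<^sub>R u + h *\<^sub>R v) u - fd f (x + s *\<^sub>R u) u"] by auto
  let ?k = "\<lambda>t. fd f (x + s *\<^sub>R u + t *\<^sub>R v) u"
  have "(?k has_real_derivative fd (\<lambda>y. fd f y u) (x + s *\<^sub>R u + t *\<^sub>R v) v) (at t)"
    if "0 \<le> t" "t \<le> h" for t
  proof -
    have 1: "x + s *\<^sub>R u + t *\<^sub>R v \<in> S"
      using B[of s t] that s by auto
    have "(?k has_derivative (\<lambda>r. fd (\<lambda>y. fd f y u) (x + s *\<^sub>R u + t *\<^sub>R v) (r *\<^sub>R v))) (at t)"
      by (rule has_derivative_compose[of "\<lambda>t. x + s *\<^sub>R u + t *\<^sub>R v" _ t UNIV "\<lambda>y. fd f y u"])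
        (auto intro!: derivative_eq_intros d2 1)
    moreover have "linear (fd (\<lambda>y. fd f y u) (x + s *\<^sub>R u + t *\<^sub>R v))"
      using d2[OF 1] has_derivative_linear by blast
    ultimately show ?thesis
      unfolding has_field_derivative_def
      by (elim has_derivative_eq_rhs) (simp add: fun_eq_iff linear_scale)
  qed
  then obtain t where t: "0 < t" "t < h"
    "?k h - ?k 0 = h * fd (\<lambda>y. fd f y u) (x + s *\<^sub>R u + t *\<^sub>R v) v"
    using MVT2[OF h, of ?k "\<lambda>t. fd (\<lambda>y. fd f y u) (x + s *\<^sub>R u + t *\<^sub>R v) v"] by auto
  show ?thesis
    by (rule exI[of _ s], rule exI[of _ t]) (use s t in \<open>auto simp: algebra_simps\<close>)
qed

text \<open>The second difference is symmetric in \<open>u\<close> and \<open>v\<close>, so the two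
  mixed derivatives agree at some pair of points of a small parallelogram; continuity carries the
  equality to \<open>x\<close>.\<close>

lemma second_derivative_symmetric_real:
  fixes f :: "'a::euclidean_space \<Rightarrow> real"
  assumes S: "open S" "x \<in> S" and C: "C_k_on 2 S f"
  shows "fd (\<lambda>y. fd f y u) x v = fd (\<lambda>y. fd f y v) x u"
proof -
  have cont: "continuous_on S (\<lambda>y. fd (\<lambda>y. fd f y u) y v)" for u v
    using C by (auto simp: numeral_2_eq_2)
  let ?F = "\<lambda>y. fd (\<lambda>y. fd f y u) y v" and ?G = "\<lambda>y. fd (\<lambda>y. fd f y v) y u"
  have "\<bar>?F x - ?G x\<bar> \<le> e" if e: "e > 0" for e
  proof -
    have "isCont ?F x" "isCont ?G x"
      using cont S continuous_on_eq_continuous_at by blast+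
    then obtain d1 d2 where d: "d1 > 0" "\<And>y. dist y x < d1 \<Longrightarrow> dist (?F y) (?F x) < e/2"
      "d2 > 0" "\<And>y. dist y x < d2 \<Longrightarrow> dist (?G y) (?G x) < e/2"
      unfolding continuous_at_eps_delta using e by (metis half_gt_zero)
    obtain d3 where d3: "d3 > 0" "ball x d3 \<subseteq> S" using S open_contains_ball by blast
    define m where "m = min d1 (min d2 d3)"
    \<comment> \<open>This side length keeps the whole parallelogram within distance
      \<open>m\<close> of \<open>x\<close>; the summand 1 covers the case
      \<open>u = v = 0\<close>.\<close>
    define h where "h = m / (2 * (norm u + norm v + 1))"
    have m: "m > 0" "m \<le> d1" "m \<le> d2" "m \<le> d3" using d d3 by (auto simp: m_def)
    have N: "norm u + norm v + 1 > 0" by (smt (verit) norm_ge_zero)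
    have h: "h > 0" using m N by (simp add: h_def)
    have near: "dist (x + s *\<^sub>R u + t *\<^sub>R v) x < m" if "0 \<le> s" "s \<le> h" "0 \<le> t" "t \<le> h" for s t
    proof -
      have "dist (x + s *\<^sub>R u + t *\<^sub>R v) x \<le> norm (s *\<^sub>R u) + norm (t *\<^sub>R v)"
        using norm_triangle_ineq[of "s *\<^sub>R u" "t *\<^sub>R v"] by (simp add: dist_norm add.assoc)
      also have "\<dots> \<le> h * norm u + h * norm v"
        using that by (auto intro!: add_mono mult_right_mono)
      also have "\<dots> < h * (2 * (norm u + norm v + 1))"
        using h N by (simp add: algebra_simps) (smt (verit) norm_ge_zero mult_nonneg_nonneg)
      also have "\<dots> = m" using N by (simp add: h_def)
      finally show ?thesis .
    qed
    have 1: "\<And>s t. 0 \<le> s \<Longrightarrow> s \<le> h \<Longrightarrow> 0 \<le> t \<Longrightarrow> t \<le> h \<Longrightarrow> x + s *\<^sub>R u + t *\<^sub>R v \<in> S"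
      using near d3(2) m(4) by (metis (no_types, lifting) dist_commute mem_ball order_less_le_trans subsetD)
    then have 2: "\<And>s t. 0 \<le> s \<Longrightarrow> s \<le> h \<Longrightarrow> 0 \<le> t \<Longrightarrow> t \<le> h \<Longrightarrow> x + s *\<^sub>R v + t *\<^sub>R u \<in> S"
      by (metis add.assoc add.commute)
    obtain s t where st: "0 \<le> s" "s \<le> h" "0 \<le> t" "t \<le> h"
      "f (x + h *\<^sub>R u + h *\<^sub>R v) - f (x + h *\<^sub>R u) - f (x + h *\<^sub>R v) + f x = h * h * ?F (x + s *\<^sub>R u + t *\<^sub>R v)"
      using second_difference_mvt[OF 1 C h] by blast
    obtain s' t' where st': "0 \<le> s'" "s' \<le> h" "0 \<le> t'" "t' \<le> h"
      "f (x + h *\<^sub>R v + h *\<^sub>R u) - f (x + h *\<^sub>R v) - f (x + h *\<^sub>R u) + f x = h * h * ?G (x + s' *\<^sub>R v + t' *\<^sub>R u)"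
      using second_difference_mvt[OF 2 C h] by blast
    have eq: "x + s' *\<^sub>R v + t' *\<^sub>R u = x + t' *\<^sub>R u + s' *\<^sub>R v" by simp
    note st' = st'[unfolded eq]
    have "h * h * ?F (x + s *\<^sub>R u + t *\<^sub>R v) = h * h * ?G (x + t' *\<^sub>R u + s' *\<^sub>R v)"
      using st(5) st'(5) by (simp add: algebra_simps)
    then have "?F (x + s *\<^sub>R u + t *\<^sub>R v) = ?G (x + t' *\<^sub>R u + s' *\<^sub>R v)" using h by simp
    moreover have "dist (?F (x + s *\<^sub>R u + t *\<^sub>R v)) (?F x) < e/2" using near st d m by (meson order_less_le_trans)
    moreover have "dist (?G (x + t' *\<^sub>R u + s' *\<^sub>R v)) (?G x) < e/2" using near st' d m by (meson order_less_le_trans)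
    moreover have "\<bar>c - d\<bar> \<le> e" if "a = b" "dist a c < e/2" "dist b d < e/2" for a b c d :: real
      using that unfolding dist_real_def by linarith
    ultimately show ?thesis by blast
  qed
  then have "\<bar>?F x - ?G x\<bar> \<le> 0" by (metis field_le_epsilon add_0)
  then show ?thesis by simp
qed

lemma fd_inner:
  assumes "f differentiable (at x)"
  shows "fd (\<lambda>y. f y \<bullet> b) x v = fd f x v \<bullet> b"
  using fd_eqI[OF has_derivative_inner_left[OF fd_works[OF assms], of b]] by simp

lemma second_derivative_symmetric:
  fixes f :: "'a::euclidean_space \<Rightarrow> 'b::euclidean_space"
  assumes S: "open S" "x \<in> S" and C: "C_k_on 2 S f"
  shows "fd (\<lambda>y. fd f y u) x v = fd (\<lambda>y. fd f y v) x u"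
proof (rule euclidean_eqI)
  fix b :: 'b assume "b \<in> Basis"
  have d1: "f differentiable (at y)" if "y \<in> S" for y
    using C that by (auto simp: numeral_2_eq_2)
  have d2: "(\<lambda>y. fd f y u) differentiable (at y)" if "y \<in> S" for y u
    using C that by (auto simp: numeral_2_eq_2)
  have "fd (\<lambda>y. fd (\<lambda>y. f y \<bullet> b) y u) x v = fd (\<lambda>y. fd f y u) x v \<bullet> b" for u v
  proof -
    have "fd (\<lambda>y. fd (\<lambda>y. f y \<bullet> b) y u) x v = fd (\<lambda>y. fd f y u \<bullet> b) x v"
      by (subst fd_cong_open[OF S, of _ "\<lambda>y. fd f y u \<bullet> b"]) (auto simp: fd_inner d1)
    then show ?thesis using fd_inner d2 S by metis
  qed
  then show "fd (\<lambda>y. fd f y u) x v \<bullet> b = fd (\<lambda>y. fd f y v) x u \<bullet> b"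
    using second_derivative_symmetric_real[OF S C_k_on_inner_const[OF S(1) C]] by metis
qed

subsection \<open>Smoothness of local inverses\<close>

text \<open>Because \<open>f\<close> vanishes at \<open>y\<close>, the term with the derivative of
  \<open>g\<close> drops out of the product rule, and continuity of \<open>g\<close> is
  enough.\<close>

lemma has_derivative_vanishing_scaleR:
  fixes f :: "'a::real_normed_vector \<Rightarrow> real"
  assumes f: "(f has_derivative f') (at y)" "f y = 0" and g: "isCont g y"
  shows "((\<lambda>z. f z *\<^sub>R g z) has_derivative (\<lambda>h. f' h *\<^sub>R g y)) (at y)"
proof -
  have bl: "bounded_linear f'" using f has_derivative_bounded_linear by blast
  obtain K where K: "\<And>h. norm (f' h) \<le> norm h * K" using bounded_linear.bounded[OF bl] by blast
  have lim: "((\<lambda>z. norm (f z - f' (z - y)) / norm (z - y)) \<longlongrightarrow> 0) (at y)"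
    using f unfolding has_derivative_iff_norm by simp
  have gl: "(g \<longlongrightarrow> g y) (at y)" using g by (simp add: isCont_def)
  have lim2: "((\<lambda>z. norm (f z - f' (z - y)) / norm (z - y) * norm (g z) + \<bar>K\<bar> * norm (g z - g y)) \<longlongrightarrow> 0) (at y)"
    using tendsto_add[OF tendsto_mult[OF lim tendsto_norm[OF gl]]
        tendsto_mult[OF tendsto_const tendsto_norm[OF tendsto_diff[OF gl tendsto_const[of "g y"]]]]]
    by simp
  have le: "norm (norm (f z *\<^sub>R g z - f y *\<^sub>R g y - f' (z - y) *\<^sub>R g y) / norm (z - y))
      \<le> norm (f z - f' (z - y)) / norm (z - y) * norm (g z) + \<bar>K\<bar> * norm (g z - g y)" if "z \<noteq> y" for z
  proof -
    have p: "norm (z - y) > 0" using that by simp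
    have "f z *\<^sub>R g z - f y *\<^sub>R g y - f' (z - y) *\<^sub>R g y
        = (f z - f' (z - y)) *\<^sub>R g z + f' (z - y) *\<^sub>R (g z - g y)"
      by (simp add: f(2) algebra_simps)
    then have "norm (f z *\<^sub>R g z - f y *\<^sub>R g y - f' (z - y) *\<^sub>R g y)
        \<le> norm (f z - f' (z - y)) * norm (g z) + norm (f' (z - y)) * norm (g z - g y)"
      by (metis norm_scaleR norm_triangle_ineq real_norm_def)
    also have "\<dots> \<le> norm (f z - f' (z - y)) * norm (g z) + norm (z - y) * \<bar>K\<bar> * norm (g z - g y)"
    proof -
      have "norm (f' (z - y)) \<le> norm (z - y) * \<bar>K\<bar>"
        by (rule order_trans[OF K]) (simp add: mult_left_mono)
      then show ?thesis by (simp add: mult_right_mono)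
    qed
    finally show ?thesis using p by (simp add: divide_simps algebra_simps)
  qed
  have "((\<lambda>z. norm (f z *\<^sub>R g z - f y *\<^sub>R g y - f' (z - y) *\<^sub>R g y) / norm (z - y)) \<longlongrightarrow> 0) (at y)"
    using le by (intro Lim_null_comparison[OF _ lim2] eventually_at_ball'[THEN eventually_mono, of 1]) auto
  moreover have "bounded_linear (\<lambda>h. f' h *\<^sub>R g y)"
    using bounded_linear_compose[OF bounded_linear_scaleR_left bl] by blast
  ultimately show ?thesis unfolding has_derivative_iff_norm by simp
qed

text \<open>From \<open>G z - G y = - G z (A z - A y) G y\<close> the increment is a product in
  which the factor \<open>A z - A y\<close> vanishes at \<open>y\<close>, so the preceding product
  rule asks only for continuity of \<open>G\<close>. That continuity follows from a uniform bound on
  \<open>G z\<close> near \<open>y\<close>, obtained by perturbing the invertible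
  \<open>A y\<close>.\<close>

lemma inverse_family_has_derivative:
  fixes A :: "'a::euclidean_space \<Rightarrow> 'b::euclidean_space \<Rightarrow> 'c::euclidean_space"
  assumes W: "open W" "y \<in> W"
    and linA: "\<And>z. z \<in> W \<Longrightarrow> linear (A z)" and linG: "\<And>z. z \<in> W \<Longrightarrow> linear (G z)"
    and GA: "\<And>z u. z \<in> W \<Longrightarrow> G z (A z u) = u" and AG: "\<And>z u. z \<in> W \<Longrightarrow> A z (G z u) = u"
    and dA: "\<And>u. ((\<lambda>z. A z u) has_derivative (\<lambda>h. A' h u)) (at y)"
  shows "((\<lambda>z. G z v) has_derivative (\<lambda>h. - G y (A' h (G y v)))) (at y)"
proof -
  have contA: "isCont (\<lambda>z. A z u) y" for u
    using dA has_derivative_continuous by blast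
  have "bounded_linear (G y)" using linG W linear_conv_bounded_linear by blast
  then obtain C where C: "C > 0" "\<And>w. norm (G y w) \<le> norm w * C"
    using bounded_linear.pos_bounded by blast
  have "((\<lambda>z. \<Sum>b\<in>Basis. norm (A z b - A y b)) \<longlongrightarrow> (\<Sum>b\<in>Basis. norm (A y b - A y b))) (at y)"
    by (intro tendsto_intros) (use contA in \<open>auto simp: isCont_def\<close>)
  then have "((\<lambda>z. \<Sum>b\<in>Basis. norm (A z b - A y b)) \<longlongrightarrow> 0) (at y)" by simp
  \<comment> \<open>For \<open>A z\<close> this close to \<open>A y\<close>, replacing
    \<open>A y\<close> by \<open>A z\<close> in \<open>norm u \<le> C * norm (A y u)\<close> loses
    at most half of \<open>norm u\<close>; hence the bound \<open>2 * C\<close> for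
    \<open>G z\<close>.\<close>
  then have ev: "\<forall>\<^sub>F z in at y. (\<Sum>b\<in>Basis. norm (A z b - A y b)) < 1 / (2 * C)"
    using C by (auto simp: order_tendsto_iff)
  have evW: "\<forall>\<^sub>F z in at y. z \<in> W" using W by (simp add: eventually_at_in_open')
  have bound: "\<forall>\<^sub>F z in at y. z \<in> W \<and> (\<forall>w. norm (G z w) \<le> 2 * C * norm w)"
    using ev evW
  proof eventually_elim
    case (elim z)
    have "norm u \<le> 2 * C * norm (A z u)" for u
    proof -
      have "A z u - A y u = (\<Sum>b\<in>Basis. (u \<bullet> b) *\<^sub>R (A z b - A y b))"
        using linear_sum_Basis[OF linA[OF elim(2)], of u] linear_sum_Basis[OF linA[OF W(2)], of u]
        by (simp add: sum_subtractf scaleR_diff_right)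
      then have "norm (A z u - A y u) \<le> (\<Sum>b\<in>Basis. \<bar>u \<bullet> b\<bar> * norm (A z b - A y b))"
        by (metis (no_types, lifting) norm_sum norm_scaleR sum.cong)
      also have "\<dots> \<le> (\<Sum>b\<in>Basis. norm u * norm (A z b - A y b))"
        by (intro sum_mono mult_right_mono) (auto simp: Basis_le_norm)
      also have "\<dots> \<le> norm u * (1 / (2 * C))"
        unfolding sum_distrib_left[symmetric] using elim(1) by (intro mult_left_mono) auto
      finally have 1: "norm (A z u - A y u) \<le> norm u * (1 / (2 * C))" .
      have "norm u \<le> norm (A y u) * C" using C(2)[of "A y u"] GA[OF W(2)] by simp
      also have "norm (A y u) \<le> norm (A z u) + norm (A z u - A y u)"
        by (metis norm_triangle_ineq3 norm_minus_commute abs_le_iff add.commute diff_le_eq norm_triangle_sub)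
      also have "\<dots> \<le> norm (A z u) + norm u * (1 / (2 * C))" using 1 by simp
      finally have "norm u \<le> (norm (A z u) + norm u * (1 / (2 * C))) * C" using C by simp
      then show ?thesis using C(1) by (simp add: algebra_simps)
    qed
    then show ?case using elim(2) AG by metis
  qed
  have diff: "G z v - G y v = - G z (A z (G y v) - A y (G y v))" if "z \<in> W" for z v
    using linear_diff[OF linG[OF that]] GA[OF that] AG[OF W(2)] by simp
  have contG: "isCont (\<lambda>z. G z v) y" for v
  proof -
    have "((\<lambda>z. 2 * C * norm (A z (G y v) - A y (G y v))) \<longlongrightarrow> 2 * C * norm (A y (G y v) - A y (G y v))) (at y)"
      by (intro tendsto_intros) (use contA in \<open>auto simp: isCont_def\<close>)
    then have "((\<lambda>z. 2 * C * norm (A z (G y v) - A y (G y v))) \<longlongrightarrow> 0) (at y)" by simp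
    then have "((\<lambda>z. G z v - G y v) \<longlongrightarrow> 0) (at y)"
      by (rule Lim_null_comparison[rotated]) (use bound in eventually_elim, simp add: diff)
    then show ?thesis by (simp add: isCont_def LIM_zero_iff)
  qed
  let ?w = "G y v"
  have "((\<lambda>z. ((A z ?w - A y ?w) \<bullet> b) *\<^sub>R G z b) has_derivative (\<lambda>h. (A' h ?w \<bullet> b) *\<^sub>R G y b)) (at y)" for b
    by (rule has_derivative_vanishing_scaleR[OF _ _ contG]) (auto intro!: derivative_eq_intros dA)
  then have "((\<lambda>z. G y v - (\<Sum>b\<in>Basis. ((A z ?w - A y ?w) \<bullet> b) *\<^sub>R G z b)) has_derivative
      (\<lambda>h. 0 - (\<Sum>b\<in>Basis. (A' h ?w \<bullet> b) *\<^sub>R G y b))) (at y)"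
    by (intro has_derivative_diff has_derivative_sum has_derivative_const)
  moreover have "(\<Sum>b\<in>Basis. (A' h ?w \<bullet> b) *\<^sub>R G y b) = G y (A' h ?w)" for h
    using linear_sum_Basis[OF linG[OF W(2)], of "A' h ?w"] by simp
  moreover have "G z v = G y v - (\<Sum>b\<in>Basis. ((A z ?w - A y ?w) \<bullet> b) *\<^sub>R G z b)" if "z \<in> W" for z
    using linear_sum_Basis[OF linG[OF that], of "A z ?w - A y ?w"] diff[OF that, of v] by (simp add: algebra_simps)
  ultimately show ?thesis
    using has_derivative_cong_open[OF W, of "\<lambda>z. G z v"] by simp
qed

text \<open>The derivative of \<open>g\<close> is the inverse of the derivative of \<open>f\<close>
  at \<open>g y\<close>. Differentiating this inverse gives an expression polynomial in
  \<open>g'\<close> and the second derivatives of \<open>f\<close> at \<open>g y\<close>, so the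
  regularity of \<open>g\<close> and \<open>g'\<close> is raised together, one order at a
  time.\<close>

lemma smooth_on_local_inverse:
  fixes f :: "'a::euclidean_space \<Rightarrow> 'b::euclidean_space"
  assumes U: "open U" and W: "open W" and f: "smooth_on U f" and gU: "g ` W \<subseteq> U"
    and dg: "\<And>y. y \<in> W \<Longrightarrow> (g has_derivative g' y) (at y)"
    and fg: "\<And>y v. y \<in> W \<Longrightarrow> fd f (g y) (g' y v) = v"
    and gf: "\<And>y u. y \<in> W \<Longrightarrow> g' y (fd f (g y) u) = u"
  shows "smooth_on W g"
proof -
  have ling: "linear (g' y)" if "y \<in> W" for y using dg[OF that] has_derivative_linear by blast
  have linf: "linear (fd f (g y))" if "y \<in> W" for y
    using smooth_on_differentiable[OF f] gU that by (auto intro: linear_fd)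
  define H where "H y h u = fd (\<lambda>x. fd f x u) (g y) (g' y h)" for y h u
  have dG: "((\<lambda>z. g' z v) has_derivative (\<lambda>h. - g' y (H y h (g' y v)))) (at y)" if "y \<in> W" for y v
  proof (rule inverse_family_has_derivative[OF W that, of "\<lambda>z. fd f (g z)"])
    fix u
    have "((\<lambda>x. fd f x u) has_derivative fd (\<lambda>x. fd f x u) (g y)) (at (g y))"
      using smooth_on_has_derivative[OF smooth_on_fd[OF f]] gU that by blast
    from has_derivative_compose[OF dg[OF that] this]
    show "((\<lambda>z. fd f (g z) u) has_derivative (\<lambda>h. H y h u)) (at y)"
      by (simp add: H_def)
  qed (use ling linf fg gf in auto)
  \<comment> \<open>Written in components, because the closure rules for \<open>C_k_on\<close> speak
    of sums and products of functions and not of compositions of varying linear maps.\<close>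
  have expand: "- g' y (H y h (g' y v)) =
      (\<Sum>b\<in>Basis. \<Sum>a\<in>Basis. \<Sum>c\<in>Basis. (- ((g' y v \<bullet> b) * (g' y h \<bullet> a) * (fd (\<lambda>x. fd f x b) (g y) a \<bullet> c))) *\<^sub>R g' y c)"
    if y: "y \<in> W" for y h v
  proof -
    have gy: "g y \<in> U" using gU y by auto
    have d2: "(\<lambda>x. fd f x b) differentiable (at (g y))" for b
      using smooth_on_differentiable[OF smooth_on_fd[OF f] gy] .
    have 1: "H y h u = (\<Sum>b\<in>Basis. (u \<bullet> b) *\<^sub>R H y h b)" for u
    proof -
      have "fd (\<lambda>x. fd f x u) (g y) = fd (\<lambda>x. \<Sum>b\<in>Basis. (u \<bullet> b) *\<^sub>R fd f x b) (g y)"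
        by (rule fd_cong_open[OF U gy], rule linear_sum_Basis)
          (use smooth_on_differentiable[OF f] linear_fd in blast)
      also have "\<dots> = (\<lambda>k. \<Sum>b\<in>Basis. (u \<bullet> b) *\<^sub>R fd (\<lambda>x. fd f x b) (g y) k)"
        by (rule fd_eqI) (intro has_derivative_sum has_derivative_scaleR_right fd_works d2)
      finally show ?thesis by (simp add: H_def)
    qed
    have 2: "H y h b = (\<Sum>a\<in>Basis. (g' y h \<bullet> a) *\<^sub>R fd (\<lambda>x. fd f x b) (g y) a)" for b
      unfolding H_def by (rule linear_sum_Basis[OF linear_fd[OF d2]])
    have 3: "g' y w = (\<Sum>c\<in>Basis. (w \<bullet> c) *\<^sub>R g' y c)" for w
      by (rule linear_sum_Basis[OF ling[OF y]])
    have "g' y (H y h (g' y v)) = (\<Sum>b\<in>Basis. (g' y v \<bullet> b) *\<^sub>R (\<Sum>a\<in>Basis. (g' y h \<bullet> a) *\<^sub>R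
        (\<Sum>c\<in>Basis. (fd (\<lambda>x. fd f x b) (g y) a \<bullet> c) *\<^sub>R g' y c)))"
      by (subst 1, subst 2) (simp add: linear_sum[OF ling[OF y]] linear_scale[OF ling[OF y]] flip: 3)
    then show ?thesis
      by (simp add: scaleR_sum_right sum_negf mult.assoc)
  qed
  have "C_k_on k W g \<and> (\<forall>v. C_k_on k W (\<lambda>y. g' y v))" for k
  proof (induction k)
    case 0
    have "isCont g y" "isCont (\<lambda>y. g' y v) y" if "y \<in> W" for y v
      using dg dG that has_derivative_continuous by blast+
    then show ?case by (simp add: continuous_at_imp_continuous_on)
  next
    case (Suc k)
    then have C: "C_k_on k W g" "\<And>v. C_k_on k W (\<lambda>y. g' y v)" by auto
    have "C_k_on k U (\<lambda>x. fd (\<lambda>x. fd f x b) x a)" for a b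
      using smooth_on_fd[OF smooth_on_fd[OF f]] unfolding smooth_on_def by blast
    from C_k_on_compose[OF W U this C(1) gU]
    have D2: "C_k_on k W (\<lambda>y. fd (\<lambda>x. fd f x b) (g y) a)" for a b by simp
    have mult: "C_k_on k W (\<lambda>y. p y * q y)" if "C_k_on k W p" "C_k_on k W q" for p q :: "'b \<Rightarrow> real"
      using C_k_on_scaleR[OF W that] by simp
    have neg: "C_k_on k W (\<lambda>y. - p y)" if "C_k_on k W p" for p :: "'b \<Rightarrow> real"
      using C_k_on_bounded_linear_o[OF W bounded_linear_minus[OF bounded_linear_ident] that] .
    have "C_k_on k W (\<lambda>y. \<Sum>b\<in>Basis. \<Sum>a\<in>Basis. \<Sum>c\<in>Basis. (- ((g' y v \<bullet> b) * (g' y h \<bullet> a) * (fd (\<lambda>x. fd f x b) (g y) a \<bullet> c))) *\<^sub>R g' y c)" for v h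
      by (intro C_k_on_sum C_k_on_scaleR neg mult C_k_on_inner_const C D2 W)
    then have "C_k_on k W (\<lambda>y. - g' y (H y h (g' y v)))" for v h
      by (rule C_k_on_cong[OF W, rotated]) (simp add: expand)
    then have "C_k_on (Suc k) W (\<lambda>y. g' y v)" for v
      by (intro C_k_on_SucI[OF W dG]) auto
    moreover have "C_k_on (Suc k) W g"
      by (intro C_k_on_SucI[OF W dg]) (auto intro: C)
    ultimately show ?case by blast
  qed
  then show ?thesis unfolding smooth_on_def by blast
qed

text \<open>\<open>inverse_function_theorem\<close> wants the derivative as a continuous map into
  bounded linear maps; in finite dimension continuity may be tested on each basis vector.\<close>

lemma smooth_on_Blinfun_continuous:
  assumes "open U" "smooth_on U f"
  shows "continuous_on U (\<lambda>x. Blinfun (fd f x))"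
proof (rule continuous_on_blinfun_componentwise)
  fix i
  have "bounded_linear (fd f x)" if "x \<in> U" for x
    using smooth_on_has_derivative[OF assms(2) that] has_derivative_bounded_linear by blast
  moreover have "continuous_on U (\<lambda>x. fd f x i)"
    using smooth_on_continuous[OF smooth_on_fd[OF assms(2)]] .
  ultimately show "continuous_on U (\<lambda>x. blinfun_apply (Blinfun (fd f x)) i)"
    by (simp add: bounded_linear_Blinfun_apply cong: continuous_on_cong_simp)
qed

lemma linear_isometry_exists:
  assumes "DIM('a::euclidean_space) = DIM('b::euclidean_space)"
  obtains i :: "'b::euclidean_space \<Rightarrow> 'a::euclidean_space" and j :: "'a::euclidean_space \<Rightarrow> 'b::euclidean_space"
  where "linear i" "linear j" "\<And>x. i (j x) = x" "\<And>y. j (i y) = y"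
proof -
  obtain i :: "'b \<Rightarrow> 'a" and j :: "'a \<Rightarrow> 'b"
    where "linear i" "linear j" "\<And>x. norm (i x) = norm x" "\<And>y. norm (j y) = norm y"
      "\<And>x. j (i x) = x" "\<And>y. i (j y) = y"
    by (rule isomorphisms_UNIV_UNIV[OF assms[symmetric]]) (rule that; assumption)
  then show thesis using that by blast
qed

lemma smooth_inverse_function:
  fixes f :: "'a::euclidean_space \<Rightarrow> 'b::euclidean_space"
  assumes dim: "DIM('a) = DIM('b)" and U: "open U" "x0 \<in> U" and f: "smooth_on U f"
    and inj: "inj (fd f x0)"
  obtains U' V g where "open U'" "x0 \<in> U'" "U' \<subseteq> U" "open V" "homeomorphism U' V f g" "smooth_on V g"
    "\<And>y. y \<in> V \<Longrightarrow> (g has_derivative fd g y) (at y)"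
    "\<And>y v. y \<in> V \<Longrightarrow> fd f (g y) (fd g y v) = v"
    "\<And>y u. y \<in> V \<Longrightarrow> fd g y (fd f (g y) u) = u"
proof -
  obtain i :: "'b \<Rightarrow> 'a" and j :: "'a \<Rightarrow> 'b" where ij: "linear i" "linear j" "\<And>x. i (j x) = x" "\<And>y. j (i y) = y"
    using linear_isometry_exists[OF dim] by blast
  have bij: "bounded_linear i" "bounded_linear j" using ij linear_conv_bounded_linear by blast+
  \<comment> \<open>The inverse function theorem is applied to a map of \<open>'a\<close> into
    itself; the linear isomorphism \<open>i\<close> brings the target to \<open>'a\<close> and is
    undone at the end.\<close>
  define F where "F = (\<lambda>x. i (f x))"
  have sF: "smooth_on U F" unfolding F_def by (rule smooth_on_bounded_linear_o[OF U(1) bij(1) f])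
  have fdF: "fd F x = (\<lambda>v. i (fd f x v))" if "x \<in> U" for x
    unfolding F_def
    by (rule fd_eqI, rule bounded_linear.has_derivative[OF bij(1) smooth_on_has_derivative[OF f that]])
  have blF: "bounded_linear (fd F x)" if "x \<in> U" for x
    using smooth_on_has_derivative[OF sF that] has_derivative_bounded_linear by blast
  have "linear (fd F x0)" using blF U bounded_linear.linear by blast
  moreover have "inj (fd F x0)"
    unfolding fdF[OF U(2)] by (rule injI, rule injD[OF inj]) (metis ij(4))
  ultimately obtain l where l: "linear l" "\<And>x. l (fd F x0 x) = x"
    using linear_injective_left_inverse[of "fd F x0"] by (auto simp: fun_eq_iff)
  have der: "(F has_derivative blinfun_apply (Blinfun (fd F x))) (at x)" if "x \<in> U" for x
    using smooth_on_has_derivative[OF sF that] blF[OF that] by (simp add: bounded_linear_Blinfun_apply)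
  have inv0: "Blinfun l o\<^sub>L Blinfun (fd F x0) = id_blinfun"
    by (rule blinfun_eqI)
      (use l blF[OF U(2)] in \<open>simp add: bounded_linear_Blinfun_apply linear_conv_bounded_linear\<close>)
  obtain U' V g g' where *: "open U'" "U' \<subseteq> U" "x0 \<in> U'" "open V" "homeomorphism U' V F g"
      "\<And>y. y \<in> V \<Longrightarrow> (g has_derivative (g' y)) (at y)"
      "\<And>y. y \<in> V \<Longrightarrow> g' y = inv (blinfun_apply (Blinfun (fd F (g y))))"
      "\<And>y. y \<in> V \<Longrightarrow> bij (blinfun_apply (Blinfun (fd F (g y))))"
    by (rule inverse_function_theorem[OF U(1) der smooth_on_Blinfun_continuous[OF U(1) sF] U(2) inv0]) (assumption, (rule that; assumption))
  have gV: "g y \<in> U'" if "y \<in> V" for y using *(5) that unfolding homeomorphism_def by blast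
  have app: "blinfun_apply (Blinfun (fd F (g y))) = fd F (g y)" if "y \<in> V" for y
    using blF gV[OF that] *(2) by (simp add: bounded_linear_Blinfun_apply subset_iff)
  have sg: "smooth_on V g"
  proof (rule smooth_on_local_inverse[OF U(1) *(4) sF _ *(6)])
    show "g ` V \<subseteq> U" using gV *(2) by auto
    fix y assume y: "y \<in> V"
    show "fd F (g y) (g' y v) = v" for v
      using *(7,8)[OF y] app[OF y] by (metis bij_inv_eq_iff)
    show "g' y (fd F (g y) u) = u" for u
      using *(7,8)[OF y] app[OF y] by (metis bij_inv_eq_iff)
  qed
  let ?V = "i -` V" and ?g = "\<lambda>y. g (i y)"
  have oV: "open ?V" by (rule open_vimage[OF *(4)]) (use bij linear_continuous_on in blast)
  have sg': "smooth_on ?V ?g"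
    by (rule smooth_on_compose[OF oV *(4) sg smooth_on_bounded_linear[OF oV bij(1)]]) auto
  have fdg': "fd ?g y = (\<lambda>v. g' (i y) (i v))" if "y \<in> ?V" for y
    by (rule fd_eqI) (use has_derivative_compose[OF bounded_linear_imp_has_derivative[OF bij(1)] *(6), of y] that in auto)
  show thesis
  proof (rule that[OF *(1,3,2) oV])
    have hom: "\<And>x. x \<in> U' \<Longrightarrow> i (f x) \<in> V \<and> g (i (f x)) = x" "\<And>y. y \<in> V \<Longrightarrow> i (f (g y)) = y"
      using *(5) unfolding homeomorphism_def F_def by auto
    have 1: "f x = j (i (f x))" for x using ij by simp
    show "homeomorphism U' ?V f ?g"
    proof (rule homeomorphismI)
      show "continuous_on U' f" using smooth_on_continuous[OF f] *(2) continuous_on_subset by blast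
      show "continuous_on ?V ?g" using smooth_on_continuous[OF sg'] .
      show "f ` U' \<subseteq> ?V" using hom(1) by auto
      show "?g ` ?V \<subseteq> U'" using gV by auto
      show "?g (f x) = x" if "x \<in> U'" for x using hom that by auto
      show "f (?g y) = y" if "y \<in> ?V" for y using hom(2)[of "i y"] that ij(4) by (metis vimage_eq)
    qed
    show "smooth_on ?V ?g" by (rule sg')
    fix y assume y: "y \<in> ?V"
    show "(?g has_derivative fd ?g y) (at y)" using smooth_on_has_derivative[OF sg' y] .
    have gy: "g (i y) \<in> U" using gV y *(2) by auto
    have inv: "fd F (g (i y)) (g' (i y) w) = w" "g' (i y) (fd F (g (i y)) u) = u" for u w
      using *(7,8)[of "i y"] app[of "i y"] y by (metis bij_inv_eq_iff vimage_eq)+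
    show "fd f (g (i y)) (fd ?g y v) = v" for v
      using inv(1)[of "i v"] fdF[OF gy] ij(4) fdg'[OF y] by metis
    show "fd ?g y (fd f (g (i y)) u) = u" for u
      using inv(2)[of u] fdF[OF gy] fdg'[OF y] by simp
  qed
qed

subsection \<open>Holomorphic maps between complexified Euclidean spaces\<close>

text \<open>Multiplication by \<open>\<i>\<close> on a complexified space. Keeping it as a real
  linear map lets real analysis apply unchanged.\<close>

definition Jc :: "'v::real_vector cplxn \<Rightarrow> 'v cplxn" where
  "Jc w = (- snd w, fst w)"

lemma Jc_simps [simp]: "fst (Jc w) = - snd w" "snd (Jc w) = fst w" "Jc (Jc w) = - w" "Jc 0 = 0"
  by (auto simp: Jc_def prod_eq_iff)

lemma linear_Jc: "linear (Jc :: 'v::real_vector cplxn \<Rightarrow> _)"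
  by (rule linearI) (auto simp: prod_eq_iff)

lemma bounded_linear_Jc: "bounded_linear (Jc :: 'v::euclidean_space cplxn \<Rightarrow> _)"
  using linear_Jc linear_conv_bounded_linear by blast

lemma norm_Jc [simp]: "norm (Jc (w :: 'v::real_normed_vector cplxn)) = norm w"
  by (simp add: norm_prod_def add.commute)

lemma Jc_arith: "Jc (a + b) = Jc a + Jc b" "Jc (a - b) = Jc a - Jc b" "Jc (- a) = - Jc a"
  "Jc (r *\<^sub>R a) = r *\<^sub>R Jc a"
  by (auto simp: prod_eq_iff)

lemma cscale_eq: "z *\<^sub>c w = Re z *\<^sub>R w + Im z *\<^sub>R Jc w"
  by (auto simp: cscale_def prod_eq_iff)

lemma cscale_0 [simp]: "0 *\<^sub>c w = 0" "z *\<^sub>c 0 = 0"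
  by (simp_all add: cscale_eq)

text \<open>\<open>w\<close> and \<open>Jc w\<close> are orthogonal and of equal norm, so Pythagoras
  produces the modulus of \<open>z\<close>.\<close>

lemma norm_cscale: "norm (z *\<^sub>c (w :: 'v::real_inner cplxn)) = norm z * norm w"
proof -
  have o: "w \<bullet> Jc w = 0" by (simp add: inner_prod_def inner_commute)
  have "(norm (z *\<^sub>c w))\<^sup>2 = (Re z)\<^sup>2 * (norm w)\<^sup>2 + (Im z)\<^sup>2 * (norm (Jc w))\<^sup>2"
    unfolding power2_norm_eq_inner cscale_eq
    by (simp add: o inner_simps inner_commute[of "Jc w" w] power2_eq_square)
  also have "\<dots> = (norm z * norm w)\<^sup>2"
    by (simp add: cmod_power2 power_mult_distrib algebra_simps)
  finally show ?thesis by (simp add: power2_eq_iff_nonneg)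
qed

lemma linear_cscale_left: "linear (\<lambda>z. z *\<^sub>c w)"
  by (rule linearI) (auto simp: cscale_eq algebra_simps)

definition ccomp :: "'v \<Rightarrow> 'v::real_inner cplxn \<Rightarrow> complex" where
  "ccomp b w = Complex (fst w \<bullet> b) (snd w \<bullet> b)"

lemma ccomp_Jc: "ccomp b (Jc w) = \<i> * ccomp b w"
  by (simp add: ccomp_def complex_eq_iff)

lemma linear_ccomp: "linear (ccomp b)"
  by (rule linearI) (auto simp: ccomp_def complex_eq_iff inner_simps)

lemma bounded_linear_ccomp: "bounded_linear (ccomp (b::'v::euclidean_space))"
  using linear_ccomp linear_conv_bounded_linear by blast

lemma ccomp_cscale: "ccomp b (z *\<^sub>c w) = z * ccomp b w"
  by (simp add: ccomp_def cscale_def complex_eq_iff inner_simps)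

lemma norm_ccomp_le: "b \<in> Basis \<Longrightarrow> norm (ccomp b (w :: 'v::euclidean_space cplxn)) \<le> norm w"
  unfolding ccomp_def norm_prod_def complex_norm
  by (intro real_sqrt_le_mono add_mono) (simp_all add: abs_le_square_iff[symmetric] Basis_le_norm)

lemma norm_le_sum_ccomp: "norm (w :: 'v::euclidean_space cplxn) \<le> (\<Sum>b\<in>Basis. norm (ccomp b w))"
proof -
  have "w = (\<Sum>b\<in>Basis. ((fst w \<bullet> b) *\<^sub>R b, (snd w \<bullet> b) *\<^sub>R b))"
    by (simp add: prod_eq_iff fst_sum snd_sum euclidean_representation)
  then have "norm w = norm (\<Sum>b\<in>Basis. ((fst w \<bullet> b) *\<^sub>R b, (snd w \<bullet> b) *\<^sub>R b))"
    by (rule arg_cong)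
  also have "\<dots> \<le> (\<Sum>b\<in>Basis. norm ((fst w \<bullet> b) *\<^sub>R b, (snd w \<bullet> b) *\<^sub>R b))"
    by (rule norm_sum)
  also have "\<dots> = (\<Sum>b\<in>Basis. norm (ccomp b w))"
    by (intro sum.cong) (auto simp: norm_prod_def ccomp_def complex_norm)
  finally show ?thesis .
qed

text \<open>Complex differentiability, encoded as real differentiability with a derivative that
  commutes with multiplication by \<open>\<i>\<close>: the Cauchy-Riemann equations in invariant
  form.\<close>

definition holo :: "'a::euclidean_space cplxn set \<Rightarrow> ('a cplxn \<Rightarrow> 'b::euclidean_space cplxn) \<Rightarrow> bool" where
  "holo S f \<longleftrightarrow> (\<forall>x\<in>S. f differentiable (at x) \<and> (\<forall>h. fd f x (Jc h) = Jc (fd f x h)))"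

lemma holoI:
  assumes "\<And>x. x \<in> S \<Longrightarrow> (f has_derivative f' x) (at x)" "\<And>x h. x \<in> S \<Longrightarrow> f' x (Jc h) = Jc (f' x h)"
  shows "holo S f"
  unfolding holo_def using assms fd_eqI differentiable_def by metis

lemma holo_has_derivative: "holo S f \<Longrightarrow> x \<in> S \<Longrightarrow> (f has_derivative fd f x) (at x)"
  by (simp add: holo_def fd_works)

lemma holo_differentiable: "holo S f \<Longrightarrow> x \<in> S \<Longrightarrow> f differentiable (at x)"
  by (simp add: holo_def)

lemma holo_fd_Jc: "holo S f \<Longrightarrow> x \<in> S \<Longrightarrow> fd f x (Jc h) = Jc (fd f x h)"
  unfolding holo_def by blast

lemma holo_linear: "holo S f \<Longrightarrow> x \<in> S \<Longrightarrow> linear (fd f x)"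
  by (simp add: holo_def linear_fd)

lemma holo_continuous: "holo S f \<Longrightarrow> continuous_on S f"
  by (simp add: holo_def continuous_at_imp_continuous_on differentiable_imp_continuous_within)

lemma holo_subset: "holo S f \<Longrightarrow> T \<subseteq> S \<Longrightarrow> holo T f"
  by (auto simp: holo_def)

lemma holo_const: "holo S (\<lambda>x. c)"
  by (rule holoI) (auto intro: derivative_eq_intros)

lemma holo_add: "holo S f \<Longrightarrow> holo S g \<Longrightarrow> holo S (\<lambda>x. f x + g x)"
  by (rule holoI, rule has_derivative_add)
    (auto intro: holo_has_derivative simp: holo_fd_Jc Jc_arith)

lemma holo_diff: "holo S f \<Longrightarrow> holo S g \<Longrightarrow> holo S (\<lambda>x. f x - g x)"
  by (rule holoI, rule has_derivative_diff)
    (auto intro: holo_has_derivative simp: holo_fd_Jc Jc_arith)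

lemma holo_scaleR: "holo S f \<Longrightarrow> holo S (\<lambda>x. r *\<^sub>R f x)"
  by (rule holoI, rule has_derivative_scaleR_right)
    (auto intro: holo_has_derivative simp: holo_fd_Jc Jc_arith)

lemma holo_sum: "(\<And>i. i \<in> I \<Longrightarrow> holo S (f i)) \<Longrightarrow> holo S (\<lambda>x. \<Sum>i\<in>I. f i x)"
  by (induction I rule: infinite_finite_induct) (auto intro: holo_const holo_add)

lemma holo_linear_o:
  assumes "linear l" "\<And>h. l (Jc h) = Jc (l h)" "holo S f"
  shows "holo S (\<lambda>x. l (f x))"
proof (rule holoI)
  show "((\<lambda>x. l (f x)) has_derivative (\<lambda>h. l (fd f x h))) (at x)" if "x \<in> S" for x
    using bounded_linear.has_derivative[OF _ holo_has_derivative[OF assms(3) that]] assms(1)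
      linear_conv_bounded_linear by blast
  show "l (fd f x (Jc h)) = Jc (l (fd f x h))" if "x \<in> S" for x h
    by (simp only: holo_fd_Jc[OF assms(3) that] assms(2))
qed

lemma holo_id: "holo S (\<lambda>x. x)"
  by (rule holoI) (auto intro: derivative_eq_intros)

lemma holo_compose:
  assumes "holo T f" "holo S g" "g ` S \<subseteq> T"
  shows "holo S (\<lambda>x. f (g x))"
proof (rule holoI)
  fix x assume x: "x \<in> S"
  then have "g x \<in> T" using assms by auto
  then show "((\<lambda>x. f (g x)) has_derivative (\<lambda>h. fd f (g x) (fd g x h))) (at x)"
    using has_derivative_compose[OF holo_has_derivative[OF assms(2) x] holo_has_derivative[OF assms(1)]] by simp
  show "fd f (g x) (fd g x (Jc h)) = Jc (fd f (g x) (fd g x h))" for h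
    using holo_fd_Jc assms x \<open>g x \<in> T\<close> by metis
qed

section \<open>Complex lines, Cauchy estimates and uniform limits\<close>

lemma holo_line:
  assumes "holo S f" "x + L *\<^sub>c v \<in> S"
  shows "((\<lambda>L. ccomp b (f (x + L *\<^sub>c v))) has_field_derivative ccomp b (fd f (x + L *\<^sub>c v) v)) (at L)"
proof -
  have "((\<lambda>L. x + L *\<^sub>c v) has_derivative (\<lambda>\<mu>. \<mu> *\<^sub>c v)) (at L)"
    by (rule has_derivative_eq_rhs, rule has_derivative_add[OF has_derivative_const linear_imp_has_derivative[OF linear_cscale_left]]) simp
  from has_derivative_compose[OF this holo_has_derivative[OF assms]]
  have "((\<lambda>L. ccomp b (f (x + L *\<^sub>c v))) has_derivative (\<lambda>\<mu>. ccomp b (fd f (x + L *\<^sub>c v) (\<mu> *\<^sub>c v)))) (at L)"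
    by (rule bounded_linear.has_derivative[OF bounded_linear_ccomp])
  moreover have "ccomp b (fd f (x + L *\<^sub>c v) (\<mu> *\<^sub>c v)) = ccomp b (fd f (x + L *\<^sub>c v) v) * \<mu>" for \<mu>
    unfolding cscale_eq[of \<mu>]
    by (simp add: linear_add[OF holo_linear[OF assms]] linear_scale[OF holo_linear[OF assms]] holo_fd_Jc[OF assms]
        linear_add[OF linear_ccomp] linear_scale[OF linear_ccomp] ccomp_Jc complex_eq_iff algebra_simps)
  ultimately show ?thesis unfolding has_field_derivative_def by (simp add: fun_eq_iff)
qed

lemma holo_line_holomorphic:
  assumes "holo S f" "\<And>L. L \<in> T \<Longrightarrow> x + L *\<^sub>c v \<in> S"
  shows "(\<lambda>L. ccomp b (f (x + L *\<^sub>c v))) holomorphic_on T"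
  unfolding holomorphic_on_def field_differentiable_def
  using holo_line[OF assms(1)] assms(2) has_field_derivative_at_within by blast

text \<open>On a complex line the components of \<open>f\<close> are holomorphic functions of one
  variable, so the classical Cauchy inequality applies; the hypothesis on \<open>\<rho>\<close>
  keeps the disc around \<open>\<mu>\<close> inside the ball.\<close>

lemma holo_line_deriv_bound:
  fixes M r \<rho> :: real
  assumes f: "holo (ball x r) f" and M: "\<And>y. y \<in> ball x r \<Longrightarrow> norm (f y) < M"
    and v: "v \<noteq> 0" and b: "b \<in> Basis" and \<rho>: "\<rho> > 0" "norm \<mu> * norm v + \<rho> * norm v < r" and n: "n > 0"
  shows "norm ((deriv ^^ n) (\<lambda>L. ccomp b (f (x + L *\<^sub>c v))) \<mu>) \<le> fact n * M / \<rho> ^ n"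
proof -
  have in_ball: "x + L *\<^sub>c v \<in> ball x r" if "L \<in> cball \<mu> \<rho>" for L
  proof -
    have "norm L \<le> norm \<mu> + \<rho>"
      using that norm_triangle_sub[of L \<mu>] by (simp add: dist_norm norm_minus_commute)
    then have "norm L * norm v \<le> (norm \<mu> + \<rho>) * norm v" by (simp add: mult_right_mono)
    then show ?thesis using \<rho> by (simp add: dist_norm norm_cscale algebra_simps)
  qed
  show ?thesis
  proof (rule Cauchy_higher_deriv_bound[where y = 0])
    show "(\<lambda>L. ccomp b (f (x + L *\<^sub>c v))) holomorphic_on ball \<mu> \<rho>"
      by (rule holo_line_holomorphic[OF f in_ball]) auto
    have "(\<lambda>L. ccomp b (f (x + L *\<^sub>c v))) holomorphic_on cball \<mu> \<rho>"
      by (rule holo_line_holomorphic[OF f in_ball])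
    then show "continuous_on (cball \<mu> \<rho>) (\<lambda>L. ccomp b (f (x + L *\<^sub>c v)))"
      by (rule holomorphic_on_imp_continuous_on)
    show "ccomp b (f (x + w *\<^sub>c v)) \<in> ball 0 M" if "w \<in> ball \<mu> \<rho>" for w
      using M[of "x + w *\<^sub>c v"] in_ball[of w] that norm_ccomp_le[OF b, of "f (x + w *\<^sub>c v)"] by force
  qed (use \<rho> n in auto)
qed

lemma holo_Cauchy_estimate:
  fixes f :: "'a::euclidean_space cplxn \<Rightarrow> 'b::euclidean_space cplxn" and M r :: real
  assumes f: "holo (ball x r) f" and M: "\<And>y. y \<in> ball x r \<Longrightarrow> norm (f y) < M" and r: "r > 0"
  shows "norm (fd f x v) \<le> 2 * DIM('b) * M / r * norm v"
proof (cases "v = 0")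
  case True
  have "fd f x 0 = 0" using holo_linear[OF f] r by (simp add: linear_0)
  then show ?thesis using True by simp
next
  case False
  have "norm (ccomp b (fd f x v)) \<le> 2 * M / r * norm v" if b: "b \<in> Basis" for b
  proof -
    \<comment> \<open>Half of the radius at which the line leaves the ball; this is the source of
      the factor 2.\<close>
    let ?\<rho> = "r / (2 * norm v)"
    have "norm ((deriv ^^ 1) (\<lambda>L. ccomp b (f (x + L *\<^sub>c v))) 0) \<le> fact 1 * M / ?\<rho> ^ 1"
      by (rule holo_line_deriv_bound[OF f M False b]) (use r False in auto)
    moreover have "deriv (\<lambda>L. ccomp b (f (x + L *\<^sub>c v))) 0 = ccomp b (fd f x v)"
      using DERIV_imp_deriv[OF holo_line[OF f, where x=x and L=0 and v=v and b=b]] r by (simp add: cscale_eq)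
    ultimately show ?thesis using r False by (simp add: field_simps)
  qed
  then have "(\<Sum>b\<in>Basis. norm (ccomp b (fd f x v))) \<le> (\<Sum>b\<in>(Basis::'b set). 2 * M / r * norm v)"
    by (rule sum_mono)
  then show ?thesis using norm_le_sum_ccomp[of "fd f x v"] by (simp add: mult_ac)
qed

text \<open>Taylor's formula on the line through \<open>x\<close> in direction \<open>v\<close>. On
  the disc of radius \<open>r / (2 * norm v)\<close> the second derivative is bounded by Cauchy's
  inequality with radius \<open>r / (4 * norm v)\<close>, and
  \<open>32 = fact 2 * 4\<^sup>2\<close>.\<close>

lemma holo_second_order_estimate:
  fixes f :: "'a::euclidean_space cplxn \<Rightarrow> 'b::euclidean_space cplxn" and M r :: real
  assumes f: "holo (ball x r) f" and M: "\<And>y. y \<in> ball x r \<Longrightarrow> norm (f y) < M" and r: "r > 0"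
    and h: "norm h * norm v \<le> r / 4"
  shows "norm (f (x + h *\<^sub>c v) - f x - h *\<^sub>c fd f x v) \<le> DIM('b) * (32 * M / r\<^sup>2) * (norm h * norm v)\<^sup>2"
proof (cases "v = 0")
  case True
  have "fd f x 0 = 0" using holo_linear[OF f] r by (simp add: linear_0)
  moreover have "h *\<^sub>c (0::'a cplxn) = 0" "h *\<^sub>c (0::'b cplxn) = 0" by (simp_all add: cscale_eq)
  ultimately show ?thesis using True by simp
next
  case False
  have "norm (ccomp b (f (x + h *\<^sub>c v) - f x - h *\<^sub>c fd f x v)) \<le> 32 * M / r\<^sup>2 * (norm h * norm v)\<^sup>2" if b: "b \<in> Basis" for b
  proof -
    let ?g = "\<lambda>L. ccomp b (f (x + L *\<^sub>c v))"
    let ?\<rho> = "r / (4 * norm v)"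
    let ?R = "r / (2 * norm v)"
    have nv: "norm v > 0" using False by simp
    have hol: "?g holomorphic_on ball 0 (r / norm v)"
      by (rule holo_line_holomorphic[OF f]) (use nv in \<open>simp add: norm_cscale dist_norm field_simps\<close>)
    have sub: "ball 0 ?R \<subseteq> ball (0::complex) (r / norm v)" using nv r by (auto simp: field_simps)
    have "norm (((deriv ^^ 0) ?g) h - (\<Sum>i\<le>1. (deriv ^^ i) ?g 0 * (h - 0) ^ i / fact i))
        \<le> fact 2 * M / ?\<rho> ^ 2 * norm (h - 0) ^ Suc 1 / fact 1"
    proof (rule field_Taylor[of "ball 0 ?R"])
      show "((deriv ^^ i) ?g has_field_derivative (deriv ^^ Suc i) ?g z) (at z within ball 0 ?R)"
        if "z \<in> ball 0 ?R" for i z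
      proof -
        have "(deriv ^^ i) ?g holomorphic_on ball 0 (r / norm v)"
          by (intro holomorphic_higher_deriv hol) auto
        then show ?thesis
          using holomorphic_derivI[of "(deriv ^^ i) ?g" "ball 0 (r / norm v)" z] that sub
          by (auto intro: has_field_derivative_at_within)
      qed
      show "norm ((deriv ^^ Suc 1) ?g z) \<le> fact 2 * M / ?\<rho> ^ 2" if "z \<in> ball 0 ?R" for z
      proof -
        have "norm z < ?R" using that by simp
        then have "norm z * norm v < r / 2" using nv by (simp add: field_simps)
        then have "norm ((deriv ^^ 2) ?g z) \<le> fact 2 * M / ?\<rho> ^ 2"
          using nv r by (intro holo_line_deriv_bound[OF f M False b]) (auto simp: field_simps)
        then show ?thesis by (simp add: numeral_2_eq_2)
      qed
      show "h \<in> ball 0 ?R" using h nv r by (simp add: field_simps)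
    qed (use r nv in auto)
    moreover have "deriv ?g 0 = ccomp b (fd f x v)"
      using DERIV_imp_deriv[OF holo_line[OF f, where x=x and L=0 and v=v and b=b]] r by (simp add: cscale_eq)
    ultimately have "norm (?g h - ccomp b (f x) - ccomp b (fd f x v) * h) \<le> fact 2 * M / ?\<rho> ^ 2 * norm h ^ 2"
      by (simp add: numeral_2_eq_2 algebra_simps)
    moreover have "?g h - ccomp b (f x) - ccomp b (fd f x v) * h = ccomp b (f (x + h *\<^sub>c v) - f x - h *\<^sub>c fd f x v)"
      by (simp add: linear_diff[OF linear_ccomp] ccomp_cscale)
    moreover have "fact 2 * M / ?\<rho> ^ 2 * norm h ^ 2 = 32 * M / r\<^sup>2 * (norm h * norm v)\<^sup>2"
      using nv r by (simp add: field_simps power2_eq_square fact_numeral)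
    ultimately show ?thesis by simp
  qed
  then have "(\<Sum>b\<in>Basis. norm (ccomp b (f (x + h *\<^sub>c v) - f x - h *\<^sub>c fd f x v)))
      \<le> (\<Sum>b\<in>(Basis::'b set). 32 * M / r\<^sup>2 * (norm h * norm v)\<^sup>2)"
    by (rule sum_mono)
  then show ?thesis using norm_le_sum_ccomp[of "f (x + h *\<^sub>c v) - f x - h *\<^sub>c fd f x v"] by simp
qed

text \<open>The Cauchy estimate on balls of radius \<open>r/2\<close> around points of the smaller
  ball makes the derivatives uniformly Cauchy. So limit and derivative can be exchanged, and the
  limit derivative still commutes with \<open>Jc\<close>.\<close>

lemma holo_uniform_limit_ball:
  fixes f :: "nat \<Rightarrow> 'a::euclidean_space cplxn \<Rightarrow> 'b::euclidean_space cplxn"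
  assumes f: "\<And>n. holo (ball x r) (f n)" and u: "uniform_limit (ball x r) f g sequentially" and r: "r > 0"
  shows "holo (ball x (r/2)) g \<and> (\<forall>y\<in>ball x (r/2). \<forall>v. (\<lambda>n. fd (f n) y v) \<longlonglongrightarrow> fd g y v)"
proof -
  let ?B = "ball x (r/2)"
  have sub: "ball y (r/2) \<subseteq> ball x r" if "y \<in> ?B" for y
  proof
    fix z assume "z \<in> ball y (r/2)"
    then show "z \<in> ball x r" using that dist_triangle[of x z y] by (simp add: dist_commute)
  qed
  \<comment> \<open>This is \<open>2 * DIM('b) / (r/2)\<close>, the constant of the Cauchy estimate
    at radius \<open>r/2\<close>; below, the two functions compared each use up half of the
    tolerance.\<close>
  let ?K = "4 * real DIM('b) / r"
  have K: "?K > 0" using r by (simp add: DIM_positive)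
  have est: "\<exists>N. \<forall>m\<ge>N. \<forall>n\<ge>N. \<forall>y\<in>?B. \<forall>v. norm (fd (f m) y v - fd (f n) y v) \<le> e * norm v" if e: "e > 0" for e
  proof -
    have "e / (2 * ?K) > 0" using e K by (intro divide_pos_pos) auto
    then obtain N where N: "\<And>n y. n \<ge> N \<Longrightarrow> y \<in> ball x r \<Longrightarrow> dist (f n y) (g y) < e / (2 * ?K)"
      using u unfolding uniform_limit_iff eventually_sequentially by blast
    show ?thesis
    proof (intro exI[of _ N] allI impI ballI)
      fix m n y v assume mn: "m \<ge> N" "n \<ge> N" and y: "y \<in> ?B"
      have hd: "holo (ball y (r/2)) (\<lambda>z. f m z - f n z)"
        by (intro holo_diff holo_subset[OF f sub[OF y]])
      have A: "norm (fd (\<lambda>z. f m z - f n z) y v) \<le> 2 * DIM('b) * (e / ?K) / (r/2) * norm v"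
      proof (rule holo_Cauchy_estimate[OF hd])
        fix z assume "z \<in> ball y (r/2)"
        then have "dist (f m z) (g z) < e / (2 * ?K)" "dist (f n z) (g z) < e / (2 * ?K)"
          using N mn sub[OF y] by blast+
        then have "dist (f m z) (f n z) < e / (2 * ?K) + e / (2 * ?K)"
          using dist_triangle2[of "f m z" "f n z" "g z"] by linarith
        then show "norm (f m z - f n z) < e / ?K" by (simp add: dist_norm)
      qed (use r in simp)
      have B: "2 * DIM('b) * (e / ?K) / (r/2) = e" using r DIM_positive[where 'a='b] by (simp add: field_simps)
      have C: "fd (\<lambda>z. f m z - f n z) y v = fd (f m) y v - fd (f n) y v"
      proof -
        have "y \<in> ball x r" using y r by simp
        then have "((\<lambda>z. f m z - f n z) has_derivative (\<lambda>v. fd (f m) y v - fd (f n) y v)) (at y)"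
          using holo_has_derivative[OF f] by (intro has_derivative_diff) auto
        from fd_eqI[OF this] show ?thesis by (rule fun_cong)
      qed
      show "norm (fd (f m) y v - fd (f n) y v) \<le> e * norm v" using A unfolding B C .
    qed
  qed
  have "\<exists>l. (\<lambda>n. fd (f n) y v) \<longlonglongrightarrow> l" if y: "y \<in> ?B" for y v
  proof -
    have "Cauchy (\<lambda>n. fd (f n) y v)"
    proof (rule metric_CauchyI)
      fix e :: real assume e: "e > 0"
      have "e / (norm v + 1) > 0" using e by (smt (verit) divide_pos_pos norm_ge_zero)
      from est[OF this] obtain N where N: "\<And>m n. m \<ge> N \<Longrightarrow> n \<ge> N \<Longrightarrow>
          norm (fd (f m) y v - fd (f n) y v) \<le> e / (norm v + 1) * norm v" using y by blast
      have "e / (norm v + 1) * norm v < e"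
      proof -
        have "norm v / (norm v + 1) < 1" using norm_ge_zero[of v] by (simp add: pos_divide_less_eq add_nonneg_pos)
        from mult_strict_left_mono[OF this e] show ?thesis by simp
      qed
      then show "\<exists>N. \<forall>m\<ge>N. \<forall>n\<ge>N. dist (fd (f m) y v) (fd (f n) y v) < e"
        using N unfolding dist_norm by (meson order_le_less_trans)
    qed
    then show ?thesis using Cauchy_convergent convergent_def by blast
  qed
  then obtain G where G: "\<And>y v. y \<in> ?B \<Longrightarrow> (\<lambda>n. fd (f n) y v) \<longlonglongrightarrow> G y v" by metis
  have inB: "y \<in> ball x r" if "y \<in> ?B" for y using that r by simp
  have lim: "(\<lambda>n. f n y) \<longlonglongrightarrow> g y" if "y \<in> ?B" for y
    using tendsto_uniform_limitI[OF u inB[OF that]] .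
  have ev: "\<forall>\<^sub>F n in sequentially. \<forall>y\<in>?B. \<forall>h. norm (fd (f n) y h - G y h) \<le> e * norm h" if e: "e > 0" for e
  proof -
    obtain N where N: "\<And>m n y v. m \<ge> N \<Longrightarrow> n \<ge> N \<Longrightarrow> y \<in> ?B \<Longrightarrow> norm (fd (f m) y v - fd (f n) y v) \<le> e * norm v"
      using est[OF e] by metis
    have "norm (fd (f n) y h - G y h) \<le> e * norm h" if "n \<ge> N" "y \<in> ?B" for n y h
    proof (rule tendsto_le[OF sequentially_bot tendsto_const])
      show "(\<lambda>m. norm (fd (f n) y h - fd (f m) y h)) \<longlonglongrightarrow> norm (fd (f n) y h - G y h)"
        by (intro tendsto_intros G that)
      show "\<forall>\<^sub>F m in sequentially. norm (fd (f n) y h - fd (f m) y h) \<le> e * norm h"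
        using N that eventually_sequentially by blast
    qed
    then show ?thesis unfolding eventually_sequentially by blast
  qed
  have "\<exists>g2. \<forall>y\<in>?B. (\<lambda>n. f n y) \<longlonglongrightarrow> g2 y \<and> (g2 has_derivative G y) (at y within ?B)"
  proof (rule has_derivative_sequence[OF convex_ball _ ev])
    show "(f n has_derivative fd (f n) y) (at y within ?B)" if "y \<in> ?B" for n y
      using holo_has_derivative[OF f inB[OF that]] has_derivative_at_withinI by blast
    show "x \<in> ?B" using r by simp
    then show "(\<lambda>n. f n x) \<longlonglongrightarrow> g x" using lim by blast
  qed
  then obtain g2 where g2: "\<And>y. y \<in> ?B \<Longrightarrow> (\<lambda>n. f n y) \<longlonglongrightarrow> g2 y"
     "\<And>y. y \<in> ?B \<Longrightarrow> (g2 has_derivative G y) (at y within ?B)" by blast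
  have "g2 y = g y" if "y \<in> ?B" for y using g2(1) lim that LIMSEQ_unique by blast
  then have der: "(g has_derivative G y) (at y)" if "y \<in> ?B" for y
    using g2(2)[OF that] that has_derivative_cong_open[OF open_ball that, of g2 g] at_within_open[OF that open_ball]
    by auto
  have "G y (Jc h) = Jc (G y h)" if "y \<in> ?B" for y h
  proof (rule LIMSEQ_unique[OF G[OF that]])
    show "(\<lambda>n. fd (f n) y (Jc h)) \<longlonglongrightarrow> Jc (G y h)"
      using bounded_linear.tendsto[OF bounded_linear_Jc G[OF that]] holo_fd_Jc[OF f inB[OF that]] by simp
  qed
  then have "holo ?B g" using holoI[OF der] by blast
  then show ?thesis using G fd_eqI[OF der] by metis
qed

lemma holo_local: "(\<And>x. x \<in> S \<Longrightarrow> \<exists>T. x \<in> T \<and> holo T f) \<Longrightarrow> holo S f"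
  unfolding holo_def by blast

text \<open>The derivative along \<open>v\<close> is locally the uniform limit of difference
  quotients, which are holomorphic; the second-order estimate gives the rate of convergence.\<close>

lemma holo_fd:
  fixes f :: "'a::euclidean_space cplxn \<Rightarrow> 'b::euclidean_space cplxn"
  assumes S: "open S" and f: "holo S f"
  shows "holo S (\<lambda>x. fd f x v)"
proof (rule holo_local)
  fix x assume x: "x \<in> S"
  obtain r0 where r0: "r0 > 0" "cball x r0 \<subseteq> S" using S x open_contains_cball by blast
  define r where "r = r0 / 2"
  have r: "r > 0" "cball x (2 * r) \<subseteq> S" using r0 by (auto simp: r_def)
  have "compact (f ` cball x (2 * r))"
    by (intro compact_continuous_image holo_continuous holo_subset[OF f r(2)] compact_cball)
  then obtain M0 where M0: "\<And>y. y \<in> cball x (2*r) \<Longrightarrow> norm (f y) \<le> M0"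
    using compact_imp_bounded bounded_iff by (metis imageI)
  define M where "M = M0 + 1"
  have M: "norm (f y) < M" if "y \<in> cball x (2*r)" for y using M0[OF that] by (simp add: M_def)
  have sub: "ball y r \<subseteq> cball x (2*r)" if "y \<in> ball x r" for y
  proof
    fix z assume "z \<in> ball y r"
    then show "z \<in> cball x (2 * r)" using that dist_triangle[of x z y] by (simp add: dist_commute)
  qed
  \<comment> \<open>Starting the quotients at step \<open>1 / Suc N\<close> makes every increment at
    most \<open>r / 4\<close> long, as the second-order estimate requires.\<close>
  obtain N :: nat where N: "norm v / (r / 4) < N" using reals_Archimedean2 by blast
  define q where "q n = (\<lambda>y. real (n + Suc N) *\<^sub>R (f (y + (1 / real (n + Suc N)) *\<^sub>R v) - f y))" for n
  have small: "1 / real (n + Suc N) * norm v \<le> r / 4" for n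
  proof -
    have "norm v < r / 4 * real N" using N r by (simp add: field_simps)
    also have "\<dots> \<le> r / 4 * real (n + Suc N)" using r by (intro mult_left_mono) auto
    finally show ?thesis by (simp add: field_simps)
  qed
  have hq: "holo (ball x r) (q n)" for n
  proof -
    have 1: "y + (1 / real (n + Suc N)) *\<^sub>R v \<in> S" if "y \<in> ball x r" for y
    proof -
      have "y + (1 / real (n + Suc N)) *\<^sub>R v \<in> ball y r"
        using order_le_less_trans[OF small[of n], of r] r by (simp add: dist_norm)
      then show ?thesis using sub[OF that] r by blast
    qed
    have "holo (ball x r) (\<lambda>y. f (y + (1 / real (n + Suc N)) *\<^sub>R v))"
      by (rule holo_compose[OF f holo_add[OF holo_id holo_const]]) (use 1 in auto)
    moreover have "holo (ball x r) f" using holo_subset[OF f] r by (meson ball_subset_cball sub centre_in_ball subset_trans)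
    ultimately show ?thesis unfolding q_def by (intro holo_scaleR holo_diff)
  qed
  let ?C = "DIM('b) * (32 * M / r\<^sup>2) * (norm v)\<^sup>2"
  have bound: "norm (q n y - fd f y v) \<le> ?C / real (n + Suc N)" if y: "y \<in> ball x r" for n y
  proof -
    define h where "h = 1 / real (n + Suc N)"
    have h0: "h > 0" "real (n + Suc N) * h = 1" by (simp_all add: h_def)
    have hy: "holo (ball y r) f" using sub[OF y] r holo_subset[OF f] by blast
    have e: "complex_of_real h *\<^sub>c w = h *\<^sub>R w" for w :: "'c::real_vector cplxn" by (simp add: cscale_eq)
    have nh: "norm (complex_of_real h) = h" using h0 by simp
    have "norm (f (y + complex_of_real h *\<^sub>c v) - f y - complex_of_real h *\<^sub>c fd f y v)
        \<le> DIM('b) * (32 * M / r\<^sup>2) * (norm (complex_of_real h) * norm v)\<^sup>2"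
      by (rule holo_second_order_estimate[OF hy _ r(1)])
        (use M sub[OF y] in blast, unfold nh, use small[of n] in \<open>simp only: h_def\<close>)
    then have "norm (f (y + h *\<^sub>R v) - f y - h *\<^sub>R fd f y v) \<le> ?C * h\<^sup>2"
      unfolding e nh by (simp add: power_mult_distrib mult_ac)
    moreover have "q n y - fd f y v = real (n + Suc N) *\<^sub>R (f (y + h *\<^sub>R v) - f y - h *\<^sub>R fd f y v)"
      using h0(2) by (simp only: q_def h_def[symmetric] scaleR_diff_right scaleR_scaleR scaleR_one)
    ultimately have "norm (q n y - fd f y v) \<le> real (n + Suc N) * (?C * h\<^sup>2)"
      by (simp only: norm_scaleR abs_of_nat) (intro mult_left_mono, auto)
    also have "\<dots> = ?C * (real (n + Suc N) * h) * h" by (simp only: power2_eq_square mult_ac)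
    also have "\<dots> = ?C / real (n + Suc N)" unfolding h0(2) by (simp add: h_def)
    finally show ?thesis .
  qed
  have "uniform_limit (ball x r) q (\<lambda>y. fd f y v) sequentially"
  proof (rule uniform_limitI)
    fix e :: real assume e: "e > 0"
    obtain N1 :: nat where N1: "?C / e < N1" using reals_Archimedean2 by blast
    have "dist (q n y) (fd f y v) < e" if "n \<ge> N1" "y \<in> ball x r" for n y
    proof -
      have "?C < N1 * e" using N1 e by (simp only: pos_divide_less_eq)
      then have "?C < e * N1" by (simp only: mult.commute)
      also have "\<dots> \<le> e * real (n + Suc N)" using that e by (intro mult_left_mono) auto
      finally have "?C / real (n + Suc N) < e" by (subst pos_divide_less_eq) auto
      then show ?thesis using bound[OF that(2), of n] by (simp only: dist_norm)
    qed
    then show "\<forall>\<^sub>F n in sequentially. \<forall>y\<in>ball x r. dist (q n y) (fd f y v) < e"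
      unfolding eventually_sequentially by blast
  qed
  from holo_uniform_limit_ball[OF hq this r(1)]
  show "\<exists>T. x \<in> T \<and> holo T (\<lambda>x. fd f x v)" using r by (intro exI[of _ "ball x (r/2)"]) auto
qed

lemma holo_smooth:
  assumes "open S" "holo S f"
  shows "smooth_on S f"
proof -
  have "C_k_on k S f" for k
    using assms(2)
  proof (induction k arbitrary: f)
    case (Suc k)
    then show ?case using holo_fd[OF assms(1)] holo_differentiable by (simp) blast
  qed (simp add: holo_continuous)
  then show ?thesis by (simp add: smooth_on_def)
qed

text \<open>The complex line \<open>fst w + L snd w\<close> reaches \<open>w\<close> at
  \<open>L = \<i>\<close> and consists of real points for real \<open>L\<close>. There
  \<open>f\<close> vanishes, and the one-variable identity theorem does the rest.\<close>

lemma holo_zero: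
  fixes f :: "'a::euclidean_space cplxn \<Rightarrow> 'b::euclidean_space cplxn"
  assumes f: "holo (ball 0 r) f" and real: "\<And>u. norm u < r \<Longrightarrow> f (u, 0) = 0" and w: "w \<in> ball 0 r"
  shows "f w = 0"
proof -
  have "ccomp b (f w) = 0" if b: "b \<in> Basis" for b
  proof -
    \<comment> \<open>The parameters whose points stay in the ball. As an affine preimage of a ball
      this set is open and convex, so the identity theorem can pass from 0 to \<open>\<i>\<close>
      within it.\<close>
    define T where "T = {L. (fst w, 0) + L *\<^sub>c (snd w, 0) \<in> ball 0 r}"
    have lin: "linear (\<lambda>L. L *\<^sub>c (snd w, 0))" by (rule linear_cscale_left)
    have T: "T = (\<lambda>L. L *\<^sub>c (snd w, 0)) -` ((\<lambda>y. - (fst w, 0) + y) ` ball 0 r)"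
    proof -
      have "a + z \<in> B \<longleftrightarrow> z \<in> (\<lambda>y. - a + y) ` B" for a z :: "'a cplxn" and B
        by (auto intro: image_eqI[of _ _ "a + z"])
      then show ?thesis unfolding T_def by blast
    qed
    have "open ((\<lambda>y. - (fst w, 0 :: 'a) + y) ` ball 0 r)" using open_translation[OF open_ball] .
    then have oT: "open T" unfolding T
      by (rule open_vimage) (use lin linear_continuous_on linear_conv_bounded_linear in blast)
    have cT: "convex T" unfolding T
      by (rule convex_linear_vimage[OF lin]) (rule convex_translation[OF convex_ball])
    have zero: "0 \<in> T" and i: "\<i> \<in> T"
    proof -
      have "norm (fst w) \<le> norm w" by (metis norm_fst_le prod.collapse)
      then have "norm (fst w, 0 :: 'a) < r" using w by (simp add: norm_prod_def[of "(fst w, 0)"])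
      then show "0 \<in> T" by (simp add: T_def)
      have "(fst w, 0) + \<i> *\<^sub>c (snd w, 0) = w" by (simp add: cscale_def)
      then show "\<i> \<in> T" using w by (simp add: T_def)
    qed
    show ?thesis
    proof -
      have "ccomp b (f ((fst w, 0) + \<i> *\<^sub>c (snd w, 0))) = 0"
      proof (rule analytic_continuation[of "\<lambda>L. ccomp b (f ((fst w, 0) + L *\<^sub>c (snd w, 0)))" T "T \<inter> range of_real" 0])
        show "(\<lambda>L. ccomp b (f ((fst w, 0) + L *\<^sub>c (snd w, 0)))) holomorphic_on T"
          by (rule holo_line_holomorphic[OF f]) (simp add: T_def)
        show "0 islimpt T \<inter> range complex_of_real"
        proof (rule islimpt_approachable[THEN iffD2], intro allI impI)
          fix e :: real assume e: "e > 0"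
          obtain d where d: "d > 0" "ball 0 d \<subseteq> T" using oT zero open_contains_ball by blast
          have "complex_of_real (min d e / 2) \<in> T"
            using d e by (intro subsetD[OF d(2)]) (auto simp: min_def)
          then show "\<exists>x'\<in>T \<inter> range complex_of_real. x' \<noteq> 0 \<and> dist x' 0 < e"
            using d e by (intro bexI[of _ "complex_of_real (min d e / 2)"] IntI rangeI) (auto simp: min_def)
        qed
        show "ccomp b (f ((fst w, 0) + z *\<^sub>c (snd w, 0))) = 0" if z: "z \<in> T \<inter> range complex_of_real" for z
        proof -
          obtain t where t: "z = complex_of_real t" using z by blast
          have e: "(fst w, 0) + z *\<^sub>c (snd w, 0) = (fst w + t *\<^sub>R snd w, 0)" by (simp add: t cscale_def)
          then have "norm (fst w + t *\<^sub>R snd w) < r" using z by (simp add: T_def)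
          then show ?thesis using real e by (simp add: ccomp_def complex_eq_iff)
        qed
      qed (use oT cT convex_connected i zero in auto)
      then show ?thesis by (simp add: cscale_def)
    qed
  qed
  then show ?thesis using norm_le_sum_ccomp[of "f w"] by simp
qed

subsection \<open>Complexification of real-analytic maps\<close>

text \<open>Scalar functions get their own predicate because \<open>holo\<close> takes values in a
  complexification, which carries no multiplication; monomials are formed here and then attached to
  a vector by \<open>cholo_cscale\<close>.\<close>

definition cholo :: "'a::euclidean_space cplxn set \<Rightarrow> ('a cplxn \<Rightarrow> complex) \<Rightarrow> bool" where
  "cholo S q \<longleftrightarrow> (\<forall>x\<in>S. \<exists>q'. (q has_derivative q') (at x) \<and> (\<forall>h. q' (Jc h) = \<i> * q' h))"

lemma cholo_const: "cholo S (\<lambda>w. c)"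
  unfolding cholo_def by (intro ballI exI[of _ "\<lambda>h. 0"]) auto

lemma cholo_ccomp: "cholo S (ccomp b)"
  unfolding cholo_def
  by (intro ballI exI[of _ "ccomp b"] conjI bounded_linear_imp_has_derivative bounded_linear_ccomp allI ccomp_Jc)

lemma cholo_mult:
  assumes "cholo S p" "cholo S q"
  shows "cholo S (\<lambda>w. p w * q w)"
  unfolding cholo_def
proof
  fix x assume "x \<in> S"
  then obtain p' q' where "(p has_derivative p') (at x)" "\<And>h. p' (Jc h) = \<i> * p' h"
    "(q has_derivative q') (at x)" "\<And>h. q' (Jc h) = \<i> * q' h"
    using assms unfolding cholo_def by metis
  then show "\<exists>r'. ((\<lambda>w. p w * q w) has_derivative r') (at x) \<and> (\<forall>h. r' (Jc h) = \<i> * r' h)"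
    by (intro exI[of _ "\<lambda>h. p x * q' h + p' h * q x"]) (auto intro: has_derivative_mult simp: algebra_simps)
qed

lemma cholo_power: "cholo S q \<Longrightarrow> cholo S (\<lambda>w. q w ^ n)"
  by (induction n) (auto intro: cholo_const cholo_mult)

lemma cholo_prod: "(\<And>i. i \<in> I \<Longrightarrow> cholo S (q i)) \<Longrightarrow> cholo S (\<lambda>w. \<Prod>i\<in>I. q i w)"
  by (induction I rule: infinite_finite_induct) (auto intro: cholo_const cholo_mult)

lemma cholo_cscale:
  fixes k :: "'b::euclidean_space cplxn"
  assumes "cholo S q"
  shows "holo S (\<lambda>w. q w *\<^sub>c k)"
proof -
  have "\<exists>q'. (q has_derivative q' ) (at x) \<and> (\<forall>h. q' (Jc h) = \<i> * q' h)" if "x \<in> S" for x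
    using assms that unfolding cholo_def by blast
  then obtain q' where q': "\<And>x. x \<in> S \<Longrightarrow> (q has_derivative q' x) (at x)"
    "\<And>x h. x \<in> S \<Longrightarrow> q' x (Jc h) = \<i> * q' x h" by metis
  have bl: "bounded_linear (\<lambda>z. z *\<^sub>c k)"
    using linear_cscale_left linear_conv_bounded_linear by blast
  show ?thesis
  proof (rule holoI)
    fix x assume x: "x \<in> S"
    show "((\<lambda>w. q w *\<^sub>c k) has_derivative (\<lambda>h. q' x h *\<^sub>c k)) (at x)"
      by (rule bounded_linear.has_derivative[OF bl q'(1)[OF x]])
    show "q' x (Jc h) *\<^sub>c k = Jc (q' x h *\<^sub>c k)" for h
      by (simp add: q'(2)[OF x] cscale_eq Jc_arith)
  qed
qed

text \<open>In finite dimension unconditional and absolute summability coincide: it holds for each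
  real component, and the norm is at most the sum of the absolute components.\<close>

lemma has_sum_abs_summable:
  fixes t :: "'i \<Rightarrow> 'b::euclidean_space"
  assumes "t summable_on I"
  shows "(\<lambda>i. norm (t i)) summable_on I"
proof -
  have "(\<lambda>i. \<bar>t i \<bullet> b\<bar>) summable_on I" for b
    using summable_on_iff_abs_summable_on_real[THEN iffD1,
        OF summable_on_bounded_linear[OF bounded_linear_inner_left assms, of b]] by simp
  note comp = this
  have "(\<lambda>i. \<Sum>b\<in>B. \<bar>t i \<bullet> b\<bar>) summable_on I" if "finite B" for B
    using that by (induction rule: finite_induct) (auto intro: summable_on_add comp)
  then have "(\<lambda>i. \<Sum>b\<in>Basis. \<bar>t i \<bullet> b\<bar>) summable_on I" using finite_Basis by blast
  then show ?thesis
    using Infinite_Sum.abs_summable_on_comparison_test'[of "\<lambda>i. \<Sum>b\<in>Basis. \<bar>t i \<bullet> b\<bar>" I t] norm_le_l1 by blast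
qed

text \<open>Substitute complex coordinates into the power series. Absolute convergence at one real
  point, all of whose coordinates relative to \<open>p\<close> equal \<open>\<rho>\<close>,
  dominates the series on the complex ball of radius \<open>\<rho>\<close>.\<close>

lemma real_analytic_holo_extension:
  fixes f :: "'a::euclidean_space \<Rightarrow> 'b::euclidean_space"
  assumes "real_analytic_on S f" "p \<in> S"
  obtains r F where "r > 0" "holo (ball 0 r) F" "\<And>u. norm u < r \<Longrightarrow> F (u, 0) = (f (p + u), 0)"
proof -
  define I :: "('a \<Rightarrow> nat) set" where "I = {\<alpha>. \<forall>b. b \<notin> Basis \<longrightarrow> \<alpha> b = 0}"
  obtain e c where e: "e > 0" and hs: "\<And>x. x \<in> ball p e \<Longrightarrow>
      ((\<lambda>\<alpha>. (\<Prod>b\<in>Basis. ((x - p) \<bullet> b) ^ \<alpha> b) *\<^sub>R c \<alpha>) has_sum f x) I"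
    using assms unfolding real_analytic_on_def I_def by blast
  \<comment> \<open>The point \<open>p\<close> plus \<open>\<rho>\<close> times the sum of the basis
    is at distance at most \<open>DIM('a) * \<rho> = e/2\<close> from \<open>p\<close>, so the
    series converges there.\<close>
  define \<rho> where "\<rho> = e / (2 * DIM('a))"
  have \<rho>: "\<rho> > 0" using e by (simp add: \<rho>_def)
  have \<rho>e: "\<rho> \<le> e"
  proof -
    have "1 \<le> 2 * real DIM('a)" using DIM_positive[where 'a='a] by linarith
    then show ?thesis using e by (simp add: \<rho>_def field_simps)
  qed
  define x1 where "x1 = p + (\<Sum>b\<in>Basis. \<rho> *\<^sub>R b)"
  have comp: "(x1 - p) \<bullet> b = \<rho>" if "b \<in> Basis" for b
    using that by (simp add: x1_def inner_sum_left inner_Basis if_distrib cong: if_cong)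
  have "norm (x1 - p) \<le> (\<Sum>b\<in>(Basis::'a set). \<rho>)"
    unfolding x1_def using norm_sum[of "\<lambda>b. \<rho> *\<^sub>R b" "Basis::'a set"] \<rho> by simp
  also have "\<dots> < e" using e by (simp add: \<rho>_def)
  finally have "x1 \<in> ball p e" by (simp add: dist_norm norm_minus_commute)
  from has_sum_imp_summable[OF hs[OF this]]
  have "(\<lambda>\<alpha>. norm ((\<Prod>b\<in>Basis. ((x1 - p) \<bullet> b) ^ \<alpha> b) *\<^sub>R c \<alpha>)) summable_on I"
    by (rule has_sum_abs_summable)
  then have "(\<lambda>\<alpha>. norm ((\<Prod>b\<in>Basis. \<rho> ^ \<alpha> b) *\<^sub>R c \<alpha>)) summable_on I"
    using comp by simp
  define M where "M \<alpha> = (\<Prod>b\<in>Basis. \<rho> ^ \<alpha> b) * norm (c \<alpha>)" for \<alpha> :: "'a \<Rightarrow> nat"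
  have M: "M summable_on I"
  proof -
    have "norm ((\<Prod>b\<in>Basis. \<rho> ^ \<alpha> b) *\<^sub>R c \<alpha>) = M \<alpha>" for \<alpha> :: "'a \<Rightarrow> nat"
      using \<rho> by (simp add: M_def abs_prod)
    then show ?thesis using \<open>(\<lambda>\<alpha>. norm ((\<Prod>b\<in>Basis. \<rho> ^ \<alpha> b) *\<^sub>R c \<alpha>)) summable_on I\<close> by simp
  qed
  define T where "T \<alpha> w = (\<Prod>b\<in>Basis. ccomp b w ^ \<alpha> b) *\<^sub>c (c \<alpha>, 0 :: 'b)" for \<alpha> and w :: "'a cplxn"
  have T_le: "norm (T \<alpha> w) \<le> M \<alpha>" if "w \<in> ball 0 \<rho>" for \<alpha> w
  proof -
    have "norm (ccomp b w) \<le> \<rho>" if "b \<in> Basis" for b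
      using norm_ccomp_le[OF that, of w] \<open>w \<in> ball 0 \<rho>\<close> by simp
    then have "(\<Prod>b\<in>Basis. norm (ccomp b w) ^ \<alpha> b) \<le> (\<Prod>b\<in>Basis. \<rho> ^ \<alpha> b)"
      by (intro prod_mono conjI power_mono) auto
    moreover have "norm (c \<alpha>, 0 :: 'b) = norm (c \<alpha>)" by (simp add: norm_prod_def)
    ultimately show ?thesis
      by (simp add: T_def norm_cscale M_def norm_power prod_norm[symmetric] mult_right_mono)
  qed
  have T_holo: "holo A (T \<alpha>)" for \<alpha> A
    unfolding T_def by (intro cholo_cscale cholo_prod cholo_power cholo_ccomp)
  \<comment> \<open>Finite boxes of multi-indices exhausting \<open>I\<close>; they turn convergence
    along finite subsets into convergence of a sequence, the form in which the limit theorem is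
    stated.\<close>
  define A where "A n = {\<alpha>. \<forall>b. (b \<in> Basis \<longrightarrow> \<alpha> b \<in> {..n}) \<and> (b \<notin> (Basis :: 'a set) \<longrightarrow> \<alpha> b = (0::nat))}" for n
  have A_fin: "finite (A n)" for n
    unfolding A_def by (rule finite_set_of_finite_funs) auto
  have A_lim: "filterlim A (finite_subsets_at_top I) sequentially"
    unfolding filterlim_finite_subsets_at_top
  proof (intro allI impI)
    fix X assume X: "finite X \<and> X \<subseteq> I"
    define n0 where "n0 = (\<Sum>\<alpha>\<in>X. \<Sum>b\<in>Basis. \<alpha> b)"
    have "\<alpha> b \<le> n0" if "\<alpha> \<in> X" "b \<in> Basis" for \<alpha> b
    proof -
      have "\<alpha> b \<le> (\<Sum>b\<in>Basis. \<alpha> b)" using that by (intro member_le_sum) auto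
      also have "\<dots> \<le> n0" unfolding n0_def using that X
        by (intro member_le_sum[of \<alpha> X "\<lambda>\<alpha>. \<Sum>b\<in>Basis. \<alpha> b"]) auto
      finally show ?thesis .
    qed
    then have "X \<subseteq> A n" if "n \<ge> n0" for n
      using X that by (auto simp: A_def I_def) (meson le_trans)
    moreover have "A n \<subseteq> I" for n by (auto simp: A_def I_def)
    ultimately show "\<forall>\<^sub>F n in sequentially. finite (A n) \<and> X \<subseteq> A n \<and> A n \<subseteq> I"
      unfolding eventually_sequentially using A_fin by blast
  qed
  define F where "F w = infsum (\<lambda>\<alpha>. T \<alpha> w) I" for w
  have "uniform_limit (ball 0 \<rho>) (\<lambda>X w. \<Sum>\<alpha>\<in>X. T \<alpha> w) F (finite_subsets_at_top I)"
    unfolding F_def by (rule Weierstrass_m_test_general[OF T_le M])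
  from filterlim_compose[OF this A_lim]
  have ul: "uniform_limit (ball 0 \<rho>) (\<lambda>n w. \<Sum>\<alpha>\<in>A n. T \<alpha> w) F sequentially" .
  have "holo (ball 0 \<rho>) (\<lambda>w. \<Sum>\<alpha>\<in>A n. T \<alpha> w)" for n by (intro holo_sum T_holo)
  from holo_uniform_limit_ball[OF this ul \<rho>] have "holo (ball 0 (\<rho>/2)) F" by blast
  moreover have "F (u, 0) = (f (p + u), 0)" if "norm u < \<rho>/2" for u
  proof -
    have cr: "ccomp b (u, 0) = complex_of_real (u \<bullet> b)" for b by (simp add: ccomp_def complex_eq_iff)
    have "T \<alpha> (u, 0) = ((\<Prod>b\<in>Basis. (u \<bullet> b) ^ \<alpha> b) *\<^sub>R c \<alpha>, 0)" for \<alpha>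
    proof -
      have "(\<Prod>b\<in>Basis. ccomp b (u, 0) ^ \<alpha> b) = complex_of_real (\<Prod>b\<in>Basis. (u \<bullet> b) ^ \<alpha> b)"
        by (simp add: cr)
      moreover have "complex_of_real s *\<^sub>c (k, 0 :: 'b) = (s *\<^sub>R k, 0)" for s k by (simp add: cscale_def)
      ultimately show ?thesis by (simp only: T_def)
    qed
    moreover have "((\<lambda>\<alpha>. (\<Prod>b\<in>Basis. (u \<bullet> b) ^ \<alpha> b) *\<^sub>R c \<alpha>) has_sum f (p + u)) I"
      using hs[of "p + u"] that \<rho>e \<rho> by (simp add: dist_norm)
    from has_sum_bounded_linear[OF bounded_linear_Pair1 this]
    have "((\<lambda>\<alpha>. ((\<Prod>b\<in>Basis. (u \<bullet> b) ^ \<alpha> b) *\<^sub>R c \<alpha>, 0 :: 'b)) has_sum (f (p + u), 0)) I" .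
    ultimately show ?thesis unfolding F_def by (simp add: infsumI)
  qed
  ultimately show thesis using that[of "\<rho>/2" F] \<rho> by simp
qed

lemma norm_Pair_zero: "norm (x :: 'a::real_normed_vector, 0 :: 'b::real_normed_vector) = norm x"
  by (simp add: norm_prod_def)

lemma holo_restrict_smooth:
  assumes "holo (ball 0 r) F"
  shows "smooth_on (ball p r) (\<lambda>x. F (x - p, 0))"
proof (rule smooth_on_compose[OF open_ball open_ball holo_smooth[OF open_ball assms]])
  have "smooth_on (ball p r) (\<lambda>x. (x, 0 :: 'a) + (- (p, 0)))"
    by (rule smooth_on_add[OF open_ball smooth_on_bounded_linear[OF open_ball bounded_linear_Pair1]])
      (simp add: smooth_on_def C_k_on_const)
  then show "smooth_on (ball p r) (\<lambda>x. (x - p, 0 :: 'a))" by simp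
  show "(\<lambda>x. (x - p, 0 :: 'a)) ` ball p r \<subseteq> ball 0 r" by (auto simp: norm_Pair_zero mem_ball_0 mem_ball dist_norm[of p] norm_minus_commute)
qed

text \<open>Near each point the map is the first component of a holomorphic extension restricted to
  real points, and holomorphic maps are smooth.\<close>

lemma real_analytic_smooth:
  assumes "real_analytic_on S f"
  shows "smooth_on S f"
proof (rule smooth_on_local)
  fix p assume "p \<in> S"
  from real_analytic_holo_extension[OF assms this]
  obtain r F where r: "r > 0" and F: "holo (ball 0 r) F" "\<And>u. norm u < r \<Longrightarrow> F (u, 0) = (f (p + u), 0)"
    by blast
  have "smooth_on (ball p r) (\<lambda>x. fst (F (x - p, 0)))"
    by (rule smooth_on_bounded_linear_o[OF open_ball bounded_linear_fst holo_restrict_smooth[OF F(1)]])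
  then have "smooth_on (ball p r) f"
    by (rule smooth_on_cong[OF open_ball, rotated]) (simp add: F(2) dist_norm norm_minus_commute)
  then show "\<exists>T. p \<in> T \<and> smooth_on T f \<and> open T" using r by (intro exI[of _ "ball p r"]) auto
qed

subsection \<open>Holomorphic families of linear maps\<close>

text \<open>A holomorphic matrix function without matrices. Holomorphy for each fixed vector
  suffices, since linearity in finite dimension then gives joint smoothness
  (\<open>smooth_fam\<close>).\<close>

definition holo_fam :: "'a::euclidean_space cplxn set \<Rightarrow>
  ('a cplxn \<Rightarrow> 'b::euclidean_space cplxn \<Rightarrow> 'c::euclidean_space cplxn) \<Rightarrow> bool" where
  "holo_fam S M \<longleftrightarrow> (\<forall>w. holo S (\<lambda>y. M y w)) \<and> (\<forall>y\<in>S. linear (M y) \<and> (\<forall>w. M y (Jc w) = Jc (M y w)))"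

lemma holo_famI:
  "(\<And>w. holo S (\<lambda>y. M y w)) \<Longrightarrow> (\<And>y. y \<in> S \<Longrightarrow> linear (M y)) \<Longrightarrow>
   (\<And>y w. y \<in> S \<Longrightarrow> M y (Jc w) = Jc (M y w)) \<Longrightarrow> holo_fam S M"
  unfolding holo_fam_def by blast

lemma holo_famD:
  assumes "holo_fam S M"
  shows "holo S (\<lambda>y. M y w)" "y \<in> S \<Longrightarrow> linear (M y)" "y \<in> S \<Longrightarrow> M y (Jc w) = Jc (M y w)"
  using assms unfolding holo_fam_def by blast+

lemma fd_fam_linear:
  assumes M: "holo_fam S M" and S: "open S" "x \<in> S"
  shows "linear (\<lambda>w. fd (\<lambda>y. M y w) x h)"
proof (rule linearI)
  have d: "((\<lambda>y. M y w) has_derivative fd (\<lambda>y. M y w) x) (at x)" for w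
    using holo_has_derivative[OF holo_famD(1)[OF M] S(2)] .
  show "fd (\<lambda>y. M y (w + w')) x h = fd (\<lambda>y. M y w) x h + fd (\<lambda>y. M y w') x h" for w w'
    by (subst fd_cong_open[OF S, of _ "\<lambda>y. M y w + M y w'"])
      (simp_all add: linear_add[OF holo_famD(2)[OF M]] fd_eqI[OF has_derivative_add[OF d d]])
  show "fd (\<lambda>y. M y (r *\<^sub>R w)) x h = r *\<^sub>R fd (\<lambda>y. M y w) x h" for r w
    by (subst fd_cong_open[OF S, of _ "\<lambda>y. r *\<^sub>R M y w"])
      (simp_all add: linear_scale[OF holo_famD(2)[OF M]] fd_eqI[OF has_derivative_scaleR_right[OF d]])
qed

lemma fd_fam_Jc:
  assumes M: "holo_fam S M" and S: "open S" "x \<in> S"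
  shows "fd (\<lambda>y. M y (Jc w)) x h = Jc (fd (\<lambda>y. M y w) x h)"
proof -
  have d: "((\<lambda>y. M y w) has_derivative fd (\<lambda>y. M y w) x) (at x)"
    using holo_has_derivative[OF holo_famD(1)[OF M] S(2)] .
  show ?thesis
    by (subst fd_cong_open[OF S, of _ "\<lambda>y. Jc (M y w)"])
      (simp_all add: holo_famD(3)[OF M] fd_eqI[OF bounded_linear.has_derivative[OF bounded_linear_Jc d]])
qed

text \<open>Product rule for a family applied to a moving vector. Expanding the vector in the basis
  leaves only products of scalar functions with the families at fixed vectors.\<close>

lemma has_derivative_fam_apply:
  fixes g :: "'t::real_normed_vector \<Rightarrow> 'a::euclidean_space cplxn"
  assumes M: "holo_fam S M" and S: "open S" "x \<in> S"
    and V: "open V" "t \<in> V" and gS: "g ` V \<subseteq> S" "g t = x"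
    and g: "(g has_derivative g') (at t)" and k: "(k has_derivative k') (at t)"
  shows "((\<lambda>t. M (g t) (k t)) has_derivative (\<lambda>h. fd (\<lambda>y. M y (k t)) x (g' h) + M x (k' h))) (at t)"
proof -
  have d: "((\<lambda>y. M y w) has_derivative fd (\<lambda>y. M y w) x) (at x)" for w
    using holo_has_derivative[OF holo_famD(1)[OF M] S(2)] .
  have "((\<lambda>t. M (g t) w) has_derivative (\<lambda>h. fd (\<lambda>y. M y w) x (g' h))) (at t)" for w
    using has_derivative_compose[OF g, of "\<lambda>y. M y w"] d gS(2) by simp
  then have "((\<lambda>t. \<Sum>b\<in>Basis. (k t \<bullet> b) *\<^sub>R M (g t) b) has_derivative
      (\<lambda>h. \<Sum>b\<in>Basis. (k t \<bullet> b) *\<^sub>R fd (\<lambda>y. M y b) x (g' h) + (k' h \<bullet> b) *\<^sub>R M (g t) b)) (at t)"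
    by (intro has_derivative_sum has_derivative_scaleR has_derivative_inner_left k)
  moreover have "(\<Sum>b\<in>Basis. (k t \<bullet> b) *\<^sub>R fd (\<lambda>y. M y b) x (g' h) + (k' h \<bullet> b) *\<^sub>R M (g t) b)
      = fd (\<lambda>y. M y (k t)) x (g' h) + M x (k' h)" for h
    using linear_sum_Basis[OF fd_fam_linear[OF M S], of "k t" "g' h"]
      linear_sum_Basis[OF holo_famD(2)[OF M S(2)], of "k' h"] gS(2) by (simp add: sum.distrib)
  moreover have "M (g s) (k s) = (\<Sum>b\<in>Basis. (k s \<bullet> b) *\<^sub>R M (g s) b)" if "s \<in> V" for s
    using gS(1) that by (intro linear_sum_Basis holo_famD(2)[OF M]) auto
  ultimately show ?thesis using has_derivative_cong_open[OF V, of "\<lambda>t. M (g t) (k t)"] by simp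
qed

lemma fam_app_has_derivative:
  assumes M: "holo_fam S M" and g: "holo S g" and S: "open S" "x \<in> S"
  shows "((\<lambda>y. M y (g y)) has_derivative (\<lambda>h. fd (\<lambda>y. M y (g x)) x h + M x (fd g x h))) (at x)"
proof -
  have "(g has_derivative fd g x) (at x)" by (rule holo_has_derivative[OF g S(2)])
  from has_derivative_fam_apply[where g = "\<lambda>y. y" and g' = "\<lambda>y. y" and k = g and k' = "fd g x", OF M S S _ _ has_derivative_ident this]
  show ?thesis by simp
qed

lemma holo_fam_app:
  assumes M: "holo_fam S M" and g: "holo S g" and S: "open S"
  shows "holo S (\<lambda>y. M y (g y))"
proof (rule holoI)
  fix x assume x: "x \<in> S"
  show "((\<lambda>y. M y (g y)) has_derivative (\<lambda>h. fd (\<lambda>y. M y (g x)) x h + M x (fd g x h))) (at x)"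
    by (rule fam_app_has_derivative[OF M g S x])
  show "fd (\<lambda>y. M y (g x)) x (Jc h) + M x (fd g x (Jc h)) = Jc (fd (\<lambda>y. M y (g x)) x h + M x (fd g x h))" for h
    by (simp only: holo_fd_Jc[OF holo_famD(1)[OF M] x] holo_fd_Jc[OF g x] holo_famD(3)[OF M x] Jc_arith)
qed

lemma holo_fam_comp:
  assumes M: "holo_fam S M" and N: "holo_fam S N" and S: "open S"
  shows "holo_fam S (\<lambda>y w. M y (N y w))"
proof (rule holo_famI)
  show "holo S (\<lambda>y. M y (N y w))" for w by (rule holo_fam_app[OF M holo_famD(1)[OF N] S])
  show "linear (\<lambda>w. M y (N y w))" if "y \<in> S" for y
    using linear_compose[OF holo_famD(2)[OF N that] holo_famD(2)[OF M that]] by (simp add: o_def)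
  show "M y (N y (Jc w)) = Jc (M y (N y w))" if "y \<in> S" for y w
    by (simp only: holo_famD(3)[OF N that] holo_famD(3)[OF M that])
qed

lemma holo_fam_lincomb:
  assumes M: "holo_fam S M" and N: "holo_fam S N"
  shows "holo_fam S (\<lambda>y w. a *\<^sub>R M y w + b *\<^sub>R N y w)"
proof (rule holo_famI)
  show "holo S (\<lambda>y. a *\<^sub>R M y w + b *\<^sub>R N y w)" for w by (intro holo_add holo_scaleR holo_famD M N)
  show "linear (\<lambda>w. a *\<^sub>R M y w + b *\<^sub>R N y w)" if "y \<in> S" for y
    by (intro linear_compose_add linear_compose_scale_right holo_famD(2)[OF M] holo_famD(2)[OF N] that)
  show "a *\<^sub>R M y (Jc w) + b *\<^sub>R N y (Jc w) = Jc (a *\<^sub>R M y w + b *\<^sub>R N y w)" if "y \<in> S" for y w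
    by (simp only: holo_famD(3)[OF N that] holo_famD(3)[OF M that] Jc_arith)
qed

lemma holo_fam_const:
  assumes "linear l" "\<And>w. l (Jc w) = Jc (l w)"
  shows "holo_fam S (\<lambda>y. l)"
  by (rule holo_famI) (auto intro: holo_const assms)

lemma holo_fam_fd_fun:
  assumes f: "holo S f" and S: "open S"
  shows "holo_fam S (\<lambda>y h. fd f y h)"
  by (rule holo_famI) (auto intro: holo_fd[OF S f] holo_linear[OF f] simp: holo_fd_Jc[OF f])

lemma holo_fam_fd:
  assumes M: "holo_fam S M" and S: "open S" and g: "holo S g"
  shows "holo_fam S (\<lambda>y w. fd (\<lambda>z. M z w) y (g y))"
proof (rule holo_famI)
  show "holo S (\<lambda>y. fd (\<lambda>z. M z w) y (g y))" for w
    by (rule holo_fam_app[OF holo_fam_fd_fun[OF holo_famD(1)[OF M] S] g S])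
qed (auto intro: fd_fam_linear[OF M S] simp: fd_fam_Jc[OF M S])

lemma holo_fam_subset: "holo_fam S M \<Longrightarrow> T \<subseteq> S \<Longrightarrow> holo_fam T M"
  unfolding holo_fam_def using holo_subset by blast

lemma holo_fam_compose:
  assumes M: "holo_fam S M" and g: "holo T g" "g ` T \<subseteq> S"
  shows "holo_fam T (\<lambda>y. M (g y))"
proof (rule holo_famI)
  show "holo T (\<lambda>y. M (g y) w)" for w by (rule holo_compose[OF holo_famD(1)[OF M] g])
  show "linear (M (g y))" "M (g y) (Jc w) = Jc (M (g y) w)" if "y \<in> T" for y w
    using g(2) that holo_famD(2,3)[OF M] by blast+
qed

lemma smooth_fam:
  assumes M: "holo_fam S M" and S: "open S"
  shows "smooth_on (S \<times> UNIV) (\<lambda>p. M (fst p) (snd p))"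
proof -
  have o: "open (S \<times> (UNIV :: 'b cplxn set))" using S by (intro open_Times) auto
  have "smooth_on (S \<times> UNIV) (\<lambda>p. \<Sum>b\<in>Basis. (snd p \<bullet> b) *\<^sub>R M (fst p) b)"
    unfolding smooth_on_def
  proof (rule allI, rule C_k_on_sum[OF o], rule C_k_on_scaleR[OF o])
    fix k and b :: "'b cplxn"
    show "C_k_on k (S \<times> (UNIV :: 'b cplxn set)) (\<lambda>p. snd p \<bullet> b)"
      by (rule C_k_on_inner_const[OF o C_k_on_bounded_linear[OF o bounded_linear_snd]])
    show "C_k_on k (S \<times> (UNIV :: 'b cplxn set)) (\<lambda>p. M (fst p) b)"
    proof (rule C_k_on_compose[where f = "\<lambda>y. M y b" and g = fst, OF o S _ C_k_on_bounded_linear[OF o bounded_linear_fst]])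
      show "C_k_on k S (\<lambda>y. M y b)" using holo_smooth[OF S holo_famD(1)[OF M]] unfolding smooth_on_def by blast
    qed auto
  qed
  then show ?thesis
    by (rule smooth_on_cong[OF o, rotated]) (simp add: linear_sum_Basis[OF holo_famD(2)[OF M], symmetric] mem_Times_iff)
qed

subsection \<open>Integrals depending on a parameter\<close>

text \<open>Leibniz' rule; \<open>K\<close> is smooth on a set around
  \<open>D \<times> {0..1}\<close>, so its partial derivative is jointly continuous up to both ends
  of the interval.\<close>

lemma parametric_integral_has_derivative:
  fixes K :: "'a::euclidean_space \<times> real \<Rightarrow> 'b::euclidean_space"
  assumes K: "smooth_on W K" and W: "D \<times> {0..1} \<subseteq> W" and D: "open D" "convex D" "y \<in> D"
  shows "((\<lambda>y. integral {0..1} (\<lambda>s. K (y, s))) has_derivative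
      (\<lambda>h. integral {0..1} (\<lambda>s. fd K (y, s) (h, 0)))) (at y)"
proof -
  define B where "B y s = Blinfun (\<lambda>h. fd K (y, s) (h, 0))" for y s
  have dK: "(K has_derivative fd K (y, s)) (at (y, s))" if "y \<in> D" "s \<in> {0..1}" for y s
    using smooth_on_has_derivative[OF K] W that by blast
  have bl: "bounded_linear (\<lambda>h. fd K (y, s) (h, 0))" if "y \<in> D" "s \<in> {0..1}" for y s
    using bounded_linear_compose[OF has_derivative_bounded_linear[OF dK[OF that]] bounded_linear_Pair1] .
  have B: "blinfun_apply (B y s) = (\<lambda>h. fd K (y, s) (h, 0))" if "y \<in> D" "s \<in> {0..1}" for y s
    unfolding B_def by (rule bounded_linear_Blinfun_apply[OF bl[OF that]])
  have contK: "continuous_on (D \<times> {0..1}) (\<lambda>p. fd K p (h, 0))" for h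
    using smooth_on_continuous[OF smooth_on_fd[OF K]] W continuous_on_subset by blast
  have contB: "continuous_on (D \<times> {0..1}) (\<lambda>(y, s). B y s)"
  proof (rule continuous_on_blinfun_componentwise)
    fix i
    show "continuous_on (D \<times> {0..1}) (\<lambda>x. blinfun_apply (case x of (y, s) \<Rightarrow> B y s) i)"
      by (rule continuous_on_eq[OF contK[of i]]) (auto simp: B)
  qed
  have sec: "continuous_on {0..1} (Pair y)" "Pair y ` {0..1} \<subseteq> D \<times> {0..1}" if "y \<in> D" for y
    using that by (auto intro!: continuous_intros)
  have "((\<lambda>y. integral (cbox 0 1) (\<lambda>s. K (y, s))) has_derivative integral (cbox 0 1) (B y)) (at y within D)"
  proof (rule leibniz_rule[OF _ _ _ D(3,2)])
    fix x s assume x: "x \<in> D" and s: "s \<in> cbox (0::real) 1"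
    have "((\<lambda>x. (x, s)) has_derivative (\<lambda>h. (h, 0))) (at x)"
      by (auto intro!: derivative_eq_intros)
    from has_derivative_compose[OF this dK[OF x]] s
    have "((\<lambda>x. K (x, s)) has_derivative blinfun_apply (B x s)) (at x)"
      using B[OF x] by simp
    then show "((\<lambda>x. K (x, s)) has_derivative blinfun_apply (B x s)) (at x within D)"
      by (rule has_derivative_at_withinI)
  next
    fix x assume x: "x \<in> D"
    have "continuous_on {0..1} (\<lambda>s. K (x, s))"
      by (rule continuous_on_compose2[OF continuous_on_subset[OF smooth_on_continuous[OF K] W] sec[OF x]])
    then show "(\<lambda>s. K (x, s)) integrable_on cbox 0 1" by (simp add: integrable_continuous_interval)
  qed (simp add: contB)
  moreover have "blinfun_apply (integral {0..1} (B y)) = (\<lambda>h. integral {0..1} (\<lambda>s. fd K (y, s) (h, 0)))"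
  proof
    fix h
    have "continuous_on {0..1} (\<lambda>s. (\<lambda>(y, s). B y s) (y, s))"
      by (rule continuous_on_compose2[OF contB sec[OF D(3)]])
    then have "B y integrable_on {0..1}" by (simp add: integrable_continuous_interval)
    from blinfun_apply_integral[OF this, of h]
    show "blinfun_apply (integral {0..1} (B y)) h = integral {0..1} (\<lambda>s. fd K (y, s) (h, 0))"
      using integral_cong[of "{0..1}" "\<lambda>s. blinfun_apply (B y s) h" "\<lambda>s. fd K (y, s) (h, 0)"] B[OF D(3)] by simp
  qed
  ultimately show ?thesis using at_within_open[OF D(3,1)] by simp
qed

subsection \<open>The holomorphic Frobenius theorem\<close>

lemma compact_continuous_bound:
  fixes f :: "'a::euclidean_space \<Rightarrow> 'b::euclidean_space"
  assumes "compact C" "continuous_on C f"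
  obtains B where "B > 0" "\<And>x. x \<in> C \<Longrightarrow> norm (f x) \<le> B"
proof -
  have "bounded (f ` C)" using compact_imp_bounded compact_continuous_image assms by blast
  then show thesis using that unfolding bounded_pos by blast
qed

text \<open>A linear map is controlled by its values on the basis, and each of these finitely many
  functions is bounded on the compact set.\<close>

lemma basis_family_bound:
  fixes L :: "'a::euclidean_space \<Rightarrow> 'b::euclidean_space \<Rightarrow> 'c::euclidean_space"
  assumes "compact C" "\<And>b. continuous_on C (\<lambda>x. L x b)" "\<And>x. x \<in> C \<Longrightarrow> linear (L x)"
  obtains B where "B > 0" "\<And>x h. x \<in> C \<Longrightarrow> norm (L x h) \<le> B * norm h"
proof -
  have "\<forall>b. \<exists>B>0. \<forall>x\<in>C. norm (L x b) \<le> B"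
    using compact_continuous_bound[OF assms(1,2)] by metis
  then obtain B where B: "\<And>b. B b > 0" "\<And>b x. x \<in> C \<Longrightarrow> norm (L x b) \<le> B b" by metis
  have "norm (L x h) \<le> (\<Sum>b\<in>Basis. B b) * norm h" if "x \<in> C" for x h
  proof -
    have "norm (L x h) \<le> (\<Sum>b\<in>Basis. norm ((h \<bullet> b) *\<^sub>R L x b))"
      by (subst linear_sum_Basis[OF assms(3)[OF that]]) (rule norm_sum)
    also have "\<dots> \<le> (\<Sum>b\<in>Basis. norm h * B b)"
      using B(2)[OF that] by (intro sum_mono) (simp add: Basis_le_norm mult_mono)
    finally show ?thesis by (simp add: sum_distrib_left mult.commute)
  qed
  moreover have "(\<Sum>b\<in>Basis. B b) > 0" using B(1) by (intro sum_pos) auto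
  ultimately show thesis using that by blast
qed

lemma smooth_on_lipschitz:
  fixes f :: "'a::euclidean_space \<Rightarrow> 'b::euclidean_space"
  assumes S: "open S" "C \<subseteq> S" "compact C" "convex C" and f: "smooth_on S f"
  obtains B where "B > 0" "\<And>x y. x \<in> C \<Longrightarrow> y \<in> C \<Longrightarrow> norm (f x - f y) \<le> B * norm (x - y)"
proof -
  have d: "(f has_derivative fd f x) (at x)" if "x \<in> C" for x
    using smooth_on_has_derivative[OF f] S(2) that by blast
  have "continuous_on C (\<lambda>x. fd f x b)" for b
    using smooth_on_continuous[OF smooth_on_fd[OF f]] S(2) continuous_on_subset by blast
  then obtain B where B: "B > 0" "\<And>x h. x \<in> C \<Longrightarrow> norm (fd f x h) \<le> B * norm h"
    using basis_family_bound[OF S(3), of "fd f"] d has_derivative_linear by blast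
  have "norm (f x - f y) \<le> B * norm (x - y)" if "x \<in> C" "y \<in> C" for x y
    by (rule differentiable_bound[OF S(4) _ _ that, where f' = "fd f"])
      (use d B in \<open>auto intro: has_derivative_at_withinI onorm_bound\<close>)
  then show thesis using that B by blast
qed

text \<open>Size, Lipschitz dependence and derivative are bounded by one constant. The smaller
  radius \<open>r1\<close> supplies compactness.\<close>

lemma holo_fam_bounds:
  assumes M: "holo_fam (ball 0 r) M" and r1: "r1 < r"
  obtains K where "K > 0" "\<And>z w. z \<in> cball 0 r1 \<Longrightarrow> norm (M z w) \<le> K * norm w"
    "\<And>z z' w. z \<in> cball 0 r1 \<Longrightarrow> z' \<in> cball 0 r1 \<Longrightarrow> norm (M z w - M z' w) \<le> K * norm (z - z') * norm w"
    "\<And>z h w. z \<in> cball 0 r1 \<Longrightarrow> norm (fd (\<lambda>z. M z w) z h) \<le> K * norm h * norm w"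
proof -
  have sub: "cball 0 r1 \<subseteq> ball 0 r" using r1 by auto
  have sm: "smooth_on (ball 0 r) (\<lambda>z. M z w)" for w by (rule holo_smooth[OF open_ball holo_famD(1)[OF M]])
  have cont: "continuous_on (cball 0 r1) (\<lambda>z. M z w)" for w
    using smooth_on_continuous[OF sm] sub continuous_on_subset by blast
  have cont2: "continuous_on (cball 0 r1) (\<lambda>z. fd (\<lambda>z. M z w) z h)" for w h
    using smooth_on_continuous[OF smooth_on_fd[OF sm]] sub continuous_on_subset by blast
  have lin: "linear (M z)" if "z \<in> cball 0 r1" for z using holo_famD(2)[OF M] sub that by blast
  obtain K1 where K1: "K1 > 0" "\<And>z w. z \<in> cball 0 r1 \<Longrightarrow> norm (M z w) \<le> K1 * norm w"
    using basis_family_bound[OF compact_cball cont lin] by blast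
  have "\<forall>w. \<exists>B>0. \<forall>z\<in>cball 0 r1. \<forall>z'\<in>cball 0 r1. norm (M z w - M z' w) \<le> B * norm (z - z')"
    using smooth_on_lipschitz[OF open_ball sub compact_cball convex_cball sm] by metis
  then obtain B where B: "\<And>w. B w > 0" "\<And>w z z'. z \<in> cball 0 r1 \<Longrightarrow> z' \<in> cball 0 r1 \<Longrightarrow> norm (M z w - M z' w) \<le> B w * norm (z - z')"
    by metis
  let ?K2 = "\<Sum>b\<in>Basis. B b"
  have K2: "norm (M z w - M z' w) \<le> ?K2 * norm (z - z') * norm w" if z: "z \<in> cball 0 r1" "z' \<in> cball 0 r1" for z z' w
  proof -
    have l: "linear (\<lambda>w. M z w - M z' w)" using lin z by (intro linear_compose_sub) auto
    have "norm (M z w - M z' w) \<le> (\<Sum>b\<in>Basis. norm ((w \<bullet> b) *\<^sub>R (M z b - M z' b)))"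
      by (subst linear_sum_Basis[OF l]) (rule norm_sum)
    also have "\<dots> \<le> (\<Sum>b\<in>Basis. norm w * (B b * norm (z - z')))"
      using B(2)[OF z] by (intro sum_mono) (simp add: Basis_le_norm mult_mono)
    also have "\<dots> = ?K2 * norm (z - z') * norm w" by (simp add: sum_distrib_left sum_distrib_right mult_ac)
    finally show ?thesis .
  qed
  have "\<forall>h. \<exists>B>0. \<forall>z\<in>cball 0 r1. \<forall>w. norm (fd (\<lambda>z. M z w) z h) \<le> B * norm w"
  proof
    fix h
    have "linear (\<lambda>w. fd (\<lambda>z. M z w) z h)" if "z \<in> cball 0 r1" for z
      using fd_fam_linear[OF M open_ball] sub that by blast
    then obtain B where "B > 0" "\<And>z w. z \<in> cball 0 r1 \<Longrightarrow> norm (fd (\<lambda>z. M z w) z h) \<le> B * norm w"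
      using basis_family_bound[of "cball 0 r1" "\<lambda>z w. fd (\<lambda>z. M z w) z h"] compact_cball cont2 by blast
    then show "\<exists>B>0. \<forall>z\<in>cball 0 r1. \<forall>w. norm (fd (\<lambda>z. M z w) z h) \<le> B * norm w" by blast
  qed
  then obtain E where E: "\<And>h. E h > 0" "\<And>h z w. z \<in> cball 0 r1 \<Longrightarrow> norm (fd (\<lambda>z. M z w) z h) \<le> E h * norm w" by metis
  let ?K3 = "\<Sum>b\<in>Basis. E b"
  have K3: "norm (fd (\<lambda>z. M z w) z h) \<le> ?K3 * norm h * norm w" if z: "z \<in> cball 0 r1" for z h w
  proof -
    have l: "linear (fd (\<lambda>z. M z w) z)" using holo_linear[OF holo_famD(1)[OF M]] sub z by blast
    have "norm (fd (\<lambda>z. M z w) z h) \<le> (\<Sum>b\<in>Basis. norm ((h \<bullet> b) *\<^sub>R fd (\<lambda>z. M z w) z b))"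
      by (subst linear_sum_Basis[OF l]) (rule norm_sum)
    also have "\<dots> \<le> (\<Sum>b\<in>Basis. norm h * (E b * norm w))"
      using E(2)[OF z] by (intro sum_mono) (simp add: Basis_le_norm mult_mono)
    also have "\<dots> = ?K3 * norm h * norm w" by (simp add: sum_distrib_left sum_distrib_right mult_ac)
    finally show ?thesis .
  qed
  have pos: "?K2 > 0" "?K3 > 0" using B(1) E(1) by (auto intro!: sum_pos)
  let ?K = "K1 + ?K2 + ?K3"
  show thesis
  proof (rule that[of ?K])
    show "norm (M z w) \<le> ?K * norm w" if "z \<in> cball 0 r1" for z w
      by (rule order_trans[OF K1(2)[OF that]]) (use pos in \<open>intro mult_right_mono; simp\<close>)
    show "norm (M z w - M z' w) \<le> ?K * norm (z - z') * norm w" if "z \<in> cball 0 r1" "z' \<in> cball 0 r1" for z z' w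
      by (rule order_trans[OF K2[OF that]]) (use pos K1 in \<open>intro mult_right_mono; simp\<close>)
    show "norm (fd (\<lambda>z. M z w) z h) \<le> ?K * norm h * norm w" if "z \<in> cball 0 r1" for z h w
      by (rule order_trans[OF K3[OF that]]) (use pos K1 in \<open>intro mult_right_mono; simp\<close>)
  qed (use pos K1 in simp)
qed

lemma smooth_on_scaleR: "open S \<Longrightarrow> smooth_on S f \<Longrightarrow> smooth_on S g \<Longrightarrow> smooth_on S (\<lambda>x. f x *\<^sub>R g x)"
  unfolding smooth_on_def using C_k_on_scaleR by blast

text \<open>The integrand is jointly smooth in \<open>(y, s)\<close>, which permits differentiation
  under the integral, and holomorphic in \<open>y\<close> for each \<open>s\<close>;
  \<open>Jc\<close> passes through the integral because it is bounded linear.\<close>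

lemma holo_flow_integral:
  fixes N :: "'a::euclidean_space cplxn \<Rightarrow> 'a cplxn \<Rightarrow> 'b::euclidean_space cplxn" and P Q :: "'a cplxn \<Rightarrow> 'a cplxn"
  assumes N: "holo_fam D N" and D: "open D" "convex D"
    and P: "linear P" "\<And>w. P (Jc w) = Jc (P w)" and Q: "linear Q" "\<And>w. Q (Jc w) = Jc (Q w)"
    and line: "\<And>y s. y \<in> D \<Longrightarrow> 0 \<le> s \<Longrightarrow> s \<le> 1 \<Longrightarrow> Q y + s *\<^sub>R P y \<in> D"
  shows "holo D (\<lambda>y. integral {0..1} (\<lambda>s. N (Q y + s *\<^sub>R P y) (P y)))"
proof -
  define W where "W = (\<lambda>p. Q (fst p) + snd p *\<^sub>R P (fst p)) -` D"
  define K where "K p = N (Q (fst p) + snd p *\<^sub>R P (fst p)) (P (fst p))" for p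
  have bl: "bounded_linear P" "bounded_linear Q" using P Q linear_conv_bounded_linear by blast+
  have blf: "bounded_linear (\<lambda>p. P (fst p))" "bounded_linear (\<lambda>p. Q (fst p))"
    using bl by (auto intro: bounded_linear_compose bounded_linear_fst)
  have sl: "smooth_on A (\<lambda>p. Q (fst p) + snd p *\<^sub>R P (fst p))" if "open A" for A :: "('a cplxn \<times> real) set"
    by (intro smooth_on_add smooth_on_scaleR smooth_on_bounded_linear that blf bounded_linear_snd)
  have W: "open W" unfolding W_def
    by (rule open_vimage[OF D(1)]) (use smooth_on_continuous[OF sl] in auto)
  have DW: "D \<times> {0..1} \<subseteq> W" using line by (auto simp: W_def)
  have oDU: "open (D \<times> (UNIV :: 'a cplxn set))" using D by (intro open_Times) auto
  have K: "smooth_on W K"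
  proof -
    have "smooth_on W (\<lambda>p. (\<lambda>q. N (fst q) (snd q)) (Q (fst p) + snd p *\<^sub>R P (fst p), P (fst p)))"
    proof (rule smooth_on_compose[OF W oDU smooth_fam[OF N D(1)]])
      show "smooth_on W (\<lambda>p. (Q (fst p) + snd p *\<^sub>R P (fst p), P (fst p)))"
        by (intro smooth_on_Pair sl smooth_on_bounded_linear W blf)
    qed (auto simp: W_def)
    then show ?thesis by (simp add: K_def[abs_def])
  qed
  have der: "((\<lambda>y. integral {0..1} (\<lambda>s. K (y, s))) has_derivative
      (\<lambda>h. integral {0..1} (\<lambda>s. fd K (y, s) (h, 0)))) (at y)" if "y \<in> D" for y
    by (rule parametric_integral_has_derivative[OF K DW D that])
  have J: "fd K (y, s) (Jc h, 0) = Jc (fd K (y, s) (h, 0))" if "y \<in> D" "s \<in> {0..1}" for y s h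
  proof -
    have h1: "holo D (\<lambda>y. Q y + s *\<^sub>R P y)"
      by (intro holo_add holo_scaleR holo_linear_o[OF P holo_id] holo_linear_o[OF Q holo_id])
    have "holo_fam D (\<lambda>y. N (Q y + s *\<^sub>R P y))"
      by (rule holo_fam_compose[OF N h1]) (use line that in auto)
    from holo_fam_app[OF this holo_linear_o[OF P holo_id] D(1)]
    have hK: "holo D (\<lambda>y. K (y, s))" by (simp add: K_def)
    have "((\<lambda>y. (y, s)) has_derivative (\<lambda>h. (h, 0))) (at y)" by (auto intro!: derivative_eq_intros)
    moreover have "(y, s) \<in> W" using DW that by blast
    ultimately have "((\<lambda>y. K (y, s)) has_derivative (\<lambda>h. fd K (y, s) (h, 0))) (at y)"
      using has_derivative_compose[OF _ smooth_on_has_derivative[OF K], of "\<lambda>y. (y, s)"] by blast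
    from fd_eqI[OF this] holo_fd_Jc[OF hK that(1), of h] show ?thesis by simp
  qed
  have "holo D (\<lambda>y. integral {0..1} (\<lambda>s. K (y, s)))"
  proof (rule holoI[OF der])
    fix y h assume y: "y \<in> D"
    have "continuous_on {0..1} (\<lambda>s. (\<lambda>p. fd K p (h, 0)) (y, s))"
      by (rule continuous_on_compose2[OF smooth_on_continuous[OF smooth_on_fd[OF K]]])
        (use DW y in \<open>auto intro!: continuous_intros\<close>)
    then have "(\<lambda>s. fd K (y, s) (h, 0)) integrable_on {0..1}" by (simp add: integrable_continuous_interval)
    from integral_linear[OF this bounded_linear_Jc]
    have "integral {0..1} (\<lambda>s. Jc (fd K (y, s) (h, 0))) = Jc (integral {0..1} (\<lambda>s. fd K (y, s) (h, 0)))"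
      by (simp add: o_def)
    then show "integral {0..1} (\<lambda>s. fd K (y, s) (Jc h, 0)) = Jc (integral {0..1} (\<lambda>s. fd K (y, s) (h, 0)))"
      using integral_cong[of "{0..1}" "\<lambda>s. fd K (y, s) (Jc h, 0)" "\<lambda>s. Jc (fd K (y, s) (h, 0))"] J[OF y] by simp
  qed
  then show ?thesis by (simp add: K_def)
qed

text \<open>\<open>\<Psi> y\<close> is the end point of the solution that starts at
  \<open>Q y\<close> and has velocity \<open>M\<close> applied to \<open>P y\<close> at the current
  position. Time is encoded in the argument: \<open>Q y + s P y\<close> has the same
  \<open>Q\<close>-part and a scaled \<open>P\<close>-part, so one function of \<open>y\<close>
  contains the entire trajectory. Picard iteration on such functions keeps holomorphy, since the
  convergence is uniform.\<close>

lemma holo_flow_exists: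
  fixes M :: "'a::euclidean_space cplxn \<Rightarrow> 'a cplxn \<Rightarrow> 'a cplxn"
  assumes M: "holo_fam (ball 0 \<rho>) M" and \<rho>: "\<rho> > 0"
    and P: "linear P" "\<And>w. P (Jc w) = Jc (P w)" "\<And>w. P (P w) = P w"
    and Q: "Q = (\<lambda>w. w - P w)"
  obtains D \<Psi> \<rho>1 where "open D" "convex D" "0 \<in> D" "\<rho>1 < \<rho>" "\<And>y s. y \<in> D \<Longrightarrow> 0 \<le> s \<Longrightarrow> s \<le> 1 \<Longrightarrow> Q y + s *\<^sub>R P y \<in> D"
    "\<And>y. y \<in> D \<Longrightarrow> \<Psi> y \<in> cball 0 \<rho>1" "holo D \<Psi>"
    "\<And>y. y \<in> D \<Longrightarrow> \<Psi> y = Q y + integral {0..1} (\<lambda>s. M (\<Psi> (Q y + s *\<^sub>R P y)) (P y))"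
proof -
  define \<rho>1 where "\<rho>1 = \<rho> / 2"
  have \<rho>1: "\<rho>1 > 0" "\<rho>1 < \<rho>" using \<rho> by (auto simp: \<rho>1_def)
  obtain K where K: "K > 0" "\<And>z w. z \<in> cball 0 \<rho>1 \<Longrightarrow> norm (M z w) \<le> K * norm w"
    "\<And>z z' w. z \<in> cball 0 \<rho>1 \<Longrightarrow> z' \<in> cball 0 \<rho>1 \<Longrightarrow> norm (M z w - M z' w) \<le> K * norm (z - z') * norm w"
    using holo_fam_bounds[OF M \<rho>1(2)] by metis
  \<comment> \<open>The first bound keeps every iterate in the ball of radius
    \<open>\<rho>1\<close>, where the estimates with \<open>K\<close> hold; the second makes the
    iteration contract by the factor 1/2.\<close>
  define \<delta> where "\<delta> = min (\<rho>1 / (1 + K)) (1 / (2 * K))"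
  have \<delta>: "\<delta> > 0" "(1 + K) * \<delta> \<le> \<rho>1" "K * \<delta> \<le> 1/2"
  proof -
    show "\<delta> > 0" using K \<rho>1 by (simp add: \<delta>_def)
    have "\<delta> \<le> \<rho>1 / (1 + K)" "\<delta> \<le> 1 / (2 * K)" by (auto simp: \<delta>_def)
    then show "(1 + K) * \<delta> \<le> \<rho>1" "K * \<delta> \<le> 1/2" using K by (simp_all add: field_simps)
  qed
  have lQ: "linear Q" "\<And>w. Q (Jc w) = Jc (Q w)" "\<And>w. Q (Q w) = Q w" "\<And>w. P (Q w) = 0" "\<And>w. Q (P w) = 0"
    unfolding Q by (auto intro!: linear_compose_sub linear_id[unfolded id_def] P simp: P(2) Jc_arith P(3) linear_diff[OF P(1)])
  have contPQ: "continuous_on A P" "continuous_on A Q" for A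
    using P(1) lQ(1) linear_conv_bounded_linear linear_continuous_on by blast+
  define D where "D = {y. norm (Q y) < \<delta> \<and> norm (P y) < \<delta>}"
  have D_eq: "D = Q -` ball 0 \<delta> \<inter> P -` ball 0 \<delta>" by (auto simp: D_def)
  have oD: "open D" unfolding D_eq by (intro open_Int open_vimage open_ball contPQ)
  have cD: "convex D" unfolding D_eq by (intro convex_Int convex_linear_vimage P lQ convex_ball)
  have D0: "0 \<in> D" using \<delta> by (simp add: D_def linear_0[OF P(1)] linear_0[OF lQ(1)])
  have Pl: "P (Q y + s *\<^sub>R P y) = s *\<^sub>R P y" "Q (Q y + s *\<^sub>R P y) = Q y" for y s
    by (simp_all add: linear_add[OF P(1)] linear_add[OF lQ(1)] linear_scale[OF P(1)] linear_scale[OF lQ(1)] P(3) lQ)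
  have line: "Q y + s *\<^sub>R P y \<in> D" if "y \<in> D" "0 \<le> s" "s \<le> 1" for y s
  proof -
    have "\<bar>s\<bar> * norm (P y) \<le> 1 * norm (P y)" using that by (intro mult_right_mono) auto
    then show ?thesis using that by (simp add: D_def Pl)
  qed
  define step where "step \<Phi> y = Q y + integral {0..1} (\<lambda>s. M (\<Phi> (Q y + s *\<^sub>R P y)) (P y))" for \<Phi> y
  have contI: "continuous_on {0..1} (\<lambda>s. M (\<Phi> (Q y + s *\<^sub>R P y)) w)"
    if \<Phi>: "continuous_on D \<Phi>" "\<Phi> ` D \<subseteq> cball 0 \<rho>1" and y: "y \<in> D" for \<Phi> y w
  proof -
    have "continuous_on {0..1} (\<lambda>s. \<Phi> (Q y + s *\<^sub>R P y))"
      by (rule continuous_on_compose2[OF \<Phi>(1)]) (use line[OF y] in \<open>auto intro!: continuous_intros\<close>)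
    then show ?thesis
      by (rule continuous_on_compose2[OF holo_continuous[OF holo_famD(1)[OF M]]])
        (use line[OF y] \<Phi>(2) \<rho>1 in fastforce)
  qed
  have step_diff: "norm (step \<Phi> y - step \<Theta> y) \<le> c / 2"
    if \<Phi>: "continuous_on D \<Phi>" "\<Phi> ` D \<subseteq> cball 0 \<rho>1" and \<Theta>: "continuous_on D \<Theta>" "\<Theta> ` D \<subseteq> cball 0 \<rho>1"
      and c: "\<And>y. y \<in> D \<Longrightarrow> norm (\<Phi> y - \<Theta> y) \<le> c" and y: "y \<in> D" for \<Phi> \<Theta> c y
  proof -
    have c0: "c \<ge> 0" using c[OF y] norm_ge_zero order_trans by blast
    have Py: "norm (P y) \<le> \<delta>" using y by (simp add: D_def)
    have "step \<Phi> y - step \<Theta> y = integral {0..1} (\<lambda>s. M (\<Phi> (Q y + s *\<^sub>R P y)) (P y) - M (\<Theta> (Q y + s *\<^sub>R P y)) (P y))"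
      unfolding step_def
      by (subst integral_diff) (auto intro!: integrable_continuous_interval contI \<Phi> \<Theta> y)
    also have "norm \<dots> \<le> (c / 2) * (1 - 0)"
    proof (rule integral_bound)
      show "continuous_on {0..1} (\<lambda>s. M (\<Phi> (Q y + s *\<^sub>R P y)) (P y) - M (\<Theta> (Q y + s *\<^sub>R P y)) (P y))"
        by (intro continuous_on_diff contI \<Phi> \<Theta> y)
      fix s :: real assume s: "s \<in> {0..1}"
      let ?l = "Q y + s *\<^sub>R P y"
      have l: "?l \<in> D" using line[OF y] s by auto
      have "norm (M (\<Phi> ?l) (P y) - M (\<Theta> ?l) (P y)) \<le> K * norm (\<Phi> ?l - \<Theta> ?l) * norm (P y)"
        using K(3) \<Phi>(2) \<Theta>(2) l by blast
      also have "\<dots> \<le> K * c * \<delta>" using K(1) c[OF l] Py c0 by (intro mult_mono) auto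
      also have "\<dots> = K * \<delta> * c" by simp
      also have "\<dots> \<le> 1/2 * c" using \<delta>(3) c0 by (rule mult_right_mono)
      finally show "norm (M (\<Phi> ?l) (P y) - M (\<Theta> ?l) (P y)) \<le> c / 2" by simp
    qed simp
    finally show ?thesis by simp
  qed
  have step_holo: "holo D (step \<Phi>) \<and> step \<Phi> ` D \<subseteq> cball 0 \<rho>1"
    if \<Phi>: "holo D \<Phi>" "\<Phi> ` D \<subseteq> cball 0 \<rho>1" for \<Phi>
  proof
    have "holo_fam D (\<lambda>y. M (\<Phi> y))"
      by (rule holo_fam_compose[OF M \<Phi>(1)]) (use \<Phi>(2) \<rho>1 in fastforce)
    from holo_flow_integral[OF this oD cD P(1,2) lQ(1,2) line]
    show "holo D (step \<Phi>)" unfolding step_def by (intro holo_add holo_linear_o[OF lQ(1,2) holo_id])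
    show "step \<Phi> ` D \<subseteq> cball 0 \<rho>1"
    proof
      fix z assume "z \<in> step \<Phi> ` D"
      then obtain y where y: "y \<in> D" "z = step \<Phi> y" by blast
      have Py: "norm (P y) \<le> \<delta>" "norm (Q y) \<le> \<delta>" using y by (simp_all add: D_def)
      have "norm (integral {0..1} (\<lambda>s. M (\<Phi> (Q y + s *\<^sub>R P y)) (P y))) \<le> (K * \<delta>) * (1 - 0)"
      proof (rule integral_bound)
        show "continuous_on {0..1} (\<lambda>s. M (\<Phi> (Q y + s *\<^sub>R P y)) (P y))"
          by (intro contI holo_continuous \<Phi> y)
        fix s :: real assume s: "s \<in> {0..1}"
        have "\<Phi> (Q y + s *\<^sub>R P y) \<in> cball 0 \<rho>1" using line[OF y(1), of s] s \<Phi>(2) by (auto simp: image_subset_iff)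
        from K(2)[OF this, of "P y"]
        have "norm (M (\<Phi> (Q y + s *\<^sub>R P y)) (P y)) \<le> K * norm (P y)" .
        also have "\<dots> \<le> K * \<delta>" using Py(1) K(1) by (intro mult_left_mono) auto
        finally show "norm (M (\<Phi> (Q y + s *\<^sub>R P y)) (P y)) \<le> K * \<delta>" .
      qed simp
      then have "norm z \<le> \<delta> + K * \<delta>"
        unfolding y(2) step_def using Py(2) by (intro norm_triangle_le) simp
      then show "z \<in> cball 0 \<rho>1" using \<delta>(2) by (simp add: algebra_simps)
    qed
  qed
  define \<Phi> where "\<Phi> n = (step ^^ n) Q" for n
  have \<Phi>: "holo D (\<Phi> n) \<and> \<Phi> n ` D \<subseteq> cball 0 \<rho>1" for n
  proof (induction n)
    case 0
    have "\<delta> \<le> \<rho>1" using \<delta> K by (smt (verit) mult_less_cancel_right2)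
    then have "Q ` D \<subseteq> cball 0 \<rho>1" by (auto simp: D_def)
    then show ?case using holo_linear_o[OF lQ(1,2) holo_id] by (simp add: \<Phi>_def)
  next
    case (Suc n)
    then show ?case using step_holo by (simp add: \<Phi>_def)
  qed
  then have \<Phi>h: "\<And>n. holo D (\<Phi> n)" "\<And>n. \<Phi> n ` D \<subseteq> cball 0 \<rho>1" "\<And>n. continuous_on D (\<Phi> n)"
    using holo_continuous by blast+
  have \<Phi>Suc: "\<Phi> (Suc n) = step (\<Phi> n)" for n by (simp add: \<Phi>_def)
  have bound: "norm (\<Phi> (Suc n) y - \<Phi> n y) \<le> 2 * \<rho>1 * (1/2) ^ n" if "y \<in> D" for n y
    using that
  proof (induction n arbitrary: y)
    case 0
    have "norm (\<Phi> (Suc 0) y) \<le> \<rho>1" "norm (\<Phi> 0 y) \<le> \<rho>1" using \<Phi>h(2)[of 0] \<Phi>h(2)[of "Suc 0"] 0 by auto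
    then show ?case using norm_triangle_ineq4[of "\<Phi> (Suc 0) y" "\<Phi> 0 y"] by simp
  next
    case (Suc n)
    have "norm (step (\<Phi> (Suc n)) y - step (\<Phi> n) y) \<le> 2 * \<rho>1 * (1/2) ^ n / 2"
      by (rule step_diff[OF \<Phi>h(3,2) \<Phi>h(3,2) Suc.IH Suc.prems])
    then show ?case by (simp add: \<Phi>Suc)
  qed
  \<comment> \<open>The limit is written as a telescoping series so that the M-test yields uniform
    convergence.\<close>
  define \<Psi> where "\<Psi> y = Q y + suminf (\<lambda>i. \<Phi> (Suc i) y - \<Phi> i y)" for y
  have tel: "(\<Sum>i<n. \<Phi> (Suc i) y - \<Phi> i y) = \<Phi> n y - Q y" for n y
    using sum_lessThan_telescope[of "\<lambda>i. \<Phi> i y" n] by (simp add: \<Phi>_def[of 0])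
  have "uniform_limit D (\<lambda>n y. \<Sum>i<n. \<Phi> (Suc i) y - \<Phi> i y) (\<lambda>y. suminf (\<lambda>i. \<Phi> (Suc i) y - \<Phi> i y)) sequentially"
    by (rule Weierstrass_m_test[OF bound]) (auto intro!: summable_mult summable_geometric)
  then have ul: "uniform_limit D \<Phi> \<Psi> sequentially"
    unfolding tel \<Psi>_def uniform_limit_iff dist_norm by (simp add: algebra_simps)
  have lim: "(\<lambda>n. \<Phi> n y) \<longlonglongrightarrow> \<Psi> y" if "y \<in> D" for y
    using tendsto_uniform_limitI[OF ul that] .
  have \<Psi>b: "\<Psi> y \<in> cball 0 \<rho>1" if "y \<in> D" for y
    by (rule Lim_in_closed_set[OF closed_cball _ _ lim[OF that]]) (use \<Phi>h(2) that in \<open>auto simp: image_subset_iff\<close>)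
  have \<Psi>h: "holo D \<Psi>"
  proof (rule holo_local)
    fix x assume "x \<in> D"
    then obtain r where r: "r > 0" "ball x r \<subseteq> D" using oD open_contains_ball by blast
    have "holo (ball x r) (\<Phi> n)" for n using holo_subset[OF \<Phi>h(1) r(2)] .
    from holo_uniform_limit_ball[OF this uniform_limit_on_subset[OF ul r(2)] r(1)]
    show "\<exists>T. x \<in> T \<and> holo T \<Psi>" using r by (intro exI[of _ "ball x (r/2)"]) auto
  qed
  have fixpt: "\<Psi> y = step \<Psi> y" if y: "y \<in> D" for y
  proof (rule LIMSEQ_unique)
    show "(\<lambda>n. \<Phi> (Suc n) y) \<longlonglongrightarrow> \<Psi> y" using lim[OF y] by (rule LIMSEQ_Suc)
    show "(\<lambda>n. \<Phi> (Suc n) y) \<longlonglongrightarrow> step \<Psi> y"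
    proof (rule metric_LIMSEQ_I)
      fix e :: real assume e: "e > 0"
      obtain N where N: "\<And>n y. n \<ge> N \<Longrightarrow> y \<in> D \<Longrightarrow> dist (\<Phi> n y) (\<Psi> y) < e"
        using ul e unfolding uniform_limit_iff eventually_sequentially by blast
      have "dist (\<Phi> (Suc n) y) (step \<Psi> y) < e" if "n \<ge> N" for n
      proof -
        have "norm (step (\<Phi> n) y - step \<Psi> y) \<le> e / 2"
          by (rule step_diff[OF \<Phi>h(3,2) holo_continuous[OF \<Psi>h] _ _ y])
            (use \<Psi>b N[OF that] in \<open>auto simp: dist_norm less_imp_le\<close>)
        then show ?thesis using e by (simp add: \<Phi>Suc dist_norm)
      qed
      then show "\<exists>N. \<forall>n\<ge>N. dist (\<Phi> (Suc n) y) (step \<Psi> y) < e" by blast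
    qed
  qed
  show thesis
    by (rule that[OF oD cD D0 \<rho>1(2) line \<Psi>b \<Psi>h]) (use fixpt in \<open>auto simp: step_def\<close>)
qed

text \<open>Gronwall: the weight \<open>exp (- 2 * C * s)\<close> makes the squared norm
  nonincreasing, and it starts at 0.\<close>

lemma linear_ode_zero:
  fixes k :: "real \<Rightarrow> 'a::real_inner"
  assumes k: "\<And>s. 0 < s \<Longrightarrow> s < 1 \<Longrightarrow> (k has_vector_derivative k' s) (at s)"
    and b: "\<And>s. 0 < s \<Longrightarrow> s < 1 \<Longrightarrow> norm (k' s) \<le> C * norm (k s)"
    and c: "continuous_on {0..1} k" and 0: "k 0 = 0"
  shows "k 1 = 0"
proof -
  let ?f = "\<lambda>s. exp (- 2 * C * s) * (k s \<bullet> k s)"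
  have "\<exists>y. (?f has_real_derivative y) (at s) \<and> y \<le> 0" if s: "0 < s" "s < 1" for s
  proof (intro exI conjI)
    have "((\<lambda>s. k s \<bullet> k s) has_derivative (\<lambda>h. k s \<bullet> (h *\<^sub>R k' s) + (h *\<^sub>R k' s) \<bullet> k s)) (at s)"
      using k[OF s] unfolding has_vector_derivative_def by (intro has_derivative_inner) auto
    then have "((\<lambda>s. k s \<bullet> k s) has_derivative (\<lambda>h. h * (2 * (k s \<bullet> k' s)))) (at s)"
      by (elim has_derivative_eq_rhs) (auto simp: inner_commute algebra_simps)
    then have "((\<lambda>s. k s \<bullet> k s) has_real_derivative 2 * (k s \<bullet> k' s)) (at s)"
      unfolding has_field_derivative_def by (elim has_derivative_eq_rhs) auto
    then show "(?f has_real_derivative exp (- 2 * C * s) * (2 * (k s \<bullet> k' s)) + exp (- 2 * C * s) * (- 2 * C) * (k s \<bullet> k s)) (at s)"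
      by (auto intro!: derivative_eq_intros)
    have "k s \<bullet> k' s \<le> norm (k s) * norm (k' s)" by (rule norm_cauchy_schwarz)
    also have "\<dots> \<le> norm (k s) * (C * norm (k s))" using b[OF s] by (intro mult_left_mono) auto
    also have "\<dots> = C * (k s \<bullet> k s)" by (simp add: power2_norm_eq_inner[symmetric] power2_eq_square)
    finally have "exp (- 2 * C * s) * (k s \<bullet> k' s) \<le> exp (- 2 * C * s) * (C * (k s \<bullet> k s))"
      by (intro mult_left_mono) auto
    then show "exp (- 2 * C * s) * (2 * (k s \<bullet> k' s)) + exp (- 2 * C * s) * (- 2 * C) * (k s \<bullet> k s) \<le> 0"
      by (simp add: algebra_simps)
  qed
  then have "?f 1 \<le> ?f 0"
    by (intro DERIV_nonpos_imp_decreasing_open[of 0 1 ?f]) (auto intro!: continuous_intros c)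
  then have "k 1 \<bullet> k 1 \<le> 0" using 0 by (simp add: mult_le_0_iff)
  then show ?thesis by (simp add: inner_ge_zero antisym_conv)
qed

text \<open>Along the segment from \<open>Q y\<close> to \<open>y\<close> a change of variable turns
  the fixed point equation into an integral from 0 to \<open>s\<close>; differentiating at the end
  point \<open>s = 1\<close> gives the claim. The derivative is taken within \<open>{0..1}\<close>
  because the integral equation is known only there.\<close>

lemma flow_radial_derivative:
  fixes M :: "'a::euclidean_space cplxn \<Rightarrow> 'a cplxn \<Rightarrow> 'a cplxn"
  assumes M: "holo_fam (ball 0 \<rho>) M" and D: "open D" and \<Psi>h: "holo D \<Psi>" and r1: "\<rho>1 < \<rho>"
    and \<Psi>b: "\<And>y. y \<in> D \<Longrightarrow> \<Psi> y \<in> cball 0 \<rho>1"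
    and P: "linear P" "\<And>w. P (P w) = P w" and Q: "Q = (\<lambda>w. w - P w)"
    and line: "\<And>y s. y \<in> D \<Longrightarrow> 0 \<le> s \<Longrightarrow> s \<le> 1 \<Longrightarrow> Q y + s *\<^sub>R P y \<in> D"
    and fixpt: "\<And>y. y \<in> D \<Longrightarrow> \<Psi> y = Q y + integral {0..1} (\<lambda>s. M (\<Psi> (Q y + s *\<^sub>R P y)) (P y))"
    and y: "y \<in> D"
  shows "fd \<Psi> y (P y) = M (\<Psi> y) (P y)"
proof -
  let ?l = "\<lambda>s. Q y + s *\<^sub>R P y"
  let ?f = "\<lambda>s. M (\<Psi> (?l s)) (P y)"
  have lin: "P (?l s) = s *\<^sub>R P y" "Q (?l s) = Q y" for s
    unfolding Q by (simp_all add: linear_add[OF P(1)] linear_diff[OF P(1)] linear_scale[OF P(1)] P(2))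
  have yl: "?l 1 = y" by (simp add: Q)
  have "continuous_on {0..1} (\<lambda>s. \<Psi> (?l s))"
    by (rule continuous_on_compose2[OF holo_continuous[OF \<Psi>h]]) (use line[OF y] in \<open>auto intro!: continuous_intros\<close>)
  then have contf: "continuous_on {0..1} ?f"
    by (rule continuous_on_compose2[OF holo_continuous[OF holo_famD(1)[OF M]]])
      (use line[OF y] \<Psi>b r1 in fastforce)
  have \<Gamma>: "\<Psi> (?l s) = Q y + integral {0..s} ?f" if s: "s \<in> {0..1}" for s
  proof (cases "s = 0")
    \<comment> \<open>The change of variable divides by \<open>s\<close>; at \<open>s = 0\<close>
      the integrand vanishes instead.\<close>
    case True
    have ld: "?l 0 \<in> D" using line[OF y, of 0] by simp
    have "\<Psi> (?l 0) \<in> ball 0 \<rho>" using \<Psi>b[OF ld] r1 by simp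
    then have "M (\<Psi> (?l 0)) 0 = 0" by (rule linear_0[OF holo_famD(2)[OF M]])
    then have "integral {0..1::real} (\<lambda>s. M (\<Psi> (Q y)) 0) = 0" by simp
    note I0 = this
    have "\<Psi> (Q y) = Q y"
      using fixpt[OF ld, unfolded lin, unfolded scaleR_zero_left scaleR_zero_right add_0_right, unfolded I0] by simp
    then show ?thesis using True by simp
  next
    case False
    then have s0: "s > 0" using s by simp
    have ld: "?l s \<in> D" using line[OF y] s by auto
    have "\<Psi> (?l s) = Q y + integral {0..1} (\<lambda>\<sigma>. M (\<Psi> (Q y + \<sigma> *\<^sub>R (s *\<^sub>R P y))) (s *\<^sub>R P y))"
      using fixpt[OF ld] by (simp only: lin)
    also have "integral {0..1} (\<lambda>\<sigma>. M (\<Psi> (Q y + \<sigma> *\<^sub>R (s *\<^sub>R P y))) (s *\<^sub>R P y)) = integral {0..1} (\<lambda>\<sigma>. s *\<^sub>R ?f (s * \<sigma>))"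
    proof (rule integral_cong)
      fix \<sigma> :: real assume \<sigma>: "\<sigma> \<in> {0..1}"
      have "s * \<sigma> \<le> 1" "0 \<le> s * \<sigma>" using \<sigma> s by (auto intro: mult_le_one)
      then have "\<Psi> (?l (s * \<sigma>)) \<in> ball 0 \<rho>" using \<Psi>b[OF line[OF y]] r1 by fastforce
      then show "M (\<Psi> (Q y + \<sigma> *\<^sub>R (s *\<^sub>R P y))) (s *\<^sub>R P y) = s *\<^sub>R ?f (s * \<sigma>)"
        using linear_scale[OF holo_famD(2)[OF M]] by (simp add: mult.commute)
    qed
    also have "\<dots> = integral {0..s} ?f"
    proof -
      have "?f integrable_on {0..s}"
        using contf s by (intro integrable_continuous_interval) (auto intro: continuous_on_subset)
      then have "(?f has_integral integral {0..s} ?f) {0..s}" by (simp add: integrable_integral)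
      from has_integral_stretch_real[OF this, of s]
      have "((\<lambda>\<sigma>. ?f (s * \<sigma>)) has_integral (1 / s) *\<^sub>R integral {0..s} ?f) ((\<lambda>x. x / s) ` {0..s})"
        using s0 by simp
      moreover have "(\<lambda>x. x / s) ` {0..s} = {0..1}"
        using s0 by (auto simp: image_iff field_simps intro!: bexI[of _ "_ * s"])
      ultimately have "((\<lambda>\<sigma>. s *\<^sub>R ?f (s * \<sigma>)) has_integral s *\<^sub>R ((1 / s) *\<^sub>R integral {0..s} ?f)) {0..1}"
        by (intro has_integral_cmul) simp
      then show ?thesis using s0 by (intro integral_unique) simp
    qed
    finally show ?thesis .
  qed
  have "((\<lambda>u. integral {0..u} ?f) has_vector_derivative ?f 1) (at 1 within {0..1})"
    by (rule integral_has_vector_derivative[OF contf]) simp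
  then have "((\<lambda>u. Q y + integral {0..u} ?f) has_vector_derivative 0 + ?f 1) (at 1 within {0..1})"
    by (intro has_vector_derivative_add has_vector_derivative_const)
  then have 1: "((\<lambda>s. \<Psi> (?l s)) has_vector_derivative ?f 1) (at 1 within {0..1})"
    unfolding add_0 by (rule has_vector_derivative_transform[rotated 2]) (use \<Gamma> in auto)
  have "(?l has_derivative (\<lambda>h. h *\<^sub>R P y)) (at 1)" by (auto intro!: derivative_eq_intros)
  from has_derivative_compose[OF this, of \<Psi> "fd \<Psi> y"] holo_has_derivative[OF \<Psi>h y] yl
  have "((\<lambda>s. \<Psi> (?l s)) has_derivative (\<lambda>h. fd \<Psi> y (h *\<^sub>R P y))) (at 1)" by simp
  then have "((\<lambda>s. \<Psi> (?l s)) has_vector_derivative fd \<Psi> y (P y)) (at 1)"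
    unfolding has_vector_derivative_def by (simp add: linear_scale[OF holo_linear[OF \<Psi>h y]])
  then have 2: "((\<lambda>s. \<Psi> (?l s)) has_vector_derivative fd \<Psi> y (P y)) (at 1 within {0..1})"
    by (rule has_vector_derivative_at_within)
  show ?thesis
    using vector_derivative_unique_within_closed_interval[OF _ _ 1[folded cbox_interval] 2[folded cbox_interval]] yl by simp
qed

text \<open>Let \<open>X s\<close> be \<open>s\<close> times the derivative of \<open>\<Psi>\<close>
  along \<open>v\<close> at the point \<open>l s\<close> of the segment to \<open>y\<close>. Its
  part \<open>k\<close> outside the distribution satisfies a homogeneous linear equation:
  differentiating the radial identity produces inhomogeneous terms, and \<open>invol\<close> cancels
  them. Since \<open>k 0 = 0\<close>, also \<open>k 1 = 0\<close>. As \<open>\<pi>\<close> is a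
  projection, the derivative of \<open>\<pi> x (\<pi> z v)\<close> at \<open>z\<close> is the outer
  part of the derivative of \<open>\<pi> x v\<close>; so \<open>invol\<close> says that the brackets
  of the fields \<open>\<pi> x u\<close> and \<open>\<pi> x v\<close> have no outer part.\<close>

lemma flow_tangent:
  fixes \<pi> :: "'a::euclidean_space cplxn \<Rightarrow> 'a cplxn \<Rightarrow> 'a cplxn"
  assumes M: "holo_fam (ball 0 \<rho>) \<pi>" and D: "open D" and \<Psi>h: "holo D \<Psi>" and r1: "\<rho>1 < \<rho>"
    and \<Psi>b: "\<And>y. y \<in> D \<Longrightarrow> \<Psi> y \<in> cball 0 \<rho>1"
    and P: "linear P" "\<And>w. P (P w) = P w" "\<And>w. P (Jc w) = Jc (P w)" and Q: "Q = (\<lambda>w. w - P w)"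
    and line: "\<And>y s. y \<in> D \<Longrightarrow> 0 \<le> s \<Longrightarrow> s \<le> 1 \<Longrightarrow> Q y + s *\<^sub>R P y \<in> D"
    and rad: "\<And>y. y \<in> D \<Longrightarrow> fd \<Psi> y (P y) = \<pi> (\<Psi> y) (P y)"
    and proj: "\<And>z w. z \<in> ball 0 \<rho> \<Longrightarrow> \<pi> z (\<pi> z w) = \<pi> z w"
    and invol: "\<And>z u v. z \<in> ball 0 \<rho> \<Longrightarrow> fd (\<lambda>x. \<pi> x (\<pi> z v)) z (\<pi> z u) = fd (\<lambda>x. \<pi> x (\<pi> z u)) z (\<pi> z v)"
    and y: "y \<in> D" and v: "P v = v"
  shows "\<pi> (\<Psi> y) (fd \<Psi> y v) = fd \<Psi> y v"
proof -
  define l where "l s = Q y + s *\<^sub>R P y" for s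
  have ly: "l 1 = y" by (simp add: l_def Q)
  have lin: "P (l s) = s *\<^sub>R P y" for s
    unfolding l_def Q by (simp add: linear_add[OF P(1)] linear_diff[OF P(1)] linear_scale[OF P(1)] P(2))
  have lD: "l s \<in> D" if "0 \<le> s" "s \<le> 1" for s using line[OF y that] by (simp add: l_def)
  have zB: "\<Psi> x \<in> ball 0 \<rho>" if "x \<in> D" for x using \<Psi>b[OF that] r1 by simp
  have \<Psi>sub: "\<Psi> ` D \<subseteq> ball 0 \<rho>" using zB by blast
  define \<zeta> where "\<zeta> = P y"
  define g where "g = (\<lambda>x. fd \<Psi> x v)"
  have gh: "holo D g" unfolding g_def by (rule holo_fd[OF D \<Psi>h])
  define d where "d z a b = fd (\<lambda>x. \<pi> x b) z a" for z a b
  have da: "linear (\<lambda>a. d z a b)" if "z \<in> ball 0 \<rho>" for z b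
    unfolding d_def using holo_linear[OF holo_famD(1)[OF M] that] .
  have db: "linear (\<lambda>b. d z a b)" if "z \<in> ball 0 \<rho>" for z a
    unfolding d_def by (rule fd_fam_linear[OF M open_ball that])
  \<comment> \<open>The identity \<open>\<pi> \<pi> = \<pi>\<close>, differentiated.\<close>
  have dproj: "d z a (\<pi> z b) + \<pi> z (d z a b) = d z a b" if z: "z \<in> ball 0 \<rho>" for z a b
  proof -
    have "fd (\<lambda>x. \<pi> x (\<pi> x b)) z a = d z a (\<pi> z b) + \<pi> z (d z a b)"
      unfolding d_def fd_eqI[OF fam_app_has_derivative[OF M holo_famD(1)[OF M] open_ball z]] ..
    moreover have "fd (\<lambda>x. \<pi> x (\<pi> x b)) z = fd (\<lambda>x. \<pi> x b) z"
      by (rule fd_cong_open[OF open_ball z]) (rule proj)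
    ultimately show ?thesis by (simp add: d_def)
  qed
  have inv: "d z (\<pi> z u) (\<pi> z w) = d z (\<pi> z w) (\<pi> z u)" if "z \<in> ball 0 \<rho>" for z u w
    unfolding d_def by (rule invol[OF that])
  \<comment> \<open>the radial identity, differentiated in the direction \<open>v\<close>\<close>
  have rad': "fd g x (P x) + g x = d (\<Psi> x) (g x) (P x) + \<pi> (\<Psi> x) v" if x: "x \<in> D" for x
  proof -
    have 1: "((\<lambda>x. fd \<Psi> x (P x)) has_derivative (\<lambda>h. fd (\<lambda>z. fd \<Psi> z (P x)) x h + fd \<Psi> x (P h))) (at x)"
      using fam_app_has_derivative[OF holo_fam_fd_fun[OF \<Psi>h D] holo_linear_o[OF P(1,3) holo_id] D x]
        fd_eqI[OF linear_imp_has_derivative[OF P(1)], of x] by simp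
    have 2: "((\<lambda>x. \<pi> (\<Psi> x) (P x)) has_derivative (\<lambda>h. d (\<Psi> x) (fd \<Psi> x h) (P x) + \<pi> (\<Psi> x) (P h))) (at x)"
      unfolding d_def
      by (rule has_derivative_fam_apply[OF M open_ball zB[OF x] D x \<Psi>sub refl holo_has_derivative[OF \<Psi>h x] linear_imp_has_derivative[OF P(1)]])
    have "fd (\<lambda>x. fd \<Psi> x (P x)) x = fd (\<lambda>x. \<pi> (\<Psi> x) (P x)) x"
      by (rule fd_cong_open[OF D x rad])
    then have "fd (\<lambda>z. fd \<Psi> z (P x)) x v + fd \<Psi> x (P v) = d (\<Psi> x) (fd \<Psi> x v) (P x) + \<pi> (\<Psi> x) (P v)"
      unfolding fd_eqI[OF 1] fd_eqI[OF 2] by metis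
    moreover have "fd (\<lambda>z. fd \<Psi> z (P x)) x v = fd (\<lambda>z. fd \<Psi> z v) x (P x)"
      using holo_smooth[OF D \<Psi>h] by (intro second_derivative_symmetric[OF D x]) (simp add: smooth_on_def)
    ultimately show ?thesis by (simp add: v g_def)
  qed
  define z where "z s = \<Psi> (l s)" for s
  \<comment> \<open>The factor \<open>s\<close> makes \<open>X\<close> start at 0. It also absorbs
    the factor in \<open>P (l s) = s \<zeta>\<close>, so that the differentiated radial identity
    becomes an equation for the derivative of \<open>X\<close> without division by
    \<open>s\<close>.\<close>
  define X where "X s = s *\<^sub>R g (l s)" for s
  define k where "k s = X s - \<pi> (z s) (X s)" for s
  have zs: "z s \<in> ball 0 \<rho>" "z s \<in> cball 0 \<rho>1" if "0 \<le> s" "s \<le> 1" for s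
    unfolding z_def using zB \<Psi>b lD[OF that] by auto
  have l': "(l has_derivative (\<lambda>h. h *\<^sub>R \<zeta>)) (at s)" for s
    unfolding l_def[abs_def] \<zeta>_def by (auto intro!: derivative_eq_intros)
  define X' where "X' s = d (z s) (X s) \<zeta> + \<pi> (z s) v" for s
  have Xd: "(X has_derivative (\<lambda>h. h *\<^sub>R X' s)) (at s)" if s: "0 \<le> s" "s \<le> 1" for s
  proof -
    have "((\<lambda>s. g (l s)) has_derivative (\<lambda>h. fd g (l s) (h *\<^sub>R \<zeta>))) (at s)"
      using has_derivative_compose[OF l' holo_has_derivative[OF gh lD[OF s]]] by simp
    from has_derivative_scaleR[OF has_derivative_ident this]
    have "(X has_derivative (\<lambda>h. s *\<^sub>R fd g (l s) (h *\<^sub>R \<zeta>) + h *\<^sub>R g (l s))) (at s)"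
      by (simp add: X_def[abs_def])
    moreover have "s *\<^sub>R fd g (l s) (h *\<^sub>R \<zeta>) + h *\<^sub>R g (l s) = h *\<^sub>R X' s" for h
    proof -
      have "s *\<^sub>R fd g (l s) (h *\<^sub>R \<zeta>) + h *\<^sub>R g (l s) = h *\<^sub>R (fd g (l s) (P (l s)) + g (l s))"
        unfolding lin \<zeta>_def by (simp add: linear_scale[OF holo_linear[OF gh lD[OF s]]] algebra_simps)
      also have "\<dots> = h *\<^sub>R (d (z s) (g (l s)) (s *\<^sub>R \<zeta>) + \<pi> (z s) v)"
        by (simp only: rad'[OF lD[OF s]]) (simp only: lin \<zeta>_def z_def)
      also have "d (z s) (g (l s)) (s *\<^sub>R \<zeta>) = d (z s) (X s) \<zeta>"
        unfolding X_def linear_scale[OF da[OF zs(1)[OF s]]] linear_scale[OF db[OF zs(1)[OF s]]] ..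
      finally show ?thesis by (simp add: X'_def)
    qed
    ultimately show ?thesis by simp
  qed
  have zd: "(z has_derivative (\<lambda>h. h *\<^sub>R \<pi> (z s) \<zeta>)) (at s)" if s: "0 < s" "s < 1" for s
  proof -
    have L: "l s \<in> D" using lD s by simp
    have "(z has_derivative (\<lambda>h. fd \<Psi> (l s) (h *\<^sub>R \<zeta>))) (at s)"
      using has_derivative_compose[OF l' holo_has_derivative[OF \<Psi>h L]] by (simp add: z_def[abs_def])
    moreover have "fd \<Psi> (l s) (h *\<^sub>R \<zeta>) = h *\<^sub>R \<pi> (z s) \<zeta>" for h
    proof -
      have "s *\<^sub>R fd \<Psi> (l s) \<zeta> = s *\<^sub>R \<pi> (z s) \<zeta>"
        using rad[OF L] unfolding lin z_def \<zeta>_def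
        by (simp add: linear_scale[OF holo_linear[OF \<Psi>h L]] linear_scale[OF holo_famD(2)[OF M zB[OF L]]])
      then show ?thesis using s by (simp add: linear_scale[OF holo_linear[OF \<Psi>h L]])
    qed
    ultimately show ?thesis by simp
  qed
  define k' where "k' s = d (z s) (k s) (\<pi> (z s) \<zeta>) - d (z s) (\<pi> (z s) \<zeta>) (k s)" for s
  have kd: "(k has_vector_derivative k' s) (at s)" if s: "0 < s" "s < 1" for s
  proof -
    have s': "0 \<le> s" "s \<le> 1" using s by auto
    let ?z = "z s"
    note Z = zs(1)[OF s']
    define V where "V = {0<..<1} \<inter> z -` ball 0 \<rho>"
    have "isCont z t" if "t \<in> {0<..<1}" for t
      using has_derivative_continuous[OF zd[of t]] that by simp
    then have "continuous_on {0<..<1} z" by (simp add: continuous_at_imp_continuous_on)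
    then have V: "open V" unfolding V_def by (rule continuous_open_preimage) auto
    have sV: "s \<in> V" using s Z by (auto simp: V_def)
    have pd: "((\<lambda>s. \<pi> (z s) (X s)) has_derivative (\<lambda>h. d ?z (h *\<^sub>R \<pi> ?z \<zeta>) (X s) + \<pi> ?z (h *\<^sub>R X' s))) (at s)"
      unfolding d_def
      by (rule has_derivative_fam_apply[OF M open_ball Z V sV _ refl zd[OF s] Xd[OF s']]) (auto simp: V_def)
    have "(k has_derivative (\<lambda>h. h *\<^sub>R X' s - (d ?z (h *\<^sub>R \<pi> ?z \<zeta>) (X s) + \<pi> ?z (h *\<^sub>R X' s)))) (at s)"
      unfolding k_def[abs_def] by (rule has_derivative_diff[OF Xd[OF s'] pd])
    moreover have "h *\<^sub>R X' s - (d ?z (h *\<^sub>R \<pi> ?z \<zeta>) (X s) + \<pi> ?z (h *\<^sub>R X' s)) = h *\<^sub>R k' s" for h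
    proof -
      \<comment> \<open>\<open>X\<close> is split into its tangential and outer parts. The two terms
        with both arguments tangential are interchanged by \<open>inv\<close> and drop out, and only
        terms in \<open>k\<close> remain.\<close>
      have Xk: "X s = k s + \<pi> ?z (X s)" by (simp add: k_def)
      have e1: "X' s - \<pi> ?z (X' s) = d ?z (X s) \<zeta> - \<pi> ?z (d ?z (X s) \<zeta>)"
        unfolding X'_def linear_add[OF holo_famD(2)[OF M Z]] proj[OF Z] by simp
      have e2: "d ?z (X s) \<zeta> - \<pi> ?z (d ?z (X s) \<zeta>) = d ?z (X s) (\<pi> ?z \<zeta>)"
        using dproj[OF Z, of "X s" \<zeta>] by (simp add: algebra_simps)
      have e3: "d ?z (X s) (\<pi> ?z \<zeta>) = d ?z (k s) (\<pi> ?z \<zeta>) + d ?z (\<pi> ?z (X s)) (\<pi> ?z \<zeta>)"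
        by (subst Xk) (rule linear_add[OF da[OF Z]])
      have e4: "d ?z (\<pi> ?z \<zeta>) (X s) = d ?z (\<pi> ?z \<zeta>) (k s) + d ?z (\<pi> ?z \<zeta>) (\<pi> ?z (X s))"
        by (subst Xk) (rule linear_add[OF db[OF Z]])
      have "X' s - d ?z (\<pi> ?z \<zeta>) (X s) - \<pi> ?z (X' s) = (X' s - \<pi> ?z (X' s)) - d ?z (\<pi> ?z \<zeta>) (X s)"
        by (simp only: diff_diff_eq add.commute)
      also have "\<dots> = k' s"
        unfolding e1 e2 unfolding e3 e4 unfolding k'_def inv[OF Z, of "X s" \<zeta>] by (rule add_diff_cancel_right)
      finally have "X' s - d ?z (\<pi> ?z \<zeta>) (X s) - \<pi> ?z (X' s) = k' s" .
      then show ?thesis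
        unfolding linear_scale[OF da[OF Z]] linear_scale[OF holo_famD(2)[OF M Z]]
        by (metis (no_types) scaleR_diff_right diff_diff_eq)
    qed
    ultimately show ?thesis unfolding has_vector_derivative_def by simp
  qed
  obtain K where K: "K > 0" "\<And>z h w. z \<in> cball 0 \<rho>1 \<Longrightarrow> norm (d z h w) \<le> K * norm h * norm w"
    "\<And>z w. z \<in> cball 0 \<rho>1 \<Longrightarrow> norm (\<pi> z w) \<le> K * norm w"
    unfolding d_def using holo_fam_bounds[OF M r1] by metis
  have "k 1 = 0"
  proof (rule linear_ode_zero[OF kd])
    fix s :: real assume s: "0 < s" "s < 1"
    have Z: "z s \<in> cball 0 \<rho>1" using zs(2) s by simp
    have "norm (k' s) \<le> norm (d (z s) (k s) (\<pi> (z s) \<zeta>)) + norm (d (z s) (\<pi> (z s) \<zeta>) (k s))"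
      unfolding k'_def by (rule norm_triangle_ineq4)
    also have "\<dots> \<le> K * norm (k s) * norm (\<pi> (z s) \<zeta>) + K * norm (\<pi> (z s) \<zeta>) * norm (k s)"
      by (intro add_mono K Z)
    also have "\<dots> = (2 * K * norm (k s)) * norm (\<pi> (z s) \<zeta>)" by simp
    also have "\<dots> \<le> (2 * K * norm (k s)) * (K * norm \<zeta>)"
      using K(1) K(3)[OF Z] by (intro mult_left_mono) auto
    finally show "norm (k' s) \<le> (2 * K * (K * norm \<zeta>)) * norm (k s)" by (simp add: mult_ac)
  next
    have lc: "continuous_on {0..1} l" unfolding l_def by (intro continuous_intros)
    have cX: "continuous_on {0..1} X" unfolding X_def
      by (intro continuous_intros continuous_on_compose2[OF holo_continuous[OF gh] lc]) (use lD in auto)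
    have cz: "continuous_on {0..1} z" unfolding z_def
      by (rule continuous_on_compose2[OF holo_continuous[OF \<Psi>h] lc]) (use lD in auto)
    have "continuous_on {0..1} (\<lambda>s. (\<lambda>p. \<pi> (fst p) (snd p)) (z s, X s))"
      by (rule continuous_on_compose2[OF smooth_on_continuous[OF smooth_fam[OF M open_ball]]])
        (use zs in \<open>auto intro!: continuous_intros cX cz\<close>)
    then show "continuous_on {0..1} k" unfolding k_def by (intro continuous_intros cX) simp
    show "k 0 = 0" using linear_0[OF holo_famD(2)[OF M zs(1)[of 0]]] by (simp add: k_def X_def)
  qed
  then show ?thesis by (simp add: k_def X_def z_def ly g_def)
qed

text \<open>A vector \<open>u\<close> whose image under the derivative of \<open>\<Psi>\<close> is
  tangential must lie in the range of \<open>P\<close>: its part \<open>Q u\<close> is killed by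
  \<open>A\<close>, which fixes \<open>Q u\<close> at the base point 0 and changes too little nearby
  to kill it unless it is 0. Hence \<open>Q\<close> composed with the inverse of
  \<open>\<Psi>\<close> is constant along the distribution, and no dimensions have to be
  counted.\<close>

lemma holo_Frobenius:
  fixes \<pi> :: "'a::euclidean_space cplxn \<Rightarrow> 'a cplxn \<Rightarrow> 'a cplxn"
  assumes M: "holo_fam (ball 0 \<rho>) \<pi>" and \<rho>: "\<rho> > 0"
    and proj: "\<And>z w. z \<in> ball 0 \<rho> \<Longrightarrow> \<pi> z (\<pi> z w) = \<pi> z w"
    and invol: "\<And>z u v. z \<in> ball 0 \<rho> \<Longrightarrow> fd (\<lambda>x. \<pi> x (\<pi> z v)) z (\<pi> z u) = fd (\<lambda>x. \<pi> x (\<pi> z u)) z (\<pi> z v)"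
  obtains \<delta> W where "\<delta> > 0" "holo (ball 0 \<delta>) W" "fd W 0 = (\<lambda>v. v - \<pi> 0 v)"
    "\<And>x v. x \<in> ball 0 \<delta> \<Longrightarrow> fd W x (\<pi> x v) = 0"
proof -
  define P where "P = \<pi> 0"
  define Q where "Q = (\<lambda>w. w - P w)"
  have z0: "(0::'a cplxn) \<in> ball 0 \<rho>" using \<rho> by simp
  have P: "linear P" "\<And>w. P (Jc w) = Jc (P w)" "\<And>w. P (P w) = P w"
    unfolding P_def using holo_famD(2,3)[OF M z0] proj[OF z0] by auto
  have lQ: "linear Q" "\<And>w. Q (Jc w) = Jc (Q w)" "\<And>w. Q (Q w) = Q w" "\<And>w. P (Q w) = 0"
    unfolding Q_def by (auto intro!: linear_compose_sub linear_id[unfolded id_def] P simp: P(2) Jc_arith P(3) linear_diff[OF P(1)])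
  obtain D \<Psi> \<rho>1 where *: "open D" "convex D" "0 \<in> D" "\<rho>1 < \<rho>" "\<And>y s. y \<in> D \<Longrightarrow> 0 \<le> s \<Longrightarrow> s \<le> 1 \<Longrightarrow> Q y + s *\<^sub>R P y \<in> D"
    "\<And>y. y \<in> D \<Longrightarrow> \<Psi> y \<in> cball 0 \<rho>1" "holo D \<Psi>"
    "\<And>y. y \<in> D \<Longrightarrow> \<Psi> y = Q y + integral {0..1} (\<lambda>s. \<pi> (\<Psi> (Q y + s *\<^sub>R P y)) (P y))"
    using holo_flow_exists[OF M \<rho> P Q_def] by metis
  have rad: "fd \<Psi> y (P y) = \<pi> (\<Psi> y) (P y)" if "y \<in> D" for y
    by (rule flow_radial_derivative[OF M *(1,7,4,6) P(1,3) Q_def *(5,8) that])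
  have tangent: "\<pi> (\<Psi> y) (fd \<Psi> y (P u)) = fd \<Psi> y (P u)" if "y \<in> D" for y u
    by (rule flow_tangent[OF M *(1,7,4,6) P(1,3,2) Q_def *(5) rad proj invol that P(3)])
  have zB: "\<Psi> y \<in> ball 0 \<rho>" if "y \<in> D" for y using *(6)[OF that] *(4) by simp
  have \<Psi>Q: "\<Psi> (Q y) = Q y" if "Q y \<in> D" for y
  proof -
    have "\<pi> (\<Psi> (Q y)) 0 = 0" by (rule linear_0[OF holo_famD(2)[OF M zB[OF that]]])
    then have "integral {0..1::real} (\<lambda>s. \<pi> (\<Psi> (Q y)) 0) = 0" by simp
    note I0 = this
    show ?thesis using *(8)[OF that, unfolded lQ(3,4) scaleR_zero_right add_0_right, unfolded I0] by simp
  qed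
  have \<Psi>0: "\<Psi> 0 = 0" using \<Psi>Q[of 0] *(3) by (simp add: linear_0[OF lQ(1)])
  have lin\<Psi>: "linear (fd \<Psi> y)" if "y \<in> D" for y using holo_linear[OF *(7) that] .
  have small: "\<forall>\<^sub>F t in at_right (0::real). t *\<^sub>R h \<in> D" for h
  proof -
    have "((\<lambda>t. t *\<^sub>R h) \<longlongrightarrow> 0 *\<^sub>R h) (at_right 0)" by (intro tendsto_intros)
    then show ?thesis using topological_tendstoD *(1,3) by fastforce
  qed
  \<comment> \<open>Near 0 the points of the range of \<open>Q\<close> are fixed by
    \<open>\<Psi>\<close>, because \<open>P\<close> vanishes on them.\<close>
  have d0Q: "fd \<Psi> 0 (Q h) = Q h" for h
  proof -
    have 1: "((\<lambda>t. t *\<^sub>R Q h) has_derivative (\<lambda>t. t *\<^sub>R Q h)) (at 0)" by (auto intro!: derivative_eq_intros)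
    have 2: "((\<lambda>t. \<Psi> (t *\<^sub>R Q h)) has_derivative (\<lambda>t. fd \<Psi> 0 (t *\<^sub>R Q h))) (at 0)"
      using has_derivative_compose[OF 1, of \<Psi> "fd \<Psi> 0"] holo_has_derivative[OF *(7,3)] by simp
    define T where "T = (\<lambda>t. t *\<^sub>R Q h) -` D"
    have T: "open T" "0 \<in> T" unfolding T_def using *(1,3) by (auto intro!: open_vimage continuous_intros)
    have "\<Psi> (t *\<^sub>R Q h) = t *\<^sub>R Q h" if "t \<in> T" for t
      using \<Psi>Q[of "t *\<^sub>R Q h"] that by (simp add: T_def linear_scale[OF lQ(1)] lQ(3))
    then have "((\<lambda>t. t *\<^sub>R Q h) has_derivative (\<lambda>t. fd \<Psi> 0 (t *\<^sub>R Q h))) (at 0)"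
      using has_derivative_cong_open[OF T, of "\<lambda>t. \<Psi> (t *\<^sub>R Q h)" "\<lambda>t. t *\<^sub>R Q h"] 2 by simp
    from has_derivative_unique[OF this 1] show ?thesis by (metis scaleR_one)
  qed
  \<comment> \<open>At 0 itself the radial identity is void; it is used at \<open>t P h\<close> with
    \<open>t > 0\<close>, divided by \<open>t\<close>, and then \<open>t\<close> is sent to
    0.\<close>
  have d0P: "fd \<Psi> 0 (P h) = P h" for h
  proof (rule tendsto_unique)
    let ?F = "at_right (0::real)"
    have c: "isCont (\<lambda>y. fd \<Psi> y (P h)) 0" "isCont (\<lambda>y. \<pi> (\<Psi> y) (P h)) 0"
    proof -
      have "\<Psi> ` D \<subseteq> ball 0 \<rho>" using zB by blast
      from holo_continuous[OF holo_compose[OF holo_famD(1)[OF M] *(7) this]]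
      show "isCont (\<lambda>y. \<pi> (\<Psi> y) (P h)) 0" using *(1,3) continuous_on_eq_continuous_at by blast
      show "isCont (\<lambda>y. fd \<Psi> y (P h)) 0"
        using holo_continuous[OF holo_fd[OF *(1,7)]] *(1,3) continuous_on_eq_continuous_at by blast
    qed
    have t: "((\<lambda>t. t *\<^sub>R P h) \<longlongrightarrow> 0) ?F"
    proof -
      have "((\<lambda>t. t *\<^sub>R P h) \<longlongrightarrow> 0 *\<^sub>R P h) ?F" by (intro tendsto_intros)
      then show ?thesis by simp
    qed
    show "((\<lambda>t. fd \<Psi> (t *\<^sub>R P h) (P h)) \<longlongrightarrow> fd \<Psi> 0 (P h)) ?F"
      by (rule isCont_tendsto_compose[OF c(1) t])
    have "((\<lambda>t. \<pi> (\<Psi> (t *\<^sub>R P h)) (P h)) \<longlongrightarrow> \<pi> (\<Psi> 0) (P h)) ?F"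
      by (rule isCont_tendsto_compose[OF c(2) t])
    then have lim: "((\<lambda>t. \<pi> (\<Psi> (t *\<^sub>R P h)) (P h)) \<longlongrightarrow> P h) ?F"
      using \<Psi>0 P(3) by (simp add: P_def)
    show "((\<lambda>t. fd \<Psi> (t *\<^sub>R P h) (P h)) \<longlongrightarrow> P h) ?F"
    proof (rule Lim_transform_eventually[OF lim])
      have "\<forall>\<^sub>F t in ?F. t > 0" by (simp add: eventually_at_right_less)
      then show "\<forall>\<^sub>F t in ?F. \<pi> (\<Psi> (t *\<^sub>R P h)) (P h) = fd \<Psi> (t *\<^sub>R P h) (P h)"
        using small[of "P h"]
      proof eventually_elim
        case (elim t)
        have "t *\<^sub>R fd \<Psi> (t *\<^sub>R P h) (P h) = t *\<^sub>R \<pi> (\<Psi> (t *\<^sub>R P h)) (P h)"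
          using rad[OF elim(2)] unfolding linear_scale[OF P(1)] P(3) linear_scale[OF lin\<Psi>[OF elim(2)]]
            linear_scale[OF holo_famD(2)[OF M zB[OF elim(2)]]] .
        then show ?case using elim(1) by simp
      qed
    qed
  qed simp
  have d0: "fd \<Psi> 0 h = h" for h
    using linear_add[OF lin\<Psi>[OF *(3)], of "Q h" "P h"] d0Q d0P by (simp add: Q_def)
  obtain U V g where inv: "open U" "0 \<in> U" "U \<subseteq> D" "open V" "homeomorphism U V \<Psi> g" "smooth_on V g"
    "\<And>y. y \<in> V \<Longrightarrow> (g has_derivative fd g y) (at y)"
    "\<And>y v. y \<in> V \<Longrightarrow> fd \<Psi> (g y) (fd g y v) = v"
    "\<And>y u. y \<in> V \<Longrightarrow> fd g y (fd \<Psi> (g y) u) = u"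
  proof (rule smooth_inverse_function[OF refl *(1,3) holo_smooth[OF *(1,7)]])
    show "inj (fd \<Psi> 0)" using d0 by (intro injI) simp
  qed (rule that; assumption)
  have gU: "g x \<in> U" "\<Psi> (g x) = x" if "x \<in> V" for x using inv(5) that unfolding homeomorphism_def by auto
  have gD: "g x \<in> D" if "x \<in> V" for x using gU(1)[OF that] inv(3) by auto
  have V0: "0 \<in> V" "g 0 = 0" using inv(5,2) \<Psi>0 unfolding homeomorphism_def by (metis imageI)+
  have gh: "holo V g"
  proof (rule holoI[OF inv(7)])
    fix x h assume x: "x \<in> V"
    have "fd \<Psi> (g x) (Jc (fd g x h)) = Jc h" by (simp add: holo_fd_Jc[OF *(7) gD[OF x]] inv(8)[OF x])
    then show "fd g x (Jc h) = Jc (fd g x h)" using inv(9)[OF x] by metis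
  qed
  define W where "W = (\<lambda>x. Q (g x))"
  have Wh: "holo V W" unfolding W_def by (rule holo_linear_o[OF lQ(1,2) gh])
  have fdW: "fd W x h = Q (fd g x h)" if "x \<in> V" for x h
  proof -
    have "bounded_linear Q" using lQ linear_conv_bounded_linear by blast
    from fd_eqI[OF bounded_linear.has_derivative[OF this inv(7)[OF that]]] show ?thesis by (simp add: W_def)
  qed
  \<comment> \<open>The part of the derivative of \<open>\<Psi>\<close> that sticks out of the
    distribution.\<close>
  define A where "A y w = fd \<Psi> y w - \<pi> (\<Psi> y) (fd \<Psi> y w)" for y w
  have Afam: "holo_fam D A"
  proof -
    have 1: "holo_fam D (\<lambda>y. \<pi> (\<Psi> y))" by (rule holo_fam_compose[OF M *(7)]) (use zB in auto)
    have 2: "holo_fam D (\<lambda>y h. fd \<Psi> y h)" by (rule holo_fam_fd_fun[OF *(7,1)])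
    have "holo_fam D (\<lambda>y w. 1 *\<^sub>R fd \<Psi> y w + (-1) *\<^sub>R \<pi> (\<Psi> y) (fd \<Psi> y w))"
      by (rule holo_fam_lincomb[OF 2 holo_fam_comp[OF 1 2 *(1)]])
    then show ?thesis by (simp add: A_def[abs_def])
  qed
  obtain r where r: "r > 0" "ball 0 r \<subseteq> D" using *(1,3) open_contains_ball by blast
  have "r / 2 < r" using r by simp
  from holo_fam_bounds[OF holo_fam_subset[OF Afam r(2)] this]
  obtain K where K: "K > 0" "\<And>z z' w. z \<in> cball 0 (r/2) \<Longrightarrow> z' \<in> cball 0 (r/2) \<Longrightarrow> norm (A z w - A z' w) \<le> K * norm (z - z') * norm w"
    by metis
  \<comment> \<open>Within this radius \<open>A\<close> differs from \<open>A 0\<close> by at most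
    half of the norm, which forces \<open>Q u = 0\<close>; the bound \<open>r/2\<close> is where the
    Lipschitz estimate holds.\<close>
  define e where "e = min (r/2) (1 / (2 * K))"
  have e: "e > 0" using r K by (simp add: e_def)
  have "open (V \<inter> g -` ball 0 e)"
    using continuous_open_preimage[OF smooth_on_continuous[OF inv(6)] inv(4) open_ball] .
  then obtain \<delta> where \<delta>: "\<delta> > 0" "ball 0 \<delta> \<subseteq> V \<inter> g -` ball 0 e"
    using V0 e open_contains_ball by (metis Int_iff vimageI centre_in_ball)
  show thesis
  proof (rule that[OF \<delta>(1)])
    show "holo (ball 0 \<delta>) W" using holo_subset[OF Wh] \<delta> by blast
    show "fd W 0 = (\<lambda>v. v - \<pi> 0 v)"
    proof
      fix v
      have "fd g 0 v = v" using inv(8)[OF V0(1), of v] d0 V0(2) by simp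
      then show "fd W 0 v = v - \<pi> 0 v" using fdW[OF V0(1)] by (simp add: Q_def P_def)
    qed
    fix x v :: "'a cplxn" assume x: "x \<in> ball 0 \<delta>"
    then have xV: "x \<in> V" and ge: "norm (g x) < e" using \<delta>(2) by auto
    define u where "u = fd g x (\<pi> x v)"
    have yD: "g x \<in> D" using gD[OF xV] .
    have "x \<in> ball 0 \<rho>" using zB[OF yD] gU(2)[OF xV] by simp
    have \<Psi>u: "fd \<Psi> (g x) u = \<pi> x v" unfolding u_def by (rule inv(8)[OF xV])
    have Alin: "linear (A (g x))" using holo_famD(2)[OF Afam yD] .
    have "A (g x) u = 0" by (simp add: A_def \<Psi>u gU(2)[OF xV] proj[OF \<open>x \<in> ball 0 \<rho>\<close>])
    moreover have "A (g x) (P u) = 0" by (simp add: A_def tangent[OF yD])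
    ultimately have AQ: "A (g x) (Q u) = 0" unfolding Q_def by (simp add: linear_diff[OF Alin])
    have A0: "A 0 (Q u) = Q u" using lQ(4) by (simp add: A_def d0 \<Psi>0 P_def[symmetric])
    have "norm (Q u) = norm (A 0 (Q u) - A (g x) (Q u))" by (simp add: AQ A0)
    also have "\<dots> \<le> K * norm (0 - g x) * norm (Q u)"
      by (rule K(2)) (use ge r in \<open>auto simp: e_def\<close>)
    also have "\<dots> \<le> 1/2 * norm (Q u)"
    proof (rule mult_right_mono)
      have "norm (g x) \<le> 1 / (2 * K)" using ge by (simp add: e_def)
      then show "K * norm (0 - g x) \<le> 1/2" using K(1) by (simp add: field_simps)
    qed simp
    finally have "Q u = 0" by simp
    then show "fd W x (\<pi> x v) = 0" using fdW[OF xV] by (simp add: u_def)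
  qed
qed

subsection \<open>Local holomorphic coordinates transverse to the Reeb field\<close>

text \<open>\<open>J\<close> is a complex structure on the hyperplane \<open>ker e\<close>. A
  complex basis grows one vector at a time: while fewer than \<open>CARD('n)\<close> are present,
  dimension counting gives one outside the real span of the old vectors and their images under
  \<open>J\<close>. On the whole space \<open>m\<close> is read off from \<open>- J (J v)\<close>,
  which lies in \<open>ker e\<close> and equals \<open>v\<close> there.\<close>

lemma complex_structure_iso:
  fixes J :: "'e::euclidean_space \<Rightarrow> 'e" and e :: "'e \<Rightarrow> real"
  assumes dim: "DIM('e) = 2 * CARD('n::finite) + 1"
    and J: "linear J" and e: "linear e" "e x1 \<noteq> 0"
    and JJ: "\<And>v. e v = 0 \<Longrightarrow> J (J v) = - v" and eJ: "\<And>v. e (J v) = 0"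
  obtains m :: "'e \<Rightarrow> complex ^ 'n" where "linear m" "\<And>v. m (J v) = \<i> *s m v"
    "\<And>v. e v = 0 \<Longrightarrow> m v = 0 \<Longrightarrow> v = 0"
proof -
  define H where "H = {v. e v = 0}"
  have HJ: "J v \<in> H" for v using eJ by (simp add: H_def)
  have "dim H = DIM('e) - 1"
  proof -
    define a where "a = (\<Sum>b\<in>Basis. e b *\<^sub>R b)"
    have a: "e v = a \<bullet> v" for v
      unfolding linear_sum_Basis[OF e(1), of v] a_def inner_sum_left
      by (intro sum.cong refl) (simp add: inner_commute mult.commute)
    then have "a \<noteq> 0" using e(2) by auto
    then show ?thesis using dim_hyperplane[of a] by (simp add: H_def a)
  qed
  then have dimH: "dim H = 2 * CARD('n)" using dim by simp
  have subH: "subspace H" unfolding H_def by (simp add: subspace_def linear_add[OF e(1)] linear_scale[OF e(1)] linear_0[OF e(1)])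
  define cm where "cm c v = Re c *\<^sub>R v + Im c *\<^sub>R J v" for c v
  define \<kappa> where "\<kappa> b w = (\<Sum>i\<in>UNIV. cm (w $ i) (b i))" for b :: "'n \<Rightarrow> 'e" and w :: "complex ^ 'n"
  \<comment> \<open>Induction on the set \<open>K\<close> of indices already served; what
    \<open>b\<close> does outside \<open>K\<close> has no influence, as the coefficients are 0
    there.\<close>
  have "\<exists>b. (\<forall>i. b i \<in> H) \<and> (\<forall>w. (\<forall>i. i \<notin> K \<longrightarrow> w $ i = 0) \<longrightarrow> \<kappa> b w = 0 \<longrightarrow> w = 0)" if "finite K" for K :: "'n set"
    using that
  proof (induction K rule: finite_induct)
    case empty
    show ?case by (rule exI[of _ "\<lambda>_. 0"]) (auto simp: subspace_0[OF subH] vec_eq_iff)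
  next
    case (insert i0 K)
    then obtain b where b: "\<And>i. b i \<in> H" "\<And>w. (\<And>i. i \<notin> K \<Longrightarrow> w $ i = 0) \<Longrightarrow> \<kappa> b w = 0 \<Longrightarrow> w = 0"
      by blast
    let ?B = "b ` K \<union> (\<lambda>i. J (b i)) ` K"
    have "card K < CARD('n)"
      using insert by (metis UNIV_I card_seteq finite_code linorder_not_less subset_UNIV)
    have "card ?B \<le> card K + card K"
      using card_Un_le[of "b ` K" "(\<lambda>i. J (b i)) ` K"] card_image_le[OF insert(1), of b]
        card_image_le[OF insert(1), of "\<lambda>i. J (b i)"] by linarith
    then have "dim (span ?B) < dim H"
      using dim_le_card'[of ?B] insert(1) \<open>card K < CARD('n)\<close> dimH by (simp add: dim_span)
    then have "\<not> H \<subseteq> span ?B" using dim_subset linorder_not_less by blast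
    then obtain h where h: "h \<in> H" "h \<notin> span ?B" by blast
    have Jspan: "J x \<in> span ?B" if "x \<in> span ?B" for x
    proof -
      have "J ` ?B \<subseteq> span ?B"
      proof
        fix z assume "z \<in> J ` ?B"
        then consider (1) i where "i \<in> K" "z = J (b i)" | (2) i where "i \<in> K" "z = J (J (b i))" by auto
        then show "z \<in> span ?B"
        proof cases
          case 1
          then show ?thesis by (intro span_base) auto
        next
          case 2
          then have "z = - b i" using JJ b(1) by (simp add: H_def)
          then show ?thesis using 2 by (auto intro: span_neg span_base)
        qed
      qed
      then have "span (J ` ?B) \<subseteq> span ?B" by (simp add: span_minimal)
      then show ?thesis using that linear_span_image[OF J] by blast
    qed
    define b' where "b' = b(i0 := h)"
    have "w = 0" if w: "\<forall>i. i \<notin> insert i0 K \<longrightarrow> w $ i = 0" "\<kappa> b' w = 0" for w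
    proof -
      define c where "c = w $ i0"
      define s where "s = (\<Sum>i\<in>UNIV - {i0}. cm (w $ i) (b i))"
      have split: "\<kappa> b' w = cm c h + s"
        unfolding \<kappa>_def s_def
        by (subst sum.remove[of _ i0]) (auto simp: b'_def c_def intro!: sum.cong)
      have term_in: "cm (w $ i) (b i) \<in> span ?B" if "i \<noteq> i0" for i
      proof (cases "i \<in> K")
        case True
        then show ?thesis unfolding cm_def by (intro span_add span_scale span_base) auto
      next
        case False
        then show ?thesis using w(1) that by (simp add: cm_def span_0)
      qed
      have "s \<in> span ?B" unfolding s_def by (rule span_sum) (use term_in in auto)
      then have "- s \<in> span ?B" by (rule span_neg)
      moreover have "cm c h = - s" using split w(2) by (simp add: eq_neg_iff_add_eq_0)
      ultimately have ch: "cm c h \<in> span ?B" by simp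
      \<comment> \<open>Multiplying by the conjugate of \<open>c\<close> returns a real multiple of
        \<open>h\<close>, which is outside the span unless \<open>c = 0\<close>.\<close>
      have "cm (cnj c) (cm c h) \<in> span ?B"
        unfolding cm_def[of "cnj c"] by (intro span_add span_scale ch Jspan)
      moreover have "cm (cnj c) (cm c h) = ((Re c)\<^sup>2 + (Im c)\<^sup>2) *\<^sub>R h"
        using JJ[of h] h(1) by (simp add: cm_def H_def linear_add[OF J] linear_scale[OF J] algebra_simps power2_eq_square)
      ultimately have "((Re c)\<^sup>2 + (Im c)\<^sup>2) *\<^sub>R h \<in> span ?B" by simp
      then have "inverse ((Re c)\<^sup>2 + (Im c)\<^sup>2) *\<^sub>R (((Re c)\<^sup>2 + (Im c)\<^sup>2) *\<^sub>R h) \<in> span ?B" by (rule span_scale)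
      then have "(Re c)\<^sup>2 + (Im c)\<^sup>2 = 0" using h(2) by (cases "(Re c)\<^sup>2 + (Im c)\<^sup>2 = 0") auto
      then have c0: "c = 0" by (simp add: complex_eq_iff sum_power2_eq_zero_iff)
      have "\<kappa> b w = cm (w $ i0) (b i0) + s" unfolding \<kappa>_def s_def by (subst sum.remove[of _ i0]) auto
      then have "\<kappa> b w = \<kappa> b' w" using c0 split by (simp add: c_def cm_def)
      moreover have "w $ i = 0" if "i \<notin> K" for i
        using that w(1) c0 by (cases "i = i0") (auto simp: c_def)
      ultimately show "w = 0" using b(2) w(2) by simp
    qed
    moreover have "b' i \<in> H" for i using b(1) h(1) by (simp add: b'_def)
    ultimately show ?case by blast
  qed
  from this[of UNIV] obtain b where b: "\<And>i. b i \<in> H" "\<And>w. \<kappa> b w = 0 \<Longrightarrow> w = 0" by auto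
  have lin: "linear (\<kappa> b)"
    by (rule linearI) (auto simp: \<kappa>_def cm_def algebra_simps sum.distrib scaleR_sum_right)
  have \<kappa>H: "\<kappa> b w \<in> H" for w
    unfolding \<kappa>_def cm_def by (intro subspace_sum subH subspace_add subspace_scale b HJ)
  have inj: "inj (\<kappa> b)" using b(2) linear_injective_0[OF lin] by blast
  have "dim (range (\<kappa> b)) = DIM(complex ^ 'n)" using dim_image_eq[OF lin, of UNIV] inj by (simp add: dim_UNIV)
  then have "range (\<kappa> b) = H"
    using \<kappa>H dimH subspace_dim_equal[of "range (\<kappa> b)" H] subH linear_subspace_image[OF lin subspace_UNIV]
    by (auto simp: DIM_complex)
  then have surj: "\<exists>w. v = \<kappa> b w" if "v \<in> H" for v using that by blast
  obtain k where k: "linear k" "\<And>w. k (\<kappa> b w) = w"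
    using linear_injective_left_inverse[OF lin inj] by (auto simp: fun_eq_iff)
  have Ji: "J (\<kappa> b w) = \<kappa> b (\<i> *s w)" for w
  proof -
    have "J (cm c (b i)) = cm (\<i> * c) (b i)" for c i
      using JJ[of "b i"] b(1)[of i] by (simp add: cm_def H_def linear_add[OF J] linear_scale[OF J])
    then show ?thesis by (simp add: \<kappa>_def linear_sum[OF J])
  qed
  define m where "m v = k (- J (J v))" for v
  have mk: "\<exists>w. - J (J v) = \<kappa> b w \<and> m v = w" for v
    using surj[of "- J (J v)"] subspace_neg[OF subH HJ] k(2) by (auto simp: m_def)
  show thesis
  proof
    show "linear m" unfolding m_def
      by (rule linear_compose[of "\<lambda>v. - J (J v)" k, unfolded o_def])
        (auto intro!: k linear_compose_neg linear_compose[OF J J, unfolded o_def])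
    show "m (J v) = \<i> *s m v" for v
    proof -
      obtain w where w: "- J (J v) = \<kappa> b w" "m v = w" using mk by blast
      have "- J (J (J v)) = J (- J (J v))" by (simp add: linear_neg[OF J])
      also have "\<dots> = \<kappa> b (\<i> *s w)" unfolding w(1) by (rule Ji)
      finally show ?thesis unfolding m_def[of "J v"] using k(2) w(2) by simp
    qed
    show "v = 0" if "e v = 0" "m v = 0" for v
    proof -
      obtain w where w: "- J (J v) = \<kappa> b w" "m v = w" using mk by blast
      then show ?thesis using that JJ[of v] linear_0[OF lin] by simp
    qed
  qed
qed

section \<open>Holomorphic extension of the structure and the complex coordinates\<close>

lemma analytic_family_extension:
  fixes \<Phi> :: "'e::euclidean_space \<Rightarrow> 'e \<Rightarrow> 'e"
  assumes S: "open S" "x0 \<in> S" and an: "\<And>v. real_analytic_on S (\<lambda>x. \<Phi> x v)"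
    and lin: "\<And>x. x \<in> S \<Longrightarrow> linear (\<Phi> x)"
  obtains r M where "r > 0" "ball x0 r \<subseteq> S" "holo_fam (ball 0 r) M"
    "\<And>u v. norm u < r \<Longrightarrow> M (u, 0) (v, 0) = (\<Phi> (x0 + u) v, 0)"
proof -
  have "\<exists>r F. r > 0 \<and> holo (ball 0 r) F \<and> (\<forall>u. norm u < r \<longrightarrow> F (u, 0) = (\<Phi> (x0 + u) b, 0))" for b
    using real_analytic_holo_extension[OF an S(2)] by metis
  then obtain R F where RF: "\<And>b. R b > (0::real)" "\<And>b. holo (ball 0 (R b)) (F b)"
    "\<And>b u. norm u < R b \<Longrightarrow> F b (u, 0) = (\<Phi> (x0 + u) b, 0)" by metis
  obtain r0 where r0: "r0 > 0" "ball x0 r0 \<subseteq> S" using S open_contains_ball by blast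
  define r where "r = Min (insert r0 (R ` Basis))"
  have r: "r > 0" "r \<le> r0" "\<And>b. b \<in> Basis \<Longrightarrow> r \<le> R b"
  proof -
    show "r > 0" using r0 RF(1) by (auto simp: r_def)
    show "r \<le> r0" unfolding r_def by (intro Min_le) auto
    show "r \<le> R b" if "b \<in> Basis" for b unfolding r_def using that by (intro Min_le) auto
  qed
  \<comment> \<open>Only the values on the basis are extended; the formula is then complex linear in
    \<open>w\<close> by construction, at every complex point.\<close>
  define M where "M y w = (\<Sum>b\<in>Basis. (fst w \<bullet> b) *\<^sub>R F b y + (snd w \<bullet> b) *\<^sub>R Jc (F b y))" for y w
  have Fh: "holo (ball 0 r) (F b)" if "b \<in> Basis" for b
    using holo_subset[OF RF(2)] r(3)[OF that] by (meson subset_ball)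
  show thesis
  proof (rule that[OF r(1)])
    show "ball x0 r \<subseteq> S" using r0 r(2) subset_ball by blast
    show "holo_fam (ball 0 r) M"
    proof (rule holo_famI)
      show "holo (ball 0 r) (\<lambda>y. M y w)" for w unfolding M_def
        by (intro holo_sum holo_add holo_scaleR Fh holo_linear_o[OF linear_Jc refl])
      show "linear (M y)" for y
        by (rule linearI) (simp_all add: M_def inner_simps algebra_simps sum.distrib scaleR_sum_right)
      show "M y (Jc w) = Jc (M y w)" for y w
        by (simp add: M_def linear_sum[OF linear_Jc] Jc_arith algebra_simps sum_subtractf)
    qed
    fix u v :: 'e assume u: "norm u < r"
    then have "x0 + u \<in> S" using r0 r(2) by (intro subsetD[OF r0(2)]) (simp add: dist_norm)
    have "M (u, 0) (v, 0) = (\<Sum>b\<in>Basis. (v \<bullet> b) *\<^sub>R (\<Phi> (x0 + u) b, 0))"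
      unfolding M_def using RF(3) u r(3) by (intro sum.cong) (auto simp: order_less_le_trans)
    also have "\<dots> = (\<Phi> (x0 + u) v, 0)"
      by (simp add: prod_eq_iff fst_sum snd_sum linear_sum_Basis[OF lin[OF \<open>x0 + u \<in> S\<close>], of v])
    finally show "M (u, 0) (v, 0) = (\<Phi> (x0 + u) v, 0)" .
  qed
qed

text \<open>If \<open>\<Phi>\<^sup>3 = - \<Phi>\<close>, then \<open>(- \<Phi>\<^sup>2 + \<i> \<Phi>) / 2\<close> is the projection onto the \<open>-\<i>\<close>-eigenspace of \<open>\<Phi>\<close>
  along the other two eigenspaces.\<close>

lemma antiholomorphic_projection:
  fixes M :: "'a::euclidean_space cplxn \<Rightarrow> 'a cplxn \<Rightarrow> 'a cplxn"
  assumes M: "holo_fam (ball 0 r) M"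
    and M3: "\<And>y w. y \<in> ball 0 r \<Longrightarrow> M y (M y (M y w)) = - M y w"
    and nij: "\<And>y u v. y \<in> ball 0 r \<Longrightarrow>
       fd (\<lambda>x. M x (M y v)) y (M y (M y u)) - fd (\<lambda>x. M x (M y u)) y (M y (M y v))
       + M y (fd (\<lambda>x. M x (M y u)) y (M y v) - fd (\<lambda>x. M x (M y v)) y (M y u)) = 0"
  defines "\<pi> \<equiv> \<lambda>y w. (-1/2) *\<^sub>R M y (M y w) + (1/2) *\<^sub>R Jc (M y w)"
  shows "holo_fam (ball 0 r) \<pi>" "y \<in> ball 0 r \<Longrightarrow> \<pi> y (\<pi> y w) = \<pi> y w"
    "y \<in> ball 0 r \<Longrightarrow> fd (\<lambda>x. \<pi> x (\<pi> y v)) y (\<pi> y u) = fd (\<lambda>x. \<pi> x (\<pi> y u)) y (\<pi> y v)"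
proof -
  have MM: "holo_fam (ball 0 r) (\<lambda>y w. M y (M y w))" by (rule holo_fam_comp[OF M M open_ball])
  have JM: "holo_fam (ball 0 r) (\<lambda>y w. Jc (M y w))"
    by (rule holo_fam_comp[OF holo_fam_const[OF linear_Jc refl] M open_ball])
  show fam: "holo_fam (ball 0 r) \<pi>" unfolding \<pi>_def by (rule holo_fam_lincomb[OF MM JM])
  note Mlin = linear_add[OF holo_famD(2)[OF M]] linear_scale[OF holo_famD(2)[OF M]] linear_diff[OF holo_famD(2)[OF M]]
    linear_neg[OF holo_famD(2)[OF M]] holo_famD(3)[OF M]
  have M\<pi>: "M y (\<pi> y w) = - Jc (\<pi> y w)" if "y \<in> ball 0 r" for y w
    using that by (simp add: \<pi>_def Mlin M3 Jc_arith)
  have \<pi>I: "\<pi> y w = w" if y: "y \<in> ball 0 r" and w: "M y w = - Jc w" for y w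
  proof -
    have "M y (M y w) = - w" using w by (simp add: Mlin[OF y] Jc_arith)
    then show ?thesis using w by (simp add: \<pi>_def Jc_arith flip: scaleR_add_left)
  qed
  show proj: "\<pi> y (\<pi> y w) = \<pi> y w" if "y \<in> ball 0 r" for y w by (rule \<pi>I[OF that M\<pi>[OF that]])
  fix y u v :: "'a cplxn" assume y: "y \<in> ball 0 r"
  define d where "d a b = fd (\<lambda>x. M x b) y a" for a b
  define D where "D a b = fd (\<lambda>x. \<pi> x b) y a" for a b
  define a where "a = \<pi> y u"
  define b where "b = \<pi> y v"
  have da: "linear (\<lambda>a. d a b)" "d (Jc a) b = Jc (d a b)" for a b
    unfolding d_def using holo_linear[OF holo_famD(1)[OF M] y] holo_fd_Jc[OF holo_famD(1)[OF M] y] by auto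
  have db: "linear (\<lambda>b. d a b)" "d a (Jc b) = Jc (d a b)" for a b
    unfolding d_def by (rule fd_fam_linear[OF M open_ball y], rule fd_fam_Jc[OF M open_ball y])
  have Mab: "M y a = - Jc a" "M y b = - Jc b" "\<pi> y a = a" "\<pi> y b = b"
    unfolding a_def b_def using M\<pi>[OF y] proj[OF y] by auto
  have Mr: "c = M y (Jc c)" if "M y c = - Jc c" for c using that by (simp add: Mlin[OF y] Jc_arith)
  \<comment> \<open>The antisymmetrised derivative of \<open>M\<close> on the two eigenvectors. The
    Nijenhuis identity applies because \<open>a\<close> and \<open>b\<close> are images under
    \<open>M\<close>, namely of \<open>Jc a\<close> and \<open>Jc b\<close>, and it places
    \<open>w\<close> in the \<open>-\<i>\<close>-eigenspace.\<close>
  define w where "w = d b a - d a b"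
  have "d (M y a) b - d (M y b) a + M y (d b a - d a b) = 0"
    using nij[OF y, of "Jc b" "Jc a"] Mr[OF Mab(1), symmetric] Mr[OF Mab(2), symmetric] nij[OF y, of "Jc a" "Jc b"]
    by (simp add: d_def)
  then have "Jc w + M y w = 0"
    unfolding Mab linear_neg[OF da(1)] da(2) w_def by (simp add: Jc_arith Mlin[OF y])
  then have Mw: "M y w = - Jc w" by (simp add: eq_neg_iff_add_eq_0 add.commute)
  have D: "D p q = Jc (d p q) - (1/2) *\<^sub>R M y (d p q)" if "M y q = - Jc q" for p q
  proof -
    have h: "((\<lambda>x. M x q) has_derivative (\<lambda>h. d h q)) (at y)"
      unfolding d_def by (rule holo_has_derivative[OF holo_famD(1)[OF M] y])
    have "((\<lambda>x. M x (M x q)) has_derivative (\<lambda>h. d h (M y q) + M y (d h q))) (at y)"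
      using fam_app_has_derivative[OF M holo_famD(1)[OF M] open_ball y] by (simp add: d_def)
    then have "((\<lambda>x. \<pi> x q) has_derivative (\<lambda>h. (-1/2) *\<^sub>R (d h (M y q) + M y (d h q)) + (1/2) *\<^sub>R Jc (d h q))) (at y)"
      unfolding \<pi>_def
      by (intro has_derivative_add has_derivative_scaleR_right bounded_linear.has_derivative[OF bounded_linear_Jc] h)
    from fd_eqI[OF this]
    have "D p q = (-1/2) *\<^sub>R (d p (M y q) + M y (d p q)) + (1/2) *\<^sub>R Jc (d p q)" by (simp add: D_def)
    also have "d p (M y q) = - Jc (d p q)" unfolding that linear_neg[OF db(1)] db(2) ..
    finally show ?thesis by (simp add: algebra_simps flip: scaleR_add_left)
  qed
  have "D b a - D a b = Jc w - (1/2) *\<^sub>R M y w"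
    unfolding D[OF Mab(1)] D[OF Mab(2)] w_def by (simp add: Jc_arith Mlin[OF y] algebra_simps)
  then have Dw: "D b a - D a b = (3/2) *\<^sub>R Jc w" unfolding Mw
  proof -
    have "(3/2) *\<^sub>R Jc w = (1 + 1/2) *\<^sub>R Jc w" by simp
    also have "\<dots> = Jc w + (1/2) *\<^sub>R Jc w" by (simp only: scaleR_add_left scaleR_one)
    finally show "D b a - D a b = Jc w - (1/2) *\<^sub>R (- Jc w) \<Longrightarrow> D b a - D a b = (3/2) *\<^sub>R Jc w" by simp
  qed
  \<comment> \<open>Differentiating \<open>\<pi> \<pi> = \<pi>\<close> shows that the derivative of
    a projection, applied to a vector of its range, has no component in the range. But
    \<open>D b a - D a b\<close> is also \<open>3/2\<close> times a vector of the range, so it is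
    0.\<close>
  have "\<pi> y (D p q) = 0" if "\<pi> y q = q" for p q
  proof -
    have "fd (\<lambda>x. \<pi> x (\<pi> x q)) y p = D p (\<pi> y q) + \<pi> y (D p q)"
      unfolding D_def fd_eqI[OF fam_app_has_derivative[OF fam holo_famD(1)[OF fam] open_ball y]] ..
    moreover have "fd (\<lambda>x. \<pi> x (\<pi> x q)) y = fd (\<lambda>x. \<pi> x q) y"
      by (rule fd_cong_open[OF open_ball y]) (rule proj)
    ultimately show ?thesis using that by (simp add: D_def)
  qed
  then have "\<pi> y (D b a - D a b) = 0"
    using Mab by (simp add: linear_diff[OF holo_famD(2)[OF fam y]])
  moreover have "\<pi> y (Jc w) = Jc w" by (rule \<pi>I[OF y]) (simp add: Mlin[OF y] Mw Jc_arith)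
  ultimately have "(3/2) *\<^sub>R Jc w = 0" unfolding Dw by (simp add: linear_scale[OF holo_famD(2)[OF fam y]])
  then have "D b a = D a b" using Dw by simp
  then show "fd (\<lambda>x. \<pi> x (\<pi> y v)) y (\<pi> y u) = fd (\<lambda>x. \<pi> x (\<pi> y u)) y (\<pi> y v)"
    by (simp add: D_def a_def b_def)
qed

text \<open>\<open>W\<close> has all transverse components, including the one outside
  \<open>ker e\<close>. Composing it with the complex linear extension \<open>l\<close> of an
  isomorphism from \<open>ker e\<close> to \<open>complex ^ 'n\<close> selects the coordinates
  wanted. As \<open>l\<close> kills the \<open>-\<i>\<close>-eigenspace at \<open>x0\<close>, the
  derivative of \<open>z\<close> there is \<open>m\<close>, which is injective on
  \<open>ker e\<close>.\<close>

lemma complex_coordinates_exist: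
  fixes \<Phi> :: "'e::euclidean_space \<Rightarrow> 'e \<Rightarrow> 'e" and e :: "'e \<Rightarrow> real"
  assumes dim: "DIM('e) = 2 * CARD('n::finite) + 1"
    and S: "open S" "x0 \<in> S" and an: "\<And>v. real_analytic_on S (\<lambda>x. \<Phi> x v)"
    and lin: "\<And>x. x \<in> S \<Longrightarrow> linear (\<Phi> x)" and cube: "\<And>x v. x \<in> S \<Longrightarrow> \<Phi> x (\<Phi> x (\<Phi> x v)) = - \<Phi> x v"
    and nij: "\<And>x u v. x \<in> S \<Longrightarrow>
       fd (\<lambda>y. \<Phi> y (\<Phi> x v)) x (\<Phi> x (\<Phi> x u)) - fd (\<lambda>y. \<Phi> y (\<Phi> x u)) x (\<Phi> x (\<Phi> x v))
       + \<Phi> x (fd (\<lambda>y. \<Phi> y (\<Phi> x u)) x (\<Phi> x v) - fd (\<lambda>y. \<Phi> y (\<Phi> x v)) x (\<Phi> x u)) = 0"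
    and e: "linear e" "e x1 \<noteq> 0"
    and e\<Phi>: "\<And>v. e v = 0 \<Longrightarrow> \<Phi> x0 (\<Phi> x0 v) = - v" "\<And>v. e (\<Phi> x0 v) = 0"
  obtains T and z :: "'e \<Rightarrow> complex ^ 'n" where "open T" "x0 \<in> T" "T \<subseteq> S" "smooth_on T z"
    "\<And>x v. x \<in> T \<Longrightarrow> fd z x (\<Phi> x (\<Phi> x v)) = \<i> *s fd z x (\<Phi> x v)"
    "\<And>v. e v = 0 \<Longrightarrow> fd z x0 v = 0 \<Longrightarrow> v = 0"
proof -
  obtain r M where r: "r > 0" "ball x0 r \<subseteq> S" and M: "holo_fam (ball 0 r) M"
    and Mr: "\<And>u v. norm u < r \<Longrightarrow> M (u, 0) (v, 0) = (\<Phi> (x0 + u) v, 0)"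
    using analytic_family_extension[OF S an lin] by metis
  have inS: "x0 + u \<in> S" if "norm u < r" for u using that r(2) by (auto simp: subset_iff dist_norm)
  have inB: "(u, 0 :: 'e) \<in> ball 0 r" if "norm u < r" for u :: 'e using that by (simp add: norm_Pair_zero)
  note Mlin = linear_add[OF holo_famD(2)[OF M]] linear_scale[OF holo_famD(2)[OF M]] linear_diff[OF holo_famD(2)[OF M]]
    linear_neg[OF holo_famD(2)[OF M]] holo_famD(3)[OF M]
  have decomp: "w = (fst w, 0) + Jc (snd w, 0)" for w :: "'e cplxn" by (simp add: prod_eq_iff)
  have M3: "M y (M y (M y w)) = - M y w" if y: "y \<in> ball 0 r" for y w
  proof -
    \<comment> \<open>At real points this is \<open>cube\<close>; the left-hand side is holomorphic
      in \<open>y\<close>, so it vanishes on the complex ball.\<close>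
    have 1: "M y (M y (M y (v, 0))) + M y (v, 0) = 0" for v
    proof (rule holo_zero[OF _ _ y, of "\<lambda>y. M y (M y (M y (v, 0))) + M y (v, 0)"])
      show "holo (ball 0 r) (\<lambda>y. M y (M y (M y (v, 0))) + M y (v, 0))"
        by (intro holo_add holo_fam_app[OF M] holo_famD(1)[OF M] open_ball)
      show "M (u, 0) (M (u, 0) (M (u, 0) (v, 0))) + M (u, 0) (v, 0) = 0" if "norm u < r" for u
        by (simp add: Mr[OF that] cube[OF inS[OF that]] zero_prod_def)
    qed
    have "M y (M y (M y w)) + M y w = 0"
      by (subst (1 2) decomp[of w]) (use 1[of "fst w"] 1[of "snd w"] in \<open>simp add: Mlin[OF y] Jc_arith flip: Jc_arith(1)\<close>,
        simp add: add.assoc[symmetric] add.commute add.left_commute flip: Jc_arith(1))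
    then show ?thesis by (simp add: eq_neg_iff_add_eq_0)
  qed
  define d where "d y a b = fd (\<lambda>x. M x b) y a" for y a b
  have da: "linear (\<lambda>a. d y a b)" "d y (Jc a) b = Jc (d y a b)" if "y \<in> ball 0 r" for y a b
    unfolding d_def using holo_linear[OF holo_famD(1)[OF M] that] holo_fd_Jc[OF holo_famD(1)[OF M] that] by auto
  have db: "linear (\<lambda>b. d y a b)" "d y a (Jc b) = Jc (d y a b)" if "y \<in> ball 0 r" for y a b
    unfolding d_def by (rule fd_fam_linear[OF M open_ball that], rule fd_fam_Jc[OF M open_ball that])
  have dr: "d (u, 0) (h, 0) (v, 0) = (fd (\<lambda>x. \<Phi> x v) (x0 + u) h, 0)" if u: "norm u < r" for u h v
  proof -
    have 1: "((\<lambda>x. (x - x0, 0)) has_derivative (\<lambda>h. (h, 0))) (at (x0 + u))" by (auto intro!: derivative_eq_intros)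
    have 2: "((\<lambda>y. M y (v, 0)) has_derivative (\<lambda>a. d (u, 0) a (v, 0))) (at (x0 + u - x0, 0))"
      using holo_has_derivative[OF holo_famD(1)[OF M] inB[OF u]] by (simp add: d_def)
    have 3: "((\<lambda>x. M (x - x0, 0) (v, 0)) has_derivative (\<lambda>h. d (u, 0) (h, 0) (v, 0))) (at (x0 + u))"
      using has_derivative_compose[OF 1 2] .
    have ball: "x0 + u \<in> ball x0 r" using u by (simp add: dist_norm)
    have "M (x - x0, 0) (v, 0) = (\<Phi> x v, 0)" if "x \<in> ball x0 r" for x
      using Mr[of "x - x0" v] that by (simp add: dist_norm norm_minus_commute)
    then have "((\<lambda>x. (\<Phi> x v, 0)) has_derivative (\<lambda>h. d (u, 0) (h, 0) (v, 0))) (at (x0 + u))"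
      using 3 has_derivative_cong_open[OF open_ball ball, of "\<lambda>x. M (x - x0, 0) (v, 0)" "\<lambda>x. (\<Phi> x v, 0)"] by simp
    moreover have "((\<lambda>x. (\<Phi> x v, 0 :: 'e)) has_derivative (\<lambda>h. (fd (\<lambda>x. \<Phi> x v) (x0 + u) h, 0))) (at (x0 + u))"
      using smooth_on_has_derivative[OF real_analytic_smooth[OF an] inS[OF u]]
      by (intro has_derivative_Pair has_derivative_const)
    ultimately show ?thesis using has_derivative_unique by metis
  qed
  \<comment> \<open>Complex bilinear in \<open>a\<close> and \<open>b\<close>, so that the Nijenhuis
    identity, known for real vectors at real points, extends first to complex points and then to
    complex vectors.\<close>
  define Nf where "Nf y a b = d y (M y a) b - d y (M y b) a + M y (d y b a - d y a b)" for y a b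
  have Nf_add: "Nf y (a + a') b = Nf y a b + Nf y a' b" "Nf y a (b + b') = Nf y a b + Nf y a b'"
    and Nf_Jc: "Nf y (Jc a) b = Jc (Nf y a b)" "Nf y a (Jc b) = Jc (Nf y a b)" if y: "y \<in> ball 0 r" for y a a' b b'
    unfolding Nf_def by (simp_all add: Mlin[OF y] linear_add[OF da(1)[OF y]] linear_add[OF db(1)[OF y]] da(2)[OF y] db(2)[OF y] Jc_arith)
  have Nf0: "Nf y (M y (u, 0)) (M y (v, 0)) = 0" if y: "y \<in> ball 0 r" for y u v
  proof (rule holo_zero[OF _ _ y, of "\<lambda>y. Nf y (M y (u, 0)) (M y (v, 0))"])
    have hd: "holo (ball 0 r) (\<lambda>y. d y (p y) (q y))" if "holo (ball 0 r) p" "holo (ball 0 r) q" for p q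
      using holo_fam_app[OF holo_fam_fd[OF M open_ball that(1)] that(2) open_ball] by (simp add: d_def)
    show "holo (ball 0 r) (\<lambda>y. Nf y (M y (u, 0)) (M y (v, 0)))"
      unfolding Nf_def
      by (intro holo_add holo_diff hd holo_fam_app[OF M] holo_famD(1)[OF M] open_ball)
    show "Nf (w, 0) (M (w, 0) (u, 0)) (M (w, 0) (v, 0)) = 0" if "norm w < r" for w
    proof -
      have "Nf (w, 0) (M (w, 0) (u, 0)) (M (w, 0) (v, 0)) = (fd (\<lambda>y. \<Phi> y (\<Phi> (x0 + w) v)) (x0 + w) (\<Phi> (x0 + w) (\<Phi> (x0 + w) u))
        - fd (\<lambda>y. \<Phi> y (\<Phi> (x0 + w) u)) (x0 + w) (\<Phi> (x0 + w) (\<Phi> (x0 + w) v))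
        + \<Phi> (x0 + w) (fd (\<lambda>y. \<Phi> y (\<Phi> (x0 + w) u)) (x0 + w) (\<Phi> (x0 + w) v)
            - fd (\<lambda>y. \<Phi> y (\<Phi> (x0 + w) v)) (x0 + w) (\<Phi> (x0 + w) u)), 0)"
        by (simp add: Nf_def Mr[OF that] dr[OF that])
      then show ?thesis unfolding nij[OF inS[OF that]] zero_prod_def .
    qed
  qed
  have nijM: "Nf y (M y u) (M y v) = 0" if y: "y \<in> ball 0 r" for y u v
  proof -
    have "M y u = M y (fst u, 0) + Jc (M y (snd u, 0))" "M y v = M y (fst v, 0) + Jc (M y (snd v, 0))"
      using decomp[of u] decomp[of v] Mlin[OF y] by metis+
    then show ?thesis by (simp add: Nf_add[OF y] Nf_Jc[OF y] Nf0[OF y])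
  qed
  define \<pi> where "\<pi> = (\<lambda>y w. (-1/2) *\<^sub>R M y (M y w) + (1/2) *\<^sub>R Jc (M y w))"
  note nijM' = nijM[unfolded Nf_def d_def]
  have \<pi>1: "holo_fam (ball 0 r) \<pi>" unfolding \<pi>_def
    by (rule antiholomorphic_projection(1)[OF M], erule M3, erule nijM')
  have \<pi>2: "\<pi> y (\<pi> y w) = \<pi> y w" if "y \<in> ball 0 r" for y w unfolding \<pi>_def
    by (rule antiholomorphic_projection(2)[OF M], erule M3, erule nijM', rule that)
  have \<pi>3: "fd (\<lambda>x. \<pi> x (\<pi> y v)) y (\<pi> y u) = fd (\<lambda>x. \<pi> x (\<pi> y u)) y (\<pi> y v)" if "y \<in> ball 0 r" for y u v
    unfolding \<pi>_def by (rule antiholomorphic_projection(3)[OF M], erule M3, erule nijM', rule that)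
  obtain \<delta> W where \<delta>: "\<delta> > 0" and W: "holo (ball 0 \<delta>) W" "fd W 0 = (\<lambda>v. v - \<pi> 0 v)"
    "\<And>x v. x \<in> ball 0 \<delta> \<Longrightarrow> fd W x (\<pi> x v) = 0"
    by (rule holo_Frobenius[OF \<pi>1 r(1)]) (erule \<pi>2, erule \<pi>3, (rule that; assumption))
  obtain m :: "'e \<Rightarrow> complex ^ 'n" where m: "linear m" "\<And>v. m (\<Phi> x0 v) = \<i> *s m v"
    "\<And>v. e v = 0 \<Longrightarrow> m v = 0 \<Longrightarrow> v = 0"
    using complex_structure_iso[OF dim lin[OF S(2)] e e\<Phi>] by metis
  define l where "l w = m (fst w) + \<i> *s m (snd w)" for w
  have ll: "linear l"
    by (rule linearI) (simp_all add: l_def linear_add[OF m(1)] linear_scale[OF m(1)] vec_eq_iff algebra_simps)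
  have lJ: "l (Jc w) = \<i> *s l w" for w by (simp add: l_def linear_neg[OF m(1)] vec_eq_iff algebra_simps)
  define t where "t = min r \<delta>"
  have t: "t > 0" "t \<le> r" "t \<le> \<delta>" using r \<delta> by (auto simp: t_def)
  define z where "z x = l (W (x - x0, 0))" for x
  have bll: "bounded_linear l" using ll linear_conv_bounded_linear by blast
  have Wt: "holo (ball 0 t) W" using holo_subset[OF W(1)] t(3) subset_ball by blast
  have zs: "smooth_on (ball x0 t) z"
    unfolding z_def by (rule smooth_on_bounded_linear_o[OF open_ball bll holo_restrict_smooth[OF Wt]])
  have fdz: "fd z x h = l (fd W (x - x0, 0) (h, 0))" if x: "x \<in> ball x0 t" for x h
  proof -
    have "(x - x0, 0 :: 'e) \<in> ball 0 t" using x by (simp add: norm_Pair_zero dist_norm norm_minus_commute)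
    then have "(W has_derivative fd W (x - x0, 0)) (at (x - x0, 0))" using holo_has_derivative[OF Wt] by blast
    moreover have "((\<lambda>x. (x - x0, 0)) has_derivative (\<lambda>h. (h, 0))) (at x)" by (auto intro!: derivative_eq_intros)
    ultimately have "((\<lambda>x. W (x - x0, 0)) has_derivative (\<lambda>h. fd W (x - x0, 0) (h, 0))) (at x)"
      using has_derivative_compose by blast
    from fd_eqI[OF bounded_linear.has_derivative[OF bll this]] show ?thesis by (simp add: z_def[abs_def])
  qed
  have Mx: "M (x - x0, 0) (v, v') = (\<Phi> x v, \<Phi> x v')" if x: "x \<in> ball x0 t" for x v v'
  proof -
    have n: "norm (x - x0) < r" using x t by (simp add: dist_norm norm_minus_commute)
    have "(v, v') = (v, 0) + Jc (v', 0)" by (simp add: prod_eq_iff)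
    then have "M (x - x0, 0) (v, v') = M (x - x0, 0) (v, 0) + Jc (M (x - x0, 0) (v', 0))"
      using Mlin[OF inB[OF n]] by metis
    then show ?thesis using Mr[OF n] by (simp add: prod_eq_iff)
  qed
  show thesis
  proof (rule that[of "ball x0 t" z])
    show "x0 \<in> ball x0 t" using t by simp
    show "ball x0 t \<subseteq> S" using r(2) t(2) subset_ball by blast
    show "smooth_on (ball x0 t) z" by (rule zs)
    show "fd z x (\<Phi> x (\<Phi> x v)) = \<i> *s fd z x (\<Phi> x v)" if x: "x \<in> ball x0 t" for x v
    proof -
      have xS: "x \<in> S" using x r(2) t(2) subset_ball by blast
      define y where "y = (x - x0, 0 :: 'e)"
      have y: "y \<in> ball 0 \<delta>" "y \<in> ball 0 t" using x t by (auto simp: y_def norm_Pair_zero dist_norm norm_minus_commute)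
      define a where "a = \<Phi> x v"
      have a: "\<Phi> x (\<Phi> x a) = - a" "\<Phi> x (- a) = - \<Phi> x a"
        using cube[OF xS] linear_neg[OF lin[OF xS]] by (auto simp: a_def)
      have "- x - x = - (x + x)" for x :: 'e by simp
      then have half: "- ((1/2) *\<^sub>R a) - (1/2) *\<^sub>R a = - a" by (simp only: scaleR_add_left[symmetric]) simp
      \<comment> \<open>The pair stands for \<open>\<Phi> a - \<i> a\<close>, a vector of the
        \<open>-\<i>\<close>-eigenspace because \<open>\<Phi>\<^sup>2 a = - a\<close>. That the
        derivative of \<open>W\<close> vanishes on it is the Cauchy-Riemann equation for
        \<open>z\<close>.\<close>
      have "\<pi> y (\<Phi> x a, - a) = (\<Phi> x a, - a)"
        using half cube[OF xS, of a] by (simp add: \<pi>_def y_def Mx[OF x] a linear_neg[OF lin[OF xS]] prod_eq_iff flip: scaleR_add_left)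
      then have "fd W y (\<Phi> x a, - a) = 0" using W(3)[OF y(1), of "(\<Phi> x a, - a)"] by simp
      moreover have "(\<Phi> x a, - a) = (\<Phi> x a, 0) - Jc (a, 0)" by (simp add: prod_eq_iff)
      ultimately have "fd W y (\<Phi> x a, 0) = Jc (fd W y (a, 0))"
        using linear_diff[OF holo_linear[OF Wt y(2)]] holo_fd_Jc[OF Wt y(2)] by (metis eq_iff_diff_eq_0)
      then show ?thesis unfolding fdz[OF x] a_def[symmetric] y_def[symmetric] by (simp add: lJ)
    qed
    show "v = 0" if v: "e v = 0" "fd z x0 v = 0" for v
    proof -
      have x0: "x0 \<in> ball x0 t" using t by simp
      have \<pi>0: "\<pi> 0 (v, 0) = (1/2) *\<^sub>R (- \<Phi> x0 (\<Phi> x0 v), \<Phi> x0 v)"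
      proof -
        have "(0 :: 'e cplxn) = (x0 - x0, 0)" by (simp add: zero_prod_def)
        moreover have "\<pi> (x0 - x0, 0) (v, 0) = (1/2) *\<^sub>R (- \<Phi> x0 (\<Phi> x0 v), \<Phi> x0 v)"
          unfolding \<pi>_def Mx[OF x0] by (simp add: linear_0[OF lin[OF S(2)]] prod_eq_iff)
        ultimately show ?thesis by metis
      qed
      \<comment> \<open>As \<open>m\<close> intertwines \<open>\<Phi> x0\<close> with
        \<open>\<i>\<close>, its complex linear extension kills the
        \<open>-\<i>\<close>-eigenspace.\<close>
      have "l (\<pi> 0 (v, 0)) = 0"
        unfolding \<pi>0 by (simp add: l_def linear_neg[OF m(1)] linear_scale[OF m(1)] m(2) vec_eq_iff)
      moreover have "fd z x0 v = l ((v, 0) - \<pi> 0 (v, 0))"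
        using fdz[OF x0, of v] W(2) by (simp add: zero_prod_def[symmetric])
      ultimately have "m v = 0" using v(2) by (simp add: linear_diff[OF ll]) (simp add: l_def linear_0[OF m(1)])
      then show ?thesis using m(3) v(1) by blast
    qed
  qed simp
qed

subsection \<open>Charts\<close>

lemma chart_inv_left: "is_chart X c \<Longrightarrow> p \<in> fst c \<Longrightarrow> chart_inv c (snd c p) = p"
  and chart_inv_right: "x \<in> snd c ` fst c \<Longrightarrow> snd c (chart_inv c x) = x"
  and chart_inv_in: "x \<in> snd c ` fst c \<Longrightarrow> chart_inv c x \<in> fst c"
proof -
  assume c: "is_chart X c" and p: "p \<in> fst c"
  have "fst c \<subseteq> topspace X" using c openin_subset unfolding is_chart_def by blast
  then have "inj_on (snd c) (fst c)"
    using c unfolding is_chart_def homeomorphic_eq_everything_map by (simp add: Int_absorb1)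
  then show "chart_inv c (snd c p) = p" using p by (simp add: chart_inv_def)
qed (auto simp: chart_inv_def f_inv_into_f inv_into_into)

lemma chart_open_image:
  assumes c: "is_chart X c" and V: "openin X V" "V \<subseteq> fst c"
  shows "open (snd c ` V)"
proof -
  have "open_map (subtopology X (fst c)) (top_of_set (snd c ` fst c)) (snd c)"
    using c unfolding is_chart_def homeomorphic_eq_everything_map by blast
  moreover have "openin (subtopology X (fst c)) V" using V by (simp add: openin_subtopology_Int2 openin_subset subset_openin_subtopology)
  ultimately have "openin (top_of_set (snd c ` fst c)) (snd c ` V)" unfolding open_map_def by blast
  then show ?thesis using c openin_open_trans unfolding is_chart_def by blast
qed

lemma chart_open_vimage:
  assumes c: "is_chart X c" and T: "open T"
  shows "openin X {p \<in> fst c. snd c p \<in> T}"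
proof -
  have sub: "fst c \<subseteq> topspace X" "openin X (fst c)" using c openin_subset unfolding is_chart_def by blast+
  have "continuous_map (subtopology X (fst c)) (top_of_set (snd c ` fst c)) (snd c)"
    using c unfolding is_chart_def homeomorphic_eq_everything_map by blast
  moreover have "openin (top_of_set (snd c ` fst c)) (snd c ` fst c \<inter> T)" using T by (simp add: openin_open_Int)
  ultimately have "openin (subtopology X (fst c)) {p \<in> topspace (subtopology X (fst c)). snd c p \<in> snd c ` fst c \<inter> T}"
    unfolding continuous_map_def by blast
  moreover have "{p \<in> topspace (subtopology X (fst c)). snd c p \<in> snd c ` fst c \<inter> T} = {p \<in> fst c. snd c p \<in> T}"
    using sub(1) by auto
  ultimately show ?thesis using openin_trans_full sub(2) by metis
qed

lemma is_chartI:
  assumes U: "openin X U" and img: "open (f ` U)" and inj: "inj_on f U"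
    and im: "\<And>V. openin X V \<Longrightarrow> V \<subseteq> U \<Longrightarrow> open (f ` V)"
    and vim: "\<And>T. open T \<Longrightarrow> openin X {q \<in> U. f q \<in> T}"
  shows "is_chart X (U, f)"
proof -
  have ts: "topspace (subtopology X U) = U" using openin_subset[OF U] by auto
  have "homeomorphic_map (subtopology X U) (top_of_set (f ` U)) f"
  proof (rule bijective_open_imp_homeomorphic_map)
    show "continuous_map (subtopology X U) (top_of_set (f ` U)) f"
      unfolding continuous_map_def ts
    proof (intro conjI allI impI)
      show "f \<in> U \<rightarrow> topspace (top_of_set (f ` U))" by auto
      fix T' assume "openin (top_of_set (f ` U)) T'"
      then obtain T where T: "open T" "T' = f ` U \<inter> T" by (auto simp: openin_open)
      have "{q \<in> U. f q \<in> T'} = {q \<in> U. f q \<in> T}" using T(2) by auto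
      then show "openin (subtopology X U) {q \<in> U. f q \<in> T'}"
        using vim[OF T(1)] by (simp add: openin_open_subtopology[OF U])
    qed
    show "open_map (subtopology X U) (top_of_set (f ` U)) f"
      unfolding open_map_def
    proof (intro allI impI)
      fix V assume "openin (subtopology X U) V"
      then have "openin X V" "V \<subseteq> U" by (auto simp: openin_open_subtopology[OF U])
      then show "openin (top_of_set (f ` U)) (f ` V)"
        using im by (auto simp: openin_open_eq img)
    qed
  qed (use ts inj in auto)
  then show ?thesis using U img by (simp add: is_chart_def)
qed

lemma compatible_commute: "compatible k c d \<longleftrightarrow> compatible k d c"
  by (auto simp: compatible_def Int_commute)

lemma regular_on_smooth: "regular_on k S f \<Longrightarrow> smooth_on S f"
  by (cases k) (auto simp: regular_on_def real_analytic_smooth)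

lemma compatible_smooth_transition:
  assumes "compatible k c d"
  shows "smooth_on (snd c ` (fst c \<inter> fst d)) (\<lambda>x. snd d (chart_inv c x))"
    "smooth_on (snd d ` (fst c \<inter> fst d)) (\<lambda>x. snd c (chart_inv d x))"
  using assms regular_on_smooth unfolding compatible_def comp_def by blast+

lemma transition_has_derivative:
  assumes c: "is_chart X c" and d: "is_chart X d"
    and sm: "smooth_on (snd c ` (fst c \<inter> fst d)) (\<lambda>x. snd d (chart_inv c x))"
    and q: "q \<in> fst c" "q \<in> fst d"
  shows "((\<lambda>x. snd d (chart_inv c x)) has_derivative dmap c (snd d) q) (at (snd c q))"
  using smooth_on_has_derivative[OF sm, of "snd c q"] q by (simp add: dmap_def comp_def)

lemma overlap_open:
  assumes "is_chart X c" "is_chart X d"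
  shows "open (snd c ` (fst c \<inter> fst d))"
  using assms unfolding is_chart_def by (intro chart_open_image[OF assms(1)] openin_Int) auto

lemma dmap_inverse:
  assumes c: "is_chart X c" and d: "is_chart X d" and cd: "compatible k c d" and q: "q \<in> fst c" "q \<in> fst d"
  shows "dmap d (snd c) q (dmap c (snd d) q v) = v"
proof -
  have 1: "((\<lambda>x. snd d (chart_inv c x)) has_derivative dmap c (snd d) q) (at (snd c q))"
    by (rule transition_has_derivative[OF c d compatible_smooth_transition(1)[OF cd] q])
  have "smooth_on (snd d ` (fst d \<inter> fst c)) (\<lambda>x. snd c (chart_inv d x))"
    using compatible_smooth_transition(2)[OF cd] by (simp add: Int_commute)
  from transition_has_derivative[OF d c this q(2,1)]
  have 2: "((\<lambda>x. snd c (chart_inv d x)) has_derivative dmap d (snd c) q) (at (snd d (chart_inv c (snd c q))))"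
    by (simp add: chart_inv_left[OF c q(1)])
  have m: "snd c q \<in> snd c ` (fst c \<inter> fst d)" using q by blast
  have A: "((\<lambda>x. snd c (chart_inv d (snd d (chart_inv c x)))) has_derivative (\<lambda>v. dmap d (snd c) q (dmap c (snd d) q v))) (at (snd c q))"
    using has_derivative_compose[OF 1 2] .
  have B: "snd c (chart_inv d (snd d (chart_inv c x))) = x" if x: "x \<in> snd c ` (fst c \<inter> fst d)" for x
    using x chart_inv_left[OF c] chart_inv_left[OF d] by auto
  have "((\<lambda>x. x) has_derivative (\<lambda>v. dmap d (snd c) q (dmap c (snd d) q v))) (at (snd c q))"
    by (rule iffD1[OF has_derivative_cong_open[OF overlap_open[OF c d] m B] A])
  from has_derivative_unique[OF this has_derivative_ident] show ?thesis by (rule fun_cong)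
qed

text \<open>Differentiability is assumed in the chart \<open>d\<close>; the smooth transition
  transfers it to \<open>c\<close>, with the chain rule for the derivatives.\<close>

lemma dmap_chain:
  assumes c: "is_chart X c" and d: "is_chart X d" and cd: "compatible k c d" and q: "q \<in> fst c" "q \<in> fst d"
    and h: "(\<lambda>x. h (chart_inv d x)) differentiable (at (snd d q))"
  shows "dmap c h q v = dmap d h q (dmap c (snd d) q v)"
    "((\<lambda>x. h (chart_inv c x)) has_derivative dmap c h q) (at (snd c q))"
proof -
  have 1: "((\<lambda>x. snd d (chart_inv c x)) has_derivative dmap c (snd d) q) (at (snd c q))"
    by (rule transition_has_derivative[OF c d compatible_smooth_transition(1)[OF cd] q])
  have "((\<lambda>x. h (chart_inv d x)) has_derivative dmap d h q) (at (snd d (chart_inv c (snd c q))))"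
    using fd_works[OF h] by (simp add: dmap_def comp_def chart_inv_left[OF c q(1)])
  have m: "snd c q \<in> snd c ` (fst c \<inter> fst d)" using q by blast
  from has_derivative_compose[OF 1 \<open>((\<lambda>x. h (chart_inv d x)) has_derivative dmap d h q) (at (snd d (chart_inv c (snd c q))))\<close>]
  have A: "((\<lambda>x. h (chart_inv d (snd d (chart_inv c x)))) has_derivative (\<lambda>v. dmap d h q (dmap c (snd d) q v))) (at (snd c q))" .
  have B: "h (chart_inv d (snd d (chart_inv c x))) = h (chart_inv c x)" if x: "x \<in> snd c ` (fst c \<inter> fst d)" for x
    using x chart_inv_left[OF c] chart_inv_left[OF d] by auto
  have 3: "((\<lambda>x. h (chart_inv c x)) has_derivative (\<lambda>v. dmap d h q (dmap c (snd d) q v))) (at (snd c q))"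
    by (rule iffD1[OF has_derivative_cong_open[OF overlap_open[OF c d] m B] A])
  then show eq: "dmap c h q v = dmap d h q (dmap c (snd d) q v)" for v
    using fd_eqI[OF 3] by (simp add: dmap_def comp_def)
  show "((\<lambda>x. h (chart_inv c x)) has_derivative dmap c h q) (at (snd c q))"
    using 3 unfolding eq[symmetric] .
qed

lemma smooth_on_const: "open S \<Longrightarrow> smooth_on S (\<lambda>x. c)"
  by (simp add: smooth_on_def C_k_on_const)

subsection \<open>Straightening a closed one-form\<close>

text \<open>The primitive is the integral of \<open>\<omega>\<close> along the segment from
  \<open>x0\<close>. Closedness turns its derivative in direction \<open>h\<close> into the integral
  of the \<open>s\<close>-derivative of \<open>s * \<omega> (l (x, s)) h\<close>, whose boundary
  values leave \<open>\<omega> x h\<close>.\<close>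

lemma Poincare_lemma:
  fixes \<omega> :: "'a::euclidean_space \<Rightarrow> 'a \<Rightarrow> real"
  assumes r: "r > 0" and sm: "\<And>v. smooth_on (ball x0 r) (\<lambda>x. \<omega> x v)"
    and lin: "\<And>x. x \<in> ball x0 r \<Longrightarrow> linear (\<omega> x)"
    and closed: "\<And>x u v. x \<in> ball x0 r \<Longrightarrow> fd (\<lambda>y. \<omega> y v) x u = fd (\<lambda>y. \<omega> y u) x v"
  obtains t where "t x0 = 0" "\<And>x. x \<in> ball x0 r \<Longrightarrow> (t has_derivative \<omega> x) (at x)"
proof -
  let ?B = "ball x0 r"
  define l where "l p = x0 + snd p *\<^sub>R (fst p - x0)" for p :: "'a \<times> real"
  define K where "K p = \<omega> (l p) (fst p - x0)" for p :: "'a \<times> real"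
  define W where "W = l -` ?B"
  have sl: "smooth_on A l" if "open A" for A
  proof -
    have "smooth_on A (\<lambda>p. x0 + snd p *\<^sub>R (fst p + (- x0)))"
      by (rule smooth_on_add[OF that smooth_on_const[OF that] smooth_on_scaleR[OF that
              smooth_on_bounded_linear[OF that bounded_linear_snd]
              smooth_on_add[OF that smooth_on_bounded_linear[OF that bounded_linear_fst] smooth_on_const[OF that]]]])
    then show ?thesis by (simp add: l_def[abs_def])
  qed
  have W: "open W" unfolding W_def by (rule open_vimage[OF open_ball]) (use smooth_on_continuous[OF sl] in auto)
  have lB: "l (x, s) \<in> ?B" if "x \<in> ?B" "s \<in> {0..1}" for x s
  proof -
    have "norm (s *\<^sub>R (x - x0)) \<le> 1 * norm (x - x0)"
      unfolding norm_scaleR using that by (intro mult_right_mono) auto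
    then show ?thesis using that by (simp add: l_def dist_norm norm_minus_commute)
  qed
  then have BW: "?B \<times> {0..1} \<subseteq> W" by (auto simp: W_def)
  have lW: "l ` W \<subseteq> ?B" by (auto simp: W_def)
  have K_eq: "(\<Sum>b\<in>Basis. ((fst p - x0) \<bullet> b) *\<^sub>R \<omega> (l p) b) = K p" if "p \<in> W" for p
    unfolding K_def using lW that by (intro linear_sum_Basis[symmetric] lin) auto
  have sK: "smooth_on W K"
  proof -
    have 1: "C_k_on k W (\<lambda>p. (fst p - x0) \<bullet> b)" for k and b :: 'a
    proof -
      have "C_k_on k W (\<lambda>p. fst p + (- x0))"
        by (intro C_k_on_add W C_k_on_const C_k_on_bounded_linear bounded_linear_fst)
      from C_k_on_inner_const[OF W this] show ?thesis by simp
    qed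
    have 2: "smooth_on W (\<lambda>p. \<omega> (l p) b)" for b
      by (rule smooth_on_compose[OF W open_ball sm sl[OF W] lW])
    have "smooth_on W (\<lambda>p. \<Sum>b\<in>Basis. ((fst p - x0) \<bullet> b) *\<^sub>R \<omega> (l p) b)"
      unfolding smooth_on_def using 2
      by (intro allI C_k_on_sum C_k_on_scaleR W 1) (auto simp: smooth_on_def)
    then show ?thesis by (rule smooth_on_cong[OF W, rotated]) (rule K_eq)
  qed
  have dK: "fd K (x, s) (h, 0) = s * fd (\<lambda>y. \<omega> y h) (l (x, s)) (x - x0) + \<omega> (l (x, s)) h"
    if x: "x \<in> ?B" and s: "s \<in> {0..1}" for x s h
  proof -
    have L: "l (x, s) \<in> ?B" by (rule lB[OF that])
    have 1: "((\<lambda>y. l (y, s)) has_derivative (\<lambda>h. s *\<^sub>R h)) (at x)"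
      unfolding l_def by (auto intro!: derivative_eq_intros)
    have d\<omega>: "((\<lambda>y. \<omega> y b) has_derivative fd (\<lambda>y. \<omega> y b) (l (x, s))) (at (l (x, s)))" for b
      by (rule smooth_on_has_derivative[OF sm L])
    have 2: "((\<lambda>y. \<omega> (l (y, s)) b) has_derivative (\<lambda>h. fd (\<lambda>y. \<omega> y b) (l (x, s)) (s *\<^sub>R h))) (at x)" for b
      using has_derivative_compose[OF 1 d\<omega>] .
    have "((\<lambda>y. \<Sum>b\<in>Basis. ((y - x0) \<bullet> b) *\<^sub>R \<omega> (l (y, s)) b) has_derivative
       (\<lambda>h. \<Sum>b\<in>Basis. ((x - x0) \<bullet> b) *\<^sub>R fd (\<lambda>y. \<omega> y b) (l (x, s)) (s *\<^sub>R h) + (h \<bullet> b) *\<^sub>R \<omega> (l (x, s)) b)) (at x)"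
      by (intro has_derivative_sum has_derivative_scaleR 2) (auto intro!: derivative_eq_intros)
    moreover have "(\<Sum>b\<in>Basis. ((y - x0) \<bullet> b) *\<^sub>R \<omega> (l (y, s)) b) = K (y, s)" if "y \<in> ?B" for y
    proof -
      have "(y, s) \<in> W" using BW that s by blast
      from K_eq[OF this] show ?thesis by simp
    qed
    ultimately have der1: "((\<lambda>y. K (y, s)) has_derivative
       (\<lambda>h. \<Sum>b\<in>Basis. ((x - x0) \<bullet> b) *\<^sub>R fd (\<lambda>y. \<omega> y b) (l (x, s)) (s *\<^sub>R h) + (h \<bullet> b) *\<^sub>R \<omega> (l (x, s)) b)) (at x)"
      using has_derivative_cong_open[OF open_ball x, of "\<lambda>y. \<Sum>b\<in>Basis. ((y - x0) \<bullet> b) *\<^sub>R \<omega> (l (y, s)) b" "\<lambda>y. K (y, s)"] by blast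
    have der2: "((\<lambda>y. K (y, s)) has_derivative (\<lambda>h. fd K (x, s) (h, 0))) (at x)"
    proof -
      have "((\<lambda>y. (y, s)) has_derivative (\<lambda>h. (h, 0))) (at x)" by (auto intro!: derivative_eq_intros)
      moreover have "(x, s) \<in> W" using BW x s by blast
      ultimately show ?thesis using has_derivative_compose[OF _ smooth_on_has_derivative[OF sK], of "\<lambda>y. (y, s)"] by blast
    qed
    have "fd K (x, s) (h, 0) = (\<Sum>b\<in>Basis. ((x - x0) \<bullet> b) *\<^sub>R fd (\<lambda>y. \<omega> y b) (l (x, s)) (s *\<^sub>R h) + (h \<bullet> b) *\<^sub>R \<omega> (l (x, s)) b)"
      using fun_cong[OF has_derivative_unique[OF der2 der1], of h] .
    also have "\<dots> = s * (\<Sum>b\<in>Basis. ((x - x0) \<bullet> b) *\<^sub>R fd (\<lambda>y. \<omega> y b) (l (x, s)) h) + (\<Sum>b\<in>Basis. (h \<bullet> b) *\<^sub>R \<omega> (l (x, s)) b)"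
      using linear_scale[OF has_derivative_linear[OF d\<omega>]] by (simp add: sum.distrib sum_distrib_left mult_ac)
    also have "(\<Sum>b\<in>Basis. (h \<bullet> b) *\<^sub>R \<omega> (l (x, s)) b) = \<omega> (l (x, s)) h"
      by (rule linear_sum_Basis[OF lin[OF L], symmetric])
    also have "(\<Sum>b\<in>Basis. ((x - x0) \<bullet> b) *\<^sub>R fd (\<lambda>y. \<omega> y b) (l (x, s)) h) = fd (\<lambda>y. \<omega> y h) (l (x, s)) (x - x0)"
      unfolding closed[OF L, of _ h] by (rule linear_sum_Basis[OF has_derivative_linear[OF d\<omega>], symmetric])
    finally show ?thesis .
  qed
  define t where "t x = integral {0..1} (\<lambda>s. K (x, s))" for x
  have "(t has_derivative \<omega> x) (at x)" if x: "x \<in> ?B" for x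
  proof -
    have "(t has_derivative (\<lambda>h. integral {0..1} (\<lambda>s. fd K (x, s) (h, 0)))) (at x)"
      unfolding t_def by (rule parametric_integral_has_derivative[OF sK BW open_ball convex_ball x])
    moreover have "integral {0..1} (\<lambda>s. fd K (x, s) (h, 0)) = \<omega> x h" for h
    proof -
      have "((\<lambda>s. s *\<^sub>R \<omega> (l (x, s)) h) has_vector_derivative fd K (x, s) (h, 0)) (at s within {0..1})"
        if s: "s \<in> {0..1}" for s
      proof -
        have "((\<lambda>s. l (x, s)) has_derivative (\<lambda>k. k *\<^sub>R (x - x0))) (at s)"
          unfolding l_def by (auto intro!: derivative_eq_intros)
        from has_derivative_compose[OF this smooth_on_has_derivative[OF sm lB[OF x s]]]
        have "((\<lambda>s. \<omega> (l (x, s)) h) has_derivative (\<lambda>k. fd (\<lambda>y. \<omega> y h) (l (x, s)) (k *\<^sub>R (x - x0)))) (at s)" .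
        from has_derivative_scaleR[OF has_derivative_ident this]
        have "((\<lambda>s. s *\<^sub>R \<omega> (l (x, s)) h) has_derivative (\<lambda>k. k *\<^sub>R fd K (x, s) (h, 0))) (at s)"
          by (rule has_derivative_eq_rhs)
            (simp add: dK[OF x s] linear_scale[OF linear_fd[OF smooth_on_differentiable[OF sm lB[OF x s]]]] fun_eq_iff distrib_left mult_ac)
        then show ?thesis unfolding has_vector_derivative_def by (rule has_derivative_at_withinI)
      qed
      then have "((\<lambda>s. fd K (x, s) (h, 0)) has_integral 1 *\<^sub>R \<omega> (l (x, 1)) h - 0 *\<^sub>R \<omega> (l (x, 0)) h) {0..1}"
        by (intro fundamental_theorem_of_calculus) auto
      then show ?thesis by (simp add: integral_unique l_def)
    qed
    ultimately show ?thesis by simp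
  qed
  moreover have "t x0 = 0"
  proof -
    have "K (x0, s) = 0" for s
      using linear_0[OF lin[of x0]] r by (simp add: K_def l_def)
    then show ?thesis by (simp add: t_def)
  qed
  ultimately show thesis using that by blast
qed

text \<open>The first coordinate is a primitive of \<open>\<eta>\<close>, so its level sets are
  integral manifolds of \<open>ker \<eta>\<close>. Compatibility is asked for in the smooth sense,
  the regularity in which both leaves and diffeomorphisms are defined.\<close>

definition foliated_chart ::
  "'m topology \<Rightarrow> ('m, 'e::euclidean_space) chart set \<Rightarrow> ('m, 'e) one_form \<Rightarrow>
   ('m, real \<times> 'l::euclidean_space) chart \<Rightarrow> real \<Rightarrow> 'l set \<Rightarrow> bool" where
  "foliated_chart X A \<eta> f s D \<longleftrightarrow>
     is_chart X f \<and> snd f ` fst f = {- s<..<s} \<times> D \<and> s > 0 \<and> open D \<and> connected D \<and> D \<noteq> {} \<and>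
     (\<forall>c\<in>A. compatible Smooth c f) \<and>
     (\<forall>c\<in>A. \<forall>q\<in>fst f \<inter> fst c. \<eta> c q = dmap c (\<lambda>q. fst (snd f q)) q)"

text \<open>A vector killed by \<open>\<eta>\<close> and by the derivative of \<open>z\<close> is 0,
  so \<open>F = (t, z)\<close> is a local diffeomorphism. Its image is cut down to an interval times
  a ball, the shape required of the final charts. \<open>z\<close> is left free because the
  construction serves both for building leaves and for the final charts.\<close>

lemma foliated_chart_exists:
  fixes z :: "'e::euclidean_space \<Rightarrow> 'l::euclidean_space"
  assumes dim: "DIM('e) = DIM('l) + 1"
    and charts: "\<And>c. c \<in> A \<Longrightarrow> is_chart X c" and compat: "\<And>c d. c \<in> A \<Longrightarrow> d \<in> A \<Longrightarrow> compatible k c d"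
    and \<eta>: "is_one_form k' A \<eta>" "closed_one_form A \<eta>"
    and c: "c \<in> A" "p \<in> fst c" and T: "open T" "snd c p \<in> T" and z: "smooth_on T z"
    and inj: "\<And>v. \<eta> c p v = 0 \<Longrightarrow> fd z (snd c p) v = 0 \<Longrightarrow> v = 0"
  obtains f s D where "p \<in> fst f" "fst f \<subseteq> fst c" "foliated_chart X A \<eta> f s D"
    "\<And>q. q \<in> fst f \<Longrightarrow> snd c q \<in> T \<and> snd (snd f q) = z (snd c q)"
proof -
  let ?x0 = "snd c p"
  have chc: "is_chart X c" using charts c by blast
  have opimg: "open (snd c ` fst c)" using chc by (simp add: is_chart_def)
  have "open (T \<inter> snd c ` fst c)" "?x0 \<in> T \<inter> snd c ` fst c" using T c(2) opimg by auto
  then obtain r where r: "r > 0" "ball ?x0 r \<subseteq> T \<inter> snd c ` fst c" using open_contains_ball by blast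
  define \<omega> where "\<omega> x v = \<eta> c (chart_inv c x) v" for x v
  have sm: "smooth_on (ball ?x0 r) (\<lambda>x. \<omega> x v)" for v
  proof -
    have "regular_on k' (snd c ` fst c) (\<lambda>x. \<omega> x v)"
      using \<eta>(1) c(1) unfolding is_one_form_def in_coords_def \<omega>_def by blast
    then show ?thesis using regular_on_smooth smooth_on_subset r(2) by blast
  qed
  have lin: "linear (\<omega> x)" if "x \<in> ball ?x0 r" for x
  proof -
    have "linear (\<eta> c (chart_inv c x))"
      using \<eta>(1) c(1) chart_inv_in[of x c] r(2) that unfolding is_one_form_def by blast
    then show ?thesis by (simp add: \<omega>_def[abs_def])
  qed
  have closed: "fd (\<lambda>y. \<omega> y v) x u = fd (\<lambda>y. \<omega> y u) x v" if "x \<in> ball ?x0 r" for x u v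
  proof -
    have "x \<in> snd c ` fst c" using that r(2) by blast
    then have "fd (\<lambda>y. in_coords c \<eta> y v) x u - fd (\<lambda>y. in_coords c \<eta> y u) x v = 0"
      using \<eta>(2) c(1) unfolding closed_one_form_def by blast
    then show ?thesis by (simp add: \<omega>_def[abs_def] in_coords_def)
  qed
  obtain t where t: "t ?x0 = 0" "\<And>x. x \<in> ball ?x0 r \<Longrightarrow> (t has_derivative \<omega> x) (at x)"
    using Poincare_lemma[OF r(1) sm lin closed] by blast
  have st: "smooth_on (ball ?x0 r) t" by (rule smooth_onI[OF open_ball t(2) sm])
  have sz: "smooth_on (ball ?x0 r) z" using smooth_on_subset[OF z] r(2) by blast
  define F where "F x = (t x, z x)" for x
  have sF: "smooth_on (ball ?x0 r) F" unfolding F_def by (rule smooth_on_Pair[OF open_ball st sz])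
  have x0: "?x0 \<in> ball ?x0 r" using r by simp
  have fdF: "fd F x v = (\<omega> x v, fd z x v)" if "x \<in> ball ?x0 r" for x v
    using fd_eqI[OF has_derivative_Pair[OF t(2)[OF that] smooth_on_has_derivative[OF sz that]]] by (simp add: F_def[abs_def])
  have "inj (fd F ?x0)"
  proof -
    have "v = 0" if "fd F ?x0 v = 0" for v
      using that inj[of v] unfolding fdF[OF x0] by (simp add: \<omega>_def chart_inv_left[OF chc c(2)] zero_prod_def)
    then show ?thesis using linear_injective_0[OF linear_fd[OF smooth_on_differentiable[OF sF x0]]] by blast
  qed
  moreover have "DIM('e) = DIM(real \<times> 'l)" using dim by simp
  ultimately obtain U' V g where inv: "open U'" "?x0 \<in> U'" "U' \<subseteq> ball ?x0 r" "open V" "homeomorphism U' V F g" "smooth_on V g"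
    using smooth_inverse_function[OF _ open_ball x0 sF] by metis
  have hom: "\<And>x. x \<in> U' \<Longrightarrow> F x \<in> V \<and> g (F x) = x" "\<And>y. y \<in> V \<Longrightarrow> g y \<in> U' \<and> F (g y) = y"
    using inv(5) unfolding homeomorphism_def by blast+
  \<comment> \<open>The primitive vanishes at \<open>p\<close>, which allows an interval symmetric
    about 0.\<close>
  have "(0, z ?x0) \<in> V" using hom(1)[OF inv(2)] by (simp add: F_def t(1))
  then obtain A1 D1 where AD: "open A1" "open D1" "(0, z ?x0) \<in> A1 \<times> D1" "A1 \<times> D1 \<subseteq> V"
    using inv(4) open_prod_elim by metis
  then obtain s where s: "s > 0" "ball 0 s \<subseteq> A1" using open_contains_ball by blast
  obtain \<rho> where \<rho>: "\<rho> > 0" "ball (z ?x0) \<rho> \<subseteq> D1" using AD open_contains_ball by blast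
  define D where "D = ball (z ?x0) \<rho>"
  define B where "B = {- s<..<s} \<times> D"
  have BV: "B \<subseteq> V"
  proof -
    have "{- s<..<s} \<subseteq> A1" using s(2) by (auto simp: subset_iff dist_real_def)
    then show ?thesis using AD(4) \<rho>(2) by (auto simp: B_def D_def)
  qed
  have oB: "open B" unfolding B_def D_def by (intro open_Times) auto
  define U'' where "U'' = U' \<inter> F -` B"
  have U''o: "open U''"
    unfolding U''_def using continuous_open_preimage[OF _ inv(1) oB] smooth_on_continuous[OF smooth_on_subset[OF sF inv(3)]] by blast
  define U where "U = {q \<in> fst c. snd c q \<in> U''}"
  define f where "f q = F (snd c q)" for q
  have U''img: "U'' \<subseteq> snd c ` fst c" using inv(3) r(2) by (auto simp: U''_def)
  have cU: "snd c ` U = U''" using U''img by (auto simp: U_def)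
  have FU: "F ` U'' = B" using hom BV by (force simp: U''_def)
  have fU: "f ` U = B" unfolding f_def using cU FU by (metis image_image)
  have Uo: "openin X U" unfolding U_def by (rule chart_open_vimage[OF chc U''o])
  have Uc: "U \<subseteq> fst c" by (auto simp: U_def)
  have gf: "g (f q) = snd c q" "f q \<in> B" "snd c q \<in> U''" if "q \<in> U" for q
    using that hom(1) by (auto simp: f_def U_def U''_def)
  have chf: "is_chart X (U, f)"
  proof (rule is_chartI[OF Uo])
    show "open (f ` U)" using fU oB by simp
    show "inj_on f U"
      using gf(1) chart_inv_left[OF chc] Uc by (metis inj_onI subsetD)
    show "open (f ` V')" if V': "openin X V'" "V' \<subseteq> U" for V'
    proof -
      have o: "open (snd c ` V')" using chart_open_image[OF chc V'(1)] V'(2) Uc by blast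
      have "f ` V' = B \<inter> g -` (snd c ` V')"
      proof
        show "f ` V' \<subseteq> B \<inter> g -` (snd c ` V')" using gf V' by auto
        show "B \<inter> g -` (snd c ` V') \<subseteq> f ` V'"
        proof
          fix y assume y: "y \<in> B \<inter> g -` (snd c ` V')"
          then obtain q where "q \<in> V'" "g y = snd c q" by auto
          then have "f q = y" using hom(2)[of y] y BV by (auto simp: f_def)
          then show "y \<in> f ` V'" using \<open>q \<in> V'\<close> by blast
        qed
      qed
      then show ?thesis
        using continuous_open_preimage[OF smooth_on_continuous[OF smooth_on_subset[OF inv(6) BV]] oB o] by simp
    qed
    show "openin X {q \<in> U. f q \<in> T'}" if "open T'" for T'
    proof -
      have "open (U'' \<inter> F -` T')"
        using continuous_open_preimage[OF smooth_on_continuous[OF smooth_on_subset[OF sF]] U''o that] inv(3) by (auto simp: U''_def)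
      from chart_open_vimage[OF chc this]
      show ?thesis by (rule back_subst[of "openin X"]) (auto simp: U_def f_def)
    qed
  qed
  have invf: "chart_inv (U, f) y = chart_inv c (g y)" if y: "y \<in> B" for y
  proof -
    obtain q where q: "q \<in> U" "y = f q" using fU y by blast
    then show ?thesis using chart_inv_left[OF chf] gf(1) chart_inv_left[OF chc] Uc by auto
  qed
  have comp: "compatible Smooth c' (U, f)" if c': "c' \<in> A" for c'
  proof -
    have chc': "is_chart X c'" using charts c' .
    have o1: "open (snd c' ` (fst c' \<inter> U))"
      using chart_open_image[OF chc'] Uo chc' by (auto simp: is_chart_def)
    have sub: "snd c' ` (fst c' \<inter> U) \<subseteq> snd c' ` (fst c' \<inter> fst c)" using Uc by auto
    have 1: "smooth_on (snd c' ` (fst c' \<inter> U)) (\<lambda>x. F (snd c (chart_inv c' x)))"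
    proof (rule smooth_on_compose[OF o1 open_ball sF])
      show "smooth_on (snd c' ` (fst c' \<inter> U)) (\<lambda>x. snd c (chart_inv c' x))"
        by (rule smooth_on_subset[OF compatible_smooth_transition(1)[OF compat[OF c' c(1)]] sub])
      show "(\<lambda>x. snd c (chart_inv c' x)) ` snd c' ` (fst c' \<inter> U) \<subseteq> ball ?x0 r"
        using chart_inv_left[OF chc'] gf(3) inv(3) by (auto simp: U''_def)
    qed
    have o2: "open (f ` (fst c' \<inter> U))"
      using chart_open_image[OF chf, of "fst c' \<inter> U"] Uo chc' by (auto simp: is_chart_def)
    have subB: "f ` (fst c' \<inter> U) \<subseteq> B" using gf(2) by blast
    have o3: "open (snd c ` (fst c \<inter> fst c'))" by (rule overlap_open[OF chc chc'])
    have "smooth_on (f ` (fst c' \<inter> U)) (\<lambda>y. snd c' (chart_inv c (g y)))"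
    proof (rule smooth_on_compose[OF o2 o3 compatible_smooth_transition(1)[OF compat[OF c(1) c']]])
      show "smooth_on (f ` (fst c' \<inter> U)) g" using smooth_on_subset[OF inv(6)] subB BV by blast
      show "g ` f ` (fst c' \<inter> U) \<subseteq> snd c ` (fst c \<inter> fst c')" using gf(1) Uc by auto
    qed
    then have 2: "smooth_on (f ` (fst c' \<inter> U)) (\<lambda>y. snd c' (chart_inv (U, f) y))"
      by (rule smooth_on_cong[OF o2, rotated]) (use invf subB in \<open>metis subsetD\<close>)
    show ?thesis
      unfolding compatible_def using 1 2 by (simp add: regular_on_def comp_def f_def[abs_def])
  qed
  \<comment> \<open>\<open>\<eta> = dt\<close> is known in \<open>c\<close>; the transformation law
    of \<open>\<eta>\<close> and the chain rule carry it to every other chart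
    \<open>c'\<close>.\<close>
  have eta: "\<eta> c' q = dmap c' (\<lambda>q. fst (f q)) q" if c': "c' \<in> A" and q: "q \<in> U" "q \<in> fst c'" for c' q
  proof
    fix v
    have chc': "is_chart X c'" using charts c' .
    have qc: "q \<in> fst c" using q Uc by auto
    have xq: "snd c q \<in> ball ?x0 r" using gf(3)[OF q(1)] inv(3) by (auto simp: U''_def)
    have ev: "t x = fst (f (chart_inv c x))" if "x \<in> snd c ` fst c" for x
      using chart_inv_right[OF that] by (simp add: f_def F_def)
    have m: "snd c q \<in> snd c ` fst c" using qc by blast
    have d: "((\<lambda>x. fst (f (chart_inv c x))) has_derivative \<omega> (snd c q)) (at (snd c q))"
      by (rule iffD1[OF has_derivative_cong_open[OF opimg m ev] t(2)[OF xq]])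
    have "dmap c' (\<lambda>q. fst (f q)) q v = dmap c (\<lambda>q. fst (f q)) q (dmap c' (snd c) q v)"
      by (rule dmap_chain(1)[OF chc' chc compat[OF c' c(1)] q(2) qc]) (use d in \<open>auto simp: differentiable_def\<close>)
    also have "dmap c (\<lambda>q. fst (f q)) q = \<eta> c q"
      using fd_eqI[OF d] chart_inv_left[OF chc qc] by (simp add: dmap_def comp_def \<omega>_def[abs_def])
    also have "\<eta> c q (dmap c' (snd c) q v) = \<eta> c' q v"
      using \<eta>(1) c' c(1) q qc unfolding is_one_form_def by blast
    finally show "\<eta> c' q v = dmap c' (\<lambda>q. fst (f q)) q v" by simp
  qed
  show thesis
  proof (rule that[of "(U, f)" s D])
    have "F ?x0 \<in> B" using s \<rho> by (simp add: F_def t(1) B_def D_def)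
    then show "p \<in> fst (U, f)" using c(2) inv(2) by (simp add: U_def U''_def)
    show "foliated_chart X A \<eta> (U, f) s D"
      unfolding foliated_chart_def using chf fU s(1) \<rho>(1) comp eta by (auto simp: B_def D_def)
    show "snd c q \<in> T \<and> snd (snd (U, f) q) = z (snd c q)" if "q \<in> fst (U, f)" for q
      using gf(3)[of q] that inv(3) r(2) by (auto simp: U''_def f_def F_def)
  qed (use Uc in simp)
qed

subsection \<open>The Nijenhuis tensor of an invariant submanifold\<close>

text \<open>The second derivatives of the immersion cancel by symmetry.\<close>

lemma nijenhuis_immersion:
  fixes \<iota> :: "'l::euclidean_space \<Rightarrow> 'e::euclidean_space" and \<Phi> :: "'e \<Rightarrow> 'e \<Rightarrow> 'e" and J :: "'l \<Rightarrow> 'l \<Rightarrow> 'l"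
  assumes W: "open W" "y \<in> W" and \<iota>: "smooth_on W \<iota>" and S: "open S" "\<iota> ` W \<subseteq> S"
    and \<Phi>: "\<And>v. smooth_on S (\<lambda>x. \<Phi> x v)" "\<And>x. x \<in> S \<Longrightarrow> linear (\<Phi> x)"
    and J: "\<And>v. smooth_on W (\<lambda>x. J x v)" "\<And>x. x \<in> W \<Longrightarrow> linear (J x)"
    and eq: "\<And>x v. x \<in> W \<Longrightarrow> fd \<iota> x (J x v) = \<Phi> (\<iota> x) (fd \<iota> x v)"
    and nij: "nijenhuis J (\<lambda>_. u) (\<lambda>_. v) y = 0"
  defines "a \<equiv> fd \<iota> y u" and "b \<equiv> fd \<iota> y v" and "x \<equiv> \<iota> y"
  shows "fd (\<lambda>x. \<Phi> x b) x (\<Phi> x a) - fd (\<lambda>x. \<Phi> x a) x (\<Phi> x b)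
     + \<Phi> x (fd (\<lambda>x. \<Phi> x a) x b - fd (\<lambda>x. \<Phi> x b) x a) = 0"
proof -
  have xS: "x \<in> S" using S(2) W(2) by (auto simp: x_def)
  define i where "i v = fd \<iota> y v" for v
  define H where "H v w = fd (\<lambda>y. fd \<iota> y v) y w" for v w
  define dJ where "dJ h v = fd (\<lambda>y. J y v) y h" for h v
  define d\<Phi> where "d\<Phi> h v = fd (\<lambda>x. \<Phi> x v) x h" for h v
  have li: "linear i" unfolding i_def[abs_def] by (rule linear_fd[OF smooth_on_differentiable[OF \<iota> W(2)]])
  have sym: "H v w = H w v" for v w
    unfolding H_def using \<iota> by (intro second_derivative_symmetric[OF W]) (simp add: smooth_on_def)
  have L\<Phi>: "linear (\<Phi> x)" by (rule \<Phi>(2)[OF xS])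
  have D\<iota>: "(\<iota> has_derivative i) (at y)"
    unfolding i_def[abs_def] by (rule smooth_on_has_derivative[OF \<iota> W(2)])
  have D2: "((\<lambda>z. fd \<iota> z w) has_derivative H w) (at y)" for w
    unfolding H_def by (rule smooth_on_has_derivative[OF smooth_on_fd[OF \<iota>] W(2)])
  \<comment> \<open>The intertwining relation \<open>eq\<close>, differentiated at \<open>y\<close>
    in direction \<open>h\<close>; \<open>H\<close> is the second derivative of the
    immersion.\<close>
  have main: "i (dJ h w) = d\<Phi> (i h) (i w) + \<Phi> x (H w h) - H (J y w) h" for h w
  proof -
    have dJd: "((\<lambda>z. J z w) has_derivative (\<lambda>h. dJ h w)) (at y)"
      unfolding dJ_def by (rule smooth_on_has_derivative[OF J(1) W(2)])
    have Jb: "((\<lambda>z. J z w \<bullet> e) has_derivative (\<lambda>h. dJ h w \<bullet> e)) (at y)" for e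
      by (rule has_derivative_inner_left[OF dJd])
    have L: "((\<lambda>z. \<Sum>e\<in>Basis. (J z w \<bullet> e) *\<^sub>R fd \<iota> z e) has_derivative
        (\<lambda>h. \<Sum>e\<in>Basis. (J y w \<bullet> e) *\<^sub>R H e h + (dJ h w \<bullet> e) *\<^sub>R i e)) (at y)"
      unfolding i_def by (intro has_derivative_sum has_derivative_scaleR Jb D2)
    have Lsum: "(\<Sum>e\<in>Basis. (J z w \<bullet> e) *\<^sub>R fd \<iota> z e) = fd \<iota> z (J z w)" if "z \<in> W" for z
      by (rule linear_sum_Basis[OF linear_fd[OF smooth_on_differentiable[OF \<iota> that]], symmetric])
    have Hlin: "(\<Sum>e\<in>Basis. (p \<bullet> e) *\<^sub>R H e h) = H p h" for p h
    proof -
      have "fd (\<lambda>z. fd \<iota> z p) y = fd (\<lambda>z. \<Sum>e\<in>Basis. (p \<bullet> e) *\<^sub>R fd \<iota> z e) y"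
        by (rule fd_cong_open[OF W]) (rule linear_sum_Basis[OF linear_fd[OF smooth_on_differentiable[OF \<iota>]]])
      also have "\<dots> = (\<lambda>h. \<Sum>e\<in>Basis. (p \<bullet> e) *\<^sub>R H e h)"
        by (rule fd_eqI) (intro has_derivative_sum has_derivative_scaleR_right D2)
      finally show ?thesis by (simp add: H_def)
    qed
    have R0: "((\<lambda>z. \<Phi> (\<iota> z) e) has_derivative (\<lambda>h. d\<Phi> (i h) e)) (at y)" for e
      using has_derivative_compose[OF D\<iota>, of "\<lambda>x. \<Phi> x e"] smooth_on_has_derivative[OF \<Phi>(1) xS, of e]
      by (simp add: d\<Phi>_def x_def)
    have Rb: "((\<lambda>z. fd \<iota> z w \<bullet> e) has_derivative (\<lambda>h. H w h \<bullet> e)) (at y)" for e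
      by (rule has_derivative_inner_left[OF D2])
    have R: "((\<lambda>z. \<Sum>e\<in>Basis. (fd \<iota> z w \<bullet> e) *\<^sub>R \<Phi> (\<iota> z) e) has_derivative
        (\<lambda>h. \<Sum>e\<in>Basis. (i w \<bullet> e) *\<^sub>R d\<Phi> (i h) e + (H w h \<bullet> e) *\<^sub>R \<Phi> x e)) (at y)"
      unfolding i_def[of w] x_def by (intro has_derivative_sum has_derivative_scaleR Rb R0)
    have Rsum: "(\<Sum>e\<in>Basis. (fd \<iota> z w \<bullet> e) *\<^sub>R \<Phi> (\<iota> z) e) = \<Phi> (\<iota> z) (fd \<iota> z w)" if "z \<in> W" for z
      using S(2) that by (intro linear_sum_Basis[symmetric] \<Phi>(2)) auto
    have d\<Phi>lin: "(\<Sum>e\<in>Basis. (p \<bullet> e) *\<^sub>R d\<Phi> h e) = d\<Phi> h p" for p h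
    proof -
      have "fd (\<lambda>z. \<Phi> z p) x = fd (\<lambda>z. \<Sum>e\<in>Basis. (p \<bullet> e) *\<^sub>R \<Phi> z e) x"
        by (rule fd_cong_open[OF S(1) xS]) (rule linear_sum_Basis[OF \<Phi>(2)])
      also have "\<dots> = (\<lambda>h. \<Sum>e\<in>Basis. (p \<bullet> e) *\<^sub>R d\<Phi> h e)"
        unfolding d\<Phi>_def
        by (rule fd_eqI) (intro has_derivative_sum has_derivative_scaleR_right smooth_on_has_derivative[OF \<Phi>(1) xS])
      finally show ?thesis by (simp add: d\<Phi>_def)
    qed
    have ee: "(\<Sum>e\<in>Basis. (J z w \<bullet> e) *\<^sub>R fd \<iota> z e) = (\<Sum>e\<in>Basis. (fd \<iota> z w \<bullet> e) *\<^sub>R \<Phi> (\<iota> z) e)" if "z \<in> W" for z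
      unfolding Lsum[OF that] Rsum[OF that] by (rule eq[OF that])
    have "(\<lambda>h. \<Sum>e\<in>Basis. (J y w \<bullet> e) *\<^sub>R H e h + (dJ h w \<bullet> e) *\<^sub>R i e) =
        (\<lambda>h. \<Sum>e\<in>Basis. (i w \<bullet> e) *\<^sub>R d\<Phi> (i h) e + (H w h \<bullet> e) *\<^sub>R \<Phi> x e)"
      by (rule has_derivative_unique[OF iffD1[OF has_derivative_cong_open[OF W ee] L] R])
    from fun_cong[OF this, of h]
    have "H (J y w) h + i (dJ h w) = d\<Phi> (i h) (i w) + \<Phi> x (H w h)"
      by (simp add: sum.distrib Hlin d\<Phi>lin linear_sum_Basis[OF li, symmetric] linear_sum_Basis[OF L\<Phi>, symmetric])
    then show ?thesis by (simp add: algebra_simps)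
  qed
  have c0: "frechet_derivative (\<lambda>_. w) (at y) h = 0" for w :: 'l and h
    using fd_eqI[OF has_derivative_const[of w "at y"]] by simp
  \<comment> \<open>For constant fields the bracket of \<open>u\<close> and \<open>v\<close>
    vanishes and only derivatives of \<open>J\<close> remain.\<close>
  have N: "nijenhuis J (\<lambda>_. u) (\<lambda>_. v) y = dJ (J y u) v - dJ (J y v) u + J y (dJ v u) - J y (dJ u v)"
    unfolding nijenhuis_def lie_bracket_def c0 dJ_def[symmetric]
    by (simp add: linear_neg[OF J(2)[OF W(2)]] linear_diff[OF J(2)[OF W(2)]] linear_0[OF J(2)[OF W(2)]])
  have Ji: "i (J y w) = \<Phi> x (i w)" for w using eq[OF W(2)] by (simp add: i_def x_def)
  from N have "i (dJ (J y u) v - dJ (J y v) u + J y (dJ v u) - J y (dJ u v)) = 0"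
    using nij linear_0[OF li] by simp
  then have "i (dJ (J y u) v) - i (dJ (J y v) u) + \<Phi> x (i (dJ v u)) - \<Phi> x (i (dJ u v)) = 0"
    by (simp only: linear_diff[OF li] linear_add[OF li] Ji)
  then have "d\<Phi> (\<Phi> x a) b - d\<Phi> (\<Phi> x b) a + \<Phi> x (d\<Phi> b a - d\<Phi> a b) = 0"
    unfolding main Ji
    by (simp add: linear_diff[OF L\<Phi>] linear_add[OF L\<Phi>] sym[of v u] sym[of "J y v" "J y u"] sym[of "J y v" u] sym[of "J y u" v]
        flip: i_def a_def b_def)
      (simp add: a_def b_def i_def algebra_simps)
  then show ?thesis by (simp add: d\<Phi>_def)
qed

subsection \<open>Leaves\<close>

text \<open>The leaf through a point is the union of the plaques that can be reached from it by a chain of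
  intersecting plaques. Since the transversal coordinate of one foliated chart is locally constant on
  the plaques of another one, a plaque meets only countably many plaques of a countable atlas.\<close>

locale foliated_atlas =
  fixes X :: "'m topology" and A :: "('m, 'e::euclidean_space) chart set" and \<eta> :: "('m, 'e) one_form"
    and C :: "nat \<Rightarrow> ('m, real \<times> 'l::euclidean_space) chart" and s :: "nat \<Rightarrow> real" and D :: "nat \<Rightarrow> 'l set"
  assumes man: "manifold Analytic X A"
    and fol: "\<And>i. foliated_chart X A \<eta> (C i) (s i) (D i)"
    and cover: "topspace X = (\<Union>i. fst (C i))"
begin

section \<open>Plaques and their parametrisation\<close>

definition tm :: "nat \<Rightarrow> 'm \<Rightarrow> real" where "tm i q = fst (snd (C i) q)"
definition pr :: "nat \<Rightarrow> 'm \<Rightarrow> 'l" where "pr i q = snd (snd (C i) q)"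
definition plaque :: "nat \<Rightarrow> real \<Rightarrow> 'm set" where "plaque i \<tau> = {q \<in> fst (C i). tm i q = \<tau>}"
definition emb :: "nat \<Rightarrow> real \<Rightarrow> 'l \<Rightarrow> 'm" where "emb i \<tau> y = chart_inv (C i) (\<tau>, y)"

lemma chC: "is_chart X (C i)" and imgC: "snd (C i) ` fst (C i) = {- s i<..<s i} \<times> D i"
  and openD: "open (D i)" and connD: "connected (D i)"
  and compC: "c \<in> A \<Longrightarrow> compatible Smooth c (C i)"
  and etaC: "c \<in> A \<Longrightarrow> q \<in> fst (C i) \<Longrightarrow> q \<in> fst c \<Longrightarrow> \<eta> c q = dmap c (tm i) q"
  using fol[of i] unfolding foliated_chart_def tm_def[abs_def] by auto

lemma chA: "c \<in> A \<Longrightarrow> is_chart X c" and coverA: "q \<in> topspace X \<Longrightarrow> \<exists>c\<in>A. q \<in> fst c"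
  using man unfolding manifold_def by auto

lemma C_top: "q \<in> fst (C i) \<Longrightarrow> q \<in> topspace X" and openC: "openin X (fst (C i))"
  using cover chC[of i] by (auto simp: is_chart_def)

lemma C_eq: "snd (C i) q = (tm i q, pr i q)"
  by (simp add: tm_def pr_def)

lemma emb_pr: "q \<in> plaque i \<tau> \<Longrightarrow> emb i \<tau> (pr i q) = q"
  using chart_inv_left[OF chC, of q i] by (auto simp: plaque_def emb_def C_eq)

lemma plaque_img: "q \<in> plaque i \<tau> \<Longrightarrow> pr i q \<in> D i \<and> \<bar>\<tau>\<bar> < s i"
proof -
  assume q: "q \<in> plaque i \<tau>"
  then have "snd (C i) q \<in> snd (C i) ` fst (C i)" by (simp add: plaque_def)
  then show ?thesis using q unfolding imgC C_eq by (auto simp: plaque_def)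
qed

lemma emb_in:
  assumes "y \<in> D i" "\<bar>\<tau>\<bar> < s i"
  shows "emb i \<tau> y \<in> plaque i \<tau>" "pr i (emb i \<tau> y) = y"
proof -
  have "(\<tau>, y) \<in> snd (C i) ` fst (C i)" using assms imgC by auto
  from chart_inv_right[OF this] chart_inv_in[OF this]
  show "emb i \<tau> y \<in> plaque i \<tau>" "pr i (emb i \<tau> y) = y"
    by (auto simp: emb_def plaque_def C_eq)
qed

lemma pr_inj: "inj_on (pr i) (plaque i \<tau>)"
  by (metis emb_pr inj_onI)

lemma pr_plaque: "\<bar>\<tau>\<bar> < s i \<Longrightarrow> pr i ` plaque i \<tau> = D i" 
  using emb_in plaque_img by (force simp: image_iff)

text \<open>The charts \<open>C i\<close> are compatible with those of \<open>A\<close> by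
  hypothesis, so each transition between two of them is factored locally through a chart of
  \<open>A\<close>.\<close>

lemma CC_smooth: "smooth_on (snd (C i) ` (fst (C i) \<inter> fst (C j))) (\<lambda>x. snd (C j) (chart_inv (C i) x))"
proof (rule smooth_on_local)
  fix x assume "x \<in> snd (C i) ` (fst (C i) \<inter> fst (C j))"
  then obtain q where q: "q \<in> fst (C i)" "q \<in> fst (C j)" "x = snd (C i) q" by blast
  obtain c where c: "c \<in> A" "q \<in> fst c" using coverA C_top q by blast
  define V where "V = fst (C i) \<inter> fst (C j) \<inter> fst c"
  have V: "openin X V" unfolding V_def using openC chA[OF c(1)] by (auto simp: is_chart_def)
  let ?T = "snd (C i) ` V"
  have T: "open ?T" by (rule chart_open_image[OF chC V]) (auto simp: V_def)
  have sm1: "smooth_on ?T (\<lambda>x. snd c (chart_inv (C i) x))"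
    using smooth_on_subset[OF compatible_smooth_transition(2)[OF compC[OF c(1), of i]], of ?T] by (auto simp: V_def)
  have o: "open (snd c ` (fst c \<inter> fst (C j)))" by (rule overlap_open[OF chA[OF c(1)] chC])
  have "smooth_on ?T (\<lambda>x. snd (C j) (chart_inv c (snd c (chart_inv (C i) x))))"
    by (rule smooth_on_compose[OF T o compatible_smooth_transition(1)[OF compC[OF c(1)]] sm1])
      (auto simp: V_def chart_inv_left[OF chC])
  then have "smooth_on ?T (\<lambda>x. snd (C j) (chart_inv (C i) x))"
    by (rule smooth_on_cong[OF T, rotated])
      (auto simp: V_def chart_inv_left[OF chC] chart_inv_left[OF chA[OF c(1)]])
  then show "\<exists>T. x \<in> T \<and> smooth_on T (\<lambda>x. snd (C j) (chart_inv (C i) x)) \<and> open T"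
    using T q c by (intro exI[of _ ?T]) (auto simp: V_def)
qed

lemma tm_chart_differentiable:
  assumes c: "c \<in> A" and q: "q \<in> fst c" "q \<in> fst (C j)"
  shows "((\<lambda>x. tm j (chart_inv c x)) has_derivative \<eta> c q) (at (snd c q))"
proof -
  have "((\<lambda>x. snd (C j) (chart_inv c x)) has_derivative dmap c (snd (C j)) q) (at (snd c q))"
    by (rule transition_has_derivative[OF chA[OF c] chC compatible_smooth_transition(1)[OF compC[OF c]] q])
  from bounded_linear.has_derivative[OF bounded_linear_fst this]
  have "((\<lambda>x. tm j (chart_inv c x)) has_derivative (\<lambda>v. fst (dmap c (snd (C j)) q v))) (at (snd c q))"
    by (simp add: tm_def)
  moreover from fd_eqI[OF this] have "dmap c (tm j) q = (\<lambda>v. fst (dmap c (snd (C j)) q v))"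
    by (simp add: dmap_def comp_def)
  ultimately show ?thesis using etaC[OF c q(2,1)] by simp
qed

lemma eta_dmap:
  assumes c: "c \<in> A" and q: "q \<in> fst c" "q \<in> fst (C j)" "q \<in> fst (C i)"
  shows "dmap (C i) (tm j) q w = \<eta> c q (dmap (C i) (snd c) q w)"
proof -
  have "dmap (C i) (tm j) q w = dmap c (tm j) q (dmap (C i) (snd c) q w)"
    by (rule dmap_chain(1)[OF chC chA[OF c] _ q(3,1)])
      (use compC[OF c] tm_chart_differentiable[OF c q(1,2)] in \<open>auto simp: compatible_commute[of _ "C i"] differentiable_def\<close>)
  then show ?thesis using etaC[OF c q(2,1)] by simp
qed

lemma dmap_tm: "q \<in> fst (C i) \<Longrightarrow> dmap (C i) (tm i) q w = fst w"
proof -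
  assume q: "q \<in> fst (C i)"
  have o: "open (snd (C i) ` fst (C i))" "snd (C i) q \<in> snd (C i) ` fst (C i)"
    using chC[of i] q by (auto simp: is_chart_def)
  have e: "fst x = tm i (chart_inv (C i) x)" if "x \<in> snd (C i) ` fst (C i)" for x
    using chart_inv_right[OF that] by (simp add: tm_def)
  have "(fst has_derivative fst) (at (snd (C i) q))" by (rule bounded_linear_imp_has_derivative[OF bounded_linear_fst])
  from fd_eqI[OF iffD1[OF has_derivative_cong_open[OF o e] this]]
  show ?thesis by (simp add: dmap_def comp_def)
qed

text \<open>\<open>\<eta> = dt\<close>, read in the coordinates of \<open>C i\<close>
  themselves.\<close>

lemma eta_fst:
  assumes c: "c \<in> A" and q: "q \<in> fst c" "q \<in> fst (C i)"
  shows "\<eta> c q (dmap (C i) (snd c) q w) = fst w"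
  using eta_dmap[OF c q q(2)] dmap_tm[OF q(2)] by metis

text \<open>The chart \<open>d\<close> is arbitrary because two kinds are needed: charts of
  \<open>A\<close>, to see that plaques are immersed, and other foliated charts, to compare plaques
  with each other.\<close>

lemma emb_smooth:
  fixes \<tau> :: real
  assumes d: "is_chart X d" "smooth_on (snd (C i) ` (fst (C i) \<inter> fst d)) (\<lambda>x. snd d (chart_inv (C i) x))"
  defines "S \<equiv> Pair \<tau> -` (snd (C i) ` (fst (C i) \<inter> fst d))"
  shows "open S" "smooth_on S (\<lambda>y. snd d (emb i \<tau> y))"
    "y \<in> S \<Longrightarrow> ((\<lambda>y. snd d (emb i \<tau> y)) has_derivative (\<lambda>v. dmap (C i) (snd d) (emb i \<tau> y) (0, v))) (at y)"
    "y \<in> S \<Longrightarrow> emb i \<tau> y \<in> fst d \<inter> plaque i \<tau> \<and> pr i (emb i \<tau> y) = y"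
    "q \<in> plaque i \<tau> \<Longrightarrow> q \<in> fst d \<Longrightarrow> pr i q \<in> S"
proof -
  have o: "open (snd (C i) ` (fst (C i) \<inter> fst d))" by (rule overlap_open[OF chC d(1)])
  have sP: "smooth_on T (\<lambda>y. (\<tau>, y))" if "open T" for T :: "'l set"
    by (rule smooth_on_Pair[OF that smooth_on_const[OF that] smooth_on_bounded_linear[OF that bounded_linear_ident]])
  show S: "open S" unfolding S_def by (rule open_vimage[OF o]) (intro continuous_intros)
  show "smooth_on S (\<lambda>y. snd d (emb i \<tau> y))"
    unfolding emb_def by (rule smooth_on_compose[OF S o d(2) sP[OF S]]) (auto simp: S_def)
  show in_S: "emb i \<tau> y \<in> fst d \<inter> plaque i \<tau> \<and> pr i (emb i \<tau> y) = y" if yS: "y \<in> S" for y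
  proof -
    obtain q where q: "q \<in> fst (C i)" "q \<in> fst d" "(\<tau>, y) = snd (C i) q" using yS unfolding S_def vimage_def by blast
    then have "emb i \<tau> y = q" using chart_inv_left[OF chC] by (simp add: emb_def)
    then show ?thesis using q by (auto simp: plaque_def C_eq)
  qed
  show "((\<lambda>y. snd d (emb i \<tau> y)) has_derivative (\<lambda>v. dmap (C i) (snd d) (emb i \<tau> y) (0, v))) (at y)" if y: "y \<in> S"
  proof -
    have q: "emb i \<tau> y \<in> fst (C i)" "emb i \<tau> y \<in> fst d" "snd (C i) (emb i \<tau> y) = (\<tau>, y)"
      using in_S[OF y] by (auto simp: plaque_def C_eq)
    have "((\<lambda>y. (\<tau>, y)) has_derivative (\<lambda>v. (0, v))) (at y)" by (auto intro!: derivative_eq_intros)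
    moreover have "((\<lambda>x. snd d (chart_inv (C i) x)) has_derivative dmap (C i) (snd d) (emb i \<tau> y)) (at (\<tau>, y))"
      using transition_has_derivative[OF chC d q(1,2)] q(3) by simp
    ultimately show ?thesis unfolding emb_def using has_derivative_compose by blast
  qed
  show "pr i q \<in> S" if "q \<in> plaque i \<tau>" "q \<in> fst d"
    using that by (auto simp: S_def plaque_def C_eq image_iff intro!: bexI[of _ q])
qed

text \<open>Along a plaque \<open>\<eta>\<close> vanishes, and \<open>tm j\<close> is a primitive of
  \<open>\<eta>\<close> too; so it is constant on a ball, where the plaque of \<open>C i\<close>
  stays within one plaque of \<open>C j\<close>.\<close>

lemma tm_locally_constant:
  assumes q: "q \<in> plaque i \<tau>" "q \<in> fst (C j)"
  obtains \<epsilon> where "\<epsilon> > 0" "\<And>y. y \<in> ball (pr i q) \<epsilon> \<Longrightarrow> emb i \<tau> y \<in> fst (C j) \<and> emb i \<tau> y \<in> plaque i \<tau> \<and>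
     pr i (emb i \<tau> y) = y \<and> tm j (emb i \<tau> y) = tm j q"
    "continuous_on (ball (pr i q) \<epsilon>) (\<lambda>y. pr j (emb i \<tau> y))"
proof -
  note e = emb_smooth[OF chC CC_smooth[of i j], where \<tau> = \<tau>]
  let ?S = "Pair \<tau> -` (snd (C i) ` (fst (C i) \<inter> fst (C j)))"
  have "pr i q \<in> ?S" by (rule e(5)[OF q])
  then obtain \<epsilon> where \<epsilon>: "\<epsilon> > 0" "ball (pr i q) \<epsilon> \<subseteq> ?S" using e(1) open_contains_ball by blast
  have "\<exists>k. \<forall>y\<in>ball (pr i q) \<epsilon>. tm j (emb i \<tau> y) = k"
  proof (rule has_derivative_zero_constant[OF convex_ball])
    fix y assume y: "y \<in> ball (pr i q) \<epsilon>"
    then have yS: "y \<in> ?S" using \<epsilon>(2) by blast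
    have Q: "emb i \<tau> y \<in> fst (C i)" "emb i \<tau> y \<in> fst (C j)" using e(4)[OF yS] by (auto simp: plaque_def)
    obtain c where c: "c \<in> A" "emb i \<tau> y \<in> fst c" using coverA C_top Q by blast
    have "((\<lambda>y. tm j (emb i \<tau> y)) has_derivative (\<lambda>v. fst (dmap (C i) (snd (C j)) (emb i \<tau> y) (0, v)))) (at y)"
      using bounded_linear.has_derivative[OF bounded_linear_fst e(3)[OF yS]] by (simp add: tm_def)
    moreover have "fst (dmap (C i) (snd (C j)) (emb i \<tau> y) w) = fst w" for w
    proof -
      have "((\<lambda>x. snd (C j) (chart_inv (C i) x)) has_derivative dmap (C i) (snd (C j)) (emb i \<tau> y)) (at (snd (C i) (emb i \<tau> y)))"
        by (rule transition_has_derivative[OF chC chC CC_smooth Q])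
      from fd_eqI[OF bounded_linear.has_derivative[OF bounded_linear_fst this]]
      have "dmap (C i) (tm j) (emb i \<tau> y) w = fst (dmap (C i) (snd (C j)) (emb i \<tau> y) w)"
        by (simp add: dmap_def comp_def tm_def)
      then show ?thesis using eta_dmap[OF c Q(2,1)] eta_fst[OF c Q(1)] by metis
    qed
    ultimately have "((\<lambda>y. tm j (emb i \<tau> y)) has_derivative (\<lambda>v. 0)) (at y)" by simp
    then show "((\<lambda>y. tm j (emb i \<tau> y)) has_derivative (\<lambda>v. 0)) (at y within ball (pr i q) \<epsilon>)"
      by (rule has_derivative_at_withinI)
  qed
  then have "tm j (emb i \<tau> y) = tm j q" if "y \<in> ball (pr i q) \<epsilon>" for y
    using that \<epsilon>(1) emb_pr[OF q(1)] by (metis centre_in_ball)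
  moreover have "continuous_on (ball (pr i q) \<epsilon>) (\<lambda>y. pr j (emb i \<tau> y))"
    unfolding pr_def[of j] using continuous_on_subset[OF smooth_on_continuous[OF e(2)] \<epsilon>(2)] by (intro continuous_intros)
  ultimately show thesis using that \<epsilon> e(4) by blast
qed

text \<open>One topology on the whole manifold in which every plaque is open. The leaves become open
  subspaces of it, so all their topologies are obtained at once.\<close>

definition leaf_topology :: "'m topology" where
  "leaf_topology = topology (\<lambda>S. S \<subseteq> topspace X \<and> (\<forall>i \<tau>. open (pr i ` (S \<inter> plaque i \<tau>))))"

lemma openin_leaf_topology:
  "openin leaf_topology S \<longleftrightarrow> S \<subseteq> topspace X \<and> (\<forall>i \<tau>. open (pr i ` (S \<inter> plaque i \<tau>)))"
proof -
  have "istopology (\<lambda>S. S \<subseteq> topspace X \<and> (\<forall>i \<tau>. open (pr i ` (S \<inter> plaque i \<tau>))))"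
    unfolding istopology_def
  proof (intro conjI allI impI)
    fix S T i \<tau>
    assume "S \<subseteq> topspace X \<and> (\<forall>i \<tau>. open (pr i ` (S \<inter> plaque i \<tau>)))" "T \<subseteq> topspace X \<and> (\<forall>i \<tau>. open (pr i ` (T \<inter> plaque i \<tau>)))"
    moreover have "pr i ` (S \<inter> T \<inter> plaque i \<tau>) = pr i ` (S \<inter> plaque i \<tau>) \<inter> pr i ` (T \<inter> plaque i \<tau>)"
      using inj_on_image_Int[OF pr_inj, of "S \<inter> plaque i \<tau>" i \<tau> "T \<inter> plaque i \<tau>"] by (simp add: Int_ac)
    ultimately show "open (pr i ` (S \<inter> T \<inter> plaque i \<tau>))" by auto
  next
    fix K i \<tau> assume K: "\<forall>S\<in>K. S \<subseteq> topspace X \<and> (\<forall>i \<tau>. open (pr i ` (S \<inter> plaque i \<tau>)))"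
    have "pr i ` (\<Union>K \<inter> plaque i \<tau>) = (\<Union>S\<in>K. pr i ` (S \<inter> plaque i \<tau>))" by auto
    then show "open (pr i ` (\<Union>K \<inter> plaque i \<tau>))" using K by auto
  qed auto
  from topology_inverse'[OF this] show ?thesis by (simp add: leaf_topology_def)
qed

text \<open>Openness has to be seen from every other chart: near each common point the plaque of
  \<open>C j\<close> lies in that of \<open>C i\<close> by local constancy of \<open>tm\<close>, and
  the change of plaque coordinates is continuous.\<close>

lemma openin_leaf_topology_plaque:
  assumes V: "V \<subseteq> plaque i \<tau>" "open (pr i ` V)"
  shows "openin leaf_topology V"
  unfolding openin_leaf_topology
proof (intro conjI allI)
  show "V \<subseteq> topspace X" using V C_top by (auto simp: plaque_def)
  fix j \<sigma>
  show "open (pr j ` (V \<inter> plaque j \<sigma>))"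
  proof (subst open_subopen, intro ballI)
    fix y assume "y \<in> pr j ` (V \<inter> plaque j \<sigma>)"
    then obtain q where q: "q \<in> V" "q \<in> plaque j \<sigma>" "y = pr j q" by blast
    have qi: "q \<in> plaque i \<tau>" "q \<in> fst (C i)" using V(1) q by (auto simp: plaque_def)
    obtain \<epsilon> where \<epsilon>: "\<epsilon> > 0" "\<And>y. y \<in> ball (pr j q) \<epsilon> \<Longrightarrow> emb j \<sigma> y \<in> fst (C i) \<and> emb j \<sigma> y \<in> plaque j \<sigma> \<and>
       pr j (emb j \<sigma> y) = y \<and> tm i (emb j \<sigma> y) = tm i q"
      "continuous_on (ball (pr j q) \<epsilon>) (\<lambda>y. pr i (emb j \<sigma> y))"
      using tm_locally_constant[OF q(2) qi(2)] by blast
    define T where "T = ball (pr j q) \<epsilon> \<inter> (\<lambda>y. pr i (emb j \<sigma> y)) -` (pr i ` V)"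
    have "open T" unfolding T_def by (rule continuous_open_preimage[OF \<epsilon>(3) open_ball V(2)])
    moreover have "y \<in> T" using \<epsilon>(1) q emb_pr[OF q(2)] by (simp add: T_def)
    moreover have "T \<subseteq> pr j ` (V \<inter> plaque j \<sigma>)"
    proof
      fix y' assume y': "y' \<in> T"
      let ?q = "emb j \<sigma> y'"
      have Q: "?q \<in> fst (C i)" "?q \<in> plaque j \<sigma>" "pr j ?q = y'" "tm i ?q = tm i q"
        using \<epsilon>(2)[of y'] y' by (auto simp: T_def)
      have "?q \<in> plaque i \<tau>" using Q qi by (simp add: plaque_def)
      moreover obtain q' where "q' \<in> V" "pr i ?q = pr i q'" using y' by (auto simp: T_def)
      ultimately have "?q \<in> V" using inj_onD[OF pr_inj] V(1) by blast
      then show "y' \<in> pr j ` (V \<inter> plaque j \<sigma>)" using Q by (intro image_eqI[of _ _ ?q]) auto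
    qed
    ultimately show "\<exists>T. open T \<and> y \<in> T \<and> T \<subseteq> pr j ` (V \<inter> plaque j \<sigma>)" by blast
  qed
qed

text \<open>The slice at height \<open>\<tau>\<close> of an open set of the chart image is
  open.\<close>

lemma openin_leaf_topology_finer:
  assumes "openin X S"
  shows "openin leaf_topology S"
  unfolding openin_leaf_topology
proof (intro conjI allI)
  show "S \<subseteq> topspace X" using assms openin_subset by blast
  fix i \<tau>
  have "open (snd (C i) ` (S \<inter> fst (C i)))"
    by (rule chart_open_image[OF chC]) (use assms openC in auto)
  then have "open (Pair \<tau> -` (snd (C i) ` (S \<inter> fst (C i))))"
    by (rule open_vimage) (intro continuous_intros)
  moreover have "pr i ` (S \<inter> plaque i \<tau>) = Pair \<tau> -` (snd (C i) ` (S \<inter> fst (C i)))"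
    by (auto simp: plaque_def C_eq image_iff)
  ultimately show "open (pr i ` (S \<inter> plaque i \<tau>))" by simp
qed

text \<open>Plaques are named by chart number and height rather than taken as sets, so that
  countability of chains becomes a statement about pairs.\<close>

definition meets :: "((nat \<times> real) \<times> (nat \<times> real)) set" where
  "meets = {(a, b). case_prod plaque a \<inter> case_prod plaque b \<noteq> {}}"

text \<open>The heights of the plaques of \<open>C j\<close> met by a given plaque are values of a
  function that is locally constant where it matters; by Lindelof countably many open sets on which
  it is constant suffice, so only countably many values occur.\<close>

lemma countable_meets:
  assumes Y: "countable Y"
  shows "countable (meets `` Y)"
proof -
  have one: "countable {\<sigma>. plaque i \<tau> \<inter> plaque j \<sigma> \<noteq> {}}" for i \<tau> j
  proof -
    define G where "G = (\<lambda>y. tm j (emb i \<tau> y))"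
    define F where "F = {B. open B \<and> (\<exists>k. \<forall>y\<in>B. G y = k)}"
    obtain F' where F': "F' \<subseteq> F" "countable F'" "\<Union>F' = \<Union>F"
      using Lindelof[of F] by (auto simp: F_def)
    have "{\<sigma>. plaque i \<tau> \<inter> plaque j \<sigma> \<noteq> {}} \<subseteq> (\<Union>B\<in>F'. G ` B)"
    proof
      fix \<sigma> assume "\<sigma> \<in> {\<sigma>. plaque i \<tau> \<inter> plaque j \<sigma> \<noteq> {}}"
      then obtain q where q: "q \<in> plaque i \<tau>" "q \<in> fst (C j)" "\<sigma> = tm j q" by (auto simp: plaque_def)
      obtain \<epsilon> where \<epsilon>: "\<epsilon> > 0" "\<And>y. y \<in> ball (pr i q) \<epsilon> \<Longrightarrow> tm j (emb i \<tau> y) = tm j q"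
        using tm_locally_constant[OF q(1,2)] by metis
      have "ball (pr i q) \<epsilon> \<in> F" using \<epsilon>(2) by (auto simp: F_def G_def)
      then have "pr i q \<in> \<Union>F'" using F'(3) \<epsilon>(1) by (metis UnionI centre_in_ball)
      moreover have "G (pr i q) = \<sigma>" using emb_pr[OF q(1)] q(3) by (simp add: G_def)
      ultimately show "\<sigma> \<in> (\<Union>B\<in>F'. G ` B)" by blast
    qed
    moreover have "countable (\<Union>B\<in>F'. G ` B)"
    proof (rule countable_UN[OF F'(2)])
      fix B assume "B \<in> F'"
      then obtain k where "\<forall>y\<in>B. G y = k" using F'(1) by (auto simp: F_def)
      then have "G ` B \<subseteq> {k}" by auto
      then show "countable (G ` B)" by (rule countable_subset) simp
    qed
    ultimately show ?thesis using countable_subset by blast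
  qed
  have "meets `` Y = (\<Union>a\<in>Y. \<Union>j. Pair j ` {\<sigma>. case_prod plaque a \<inter> plaque j \<sigma> \<noteq> {}})"
    by (auto simp: meets_def)
  moreover have "countable (\<Union>a\<in>Y. \<Union>j. Pair j ` {\<sigma>. case_prod plaque a \<inter> plaque j \<sigma> \<noteq> {}})"
    using one by (intro countable_UN Y countable_image) (auto split: prod.split)
  ultimately show ?thesis by simp
qed

text \<open>Countably many plaques are reached by chains, which makes the leaf second countable.
  Hausdorffness is inherited from \<open>X\<close> because the leaf topology is finer, and
  connectedness propagates along chains of connected plaques. The last claim, that every plaque
  meeting \<open>L\<close> belongs to \<open>P\<close>, is what later makes \<open>L\<close>
  relatively closed in larger integral manifolds.\<close>

lemma leaf_manifold:
  assumes start: "p0 \<in> plaque i0 \<tau>0"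
  defines "P \<equiv> meets\<^sup>* `` {(i0, \<tau>0)}"
  defines "L \<equiv> (\<Union>a\<in>P. case_prod plaque a)"
  defines "Y \<equiv> subtopology leaf_topology L"
  defines "B \<equiv> (\<lambda>(i, \<tau>). (plaque i \<tau>, pr i)) ` {(i, \<tau>) \<in> P. plaque i \<tau> \<noteq> {}}"
  shows "integral_manifold X A \<eta> Y B" "p0 \<in> topspace Y"
    "(plaque i0 \<tau>0, pr i0) \<in> B" "topspace Y = L"
    "\<And>q j \<sigma>. q \<in> L \<Longrightarrow> q \<in> plaque j \<sigma> \<Longrightarrow> (j, \<sigma>) \<in> P"
proof -
  have P0: "(i0, \<tau>0) \<in> P" by (auto simp: P_def)
  \<comment> \<open>\<open>countable_meets\<close> bounds one step of a chain, and countability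
    survives iteration.\<close>
  have cP: "countable P" unfolding P_def by (rule countable_rtrancl[OF countable_meets]) auto
  show sat: "(j, \<sigma>) \<in> P" if qL: "q \<in> L" and qj: "q \<in> plaque j \<sigma>" for q j \<sigma>
  proof -
    obtain a where a: "a \<in> P" "q \<in> case_prod plaque a" using qL unfolding L_def by blast
    then have "(a, (j, \<sigma>)) \<in> meets" using qj by (auto simp: meets_def)
    moreover have "((i0, \<tau>0), a) \<in> meets\<^sup>*" using a(1) by (simp add: P_def)
    ultimately have "((i0, \<tau>0), (j, \<sigma>)) \<in> meets\<^sup>*" by (rule rtrancl_into_rtrancl[rotated])
    then show ?thesis by (simp add: P_def)
  qed
  have plaqueL: "plaque i \<tau> \<subseteq> L" if "(i, \<tau>) \<in> P" for i \<tau> using that by (force simp: L_def)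
  have plaque_open: "openin leaf_topology (plaque i \<tau>)" for i \<tau>
  proof (rule openin_leaf_topology_plaque[OF subset_refl])
    show "open (pr i ` plaque i \<tau>)"
    proof (cases "\<bar>\<tau>\<bar> < s i")
      case True
      then show ?thesis using pr_plaque openD by simp
    next
      case False
      then have "plaque i \<tau> = {}" using plaque_img by blast
      then show ?thesis by simp
    qed
  qed
  have L_open: "openin leaf_topology L" unfolding L_def using plaque_open by (auto intro!: openin_Union)
  have LX: "L \<subseteq> topspace X" using L_open openin_leaf_topology by blast
  have openY: "openin Y V \<longleftrightarrow> openin leaf_topology V \<and> V \<subseteq> L" for V
    unfolding Y_def by (rule openin_open_subtopology[OF L_open])
  show tY: "topspace Y = L"
    unfolding Y_def using openin_subset[OF L_open] by auto
  show p0: "p0 \<in> topspace Y" using plaqueL[OF P0] start tY by auto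
  show startB: "(plaque i0 \<tau>0, pr i0) \<in> B"
    using P0 start unfolding B_def by (intro image_eqI[of _ _ "(i0, \<tau>0)"]) auto
  have B_cases: "\<exists>i \<tau>. b = (plaque i \<tau>, pr i) \<and> (i, \<tau>) \<in> P \<and> \<bar>\<tau>\<bar> < s i" if "b \<in> B" for b
    using that plaque_img unfolding B_def by fast
  have chB: "is_chart Y (plaque i \<tau>, pr i)" if iP: "(i, \<tau>) \<in> P" and \<tau>: "\<bar>\<tau>\<bar> < s i" for i \<tau>
  proof (rule is_chartI)
    show "openin Y (plaque i \<tau>)" using plaque_open plaqueL[OF iP] openY by blast
    show "open (pr i ` plaque i \<tau>)" using pr_plaque[OF \<tau>] openD by simp
    show "inj_on (pr i) (plaque i \<tau>)" by (rule pr_inj)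
    show "open (pr i ` V)" if "openin Y V" "V \<subseteq> plaque i \<tau>" for V
      using that openY openin_leaf_topology by (metis Int_absorb2)
    show "openin Y {q \<in> plaque i \<tau>. pr i q \<in> T}" if "open T" for T
    proof -
      have "pr i ` {q \<in> plaque i \<tau>. pr i q \<in> T} = D i \<inter> T" using pr_plaque[OF \<tau>] by auto
      then have "openin leaf_topology {q \<in> plaque i \<tau>. pr i q \<in> T}"
        using openD that by (intro openin_leaf_topology_plaque[of _ i \<tau>]) auto
      then show ?thesis using openY plaqueL[OF iP] by blast
    qed
  qed
  have invB: "chart_inv (plaque i \<tau>, pr i) y = emb i \<tau> y" if "y \<in> pr i ` plaque i \<tau>" for i \<tau> y
    using that pr_inj emb_pr by (auto simp: chart_inv_def)
  have comp: "compatible Smooth (plaque i \<tau>, pr i) (plaque j \<sigma>, pr j)" if ij: "\<bar>\<tau>\<bar> < s i" "\<bar>\<sigma>\<bar> < s j" for i j \<tau> \<sigma>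
  proof -
    have 1: "smooth_on (pr i ` (plaque i \<tau> \<inter> plaque j \<sigma>)) (\<lambda>y. pr j (chart_inv (plaque i \<tau>, pr i) y))" for i \<tau> j \<sigma>
    proof -
      note e = emb_smooth[OF chC CC_smooth[of i j], where \<tau> = \<tau>]
      have sub: "pr i ` (plaque i \<tau> \<inter> plaque j \<sigma>) \<subseteq> Pair \<tau> -` (snd (C i) ` (fst (C i) \<inter> fst (C j)))"
        using e(5) by (auto simp: plaque_def)
      have o: "open (pr i ` (plaque i \<tau> \<inter> plaque j \<sigma>))"
        using plaque_open[of j \<sigma>] openin_leaf_topology by (simp add: Int_commute)
      have "smooth_on (pr i ` (plaque i \<tau> \<inter> plaque j \<sigma>)) (\<lambda>y. snd (snd (C j) (emb i \<tau> y)))"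
        by (rule smooth_on_bounded_linear_o[OF o bounded_linear_snd smooth_on_subset[OF e(2) sub]])
      then show ?thesis
        by (rule smooth_on_cong[OF o, rotated]) (auto simp: invB pr_def)
    qed
    show ?thesis
      unfolding compatible_def regular_on_def using 1[of i \<tau> j \<sigma>] 1[of j \<sigma> i \<tau>] by (simp add: comp_def Int_commute)
  qed
  have cont: "continuous_map Y X (\<lambda>p. p)"
  proof -
    have "openin Y {q \<in> topspace Y. q \<in> U}" if "openin X U" for U
    proof -
      have "{q \<in> topspace Y. q \<in> U} = L \<inter> U" using tY by auto
      then show ?thesis using openin_leaf_topology_finer[OF that] L_open openY by auto
    qed
    then show ?thesis using tY LX by (auto simp: continuous_map_def)
  qed
  have man: "manifold Smooth Y B"
    unfolding manifold_def
  proof (intro conjI ballI)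
    have HX: "Hausdorff_space X" using man by (simp add: manifold_def)
    show "Hausdorff_space Y" unfolding Hausdorff_space_def
    proof (intro allI impI)
      fix x y assume xy: "x \<in> topspace Y \<and> y \<in> topspace Y \<and> x \<noteq> y"
      then have "x \<in> topspace X" "y \<in> topspace X" using tY LX by auto
      then obtain U V where UV: "openin X U" "openin X V" "x \<in> U" "y \<in> V" "disjnt U V"
        using HX xy unfolding Hausdorff_space_def by blast
      have "openin Y (L \<inter> U)" "openin Y (L \<inter> V)"
        using openin_leaf_topology_finer UV L_open openY by auto
      then show "\<exists>U V. openin Y U \<and> openin Y V \<and> x \<in> U \<and> y \<in> V \<and> disjnt U V"
        using UV xy tY by (intro exI[of _ "L \<inter> U"] exI[of _ "L \<inter> V"]) (auto simp: disjnt_def)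
    qed
    show "second_countable Y"
    proof -
      obtain \<B> :: "'l set set" where \<B>: "countable \<B>" "\<And>B. B \<in> \<B> \<Longrightarrow> open B" "\<And>S. open S \<Longrightarrow> \<exists>\<U>. \<U> \<subseteq> \<B> \<and> S = \<Union>\<U>"
        using univ_second_countable by blast
      \<comment> \<open>Countably many plaques, each with a countable base pulled back from the
        model space.\<close>
      define \<V> where "\<V> = (\<lambda>((i, \<tau>), T). {q \<in> plaque i \<tau>. pr i q \<in> T}) ` (P \<times> \<B>)"
      have "countable \<V>" unfolding \<V>_def using cP \<B>(1) by (intro countable_image countable_SIGMA)
      moreover have "openin Y V" if V\<V>: "V \<in> \<V>" for V
      proof -
        obtain i \<tau> T where V: "(i, \<tau>) \<in> P" "T \<in> \<B>" "V = {q \<in> plaque i \<tau>. pr i q \<in> T}"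
          using V\<V> by (auto simp: \<V>_def)
        show ?thesis
        proof (cases "\<bar>\<tau>\<bar> < s i")
          case True
          from chart_open_vimage[OF chB[OF V(1) True] \<B>(2)[OF V(2)]] show ?thesis by (simp add: V(3))
        next
          case False
          then have "V = {}" using plaque_img V(3) by blast
          then show ?thesis by simp
        qed
      qed
      moreover have "\<exists>V\<in>\<V>. x \<in> V \<and> V \<subseteq> U" if U: "openin Y U" "x \<in> U" for U x
      proof -
        have "x \<in> L" using U openin_subset tY by blast
        then obtain i \<tau> where i: "(i, \<tau>) \<in> P" "x \<in> plaque i \<tau>" by (auto simp: L_def)
        have "open (pr i ` (U \<inter> plaque i \<tau>))" using U openY openin_leaf_topology by blast
        then obtain \<U> where \<U>: "\<U> \<subseteq> \<B>" "pr i ` (U \<inter> plaque i \<tau>) = \<Union>\<U>" using \<B>(3) by blast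
        moreover have "pr i x \<in> pr i ` (U \<inter> plaque i \<tau>)" using U i by blast
        ultimately obtain T where T: "T \<in> \<B>" "pr i x \<in> T" "T \<subseteq> pr i ` (U \<inter> plaque i \<tau>)" by blast
        let ?V = "{q \<in> plaque i \<tau>. pr i q \<in> T}"
        have VU: "?V \<subseteq> U"
        proof
          fix q assume q: "q \<in> ?V"
          then obtain q' where "q' \<in> U \<inter> plaque i \<tau>" "pr i q = pr i q'" using T(3) by blast
          then show "q \<in> U" using inj_onD[OF pr_inj, of i q q' \<tau>] q by simp
        qed
        have "?V \<in> \<V>" unfolding \<V>_def
          by (rule image_eqI[of _ _ "((i, \<tau>), T)"]) (use i(1) T(1) in auto)
        then show ?thesis using VU i(2) T(2) by (intro bexI[of _ ?V]) auto
      qed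
      ultimately show ?thesis unfolding second_countable_def by blast
    qed
    show "connected_space Y"
      unfolding connected_space_def
    proof
      assume "\<exists>E1 E2. openin Y E1 \<and> openin Y E2 \<and> topspace Y \<subseteq> E1 \<union> E2 \<and> E1 \<inter> E2 = {} \<and> E1 \<noteq> {} \<and> E2 \<noteq> {}"
      then obtain E1 E2 where E: "openin Y E1" "openin Y E2" "L \<subseteq> E1 \<union> E2" "E1 \<inter> E2 = {}" "E1 \<noteq> {}" "E2 \<noteq> {}"
        unfolding tY by blast
      \<comment> \<open>In plaque coordinates a nonempty plaque is the connected set
        \<open>D i\<close>, so it lies on one side of any separation; an intersecting plaque then
        lies on the same side.\<close>
      have dich: "plaque i \<tau> \<subseteq> E \<or> plaque i \<tau> \<inter> E = {}" if i: "(i, \<tau>) \<in> P" and E': "E = E1 \<or> E = E2" for i \<tau> E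
      proof (cases "\<bar>\<tau>\<bar> < s i")
        case True
        have o: "open (pr i ` (E1 \<inter> plaque i \<tau>))" "open (pr i ` (E2 \<inter> plaque i \<tau>))"
          using E(1,2) openY openin_leaf_topology by blast+
        have "pr i ` (E1 \<inter> plaque i \<tau>) \<inter> pr i ` (E2 \<inter> plaque i \<tau>) \<inter> D i = {}"
        proof -
          have "pr i ` ((E1 \<inter> plaque i \<tau>) \<inter> (E2 \<inter> plaque i \<tau>)) = {}" using E(4) by blast
          then show ?thesis using inj_on_image_Int[OF pr_inj, of "E1 \<inter> plaque i \<tau>" i \<tau> "E2 \<inter> plaque i \<tau>"] by simp
        qed
        moreover have "D i \<subseteq> pr i ` (E1 \<inter> plaque i \<tau>) \<union> pr i ` (E2 \<inter> plaque i \<tau>)"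
          using pr_plaque[OF True] plaqueL[OF i] E(3) by blast
        ultimately have "pr i ` (E1 \<inter> plaque i \<tau>) \<inter> D i = {} \<or> pr i ` (E2 \<inter> plaque i \<tau>) \<inter> D i = {}"
          using connectedD[OF connD[of i] o] by blast
        then have "E1 \<inter> plaque i \<tau> = {} \<or> E2 \<inter> plaque i \<tau> = {}" using pr_plaque[OF True] by blast
        then show ?thesis using E' plaqueL[OF i] E(3) by blast
      next
        case False
        then have "plaque i \<tau> = {}" using plaque_img by blast
        then show ?thesis by blast
      qed
      have all: "L \<subseteq> E" if E': "E = E1 \<or> E = E2" and p: "p0 \<in> E" for E
      proof -
        have "plaque i \<tau> \<subseteq> E" if "((i0, \<tau>0), (i, \<tau>)) \<in> meets\<^sup>*" for i \<tau>
          using that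
        proof (induction "(i, \<tau>)" arbitrary: i \<tau> rule: rtrancl_induct)
          case base
          then show ?case using dich[OF P0 E'] p start by blast
        next
          case (step a)
          obtain j \<sigma> where a: "a = (j, \<sigma>)" by (cases a)
          have "(i, \<tau>) \<in> P" unfolding P_def using rtrancl_into_rtrancl[OF step(1,2)] by simp
          moreover have "plaque j \<sigma> \<subseteq> E" using step(3) a by blast
          moreover have "plaque j \<sigma> \<inter> plaque i \<tau> \<noteq> {}" using step(2) a by (auto simp: meets_def)
          ultimately show ?case using dich[OF _ E'] by blast
        qed
        then show ?thesis by (auto simp: L_def P_def)
      qed
      have "p0 \<in> E1 \<or> p0 \<in> E2" using p0 tY E(3) by blast
      moreover have "E1 \<subseteq> L" "E2 \<subseteq> L" using E(1,2) openY by blast+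
      ultimately show False using all E(4,5,6) by blast
    qed
    show "topspace Y = (\<Union>b\<in>B. fst b)"
      unfolding tY L_def B_def by (auto split: prod.splits)
    show "is_chart Y b" if "b \<in> B" for b using B_cases[OF that] chB by blast
    show "compatible Smooth b b'" if "b \<in> B" "b' \<in> B" for b b'
      using B_cases[OF that(1)] B_cases[OF that(2)] comp by blast
  qed
  \<comment> \<open>In the coordinates of \<open>C i\<close> a plaque is a slice: its tangent
    vectors have first component 0, and \<open>\<eta>\<close> is the first component.\<close>
  have leafc: "smooth_on (snd b ` (fst b \<inter> fst c)) (snd c \<circ> chart_inv b) \<and>
      (\<forall>p\<in>fst b \<inter> fst c. inj (dmap b (snd c) p) \<and> range (dmap b (snd c) p) = {v. \<eta> c p v = 0})"
    if b: "b \<in> B" and c: "c \<in> A" for b c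
  proof -
    obtain i \<tau> where i: "b = (plaque i \<tau>, pr i)" "(i, \<tau>) \<in> P" "\<bar>\<tau>\<bar> < s i" using B_cases[OF b] by blast
    have cC: "compatible Smooth (C i) c" using compC[OF c] compatible_commute by blast
    note e = emb_smooth[OF chA[OF c] compatible_smooth_transition(1)[OF cC], where \<tau> = \<tau>]
    have ob: "open (pr i ` (plaque i \<tau> \<inter> fst c))"
      using openin_leaf_topology_finer[of "fst c"] chA[OF c] openin_leaf_topology by (simp add: is_chart_def Int_commute)
    have sub: "pr i ` (plaque i \<tau> \<inter> fst c) \<subseteq> Pair \<tau> -` (snd (C i) ` (fst (C i) \<inter> fst c))"
      using e(5) by auto
    have cong: "snd c (emb i \<tau> y) = (snd c \<circ> chart_inv b) y" if "y \<in> pr i ` (plaque i \<tau> \<inter> fst c)" for y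
      using invB[of y i \<tau>] that i(1) by auto
    have 1: "smooth_on (pr i ` (plaque i \<tau> \<inter> fst c)) (snd c \<circ> chart_inv b)"
      by (rule smooth_on_cong[OF ob cong smooth_on_subset[OF e(2) sub]])
    have "inj (dmap b (snd c) p) \<and> range (dmap b (snd c) p) = {v. \<eta> c p v = 0}" if p: "p \<in> plaque i \<tau>" "p \<in> fst c" for p
    proof -
      have pC: "p \<in> fst (C i)" using p by (simp add: plaque_def)
      have m: "pr i p \<in> pr i ` (plaque i \<tau> \<inter> fst c)" using p by blast
      have "dmap b (snd c) p = (\<lambda>v. dmap (C i) (snd c) p (0, v))"
        using fd_eqI[OF iffD1[OF has_derivative_cong_open[OF ob m cong] e(3)[OF subsetD[OF sub m]]]] emb_pr[OF p(1)]
        by (simp add: dmap_def i(1) comp_def)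
      moreover have "inj (\<lambda>v. dmap (C i) (snd c) p (0, v))"
      proof (rule injI)
        fix v w assume "dmap (C i) (snd c) p (0, v) = dmap (C i) (snd c) p (0, w)"
        then have "dmap c (snd (C i)) p (dmap (C i) (snd c) p (0, v)) = dmap c (snd (C i)) p (dmap (C i) (snd c) p (0, w))"
          by simp
        then show "v = w" by (simp add: dmap_inverse[OF chC chA[OF c] cC pC p(2)])
      qed
      moreover have "range (\<lambda>v. dmap (C i) (snd c) p (0, v)) = {v. \<eta> c p v = 0}"
      proof
        show "range (\<lambda>v. dmap (C i) (snd c) p (0, v)) \<subseteq> {v. \<eta> c p v = 0}"
          using eta_fst[OF c p(2) pC] by auto
        show "{v. \<eta> c p v = 0} \<subseteq> range (\<lambda>v. dmap (C i) (snd c) p (0, v))"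
        proof
          fix v assume v: "v \<in> {v. \<eta> c p v = 0}"
          have e2: "dmap (C i) (snd c) p (dmap c (snd (C i)) p v) = v"
            by (rule dmap_inverse[OF chA[OF c] chC compC[OF c] p(2) pC])
          then have "fst (dmap c (snd (C i)) p v) = 0"
            using eta_fst[OF c p(2) pC, of "dmap c (snd (C i)) p v"] v by simp
          then show "v \<in> range (\<lambda>v. dmap (C i) (snd c) p (0, v))"
            using e2 by (metis prod.collapse rangeI)
        qed
      qed
      ultimately show ?thesis by simp
    qed
    then show ?thesis using 1 by (simp add: i(1))
  qed
  show "integral_manifold X A \<eta> Y B"
    unfolding integral_manifold_def using man cont leafc by blast
qed

text \<open>Tangent vectors of an integral manifold are killed by \<open>\<eta>\<close>, so
  \<open>tm j\<close> has zero derivative along it and is constant on a ball of a chart of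
  \<open>Y'\<close>.\<close>

lemma integral_manifold_in_plaque:
  fixes B' :: "('m, 'l) chart set"
  assumes im: "integral_manifold X A \<eta> Y' B'" and q: "q \<in> topspace Y'" "q \<in> plaque j \<sigma>"
  obtains N where "openin Y' N" "q \<in> N" "N \<subseteq> plaque j \<sigma>"
proof -
  have manY: "manifold Smooth Y' B'" and cont: "continuous_map Y' X (\<lambda>p. p)"
    using im unfolding integral_manifold_def by blast+
  obtain b where b: "b \<in> B'" "q \<in> fst b" using manY q(1) unfolding manifold_def by blast
  have chb: "is_chart Y' b" using manY b unfolding manifold_def by blast
  have YX: "openin Y' (fst b \<inter> U)" if "openin X U" for U
  proof -
    have "openin Y' {p \<in> topspace Y'. p \<in> U}" using cont that unfolding continuous_map_def by blast
    moreover have "openin Y' (fst b)" using chb by (simp add: is_chart_def)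
    moreover have "fst b \<inter> U = fst b \<inter> {p \<in> topspace Y'. p \<in> U}" using openin_subset[OF \<open>openin Y' (fst b)\<close>] by auto
    ultimately show ?thesis by (simp add: openin_Int)
  qed
  have qj: "q \<in> fst (C j)" "tm j q = \<sigma>" using q(2) by (auto simp: plaque_def)
  have "openin Y' (fst b \<inter> fst (C j))" by (rule YX[OF openC])
  then have "open (snd b ` (fst b \<inter> fst (C j)))" by (rule chart_open_image[OF chb]) simp
  then obtain \<epsilon> where \<epsilon>: "\<epsilon> > 0" "ball (snd b q) \<epsilon> \<subseteq> snd b ` (fst b \<inter> fst (C j))"
    using b(2) qj(1) open_contains_ball by (metis IntI imageI)
  have "\<exists>k. \<forall>y\<in>ball (snd b q) \<epsilon>. tm j (chart_inv b y) = k"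
  proof (rule has_derivative_zero_constant[OF convex_ball])
    fix y assume y: "y \<in> ball (snd b q) \<epsilon>"
    then obtain p where p: "p \<in> fst b" "p \<in> fst (C j)" "y = snd b p" using \<epsilon>(2) by blast
    obtain c where c: "c \<in> A" "p \<in> fst c" using coverA C_top p by blast
    have sm: "smooth_on (snd b ` (fst b \<inter> fst c)) (snd c \<circ> chart_inv b)"
      and rng: "range (dmap b (snd c) p) = {v. \<eta> c p v = 0}"
      using im b(1) c p(1) unfolding integral_manifold_def by blast+
    have ob: "open (snd b ` (fst b \<inter> fst c))"
      by (rule chart_open_image[OF chb YX]) (use chA[OF c(1)] in \<open>auto simp: is_chart_def\<close>)
    have m: "snd b p \<in> snd b ` (fst b \<inter> fst c)" using p c by blast
    have 1: "((\<lambda>x. snd c (chart_inv b x)) has_derivative dmap b (snd c) p) (at (snd b p))"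
      using smooth_on_has_derivative[OF sm m] by (simp add: dmap_def comp_def)
    have "((\<lambda>x. tm j (chart_inv c x)) has_derivative \<eta> c p) (at (snd c (chart_inv b (snd b p))))"
      using tm_chart_differentiable[OF c p(2)] by (simp add: chart_inv_left[OF chb p(1)])
    from has_derivative_compose[OF 1 this]
    have 2: "((\<lambda>x. tm j (chart_inv c (snd c (chart_inv b x)))) has_derivative (\<lambda>v. \<eta> c p (dmap b (snd c) p v))) (at (snd b p))" .
    have 3: "tm j (chart_inv c (snd c (chart_inv b x))) = tm j (chart_inv b x)" if "x \<in> snd b ` (fst b \<inter> fst c)" for x
      using that chart_inv_left[OF chb] chart_inv_left[OF chA[OF c(1)]] by auto
    have "((\<lambda>x. tm j (chart_inv b x)) has_derivative (\<lambda>v. \<eta> c p (dmap b (snd c) p v))) (at y)"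
      unfolding p(3) by (rule iffD1[OF has_derivative_cong_open[OF ob m 3] 2])
    moreover have "\<eta> c p (dmap b (snd c) p v) = 0" for v using rng by blast
    ultimately show "((\<lambda>x. tm j (chart_inv b x)) has_derivative (\<lambda>v. 0)) (at y within ball (snd b q) \<epsilon>)"
      using has_derivative_at_withinI by auto
  qed
  then have const: "tm j (chart_inv b y) = \<sigma>" if "y \<in> ball (snd b q) \<epsilon>" for y
    using that \<epsilon>(1) chart_inv_left[OF chb b(2)] qj(2) by (metis centre_in_ball)
  show thesis
  proof (rule that)
    show "openin Y' {p \<in> fst b. snd b p \<in> ball (snd b q) \<epsilon>}" by (rule chart_open_vimage[OF chb open_ball])
    show "q \<in> {p \<in> fst b. snd b p \<in> ball (snd b q) \<epsilon>}" using b \<epsilon> by simp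
    show "{p \<in> fst b. snd b p \<in> ball (snd b q) \<epsilon>} \<subseteq> plaque j \<sigma>"
    proof
      fix p assume p: "p \<in> {p \<in> fst b. snd b p \<in> ball (snd b q) \<epsilon>}"
      then have "snd b p \<in> snd b ` (fst b \<inter> fst (C j))" using \<epsilon>(2) by blast
      then have "p \<in> fst (C j)" using chart_inv_left[OF chb] p by (metis (no_types, lifting) IntE imageE mem_Collect_eq)
      then show "p \<in> plaque j \<sigma>" using const[of "snd b p"] p chart_inv_left[OF chb, of p] by (simp add: plaque_def)
    qed
  qed
qed

text \<open>Maximality: in a larger integral manifold \<open>Y'\<close> the set \<open>L\<close> is
  open, as each of its points has a neighbourhood inside a plaque of \<open>L\<close>. Its
  complement is open too, since a plaque that meets \<open>L\<close> is contained in
  \<open>L\<close>. Connectedness of \<open>Y'\<close> leaves only \<open>L\<close>.\<close>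

lemma leaf_through:
  assumes "p0 \<in> topspace X"
  obtains Y i \<tau> and B :: "('m, 'l) chart set"
  where "leaf X A \<eta> Y B" "(plaque i \<tau>, pr i) \<in> B" "p0 \<in> plaque i \<tau>"
proof -
  obtain i0 where "p0 \<in> fst (C i0)" using assms cover by blast
  then have start: "p0 \<in> plaque i0 (tm i0 p0)" by (simp add: plaque_def)
  define P where "P = meets\<^sup>* `` {(i0, tm i0 p0)}"
  define L where "L = (\<Union>a\<in>P. case_prod plaque a)"
  define Y where "Y = subtopology leaf_topology L"
  define B where "B = (\<lambda>(i, \<tau>). (plaque i \<tau>, pr i)) ` {(i, \<tau>) \<in> P. plaque i \<tau> \<noteq> {}}"
  note lm = leaf_manifold[OF start, folded P_def, folded L_def B_def, folded Y_def]
  have "topspace Y' = topspace Y" if im: "integral_manifold X A \<eta> Y' B'" and sub: "topspace Y \<subseteq> topspace Y'"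
    for Y' and B' :: "('m, 'l) chart set"
  proof -
    have conn: "connected_space Y'" and YX: "topspace Y' \<subseteq> topspace X"
      using im unfolding integral_manifold_def manifold_def continuous_map_def by auto
    have "openin Y' L"
    proof (subst openin_subopen, intro ballI)
      fix q assume q: "q \<in> L"
      then obtain i \<tau> where i: "(i, \<tau>) \<in> P" "q \<in> plaque i \<tau>" by (auto simp: L_def)
      have "q \<in> topspace Y'" using q sub lm(4) by blast
      from integral_manifold_in_plaque[OF im this i(2)] obtain N where N: "openin Y' N" "q \<in> N" "N \<subseteq> plaque i \<tau>" .
      have "plaque i \<tau> \<subseteq> L" using i(1) by (force simp: L_def)
      then show "\<exists>T. openin Y' T \<and> q \<in> T \<and> T \<subseteq> L" using N by blast
    qed
    moreover have "openin Y' (topspace Y' - L)"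
    proof (subst openin_subopen, intro ballI)
      fix q assume q: "q \<in> topspace Y' - L"
      then obtain j where j: "q \<in> fst (C j)" using YX cover by blast
      then have qp: "q \<in> plaque j (tm j q)" by (simp add: plaque_def)
      obtain N where N: "openin Y' N" "q \<in> N" "N \<subseteq> plaque j (tm j q)"
        using integral_manifold_in_plaque[OF im _ qp] q by blast
      have "N \<inter> L = {}"
      proof (rule ccontr)
        assume "N \<inter> L \<noteq> {}"
        then obtain x where "x \<in> L" "x \<in> plaque j (tm j q)" using N(3) by blast
        from lm(5)[OF this] have "q \<in> L" using qp by (force simp: L_def)
        then show False using q by blast
      qed
      then show "\<exists>T. openin Y' T \<and> q \<in> T \<and> T \<subseteq> topspace Y' - L"
        using N openin_subset[OF N(1)] by blast
    qed
    moreover have "p0 \<in> L" using lm(2,4) by blast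
    ultimately have "topspace Y' - L = {}"
      using conn unfolding connected_space_def by (metis Diff_disjoint Un_Diff_cancel Un_upper2 empty_iff)
    then show ?thesis using sub lm(4) by blast
  qed
  then have "leaf X A \<eta> Y B" unfolding leaf_def using lm(1) by blast
  then show thesis using that lm(3) start by blast
qed

end

subsection \<open>The local expressions at a point\<close>

lemma ext_bilinear_add:
  assumes "bilinear h"
  shows "ext_bilinear h (u + u') w = ext_bilinear h u w + ext_bilinear h u' w"
    "ext_bilinear h w (u + u') = ext_bilinear h w u + ext_bilinear h w u'"
  by (simp_all add: ext_bilinear_def bilinear_ladd[OF assms] bilinear_radd[OF assms] complex_eq_iff)

lemma ext_bilinear_cscale:
  assumes "bilinear h"
  shows "ext_bilinear h (z *\<^sub>c u) w = z * ext_bilinear h u w"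
    "ext_bilinear h w (z *\<^sub>c u) = z * ext_bilinear h w u"
  by (simp_all add: ext_bilinear_def cscale_def bilinear_ladd[OF assms] bilinear_radd[OF assms]
      bilinear_lsub[OF assms] bilinear_rsub[OF assms] bilinear_lmul[OF assms] bilinear_rmul[OF assms]
      complex_eq_iff algebra_simps)

lemma ext_bilinear_sum:
  assumes "bilinear h" "finite I"
  shows "ext_bilinear h (\<Sum>i\<in>I. u i) w = (\<Sum>i\<in>I. ext_bilinear h (u i) w)"
    "ext_bilinear h w (\<Sum>i\<in>I. u i) = (\<Sum>i\<in>I. ext_bilinear h w (u i))"
proof -
  have 0: "ext_bilinear h 0 w = 0" "ext_bilinear h w 0 = 0"
    by (simp_all add: ext_bilinear_def bilinear_lzero[OF assms(1)] bilinear_rzero[OF assms(1)] complex_eq_iff)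
  show "ext_bilinear h (\<Sum>i\<in>I. u i) w = (\<Sum>i\<in>I. ext_bilinear h (u i) w)"
    using assms(2) by (induction I rule: finite_induct) (simp_all add: 0 ext_bilinear_add[OF assms(1)])
  show "ext_bilinear h w (\<Sum>i\<in>I. u i) = (\<Sum>i\<in>I. ext_bilinear h w (u i))"
    using assms(2) by (induction I rule: finite_induct) (simp_all add: 0 ext_bilinear_add[OF assms(1)])
qed

lemma vec_complex_expand:
  fixes Z :: "complex ^ 'n::finite \<Rightarrow> 'e::real_vector"
  assumes "linear Z"
  shows "Z w = (\<Sum>i\<in>UNIV. Re (w $ i) *\<^sub>R Z (axis i 1) + Im (w $ i) *\<^sub>R Z (axis i \<i>))"
proof -
  have "w = (\<Sum>i\<in>UNIV. Re (w $ i) *\<^sub>R axis i 1 + Im (w $ i) *\<^sub>R axis i \<i>)"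
  proof -
    have "(\<Sum>i\<in>UNIV. Re (w $ i) *\<^sub>R axis i 1 + Im (w $ i) *\<^sub>R axis i \<i>) $ j = w $ j" for j
    proof -
      have "(\<Sum>i\<in>UNIV. Re (w $ i) *\<^sub>R axis i 1 + Im (w $ i) *\<^sub>R axis i \<i>) $ j
          = (\<Sum>i\<in>UNIV. if i = j then w $ j else 0)"
        unfolding sum_component by (intro sum.cong) (auto simp: axis_def complex_eq_iff)
      then show ?thesis by simp
    qed
    then show ?thesis by (simp add: vec_eq_iff)
  qed
  then have "Z w = Z (\<Sum>i\<in>UNIV. Re (w $ i) *\<^sub>R axis i 1 + Im (w $ i) *\<^sub>R axis i \<i>)" by (rule arg_cong)
  then show ?thesis by (simp add: linear_sum[OF assms] linear_add[OF assms] linear_scale[OF assms])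
qed

text \<open>\<open>K\<close> and \<open>L\<close> are mutually inverse changes of components. The
  vectors \<open>Z w\<close> fill \<open>ker \<eta>\<close>, \<open>\<phi>\<close> acts on them as
  multiplication of \<open>w\<close> by \<open>\<i>\<close>, and \<open>\<xi>\<close> is
  \<open>d_t\<close> plus \<open>Z av\<close>. As \<open>\<xi>\<close> is a unit vector orthogonal
  to \<open>ker \<eta>\<close>, the products of \<open>d_t = \<xi> - Z av\<close> reduce to products
  within \<open>ker \<eta>\<close>; this gives the relations for \<open>b\<close> and
  \<open>r\<close>.\<close>

lemma local_expressions_at:
  fixes f :: "('m, real \<times> (complex ^ 'n::finite)) chart" and c :: "('m, 'e::euclidean_space) chart"
    and p :: 'm and \<phi> :: "('m, 'e) endo_field" and \<xi> :: "('m, 'e) vector_field" and \<eta> :: "('m, 'e) one_form"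
    and g :: "('m, 'e) bilinear_field"
  defines "K \<equiv> dmap f (snd c) p" and "L \<equiv> dmap c (snd f) p"
  assumes linK: "linear K" and LK: "\<And>w. L (K w) = w" and KL: "\<And>v. K (L v) = v"
    and L1: "\<And>v. fst (L v) = \<eta> c p v" and \<eta>: "\<eta> c p = dmap c (\<lambda>q. fst (snd f q)) p"
    and hol: "\<And>v. snd (L (\<phi> c p (\<phi> c p v))) = \<i> *s snd (L (\<phi> c p v))"
    and lin\<phi>: "linear (\<phi> c p)" and \<phi>\<phi>: "\<And>v. \<phi> c p (\<phi> c p v) = - v + \<eta> c p v *\<^sub>R \<xi> c p"
    and \<phi>\<xi>: "\<phi> c p (\<xi> c p) = 0" and \<eta>\<phi>: "\<And>v. \<eta> c p (\<phi> c p v) = 0" and \<eta>\<xi>: "\<eta> c p (\<xi> c p) = 1"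
    and bil: "bilinear (g c p)" and sym: "\<And>u v. g c p u v = g c p v u"
    and \<eta>g: "\<And>v. \<eta> c p v = g c p v (\<xi> c p)"
    and g\<phi>: "\<And>u v. g c p (\<phi> c p u) (\<phi> c p v) = g c p u v - \<eta> c p u * \<eta> c p v"
  defines "a \<equiv> \<lambda>i. snd (L (\<xi> c p)) $ i"
    and "h \<equiv> \<lambda>i j. ext_bilinear (g c p) (d_z f c p i) (d_zbar f c p j)"
    and "b \<equiv> \<lambda>i. ext_bilinear (g c p) (cplx (d_t f c p)) (d_z f c p i)"
    and "r \<equiv> g c p (d_t f c p) (d_t f c p)"
  shows "local_expressions f c p \<phi> \<xi> \<eta> g a (\<lambda>i. cnj (a i)) b (\<lambda>i. cnj (b i)) h r"
    "of_real r = 1 + 2 * (\<Sum>i\<in>UNIV. \<Sum>j\<in>UNIV. a i * cnj (a j) * h i j)"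
    "b i = - (\<Sum>j\<in>UNIV. cnj (a j) * h i j)"
    "h j i = cnj (h i j)"
proof -
  define Z where "Z w = K (0, w)" for w
  define dx where "dx i = Z (axis i 1)" for i
  define dy where "dy i = Z (axis i \<i>)" for i
  have linZ: "linear Z" unfolding Z_def
    using linear_compose[OF bounded_linear.linear[OF bounded_linear_Pair2] linK] by (simp add: o_def)
  have dz: "d_z f c p i = ((1/2) *\<^sub>R dx i, - (1/2) *\<^sub>R dy i)" and dzb: "d_zbar f c p i = ((1/2) *\<^sub>R dx i, (1/2) *\<^sub>R dy i)" for i
    by (simp_all add: d_z_def d_zbar_def d_x_def d_y_def dx_def dy_def Z_def K_def cplx_def cscale_def)
  have \<eta>Z: "\<eta> c p (Z w) = 0" for w using L1[of "Z w"] by (simp add: Z_def LK)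
  have \<phi>Z: "\<phi> c p (Z w) = Z (\<i> *s w)" for w
  proof -
    \<comment> \<open>\<open>hol\<close> speaks of images under \<open>\<phi>\<close>, so
      \<open>Z w\<close> is first written as one.\<close>
    have "\<phi> c p (- \<phi> c p (Z w)) = Z w" using \<phi>\<phi>[of "Z w"] \<eta>Z by (simp add: linear_neg[OF lin\<phi>])
    then have "snd (L (\<phi> c p (Z w))) = \<i> *s snd (L (Z w))" using hol[of "- \<phi> c p (Z w)"] by simp
    moreover have "fst (L (\<phi> c p (Z w))) = 0" using L1 \<eta>\<phi> by simp
    ultimately have "L (\<phi> c p (Z w)) = (0, \<i> *s w)" by (simp add: prod_eq_iff Z_def LK)
    then show ?thesis using KL[of "\<phi> c p (Z w)"] by (simp add: Z_def)
  qed
  have i_axis: "\<i> *s axis i 1 = axis i \<i>" "\<i> *s axis i \<i> = - axis i (1::complex)" for i :: 'n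
    by (simp_all add: vec_eq_iff axis_def)
  have \<phi>d: "\<phi> c p (dx i) = dy i" "\<phi> c p (dy i) = - dx i" for i
    by (simp_all add: dx_def dy_def \<phi>Z i_axis linear_neg[OF linZ])
  have \<eta>d: "\<eta> c p (dx i) = 0" "\<eta> c p (dy i) = 0" for i by (simp_all add: dx_def dy_def \<eta>Z)
  \<comment> \<open>Conjugate coefficients make the combination real, that is, the complexification
    of a real tangent vector.\<close>
  have pair: "w *\<^sub>c d_z f c p i + cnj w *\<^sub>c d_zbar f c p i = cplx (Re w *\<^sub>R dx i + Im w *\<^sub>R dy i)" for w i
    by (simp add: dz dzb cscale_def cplx_def algebra_simps flip: scaleR_add_left)
  have cplx_sum: "cplx (\<Sum>i\<in>I. u i) = (\<Sum>i\<in>I. cplx (u i))" for I and u :: "'n \<Rightarrow> 'e"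
    by (simp add: cplx_def prod_eq_iff fst_sum snd_sum)
  have cZ: "cplx (Z w) = (\<Sum>i\<in>UNIV. (w $ i) *\<^sub>c d_z f c p i + cnj (w $ i) *\<^sub>c d_zbar f c p i)" for w
    unfolding pair cplx_sum[symmetric] using vec_complex_expand[OF linZ, of w] by (simp add: dx_def dy_def)
  define av where "av = snd (L (\<xi> c p))"
  have a_av: "a i = av $ i" for i by (simp add: a_def av_def)
  have \<xi>: "\<xi> c p = d_t f c p + Z av"
  proof -
    have "L (\<xi> c p) = (1, 0) + (0, av)" using L1 \<eta>\<xi> by (simp add: prod_eq_iff av_def)
    then have "\<xi> c p = K ((1, 0) + (0, av))" using KL by metis
    then show ?thesis unfolding linear_add[OF linK] by (simp add: Z_def d_t_def K_def)
  qed
  have dt: "d_t f c p = \<xi> c p - Z av" using \<xi> by simp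
  \<comment> \<open>Invariance of \<open>g\<close> under \<open>\<phi>\<close> on
    \<open>ker \<eta>\<close>; it is the reason why products of two \<open>d_z\<close>, or of two
    \<open>d_zbar\<close>, vanish.\<close>
  have gZ: "g c p (dy i) (dy j) = g c p (dx i) (dx j)" "g c p (dx i) (dy j) = - g c p (dy i) (dx j)" for i j
    using g\<phi>[of "dx i" "dx j"] g\<phi>[of "dx i" "dy j"] by (simp_all add: \<phi>d \<eta>d bilinear_rneg[OF bil])
  have ext: "ext_bilinear (g c p) (d_z f c p i) (d_z f c p j) = 0" "ext_bilinear (g c p) (d_zbar f c p i) (d_zbar f c p j) = 0" for i j
    by (simp_all add: ext_bilinear_def dz dzb bilinear_lmul[OF bil] bilinear_rmul[OF bil] bilinear_lneg[OF bil] bilinear_rneg[OF bil]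
        gZ complex_eq_iff)
  have ext_sym: "ext_bilinear (g c p) u v = ext_bilinear (g c p) v u" for u v
    by (simp add: ext_bilinear_def sym complex_eq_iff)
  have herm: "h j i = cnj (h i j)" for i j
    using sym[of "dx j" "dx i"] sym[of "dy j" "dy i"] sym[of "dx j" "dy i"] sym[of "dy j" "dx i"]
    by (simp add: h_def ext_bilinear_def dz dzb bilinear_lmul[OF bil] bilinear_rmul[OF bil] bilinear_lneg[OF bil] bilinear_rneg[OF bil]
        complex_eq_iff)
  then show "h j i = cnj (h i j)" .
  \<comment> \<open>\<open>\<xi>\<close> is orthogonal to \<open>ker \<eta>\<close>, so only
    \<open>- Z av\<close> contributes.\<close>
  have gdt: "g c p (d_t f c p) (Z w) = - g c p (Z av) (Z w)" for w
    unfolding dt bilinear_lsub[OF bil] using \<eta>g[of "Z w"] \<eta>Z sym by simp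
  have Zw_z: "ext_bilinear (g c p) (cplx (Z w)) (d_z f c p i) = (\<Sum>j\<in>UNIV. cnj (w $ j) * h i j)"
    "ext_bilinear (g c p) (cplx (Z w)) (d_zbar f c p i) = (\<Sum>j\<in>UNIV. (w $ j) * h j i)" for w i
    unfolding cZ ext_bilinear_sum[OF bil finite] ext_bilinear_add[OF bil] ext_bilinear_cscale[OF bil] ext
    by (simp_all add: h_def ext_sym[of "d_zbar f c p _" "d_z f c p i"])
  have dtZ: "ext_bilinear (g c p) (cplx (d_t f c p)) v = - ext_bilinear (g c p) (cplx (Z av)) v"
    if "fst v \<in> range Z" "snd v \<in> range Z" for v
    using that gdt by (auto simp: ext_bilinear_def cplx_def bilinear_lzero[OF bil] complex_eq_iff)
  have rng: "(k *\<^sub>R dx i) \<in> range Z" "(k *\<^sub>R dy i) \<in> range Z" for k i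
    unfolding dx_def dy_def linear_scale[OF linZ, symmetric] by auto
  have b_eq: "b i = - (\<Sum>j\<in>UNIV. cnj (a j) * h i j)" for i
    unfolding b_def by (subst dtZ) (use rng in \<open>auto simp: dz Zw_z(1)[unfolded dz] a_av simp del: scaleR_minus_left\<close>)
  then show "b i = - (\<Sum>j\<in>UNIV. cnj (a j) * h i j)" .
  have bbar: "ext_bilinear (g c p) (cplx (d_t f c p)) (d_zbar f c p i) = cnj (b i)" for i
    by (simp add: b_def ext_bilinear_def cplx_def dz dzb bilinear_lzero[OF bil] bilinear_rmul[OF bil] bilinear_rneg[OF bil] complex_eq_iff)
  show "of_real r = 1 + 2 * (\<Sum>i\<in>UNIV. \<Sum>j\<in>UNIV. a i * cnj (a j) * h i j)"
  proof -
    have "g c p (\<xi> c p) (\<xi> c p) = 1" using \<eta>g \<eta>\<xi> by simp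
    moreover have "g c p (\<xi> c p) (Z av) = 0" "g c p (Z av) (\<xi> c p) = 0" using \<eta>g[of "Z av"] \<eta>Z sym by auto
    ultimately have r1: "r = 1 + g c p (Z av) (Z av)"
      unfolding r_def dt by (simp add: bilinear_lsub[OF bil] bilinear_rsub[OF bil])
    have "of_real (g c p (Z av) (Z av)) = ext_bilinear (g c p) (cplx (Z av)) (cplx (Z av))"
      by (simp add: ext_bilinear_def cplx_def bilinear_lzero[OF bil] bilinear_rzero[OF bil] complex_eq_iff)
    also have "\<dots> = (\<Sum>i\<in>UNIV. a i * (\<Sum>j\<in>UNIV. cnj (a j) * h i j) + cnj (a i) * (\<Sum>j\<in>UNIV. a j * h j i))"
      by (subst (2) cZ) (simp add: ext_bilinear_sum[OF bil] ext_bilinear_add[OF bil] ext_bilinear_cscale[OF bil] Zw_z a_av)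
    also have "\<dots> = (\<Sum>i\<in>UNIV. \<Sum>j\<in>UNIV. a i * cnj (a j) * h i j) + (\<Sum>i\<in>UNIV. \<Sum>j\<in>UNIV. a j * cnj (a i) * h j i)"
      by (simp add: sum.distrib sum_distrib_left mult_ac)
    \<comment> \<open>The two double sums agree after exchanging the indices, which accounts for the
      factor 2.\<close>
    also have "(\<Sum>i\<in>UNIV. \<Sum>j\<in>UNIV. a j * cnj (a i) * h j i) = (\<Sum>i\<in>UNIV. \<Sum>j\<in>UNIV. a i * cnj (a j) * h i j)"
      by (rule sum.swap)
    finally show ?thesis using r1 by simp
  qed
  have "ext_endo (\<phi> c p) (cplx (d_t f c p)) =
       (- \<i>) *\<^sub>c (\<Sum>i\<in>UNIV. a i *\<^sub>c d_z f c p i - cnj (a i) *\<^sub>c d_zbar f c p i)"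
  proof -
    have cs: "z *\<^sub>c (\<Sum>i\<in>I. u i) = (\<Sum>i\<in>I. z *\<^sub>c u i)" for z I and u :: "'n \<Rightarrow> 'e cplxn"
      by (simp add: cscale_eq linear_sum[OF linear_Jc] scaleR_sum_right sum.distrib)
    have "\<phi> c p (d_t f c p) = Z (- (\<i> *s av))"
      unfolding dt linear_diff[OF lin\<phi>] \<phi>\<xi> \<phi>Z by (simp add: linear_neg[OF linZ])
    then have "ext_endo (\<phi> c p) (cplx (d_t f c p)) = cplx (Z (- (\<i> *s av)))"
      by (simp add: ext_endo_def cplx_def linear_0[OF lin\<phi>])
    also have "\<dots> = (\<Sum>i\<in>UNIV. (- \<i>) *\<^sub>c (a i *\<^sub>c d_z f c p i - cnj (a i) *\<^sub>c d_zbar f c p i))"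
      unfolding cZ by (intro sum.cong refl) (simp add: cscale_def a_av algebra_simps)
    finally show ?thesis by (simp only: cs)
  qed
  moreover have "ext_endo (\<phi> c p) (d_z f c p i) = \<i> *\<^sub>c d_z f c p i" "ext_endo (\<phi> c p) (d_zbar f c p i) = (- \<i>) *\<^sub>c d_zbar f c p i" for i
    by (simp_all add: ext_endo_def dz dzb cscale_def linear_scale[OF lin\<phi>] linear_neg[OF lin\<phi>] \<phi>d)
  moreover have "cplx (\<xi> c p) = cplx (d_t f c p) + (\<Sum>i\<in>UNIV. a i *\<^sub>c d_z f c p i + cnj (a i) *\<^sub>c d_zbar f c p i)"
  proof -
    have "cplx (\<xi> c p) = cplx (d_t f c p) + cplx (Z av)" by (subst \<xi>) (simp add: cplx_def)
    then show ?thesis by (simp add: cZ a_av)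
  qed
  moreover have "ext_bilinear (g c p) (cplx (d_t f c p)) (cplx (d_t f c p)) = of_real r"
    by (simp add: ext_bilinear_def cplx_def r_def bilinear_lzero[OF bil] bilinear_rzero[OF bil] complex_eq_iff)
  ultimately show "local_expressions f c p \<phi> \<xi> \<eta> g a (\<lambda>i. cnj (a i)) b (\<lambda>i. cnj (b i)) h r"
    unfolding local_expressions_def using \<eta> ext bbar by (simp add: b_def h_def)
qed

subsection \<open>Almost cosymplectic manifolds with Kaehlerian leaves\<close>

text \<open>\<open>dimtype\<close> makes the index type \<open>'n\<close> of the complex coordinates
  a parameter of the locale, as the other parameters do not mention it.\<close>

locale cosymplectic_kaehler =
  fixes X :: "'m topology" and A :: "('m, 'e::euclidean_space) chart set" and \<phi> :: "('m, 'e) endo_field"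
    and \<xi> :: "('m, 'e) vector_field" and \<eta> :: "('m, 'e) one_form" and g :: "('m, 'e) bilinear_field"
    and dimtype :: "(complex ^ 'n::finite) itself"
  assumes dim: "DIM('e) = 2 * CARD('n) + 1"
    and cosymplectic: "almost_cosymplectic Analytic X A \<phi> \<xi> \<eta> g"
    and leaves: "kaehlerian_leaves TYPE(complex ^ 'n) X A \<phi> \<eta> g"
begin

section \<open>Pointwise algebra of the structure\<close>

lemma man: "manifold Analytic X A" and \<phi>_field: "is_endo_field Analytic A \<phi>"
  and \<xi>_field: "is_vector_field Analytic A \<xi>"
  and \<eta>_field: "is_one_form Analytic A \<eta>" and g_metric: "riemannian_metric Analytic A g"
  and \<eta>_closed: "closed_one_form A \<eta>"
  using cosymplectic unfolding almost_cosymplectic_def almost_contact_metric_def by blast+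

lemma chA: "c \<in> A \<Longrightarrow> is_chart X c" and coverA: "q \<in> topspace X \<Longrightarrow> \<exists>c\<in>A. q \<in> fst c"
  and compA: "c \<in> A \<Longrightarrow> d \<in> A \<Longrightarrow> compatible Analytic c d"
  using man unfolding manifold_def by auto

context
  fixes c p assumes c: "c \<in> A" "p \<in> fst c"
begin

lemma contact:
  "\<phi> c p (\<phi> c p v) = - v + \<eta> c p v *\<^sub>R \<xi> c p" "\<eta> c p (\<xi> c p) = 1" "\<eta> c p v = g c p v (\<xi> c p)"
  "g c p (\<phi> c p u) (\<phi> c p v) = g c p u v - \<eta> c p u * \<eta> c p v"
  using cosymplectic c unfolding almost_cosymplectic_def almost_contact_metric_def by blast+

lemma lin: "linear (\<phi> c p)" "linear (\<eta> c p)" "bilinear (g c p)" "g c p u v = g c p v u" "v \<noteq> 0 \<Longrightarrow> g c p v v > 0"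
proof -
  show "linear (\<phi> c p)" using c \<phi>_field unfolding is_endo_field_def by blast
  show "linear (\<eta> c p)" using c \<eta>_field unfolding is_one_form_def by blast
  show "bilinear (g c p)" using c g_metric unfolding riemannian_metric_def is_bilinear_field_def by blast
  show "g c p u v = g c p v u" using c g_metric unfolding riemannian_metric_def by blast
  show "g c p v v > 0" if "v \<noteq> 0" using c g_metric that unfolding riemannian_metric_def by blast
qed

text \<open>The compatibility of \<open>g\<close> with \<open>\<phi>\<close> gives the squared norm
  of this vector as \<open>1 - 1\<close>.\<close>

lemma \<phi>\<xi>: "\<phi> c p (\<xi> c p) = 0"
proof -
  have "g c p (\<phi> c p (\<xi> c p)) (\<phi> c p (\<xi> c p)) = 0"
    using contact(3)[of "\<xi> c p"] by (simp add: contact(2,4))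
  then show ?thesis using lin(5)[of "\<phi> c p (\<xi> c p)"] by fastforce
qed

lemma \<phi>_cube: "\<phi> c p (\<phi> c p (\<phi> c p v)) = - \<phi> c p v"
  unfolding contact(1)[of v] linear_add[OF lin(1)] linear_neg[OF lin(1)] linear_scale[OF lin(1)] \<phi>\<xi> by simp

text \<open>Applying \<open>contact(1)\<close> to \<open>\<phi> c p v\<close> and comparing with the
  cube identity leaves a multiple of the nonzero vector \<open>\<xi> c p\<close> that must
  vanish.\<close>

lemma \<eta>\<phi>: "\<eta> c p (\<phi> c p v) = 0"
proof -
  have "\<eta> c p (\<phi> c p v) *\<^sub>R \<xi> c p = 0" using contact(1)[of "\<phi> c p v"] \<phi>_cube[of v] by simp
  moreover have "\<xi> c p \<noteq> 0" using contact(2) linear_0[OF lin(2)] by force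
  ultimately show ?thesis by simp
qed

lemma \<phi>_ker: "\<eta> c p v = 0 \<Longrightarrow> \<phi> c p (\<phi> c p v) = - v"
  by (simp add: contact(1))

text \<open>Linear complex coordinates on \<open>ker \<eta>\<close> at a single point;
  \<open>\<xi> c p\<close> is the vector outside the hyperplane.\<close>

lemma complex_frame:
  obtains m :: "'e \<Rightarrow> complex ^ 'n" where "linear m" "\<And>v. \<eta> c p v = 0 \<Longrightarrow> m v = 0 \<Longrightarrow> v = 0"
  by (rule complex_structure_iso[OF dim lin(1,2), of "\<xi> c p"])
    (use contact(2) in simp, erule \<phi>_ker, rule \<eta>\<phi>, (rule that; assumption))

end

lemma DIM_eq: "DIM('e) = DIM(complex ^ 'n) + 1"
  using dim by simp

text \<open>Linear leaf coordinates are good enough here: these charts only have to produce leaves,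
  not complex coordinates.\<close>

lemma foliated_chart_at:
  assumes "q \<in> topspace X"
  obtains f :: "('m, real \<times> (complex ^ 'n)) chart" and s D where "q \<in> fst f" "foliated_chart X A \<eta> f s D"
proof -
  obtain c where c: "c \<in> A" "q \<in> fst c" using coverA assms by blast
  obtain m :: "'e \<Rightarrow> complex ^ 'n" where m: "linear m" "\<And>v. \<eta> c q v = 0 \<Longrightarrow> m v = 0 \<Longrightarrow> v = 0"
    using complex_frame[OF c] by blast
  have bl: "bounded_linear m" using m(1) linear_conv_bounded_linear by blast
  have fdm: "fd m x = m" for x by (rule fd_eqI[OF bounded_linear_imp_has_derivative[OF bl]])
  show thesis
    by (rule foliated_chart_exists[OF DIM_eq chA compA \<eta>_field \<eta>_closed c open_UNIV UNIV_I smooth_on_bounded_linear[OF open_UNIV bl]])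
      (simp_all add: fdm m(2) that)
qed

text \<open>A foliated chart is chosen for each member of a countable base that fits into one. The
  countability of this atlas is what makes the leaves second countable.\<close>

lemma foliated_atlas_exists:
  assumes "topspace X \<noteq> {}"
  obtains C :: "nat \<Rightarrow> ('m, real \<times> (complex ^ 'n)) chart" and s D where "foliated_atlas X A \<eta> C s D"
proof -
  obtain \<B> where \<B>: "countable \<B>" "\<And>V. V \<in> \<B> \<Longrightarrow> openin X V" "\<And>U x. openin X U \<Longrightarrow> x \<in> U \<Longrightarrow> \<exists>V\<in>\<B>. x \<in> V \<and> V \<subseteq> U"
  proof -
    have "second_countable X" using man unfolding manifold_def by blast
    then show ?thesis unfolding second_countable_def by (elim exE conjE) (rule that, blast+)
  qed
  define good where "good V f s D \<longleftrightarrow> foliated_chart X A \<eta> f s D \<and> V \<subseteq> fst f"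
    for V s D and f :: "('m, real \<times> (complex ^ 'n)) chart"
  define \<B>' where "\<B>' = {V \<in> \<B>. \<exists>f s D. good V f s D}"
  have cov: "\<exists>V\<in>\<B>'. q \<in> V" if q: "q \<in> topspace X" for q
  proof -
    obtain f :: "('m, real \<times> (complex ^ 'n)) chart" and s D where f: "q \<in> fst f" "foliated_chart X A \<eta> f s D"
      using foliated_chart_at[OF q] by blast
    then have "openin X (fst f)" by (simp add: foliated_chart_def is_chart_def)
    then obtain V where "V \<in> \<B>" "q \<in> V" "V \<subseteq> fst f" using \<B>(3) f(1) by blast
    moreover have "good V f s D" using f(2) \<open>V \<subseteq> fst f\<close> by (simp add: good_def)
    ultimately show ?thesis unfolding \<B>'_def by blast
  qed
  have ne: "\<B>' \<noteq> {}" using assms cov by blast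
  have cB: "countable \<B>'" using \<B>(1) by (simp add: \<B>'_def)
  define V where "V = from_nat_into \<B>'"
  have "\<exists>f s D. good (V n) f s D" for n
    using from_nat_into[OF ne, of n] by (auto simp: V_def \<B>'_def)
  then obtain C s D where C: "\<And>n. good (V n) (C n) (s n) (D n)" by metis
  have "foliated_atlas X A \<eta> C s D"
  proof
    show "manifold Analytic X A" by (rule man)
    show fol: "foliated_chart X A \<eta> (C i) (s i) (D i)" for i using C by (simp add: good_def)
    have "fst (C i) \<subseteq> topspace X" for i
      using fol[of i] openin_subset by (auto simp: foliated_chart_def is_chart_def)
    moreover have "\<exists>i. q \<in> fst (C i)" if q: "q \<in> topspace X" for q
    proof -
      obtain V' where V': "V' \<in> \<B>'" "q \<in> V'" using cov q by blast
      obtain n where "V n = V'" unfolding V_def using from_nat_into_surj[OF cB V'(1)] by blast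
      then show ?thesis using C[of n] V'(2) by (auto simp: good_def)
    qed
    ultimately show "topspace X = (\<Union>i. fst (C i))" by blast
  qed
  then show thesis by (rule that)
qed

text \<open>\<open>\<Phi> x u\<close> and \<open>\<Phi> x v\<close> lie in
  \<open>ker \<eta>\<close>, hence are tangent to the leaf through \<open>p\<close>, where
  integrability of \<open>J\<close> is known; \<open>nijenhuis_immersion\<close> transports it to
  the ambient chart. Taking images under \<open>\<Phi>\<close> as arguments expresses membership in
  \<open>ker \<eta>\<close> without \<open>\<eta>\<close>, a form that extends
  holomorphically.\<close>

lemma nijenhuis_vanishes:
  assumes c: "c \<in> A" "p \<in> fst c"
  defines "\<Phi> \<equiv> in_coords c \<phi>" and "x \<equiv> snd c p"
  shows "fd (\<lambda>y. \<Phi> y (\<Phi> x v)) x (\<Phi> x (\<Phi> x u)) - fd (\<lambda>y. \<Phi> y (\<Phi> x u)) x (\<Phi> x (\<Phi> x v))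
       + \<Phi> x (fd (\<lambda>y. \<Phi> y (\<Phi> x u)) x (\<Phi> x v) - fd (\<lambda>y. \<Phi> y (\<Phi> x v)) x (\<Phi> x u)) = 0"
proof -
  have pX: "p \<in> topspace X" using c man unfolding manifold_def by blast
  then obtain C :: "nat \<Rightarrow> ('m, real \<times> (complex ^ 'n)) chart" and s D where fa: "foliated_atlas X A \<eta> C s D"
    using foliated_atlas_exists by blast
  obtain Y i \<tau> and B :: "('m, complex ^ 'n) chart set"
    where leaf: "leaf X A \<eta> Y B" and b: "(foliated_atlas.plaque C i \<tau>, foliated_atlas.pr C i) \<in> B" "p \<in> foliated_atlas.plaque C i \<tau>"
    by (rule foliated_atlas.leaf_through[OF fa pX])
  define b where "b = (foliated_atlas.plaque C i \<tau>, foliated_atlas.pr C i)"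
  have bB: "b \<in> B" "p \<in> fst b" using b by (auto simp: b_def)
  obtain J G where JG: "induced_structure A \<phi> g B J G" "kaehler Y B J G"
    using leaves leaf unfolding kaehlerian_leaves_def by blast
  have im: "integral_manifold X A \<eta> Y B" using leaf by (simp add: leaf_def)
  have manY: "manifold Smooth Y B" and J: "is_endo_field Smooth B J" and intg: "integrable_acs B J"
    using JG(2) unfolding kaehler_def almost_kaehler_def by blast+
  have chb: "is_chart Y b" using manY bB unfolding manifold_def by blast
  have chc: "is_chart X c" by (rule chA[OF c(1)])
  have cont: "continuous_map Y X (\<lambda>p. p)" using im unfolding integral_manifold_def by blast
  define W where "W = snd b ` (fst b \<inter> fst c)"
  have "openin Y {q \<in> topspace Y. q \<in> fst c}" using cont chc unfolding continuous_map_def is_chart_def by blast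
  moreover have ob: "openin Y (fst b)" using chb by (simp add: is_chart_def)
  moreover have "fst b \<inter> {q \<in> topspace Y. q \<in> fst c} = fst b \<inter> fst c" using openin_subset[OF ob] by auto
  ultimately have "openin Y (fst b \<inter> fst c)" by (metis openin_Int)
  then have W: "open W" unfolding W_def by (rule chart_open_image[OF chb]) simp
  define y where "y = snd b p"
  have yW: "y \<in> W" using bB c by (auto simp: y_def W_def)
  define \<iota> where "\<iota> = snd c \<circ> chart_inv b"
  define Jb where "Jb = in_coords b J"
  have pt: "\<exists>q. q \<in> fst b \<and> q \<in> fst c \<and> z = snd b q \<and> chart_inv b z = q \<and> \<iota> z = snd c q \<and> chart_inv c (\<iota> z) = q" if "z \<in> W" for z
    using that chart_inv_left[OF chb] chart_inv_left[OF chc] by (auto simp: W_def \<iota>_def)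
  have \<iota>s: "smooth_on W \<iota>" and rng: "range (dmap b (snd c) p) = {v. \<eta> c p v = 0}"
    using im bB c unfolding integral_manifold_def W_def \<iota>_def by blast+
  have S: "open (snd c ` fst c)" using chc by (simp add: is_chart_def)
  have \<iota>S: "\<iota> ` W \<subseteq> snd c ` fst c" using pt by fast
  have \<Phi>s: "smooth_on (snd c ` fst c) (\<lambda>x. \<Phi> x v)" for v
    using \<phi>_field c(1) regular_on_smooth unfolding is_endo_field_def \<Phi>_def by blast
  have \<Phi>l: "linear (\<Phi> z)" if "z \<in> snd c ` fst c" for z
    using lin(1)[OF c(1) chart_inv_in[OF that]] by (simp add: \<Phi>_def in_coords_def)
  have Js: "smooth_on W (\<lambda>x. Jb x v)" for v
  proof (rule smooth_on_subset)
    show "smooth_on (snd b ` fst b) (\<lambda>x. Jb x v)"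
      using J bB(1) regular_on_smooth unfolding is_endo_field_def Jb_def by blast
  qed (auto simp: W_def)
  have Jl: "linear (Jb z)" if zW: "z \<in> W" for z
    using pt[OF zW] J bB(1) unfolding is_endo_field_def Jb_def in_coords_def by metis
  have eq: "fd \<iota> z (Jb z v) = \<Phi> (\<iota> z) (fd \<iota> z v)" if zW: "z \<in> W" for z v
  proof -
    obtain q where q: "q \<in> fst b" "q \<in> fst c" "z = snd b q" "chart_inv b z = q" "\<iota> z = snd c q" "chart_inv c (\<iota> z) = q"
      using pt[OF zW] by blast
    have "dmap b (snd c) q (J b q v) = \<phi> c q (dmap b (snd c) q v)"
      using JG(1) bB(1) c(1) q(1,2) unfolding induced_structure_def by blast
    then show ?thesis using q by (simp add: dmap_def \<iota>_def Jb_def \<Phi>_def in_coords_def)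
  qed
  have xy: "\<iota> y = x" using chart_inv_left[OF chb bB(2)] by (simp add: \<iota>_def y_def x_def)
  have \<Phi>x: "\<Phi> x w = \<phi> c p w" for w using chart_inv_left[OF chc c(2)] by (simp add: \<Phi>_def in_coords_def x_def)
  \<comment> \<open>Images under \<open>\<phi>\<close> are killed by \<open>\<eta>\<close>, and the
    tangent space of the leaf consists of all such vectors.\<close>
  have "\<Phi> x w \<in> range (fd \<iota> y)" for w
    using rng \<eta>\<phi>[OF c] by (simp add: \<Phi>x dmap_def \<iota>_def y_def)
  then obtain u' v' where uv: "\<Phi> x u = fd \<iota> y u'" "\<Phi> x v = fd \<iota> y v'" by (metis rangeE)
  have "nijenhuis Jb (\<lambda>_. u') (\<lambda>_. v') y = 0"
    using intg bB unfolding integrable_acs_def Jb_def y_def by blast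
  from nijenhuis_immersion[OF W yW \<iota>s S \<iota>S \<Phi>s \<Phi>l Js Jl eq this]
  show ?thesis unfolding xy uv[symmetric] .
qed

text \<open>The chart \<open>c\<close> is returned together with \<open>f\<close>, because the
  Cauchy-Riemann condition is established in this one chart, whose domain contains that of
  \<open>f\<close>.\<close>

lemma complex_chart_at:
  assumes "p \<in> topspace X"
  obtains f :: "('m, real \<times> (complex ^ 'n)) chart" and s D c
  where "p \<in> fst f" "c \<in> A" "fst f \<subseteq> fst c" "foliated_chart X A \<eta> f s D"
    "\<And>q v. q \<in> fst f \<Longrightarrow> snd (dmap c (snd f) q (\<phi> c q (\<phi> c q v))) = \<i> *s snd (dmap c (snd f) q (\<phi> c q v))"
proof -
  obtain c where c: "c \<in> A" "p \<in> fst c" using coverA assms by blast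
  have chc: "is_chart X c" by (rule chA[OF c(1)])
  define \<Phi> where "\<Phi> = in_coords c \<phi>"
  define S where "S = snd c ` fst c"
  have \<Phi>q: "\<Phi> (snd c q) w = \<phi> c q w" if "q \<in> fst c" for q w
    using chart_inv_left[OF chc that] by (simp add: \<Phi>_def in_coords_def)
  have S: "open S" "snd c p \<in> S" using chc c(2) by (auto simp: S_def is_chart_def)
  have an: "real_analytic_on S (\<lambda>x. \<Phi> x v)" for v
    using \<phi>_field c(1) unfolding is_endo_field_def regular_on_def \<Phi>_def S_def by simp
  have pt: "\<exists>q\<in>fst c. x = snd c q \<and> \<Phi> x = \<phi> c q" if "x \<in> S" for x
    using that \<Phi>q by (auto simp: S_def)
  have \<Phi>l: "linear (\<Phi> x)" if "x \<in> S" for x using pt[OF that] lin(1)[OF c(1)] by metis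
  have cube: "\<Phi> x (\<Phi> x (\<Phi> x v)) = - \<Phi> x v" if "x \<in> S" for x v using pt[OF that] \<phi>_cube[OF c(1)] by metis
  have nij: "fd (\<lambda>y. \<Phi> y (\<Phi> x v)) x (\<Phi> x (\<Phi> x u)) - fd (\<lambda>y. \<Phi> y (\<Phi> x u)) x (\<Phi> x (\<Phi> x v))
       + \<Phi> x (fd (\<lambda>y. \<Phi> y (\<Phi> x u)) x (\<Phi> x v) - fd (\<lambda>y. \<Phi> y (\<Phi> x v)) x (\<Phi> x u)) = 0" if xS: "x \<in> S" for x u v
  proof -
    obtain q where "q \<in> fst c" "x = snd c q" using xS by (auto simp: S_def)
    with nijenhuis_vanishes[OF c(1), of q, folded \<Phi>_def] show ?thesis by simp
  qed
  obtain T and z :: "'e \<Rightarrow> complex ^ 'n" where T: "open T" "snd c p \<in> T" "T \<subseteq> S" and z: "smooth_on T z"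
    "\<And>x v. x \<in> T \<Longrightarrow> fd z x (\<Phi> x (\<Phi> x v)) = \<i> *s fd z x (\<Phi> x v)"
    "\<And>v. \<eta> c p v = 0 \<Longrightarrow> fd z (snd c p) v = 0 \<Longrightarrow> v = 0"
  proof (rule complex_coordinates_exist[OF dim S an \<Phi>l cube nij lin(2)[OF c], of "\<xi> c p"])
    show "\<eta> c p (\<xi> c p) \<noteq> 0" by (simp add: contact(2)[OF c])
    show "\<Phi> (snd c p) (\<Phi> (snd c p) v) = - v" if "\<eta> c p v = 0" for v using \<phi>_ker[OF c that] \<Phi>q[OF c(2)] by simp
    show "\<eta> c p (\<Phi> (snd c p) v) = 0" for v using \<eta>\<phi>[OF c] \<Phi>q[OF c(2)] by simp
  qed (assumption | rule that)+
  obtain f :: "('m, real \<times> (complex ^ 'n)) chart" and s D where f: "p \<in> fst f" "fst f \<subseteq> fst c" "foliated_chart X A \<eta> f s D"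
    "\<And>q. q \<in> fst f \<Longrightarrow> snd c q \<in> T \<and> snd (snd f q) = z (snd c q)"
    by (rule foliated_chart_exists[OF DIM_eq chA compA \<eta>_field \<eta>_closed c T(1,2) z(1,3)])
      (assumption, assumption, assumption, assumption, assumption, (rule that; assumption))
  show thesis
  proof (rule that[OF f(1) c(1) f(2,3)])
    fix q v assume q: "q \<in> fst f"
    have chf: "is_chart X f" and cf: "compatible Smooth c f" using f(3) c(1) by (auto simp: foliated_chart_def)
    have qc: "q \<in> fst c" using q f(2) by auto
    have zq: "snd c q \<in> T" using f(4)[OF q] by simp
    have "((\<lambda>x. snd f (chart_inv c x)) has_derivative dmap c (snd f) q) (at (snd c q))"
      by (rule transition_has_derivative[OF chc chf compatible_smooth_transition(1)[OF cf] qc q])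
    from bounded_linear.has_derivative[OF bounded_linear_snd this]
    have 1: "((\<lambda>x. snd (snd f (chart_inv c x))) has_derivative (\<lambda>v. snd (dmap c (snd f) q v))) (at (snd c q))" .
    have m: "snd c q \<in> snd c ` (fst c \<inter> fst f)" using q qc by blast
    have e: "snd (snd f (chart_inv c x)) = z x" if "x \<in> snd c ` (fst c \<inter> fst f)" for x
      using that f(4) chart_inv_left[OF chc] by auto
    have "(z has_derivative (\<lambda>v. snd (dmap c (snd f) q v))) (at (snd c q))"
      by (rule iffD1[OF has_derivative_cong_open[OF overlap_open[OF chc chf] m e] 1])
    then have "snd (dmap c (snd f) q w) = fd z (snd c q) w" for w using fd_eqI by metis
    then show "snd (dmap c (snd f) q (\<phi> c q (\<phi> c q v))) = \<i> *s snd (dmap c (snd f) q (\<phi> c q v))"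
      using z(2)[OF zq, of v] \<Phi>q[OF qc] by simp
  qed
qed

section \<open>The coefficients and their independence of the chart\<close>

definition coef_a :: "('m, real \<times> (complex ^ 'n)) chart \<Rightarrow> ('m, 'e) chart \<Rightarrow> 'm \<Rightarrow> 'n \<Rightarrow> complex" where
  "coef_a f c q i = vec_nth (snd (dmap c (snd f) q (\<xi> c q))) i"

definition coef_b :: "('m, real \<times> (complex ^ 'n)) chart \<Rightarrow> ('m, 'e) chart \<Rightarrow> 'm \<Rightarrow> 'n \<Rightarrow> complex" where
  "coef_b f c q i = ext_bilinear (g c q) (cplx (d_t f c q)) (d_z f c q i)"

definition coef_h :: "('m, real \<times> (complex ^ 'n)) chart \<Rightarrow> ('m, 'e) chart \<Rightarrow> 'm \<Rightarrow> 'n \<Rightarrow> 'n \<Rightarrow> complex" where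
  "coef_h f c q i j = ext_bilinear (g c q) (d_z f c q i) (d_zbar f c q j)"

definition coef_r :: "('m, real \<times> (complex ^ 'n)) chart \<Rightarrow> ('m, 'e) chart \<Rightarrow> 'm \<Rightarrow> real" where
  "coef_r f c q = g c q (d_t f c q) (d_t f c q)"

lemma expressions_in_chart:
  fixes f :: "('m, real \<times> (complex ^ 'n)) chart"
  assumes f: "foliated_chart X A \<eta> f s D" and c: "c \<in> A" and q: "q \<in> fst f" "q \<in> fst c"
    and hol: "\<And>v. snd (dmap c (snd f) q (\<phi> c q (\<phi> c q v))) = \<i> *s snd (dmap c (snd f) q (\<phi> c q v))"
  shows "local_expressions f c q \<phi> \<xi> \<eta> g (coef_a f c q) (\<lambda>i. cnj (coef_a f c q i)) (coef_b f c q)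
      (\<lambda>i. cnj (coef_b f c q i)) (coef_h f c q) (coef_r f c q)"
    "of_real (coef_r f c q) = 1 + 2 * (\<Sum>i\<in>UNIV. \<Sum>j\<in>UNIV. coef_a f c q i * cnj (coef_a f c q j) * coef_h f c q i j)"
    "coef_b f c q i = - (\<Sum>j\<in>UNIV. cnj (coef_a f c q j) * coef_h f c q i j)"
    "coef_h f c q j i = cnj (coef_h f c q i j)"
proof -
  have chf: "is_chart X f" using f by (simp add: foliated_chart_def)
  have cf: "compatible Smooth c f" using f c unfolding foliated_chart_def by blast
  have fc: "compatible Smooth f c" by (rule iffD1[OF compatible_commute cf])
  have \<eta>f: "\<eta> c q = dmap c (\<lambda>q. fst (snd f q)) q" using f c q unfolding foliated_chart_def by blast
  have chc: "is_chart X c" by (rule chA[OF c])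
  have linK: "linear (dmap f (snd c) q)"
    using transition_has_derivative[OF chf chc compatible_smooth_transition(1)[OF fc] q] has_derivative_linear by blast
  have D: "((\<lambda>x. snd f (chart_inv c x)) has_derivative dmap c (snd f) q) (at (snd c q))"
    by (rule transition_has_derivative[OF chc chf compatible_smooth_transition(1)[OF cf] q(2,1)])
  have L1: "fst (dmap c (snd f) q v) = \<eta> c q v" for v
    unfolding \<eta>f using fd_eqI[OF bounded_linear.has_derivative[OF bounded_linear_fst D]] by (simp add: dmap_def comp_def)
  note le = local_expressions_at[where f = f and c = c and p = q and \<phi> = \<phi> and \<xi> = \<xi> and \<eta> = \<eta> and g = g, OF linK dmap_inverse[OF chf chc fc q] dmap_inverse[OF chc chf cf q(2,1)] L1 \<eta>f hol
     lin(1)[OF c q(2)] contact(1)[OF c q(2)] \<phi>\<xi>[OF c q(2)] \<eta>\<phi>[OF c q(2)] contact(2)[OF c q(2)] lin(3,4)[OF c q(2)] contact(3,4)[OF c q(2)],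
     folded coef_a_def coef_b_def coef_h_def coef_r_def]
  show "local_expressions f c q \<phi> \<xi> \<eta> g (coef_a f c q) (\<lambda>i. cnj (coef_a f c q i)) (coef_b f c q)
      (\<lambda>i. cnj (coef_b f c q i)) (coef_h f c q) (coef_r f c q)"
    using le(1) by (simp add: coef_a_def[abs_def] coef_b_def[abs_def] coef_h_def[abs_def] coef_r_def[abs_def])
  show "of_real (coef_r f c q) = 1 + 2 * (\<Sum>i\<in>UNIV. \<Sum>j\<in>UNIV. coef_a f c q i * cnj (coef_a f c q j) * coef_h f c q i j)"
    by (rule le(2))
  show "coef_b f c q i = - (\<Sum>j\<in>UNIV. cnj (coef_a f c q j) * coef_h f c q i j)" by (rule le(3))
  show "coef_h f c q j i = cnj (coef_h f c q i j)" by (rule le(4))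
qed

text \<open>The coefficients are computed from components in one chart of \<open>A\<close>, but one
  set of functions has to serve all of them. The change of components \<open>S\<close> carries
  \<open>g\<close>, \<open>\<phi>\<close>, \<open>\<xi>\<close> and the coordinate vectors of
  \<open>f\<close> from \<open>c\<close> to \<open>d\<close>, so the numbers stay the same.\<close>

lemma change_chart:
  fixes f :: "('m, real \<times> (complex ^ 'n)) chart"
  assumes f: "foliated_chart X A \<eta> f s D" and c: "c \<in> A" "d \<in> A" and q: "q \<in> fst f" "q \<in> fst c" "q \<in> fst d"
  shows "coef_a f d q = coef_a f c q" "coef_b f d q = coef_b f c q" "coef_h f d q = coef_h f c q" "coef_r f d q = coef_r f c q"
    "(\<And>v. snd (dmap c (snd f) q (\<phi> c q (\<phi> c q v))) = \<i> *s snd (dmap c (snd f) q (\<phi> c q v))) \<Longrightarrow>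
      snd (dmap d (snd f) q (\<phi> d q (\<phi> d q w))) = \<i> *s snd (dmap d (snd f) q (\<phi> d q w))"
proof -
  have chf: "is_chart X f" using f by (simp add: foliated_chart_def)
  have cf: "compatible Smooth c f" "compatible Smooth f c" if "c \<in> A" for c
  proof -
    show *: "compatible Smooth c f" using f that unfolding foliated_chart_def by blast
    show "compatible Smooth f c" by (rule iffD1[OF compatible_commute *])
  qed
  note chc = chA[OF c(1)] and chd = chA[OF c(2)]
  define S where "S = dmap c (snd d) q"
  have linS: "linear S" unfolding S_def
    using transition_has_derivative[OF chc chd compatible_smooth_transition(1)[OF compA[OF c]] q(2,3)] has_derivative_linear by blast
  have S_inv: "S (dmap d (snd c) q v) = v" for v
    unfolding S_def by (rule dmap_inverse[OF chd chc compA[OF c(2,1)] q(3,2)])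
  have L: "dmap d (snd f) q (S v) = dmap c (snd f) q v" for v
    unfolding S_def
    by (rule dmap_chain(1)[OF chc chd compA[OF c] q(2,3), symmetric])
      (use transition_has_derivative[OF chd chf compatible_smooth_transition(1)[OF cf(1)[OF c(2)]] q(3,1)] in \<open>auto simp: differentiable_def\<close>)
  have K: "dmap f (snd d) q w = S (dmap f (snd c) q w)" for w
    unfolding S_def
    by (rule dmap_chain(1)[OF chf chc cf(2)[OF c(1)] q(1,2)])
      (use transition_has_derivative[OF chc chd compatible_smooth_transition(1)[OF compA[OF c]] q(2,3)] in \<open>auto simp: differentiable_def\<close>)
  have \<xi>S: "\<xi> d q = S (\<xi> c q)" using \<xi>_field c q unfolding is_vector_field_def S_def by blast
  have \<phi>S: "\<phi> d q (S v) = S (\<phi> c q v)" for v using \<phi>_field c q unfolding is_endo_field_def S_def by blast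
  have gS: "g d q (S u) (S v) = g c q u v" for u v
    using g_metric c q unfolding riemannian_metric_def is_bilinear_field_def S_def by blast
  have dt: "d_t f d q = S (d_t f c q)" by (simp add: d_t_def K)
  have dz: "d_z f d q i = (S (fst (d_z f c q i)), S (snd (d_z f c q i)))"
    "d_zbar f d q i = (S (fst (d_zbar f c q i)), S (snd (d_zbar f c q i)))" for i
    by (simp_all add: d_z_def d_zbar_def d_x_def d_y_def K cplx_def cscale_def linear_scale[OF linS] linear_neg[OF linS] linear_0[OF linS])
  have ct: "cplx (d_t f d q) = (S (fst (cplx (d_t f c q))), S (snd (cplx (d_t f c q))))"
    by (simp add: dt cplx_def linear_0[OF linS])
  have ext: "ext_bilinear (g d q) (S (fst u), S (snd u)) (S (fst v), S (snd v)) = ext_bilinear (g c q) u v" for u v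
    by (simp add: ext_bilinear_def gS)
  show "coef_a f d q = coef_a f c q" by (simp add: coef_a_def[abs_def] \<xi>S L)
  show "coef_b f d q = coef_b f c q" by (simp add: coef_b_def[abs_def] dz ct ext del: fst_conv snd_conv)
  show "coef_h f d q = coef_h f c q" by (simp add: coef_h_def[abs_def] dz ext del: fst_conv snd_conv)
  show "coef_r f d q = coef_r f c q" by (simp add: coef_r_def dt gS)
  show "snd (dmap d (snd f) q (\<phi> d q (\<phi> d q w))) = \<i> *s snd (dmap d (snd f) q (\<phi> d q w))"
    if "\<And>v. snd (dmap c (snd f) q (\<phi> c q (\<phi> c q v))) = \<i> *s snd (dmap c (snd f) q (\<phi> c q v))"
    using that[of "dmap d (snd c) q w"] L \<phi>S S_inv by metis
qed

text \<open>The Cauchy-Riemann condition, known in \<open>c\<close>, is carried to an arbitrary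
  chart \<open>d\<close> of \<open>A\<close>, while the coefficients remain those computed in
  \<open>c\<close>.\<close>

lemma adapted_chart_expressions:
  fixes f :: "('m, real \<times> (complex ^ 'n)) chart"
  assumes f: "foliated_chart X A \<eta> f s D" and c: "c \<in> A" "fst f \<subseteq> fst c"
    and hol: "\<And>q v. q \<in> fst f \<Longrightarrow> snd (dmap c (snd f) q (\<phi> c q (\<phi> c q v))) = \<i> *s snd (dmap c (snd f) q (\<phi> c q v))"
    and q: "q \<in> fst f" and d: "d \<in> A" "q \<in> fst d"
  shows "local_expressions f d q \<phi> \<xi> \<eta> g (coef_a f c q) (\<lambda>i. cnj (coef_a f c q i)) (coef_b f c q)
      (\<lambda>i. cnj (coef_b f c q i)) (coef_h f c q) (coef_r f c q)"
proof -
  have qc: "q \<in> fst c" using c q by auto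
  note cc = change_chart[OF f c(1) d(1) q qc d(2)]
  from expressions_in_chart(1)[OF f d(1) q d(2) cc(5)[OF hol[OF q]]] show ?thesis by (simp only: cc(1-4))
qed

end

theorem theorem1:
  fixes X :: "'m topology"
    and A :: "('m, 'e::euclidean_space) chart set"
    and \<phi> :: "('m, 'e) endo_field"
    and \<xi> :: "('m, 'e) vector_field"
    and \<eta> :: "('m, 'e) one_form"
    and g :: "('m, 'e) bilinear_field"
  assumes dim: "DIM('e) = 2 * CARD('n::finite) + 1"
    and cosymplectic: "almost_cosymplectic Analytic X A \<phi> \<xi> \<eta> g"
    and leaves: "kaehlerian_leaves TYPE(complex ^ 'n) X A \<phi> \<eta> g"
  shows "\<exists>W :: ('m, real \<times> (complex ^ 'n)) chart set.
    topspace X = (\<Union>(U, f)\<in>W. U) \<and>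
    (\<forall>(U, f)\<in>W.
       openin X U \<and>
       (\<exists>s>0. \<exists>D' :: (complex ^ 'n) set.
          D' \<noteq> {} \<and> open D' \<and> connected D' \<and> diffeomorphism X A U f ({- s<..<s} \<times> D')) \<and>
       (\<exists>a abar b bbar :: 'm \<Rightarrow> 'n \<Rightarrow> complex.
        \<exists>h :: 'm \<Rightarrow> 'n \<Rightarrow> 'n \<Rightarrow> complex. \<exists>r :: 'm \<Rightarrow> real.
          \<forall>p\<in>U.
            (\<forall>c\<in>A. p \<in> fst c \<longrightarrow>
               local_expressions (U, f) c p \<phi> \<xi> \<eta> g
                 (a p) (abar p) (b p) (bbar p) (h p) (r p)) \<and>
            of_real (r p) = 1 + 2 * (\<Sum>i\<in>UNIV. \<Sum>j\<in>UNIV. a p i * abar p j * h p i j) \<and>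
            (\<forall>i. b p i = - (\<Sum>j\<in>UNIV. abar p j * h p i j)) \<and>
            (\<forall>i. abar p i = cnj (a p i)) \<and>
            (\<forall>i. bbar p i = cnj (b p i)) \<and>
            (\<forall>i j. h p j i = cnj (h p i j))))"
proof -
  interpret cosymplectic_kaehler X A \<phi> \<xi> \<eta> g "TYPE(complex ^ 'n)"
    by unfold_locales (fact dim cosymplectic leaves)+
  \<comment> \<open>The witness \<open>c\<close> fixes the chart in which the coefficients are
    evaluated on all of \<open>fst f\<close>.\<close>
  define good where "good f c s D \<longleftrightarrow> c \<in> A \<and> fst f \<subseteq> fst c \<and> foliated_chart X A \<eta> f s D \<and>
    (\<forall>q\<in>fst f. \<forall>v. snd (dmap c (snd f) q (\<phi> c q (\<phi> c q v))) = \<i> *s snd (dmap c (snd f) q (\<phi> c q v)))"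
    for f :: "('m, real \<times> (complex ^ 'n)) chart" and c s D
  define W where "W = {f. \<exists>c s D. good f c s D}"
  have "\<exists>f\<in>W. p \<in> fst f" if p: "p \<in> topspace X" for p
  proof -
    obtain f :: "('m, real \<times> (complex ^ 'n)) chart" and s D c where "p \<in> fst f" "c \<in> A" "fst f \<subseteq> fst c" "foliated_chart X A \<eta> f s D"
      "\<And>q v. q \<in> fst f \<Longrightarrow> snd (dmap c (snd f) q (\<phi> c q (\<phi> c q v))) = \<i> *s snd (dmap c (snd f) q (\<phi> c q v))"
      by (rule complex_chart_at[OF p]) (rule that; assumption)
    then show ?thesis unfolding W_def good_def by blast
  qed
  moreover have "openin X (fst f)" if "f \<in> W" for f
    using that by (auto simp: W_def good_def foliated_chart_def is_chart_def)
  ultimately have cover: "topspace X = (\<Union>f\<in>W. fst f)" using openin_subset by blast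
  have main: "openin X (fst F) \<and>
       (\<exists>s>0. \<exists>D' :: (complex ^ 'n) set.
          D' \<noteq> {} \<and> open D' \<and> connected D' \<and> diffeomorphism X A (fst F) (snd F) ({- s<..<s} \<times> D')) \<and>
       (\<exists>a abar b bbar :: 'm \<Rightarrow> 'n \<Rightarrow> complex.
        \<exists>h :: 'm \<Rightarrow> 'n \<Rightarrow> 'n \<Rightarrow> complex. \<exists>r :: 'm \<Rightarrow> real.
          \<forall>p\<in>fst F.
            (\<forall>c\<in>A. p \<in> fst c \<longrightarrow>
               local_expressions F c p \<phi> \<xi> \<eta> g
                 (a p) (abar p) (b p) (bbar p) (h p) (r p)) \<and>
            of_real (r p) = 1 + 2 * (\<Sum>i\<in>UNIV. \<Sum>j\<in>UNIV. a p i * abar p j * h p i j) \<and>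
            (\<forall>i. b p i = - (\<Sum>j\<in>UNIV. abar p j * h p i j)) \<and>
            (\<forall>i. abar p i = cnj (a p i)) \<and>
            (\<forall>i. bbar p i = cnj (b p i)) \<and>
            (\<forall>i j. h p j i = cnj (h p i j)))" if "F \<in> W" for F
  proof -
    obtain c s D where c: "c \<in> A" "fst F \<subseteq> fst c" and F: "foliated_chart X A \<eta> F s D"
      and hol: "\<And>q v. q \<in> fst F \<Longrightarrow> snd (dmap c (snd F) q (\<phi> c q (\<phi> c q v))) = \<i> *s snd (dmap c (snd F) q (\<phi> c q v))"
    proof -
      obtain c s D where "good F c s D" using \<open>F \<in> W\<close> unfolding W_def by blast
      then show ?thesis unfolding good_def by (elim conjE) (rule that, assumption+, blast)
    qed
    have 1: "openin X (fst F)" using F by (simp add: foliated_chart_def is_chart_def)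
    have 2: "D \<noteq> {} \<and> open D \<and> connected D \<and> diffeomorphism X A (fst F) (snd F) ({- s<..<s} \<times> D) \<and> s > 0"
      using F by (simp add: foliated_chart_def diffeomorphism_def)
    have 3: "(\<forall>d\<in>A. q \<in> fst d \<longrightarrow> local_expressions F d q \<phi> \<xi> \<eta> g (coef_a F c q) (\<lambda>i. cnj (coef_a F c q i)) (coef_b F c q)
          (\<lambda>i. cnj (coef_b F c q i)) (coef_h F c q) (coef_r F c q)) \<and>
        of_real (coef_r F c q) = 1 + 2 * (\<Sum>i\<in>UNIV. \<Sum>j\<in>UNIV. coef_a F c q i * cnj (coef_a F c q j) * coef_h F c q i j) \<and>
        (\<forall>i. coef_b F c q i = - (\<Sum>j\<in>UNIV. cnj (coef_a F c q j) * coef_h F c q i j)) \<and>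
        (\<forall>i j. coef_h F c q j i = cnj (coef_h F c q i j))" if q: "q \<in> fst F" for q
    proof -
      have qc: "q \<in> fst c" using q c(2) by auto
      note ex = expressions_in_chart[OF F c(1) q qc hol[OF q]]
      show ?thesis using adapted_chart_expressions[OF F c hol q] ex(2-4) by blast
    qed
    show ?thesis
    proof (intro conjI)
      show "\<exists>s>0. \<exists>D' :: (complex ^ 'n) set.
          D' \<noteq> {} \<and> open D' \<and> connected D' \<and> diffeomorphism X A (fst F) (snd F) ({- s<..<s} \<times> D')"
        by (rule exI[of _ s]) (use 2 in blast)
    qed (rule 1, rule exI[of _ "coef_a F c"], rule exI[of _ "\<lambda>p i. cnj (coef_a F c p i)"], rule exI[of _ "coef_b F c"],
      rule exI[of _ "\<lambda>p i. cnj (coef_b F c p i)"], rule exI[of _ "coef_h F c"], rule exI[of _ "coef_r F c"],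
      rule ballI, drule 3, elim conjE, intro conjI, assumption, assumption, assumption, (rule allI, rule refl)+, assumption)
  qed
  show ?thesis
    unfolding case_prod_unfold prod.collapse
    by (rule exI[of _ W], rule conjI, rule cover, rule ballI, rule main)
qed

end
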